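(* For any $T>0$ and any $(r,q)\in[1,\infty)\times(1,\infty)$ satisfying $$\Big[r\ge1\text{ and }q>\tfrac32\text{ and }2<\tfrac2r+\tfrac3q<5\Big]\quad\text{or}\quad\Big[r\ge1\text{ and either }\tfrac2r+\tfrac3q\ge5\text{ or }1<q\le\tfrac32\Big],$$ there exist $V_0\in\mathcal G_\sigma$ and $f\in L^r_{\rm loc}(\mathbb R_+;L^q(\mathbb R^3))$ such that: (a) the Navier–Stokes problem (NS) with data $V_0,f$ admits a global Leray–Hopf solution $V\in C^0(\mathbb R_+;L^2(\mathbb R^3))$ which satisfies the energy equality (the energy inequality (EI) with equality sign) for all $t>0$; (b) there exists $\overline q>3$ such that $V\in L^{2s/(s-3)}_{\rm loc}(\mathbb R_+;L^s(\mathbb R^3))$ for all $s>\overline q$ and, hence, this solution is unique (in the class of Leray–Hopf solutions with the same data); (c) there exist a strictly increasing sequence $\{T_m\}_{m\ge1}\subset(0,T)$ and a sequence $\{\xi_m\}_{m\ge1}\subset\mathbb R^3$ such that the solution $V$ and its associated pressure $P$ satisfy $V,P\in C^\infty\big((\mathbb R^3\times\mathbb R_+)\setminus\bigcup_{m=1}^\infty\{(\xi_m,T_m)\}\big)$; (d) this solution satisfies, for all $m\ge1$, $$\lim_{t\to T_m}\|V(t)\|_{L^\infty(\mathbb R^3)}=\infty,$$ while the associated pressure $P$ satisfies $P\in L^2_{\rm loc}(\mathbb R_+;L^p(\mathbb R^3))$ for all $p\ge1$ and $\nabla P\in L^r_{\rm loc}(\mathbb R_+;L^q(\mathbb R^3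))$.
   Context: Notation: $\xi=(x,y,z)\in\mathbb R^3$, $\mathbb R_+=[0,\infty)$. $L^r_{\rm loc}(\mathbb R_+;X)$ denotes functions belonging to $L^r(0,S;X)$ for every $S>0$. $L^p_\sigma(\mathbb R^3)$ is the subspace of divergence-free vector fields in $L^p(\mathbb R^3)$. Set $$\mathcal G=\bigcap_{k\in\mathbb N}\bigcap_{q\in[2,\infty]}W^{k,q}(\mathbb R^3)\subset C^\infty(\mathbb R^3),\qquad \mathcal G_\sigma=\{V\in\mathcal G:\ \nabla\cdot V=0\text{ in }\mathbb R^3\}$$ (vector fields $\mathbb R^3\to\mathbb R^3$). Problem (NS): $V_t-\Delta V+(V\cdot\nabla)V+\nabla P=f$ and $\nabla\cdot V=0$ in $\mathbb R^3\times(0,\infty)$, $V(\xi,0)=V_0(\xi)$. Leray–Hopf solution: for $S>0$ let $\mathcal D_S=\{\phi\in C^\infty_c(\mathbb R^3\times[0,S)):\nabla\cdot\phi=0\}$ (vector-valued $\phi$). For $V_0\in L^2_\sigma(\mathbb R^3)$ and $f\in L^2(0,S;H^{-1}(\mathbb R^3))+L^1(0,S;L^2(\mathbb R^3))$, a vector field $V$ is a Leray–Hopf solution of (NS) in $\mathbb R^3\times(0,S)$ if $V\in L^\infty(0,S;L^2_\sigma(\mathbb R^3))\cap L^2(0,S;H^1(\mathbb R^3))$, $$\int_0^\infty\!\int_{\mathbb R^3}\big[\nabla V:\nabla\phi+(V\cdot\nabla)V\cdot\phi-V\cdot\phi_t\big]d\xi\,dt=\int_0^\infty\langle f,\phi\rangle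 dt+\int_{\mathbb R^3}V_0\cdot\phi(0)\,d\xi\quad\forall\phi\in\mathcal D_S,$$ and the energy inequality holds: $$\text{(EI)}\quad\|V(t)\|_{L^2(\mathbb R^3)}^2+2\int_0^t\|\nabla V(s)\|_{L^2(\mathbb R^3)}^2ds\le\|V_0\|_{L^2(\mathbb R^3)}^2+2\int_0^t\langle f(s),V(s)\rangle ds\quad\forall t\in(0,S].$$ It is a global Leray–Hopf solution if it is a Leray–Hopf solution in $\mathbb R^3\times(0,S)$ for every $S>0$ (in particular $f\in L^2(0,S;H^{-1}(\mathbb R^3))+L^1(0,S;L^2(\mathbb R^3))$ for every $S>0$). Associated pressure: a function $P\in L^1_{\rm loc}(\mathbb R^3\times(0,S))$ for every $S>0$ such that $(V,P)$ satisfies the first equation of (NS) in the distributional sense; it solves $-\Delta P=\nabla\cdot[(V\cdot\nabla)V-f]$ in the distributional sense in $\mathbb R^3$ for a.e. $t$. *)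

theory Defs
  imports "HOL-Analysis.Analysis"
begin

text \<open>
  Functions stand for their almost-everywhere classes.  Fields on space-time are functions of
  the pair of a point of space and a time; \<open>slice u t\<close> is the field at time \<open>t\<close>.
\<close>

type_synonym space = "real^3"

abbreviation (input) slice :: "(space \<times> real \<Rightarrow> 'b) \<Rightarrow> real \<Rightarrow> space \<Rightarrow> 'b" where
  "slice u t \<equiv> (\<lambda>\<xi>. u (\<xi>, t))"


section \<open>Classical differentiation and smoothness\<close>

definition dir_deriv ::
  "'a::real_normed_vector \<Rightarrow> ('a \<Rightarrow> 'b::real_normed_vector) \<Rightarrow> 'a \<Rightarrow> 'b" where
  "dir_deriv v u x = frechet_derivative u (at x) v"

definition iter_deriv ::
  "'a::real_normed_vector list \<Rightarrow> ('a \<Rightarrow> 'b::real_normed_vector) \<Rightarrow> 'a \<Rightarrow> 'b" where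
  "iter_deriv bs u = foldr dir_deriv bs u"

text \<open>Meaningful for open \<open>U\<close> only.\<close>

primrec Ck_open ::
  "nat \<Rightarrow> 'a::euclidean_space set \<Rightarrow> ('a \<Rightarrow> 'b::real_normed_vector) \<Rightarrow> bool" where
  "Ck_open 0 U u \<longleftrightarrow> continuous_on U u"
| "Ck_open (Suc k) U u \<longleftrightarrow>
     (\<forall>x\<in>U. u differentiable (at x)) \<and> (\<forall>b\<in>Basis. Ck_open k U (dir_deriv b u))"

definition smooth_open ::
  "'a::euclidean_space set \<Rightarrow> ('a \<Rightarrow> 'b::real_normed_vector) \<Rightarrow> bool" where
  "smooth_open U u \<longleftrightarrow> open U \<and> (\<forall>k. Ck_open k U u)"

text \<open>
  On a set that need not be open (such as a part of the closed half space of nonnegative times),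
  \<open>C\<^sup>\<infinity>\<close> means: locally the restriction of a smooth function defined on an open set.
\<close>

definition smooth_on ::
  "'a::euclidean_space set \<Rightarrow> ('a \<Rightarrow> 'b::real_normed_vector) \<Rightarrow> bool" where
  "smooth_on A u \<longleftrightarrow>
     (\<forall>x\<in>A. \<exists>N v. x \<in> N \<and> smooth_open N v \<and> (\<forall>y\<in>A \<inter> N. v y = u y))"

definition test_fun ::
  "'a::euclidean_space set \<Rightarrow> ('a \<Rightarrow> 'b::real_normed_vector) set" where
  "test_fun U = {\<phi>. smooth_open UNIV \<phi> \<and>
     (\<exists>K. compact K \<and> K \<subseteq> U \<and> (\<forall>x. x \<notin> K \<longrightarrow> \<phi> x = 0))}"

definition partial :: "3 \<Rightarrow> (space \<Rightarrow> 'b::real_normed_vector) \<Rightarrow> space \<Rightarrow> 'b" where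
  "partial i u = dir_deriv (axis i 1) u"

definition divergence :: "(space \<Rightarrow> space) \<Rightarrow> space \<Rightarrow> real" where
  "divergence u \<xi> = (\<Sum>i\<in>UNIV. partial i u \<xi> $ i)"

definition gradient :: "(space \<Rightarrow> real) \<Rightarrow> space \<Rightarrow> space" where
  "gradient p \<xi> = (\<chi> i. partial i p \<xi>)"

definition laplacian :: "(space \<Rightarrow> 'b::real_normed_vector) \<Rightarrow> space \<Rightarrow> 'b" where
  "laplacian u \<xi> = (\<Sum>i\<in>UNIV. partial i (partial i u) \<xi>)"

definition time_deriv ::
  "(space \<times> real \<Rightarrow> 'b::real_normed_vector) \<Rightarrow> space \<times> real \<Rightarrow> 'b" where
  "time_deriv u = dir_deriv (0, 1) u"


section \<open>Lebesgue and Sobolev spaces\<close>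

definition Lp :: "'a measure \<Rightarrow> ennreal \<Rightarrow> ('a \<Rightarrow> 'b::real_normed_vector) set" where
  "Lp M p = {u \<in> borel_measurable M.
     if p = \<infinity> then \<exists>C. AE x in M. norm (u x) \<le> C
     else integrable M (\<lambda>x. norm (u x) powr enn2real p)}"

text \<open>Meaningful on \<open>Lp M p\<close> only.\<close>

definition Lp_norm :: "'a measure \<Rightarrow> ennreal \<Rightarrow> ('a \<Rightarrow> 'b::real_normed_vector) \<Rightarrow> real" where
  "Lp_norm M p u =
     (if p = \<infinity> then Inf {C. 0 \<le> C \<and> (AE x in M. norm (u x) \<le> C)}
      else (\<integral>x. norm (u x) powr enn2real p \<partial>M) powr (1 / enn2real p))"

definition loc_integrable ::
  "'a::euclidean_space set \<Rightarrow> ('a \<Rightarrow> 'b::{banach, second_countable_topology}) \<Rightarrow> bool" where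
  "loc_integrable U u \<longleftrightarrow> (\<forall>K. compact K \<and> K \<subseteq> U \<longrightarrow> set_integrable lebesgue K u)"

text \<open>
  \<open>w\<close> is the weak derivative of \<open>u\<close> in the directions \<open>bs\<close>.  A list of coordinate directions
  plays the role of a multi-index whose order is the length of the list.
\<close>

definition weak_deriv ::
  "'a::euclidean_space list \<Rightarrow> ('a \<Rightarrow> 'b::{banach, second_countable_topology}) \<Rightarrow> ('a \<Rightarrow> 'b) \<Rightarrow> bool"
where
  "weak_deriv bs u w \<longleftrightarrow> loc_integrable UNIV u \<and> loc_integrable UNIV w \<and>
     (\<forall>\<phi> \<in> test_fun UNIV.
        (\<integral>x. iter_deriv bs \<phi> x *\<^sub>R u x \<partial>lebesgue)
          = (-1) ^ length bs *\<^sub>R (\<integral>x. (\<phi> x :: real) *\<^sub>R w x \<partial>lebesgue))"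

definition sobolev ::
  "nat \<Rightarrow> ennreal \<Rightarrow> ('a::euclidean_space \<Rightarrow> 'b::{banach, second_countable_topology}) set" where
  "sobolev k p = {u \<in> Lp lebesgue p.
     \<forall>bs. set bs \<subseteq> Basis \<and> length bs \<le> k \<longrightarrow> (\<exists>w \<in> Lp lebesgue p. weak_deriv bs u w)}"

text \<open>Determined up to a null set, and meaningful if the weak derivative exists.\<close>

definition wpartial ::
  "3 \<Rightarrow> (space \<Rightarrow> 'b::{banach, second_countable_topology}) \<Rightarrow> space \<Rightarrow> 'b" where
  "wpartial i u = (SOME w. weak_deriv [axis i 1] u w)"

text \<open>
  The elements of the intersection of all \<open>W\<^sup>k\<^sup>,\<^sup>q\<close> have smooth representatives by Sobolev embedding;
  the smooth representative is the one that is kept.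
\<close>

definition G_space :: "(space \<Rightarrow> space) set" where
  "G_space = {u. smooth_open UNIV u \<and> (\<forall>k q. 2 \<le> q \<longrightarrow> u \<in> sobolev k q)}"

definition G_sigma :: "(space \<Rightarrow> space) set" where
  "G_sigma = {u \<in> G_space. \<forall>\<xi>. divergence u \<xi> = 0}"

definition L2_sigma :: "(space \<Rightarrow> space) set" where
  "L2_sigma = {u \<in> Lp lebesgue 2.
     \<forall>\<phi> \<in> test_fun UNIV. (\<integral>\<xi>. u \<xi> \<bullet> gradient \<phi> \<xi> \<partial>lebesgue) = 0}"

abbreviation H1 :: "(space \<Rightarrow> space) set" where
  "H1 \<equiv> sobolev 1 2"

definition L2_inner :: "(space \<Rightarrow> space) \<Rightarrow> (space \<Rightarrow> space) \<Rightarrow> real" where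
  "L2_inner u v = (\<integral>\<xi>. u \<xi> \<bullet> v \<xi> \<partial>lebesgue)"

definition wgrad_sqnorm :: "(space \<Rightarrow> space) \<Rightarrow> real" where
  "wgrad_sqnorm u = (\<Sum>i\<in>UNIV. (Lp_norm lebesgue 2 (wpartial i u))\<^sup>2)"

definition H1_norm :: "(space \<Rightarrow> space) \<Rightarrow> real" where
  "H1_norm u = sqrt ((Lp_norm lebesgue 2 u)\<^sup>2 + wgrad_sqnorm u)"

text \<open>\<open>H\<^sup>-\<^sup>1\<close> is the dual of \<open>H\<^sup>1\<close>; only the values of a functional on \<open>H\<^sup>1\<close> matter.\<close>

definition Hm1 :: "((space \<Rightarrow> space) \<Rightarrow> real) set" where
  "Hm1 = {g.
     (\<forall>u\<in>H1. \<forall>v\<in>H1. g (\<lambda>\<xi>. u \<xi> + v \<xi>) = g u + g v) \<and>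
     (\<forall>c. \<forall>u\<in>H1. g (\<lambda>\<xi>. c *\<^sub>R u \<xi>) = c * g u) \<and>
     (\<exists>C. \<forall>u\<in>H1. \<bar>g u\<bar> \<le> C * H1_norm u)}"

definition Hm1_norm :: "((space \<Rightarrow> space) \<Rightarrow> real) \<Rightarrow> real" where
  "Hm1_norm g = Sup {\<bar>g u\<bar> | u. u \<in> H1 \<and> H1_norm u \<le> 1}"


section \<open>Spaces of functions of time\<close>

text \<open>
  \<open>L\<^sup>r(0,S;X)\<close> for a space \<open>X\<close> of functions of the space variable with norm \<open>N\<close>.  For the separable
  spaces \<open>X\<close> used here (\<open>L\<^sup>q\<close> with \<open>q < \<infinity>\<close>, its solenoidal subspace, \<open>H\<^sup>1\<close>), a function
  that is strongly measurable into \<open>X\<close> is the same, up to null sets, as an \<open>X\<close>-valued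
  jointly measurable one.
\<close>

definition bochner ::
  "ennreal \<Rightarrow> real \<Rightarrow> (space \<Rightarrow> 'b) set \<Rightarrow> ((space \<Rightarrow> 'b) \<Rightarrow> real)
     \<Rightarrow> (space \<times> real \<Rightarrow> 'b::real_normed_vector) set" where
  "bochner r S X N = {u \<in> borel_measurable (lebesgue_on (UNIV \<times> {0<..<S})).
     (AE t in lebesgue_on {0<..<S}. slice u t \<in> X) \<and>
     (\<lambda>t. N (slice u t)) \<in> Lp (lebesgue_on {0<..<S}) r}"

definition LrLq :: "ennreal \<Rightarrow> ennreal \<Rightarrow> real \<Rightarrow> (space \<times> real \<Rightarrow> 'b::real_normed_vector) set" where
  "LrLq r q S = bochner r S (Lp lebesgue q) (Lp_norm lebesgue q)"

definition LrLq_loc :: "ennreal \<Rightarrow> ennreal \<Rightarrow> (space \<times> real \<Rightarrow> 'b::real_normed_vector) set" where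
  "LrLq_loc r q = {u. \<forall>S>0. u \<in> LrLq r q S}"

definition C0L2 :: "(space \<times> real \<Rightarrow> 'b::real_normed_vector) set" where
  "C0L2 = {u. \<forall>t\<ge>0. slice u t \<in> Lp lebesgue 2 \<and>
     ((\<lambda>s. Lp_norm lebesgue 2 (\<lambda>\<xi>. u (\<xi>, s) - u (\<xi>, t))) \<longlongrightarrow> 0) (at t within {0..})}"

text \<open>As \<open>H\<^sup>-\<^sup>1\<close> is separable and reflexive, weak measurability is strong measurability (Pettis).\<close>

definition L2Hm1 :: "real \<Rightarrow> (real \<Rightarrow> (space \<Rightarrow> space) \<Rightarrow> real) set" where
  "L2Hm1 S = {g.
     (\<forall>u\<in>H1. (\<lambda>t. g t u) \<in> borel_measurable (lebesgue_on {0<..<S})) \<and>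
     (AE t in lebesgue_on {0<..<S}. g t \<in> Hm1) \<and>
     (\<lambda>t. Hm1_norm (g t)) \<in> Lp (lebesgue_on {0<..<S}) 2}"

text \<open>
  \<open>L\<^sup>2(0,S;H\<^sup>-\<^sup>1) + L\<^sup>1(0,S;L\<^sup>2)\<close>.  Both summands take values in the dual of \<open>H\<^sup>1\<close>, where an \<open>L\<^sup>2\<close> field
  acts by the \<open>L\<^sup>2\<close> inner product; so \<open>F t u\<close> is the duality bracket of \<open>F(t)\<close> with \<open>u\<close>.
\<close>

definition forcing :: "real \<Rightarrow> (real \<Rightarrow> (space \<Rightarrow> space) \<Rightarrow> real) set" where
  "forcing S = {F. \<exists>g h. g \<in> L2Hm1 S \<and> h \<in> LrLq 1 2 S \<and>
     (AE t in lebesgue_on {0<..<S}. \<forall>u\<in>H1. F t u = g t u + L2_inner (slice h t) u)}"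

text \<open>
  The field \<open>f\<close> and the functional-valued \<open>F\<close> are the same distribution at almost every positive time.
  As test fields are dense in \<open>H\<^sup>1\<close>, this determines \<open>F t\<close> on \<open>H\<^sup>1\<close> if \<open>F t \<in> Hm1\<close>.
\<close>

definition same_force ::
  "(space \<times> real \<Rightarrow> space) \<Rightarrow> (real \<Rightarrow> (space \<Rightarrow> space) \<Rightarrow> real) \<Rightarrow> bool" where
  "same_force f F \<longleftrightarrow> (AE t in lebesgue_on {0<..}.
     loc_integrable UNIV (slice f t) \<and> (\<forall>\<phi> \<in> test_fun UNIV. F t \<phi> = L2_inner (slice f t) \<phi>))"


section \<open>Leray--Hopf solutions\<close>

text \<open>\<open>(u \<bullet> \<nabla>) u\<close> with weak derivatives\<close>

definition convection :: "(space \<Rightarrow> space) \<Rightarrow> space \<Rightarrow> space" where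
  "convection u \<xi> = (\<Sum>i\<in>UNIV. (u \<xi> $ i) *\<^sub>R wpartial i u \<xi>)"

text \<open>
  The space \<open>\<D>\<^sub>S\<close>.  Its elements are smooth up to the initial time and need not vanish there.
  Their values outside the time interval \<open>[0,S)\<close> are irrelevant.
\<close>

definition sol_test_fun :: "real \<Rightarrow> (space \<times> real \<Rightarrow> space) set" where
  "sol_test_fun S = {\<phi>. smooth_on (UNIV \<times> {0..<S}) \<phi> \<and>
     (\<exists>K. compact K \<and> K \<subseteq> UNIV \<times> {0..<S} \<and> (\<forall>x \<in> UNIV \<times> {0..<S} - K. \<phi> x = 0)) \<and>
     (\<forall>t\<in>{0..<S}. \<forall>\<xi>. divergence (slice \<phi> t) \<xi> = 0)}"

text \<open>The two sides of the energy inequality at time \<open>t\<close>\<close>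

definition energy_lhs :: "(space \<times> real \<Rightarrow> space) \<Rightarrow> real \<Rightarrow> real" where
  "energy_lhs V t = (Lp_norm lebesgue 2 (slice V t))\<^sup>2
     + 2 * (LINT s:{0<..<t}|lebesgue. wgrad_sqnorm (slice V s))"

definition energy_rhs :: "(space \<Rightarrow> space) \<Rightarrow> (real \<Rightarrow> (space \<Rightarrow> space) \<Rightarrow> real)
    \<Rightarrow> (space \<times> real \<Rightarrow> space) \<Rightarrow> real \<Rightarrow> real" where
  "energy_rhs V0 F V t = (Lp_norm lebesgue 2 V0)\<^sup>2
     + 2 * (LINT s:{0<..<t}|lebesgue. F s (slice V s))"

definition leray_hopf :: "real \<Rightarrow> (space \<Rightarrow> space) \<Rightarrow> (real \<Rightarrow> (space \<Rightarrow> space) \<Rightarrow> real)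
    \<Rightarrow> (space \<times> real \<Rightarrow> space) \<Rightarrow> bool" where
  "leray_hopf S V0 F V \<longleftrightarrow>
     V0 \<in> L2_sigma \<and> F \<in> forcing S \<and>
     V \<in> bochner \<infinity> S L2_sigma (Lp_norm lebesgue 2) \<and>
     V \<in> bochner 2 S H1 H1_norm \<and>
     (\<forall>\<phi> \<in> sol_test_fun S.
        (LINT t:{0<..<S}|lebesgue. (\<integral>\<xi>.
             (\<Sum>i\<in>UNIV. wpartial i (slice V t) \<xi> \<bullet> partial i (slice \<phi> t) \<xi>)
             + convection (slice V t) \<xi> \<bullet> \<phi> (\<xi>, t)
             - V (\<xi>, t) \<bullet> time_deriv \<phi> (\<xi>, t) \<partial>lebesgue))
        = (LINT t:{0<..<S}|lebesgue. F t (slice \<phi> t)) + L2_inner V0 (slice \<phi> 0)) \<and>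
     (\<forall>t\<in>{0<..S}. slice V t \<in> Lp lebesgue 2 \<and> energy_lhs V t \<le> energy_rhs V0 F V t)"

definition global_leray_hopf :: "(space \<Rightarrow> space) \<Rightarrow> (real \<Rightarrow> (space \<Rightarrow> space) \<Rightarrow> real)
    \<Rightarrow> (space \<times> real \<Rightarrow> space) \<Rightarrow> bool" where
  "global_leray_hopf V0 F V \<longleftrightarrow> (\<forall>S>0. leray_hopf S V0 F V)"

text \<open>
  The momentum equation holds in the sense of distributions on \<open>\<real>\<^sup>3 \<times> (0,\<infinity>)\<close>, and its divergence
  \<open>- \<Delta> P = \<nabla> \<bullet> [(V \<bullet> \<nabla>) V - f]\<close> in the sense of distributions on \<open>\<real>\<^sup>3\<close> at almost every time.
\<close>

definition associated_pressure :: "(real \<Rightarrow> (space \<Rightarrow> space) \<Rightarrow> real)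
    \<Rightarrow> (space \<times> real \<Rightarrow> space) \<Rightarrow> (space \<times> real \<Rightarrow> real) \<Rightarrow> bool" where
  "associated_pressure F V P \<longleftrightarrow>
     (\<forall>S>0. loc_integrable (UNIV \<times> {0<..<S}) P) \<and>
     (\<forall>\<phi> \<in> test_fun (UNIV \<times> {0<..}).
        (LINT t:{0<..}|lebesgue. (\<integral>\<xi>.
             - (V (\<xi>, t) \<bullet> time_deriv \<phi> (\<xi>, t))
             - V (\<xi>, t) \<bullet> laplacian (slice \<phi> t) \<xi>
             + convection (slice V t) \<xi> \<bullet> \<phi> (\<xi>, t)
             - P (\<xi>, t) * divergence (slice \<phi> t) \<xi> \<partial>lebesgue))
        = (LINT t:{0<..}|lebesgue. F t (slice \<phi> t))) \<and>
     (AE t in lebesgue_on {0<..}. loc_integrable UNIV (slice P t) \<and>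
        (\<forall>\<phi> \<in> test_fun UNIV.
           - (\<integral>\<xi>. P (\<xi>, t) * laplacian \<phi> \<xi> \<partial>lebesgue)
           = F t (gradient \<phi>) - L2_inner (convection (slice V t)) (gradient \<phi>)))"

text \<open>
  \<open>Q\<close> is a parameter, rather than a choice of weak derivatives made separately at each time,
  so that its joint measurability is meaningful.
\<close>

definition is_space_gradient ::
  "(space \<times> real \<Rightarrow> real) \<Rightarrow> (space \<times> real \<Rightarrow> space) \<Rightarrow> bool" where
  "is_space_gradient P Q \<longleftrightarrow> (AE t in lebesgue_on {0<..}.
     \<forall>i. weak_deriv [axis i 1] (slice P t) (\<lambda>\<xi>. Q (\<xi>, t) $ i))"

end

(* For prescribed smooth divergence-free V the force V_t - Laplace V + (V.grad) V makes V a solution with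
   pressure 0. Take V to be a sum of rotating swirls with disjoint supports, swirl k living in a ball of radius
   e_k and a time window of length about e_k^2 with amplitude e_k^(-delta). The force then has size
   e_k^(-2-delta), and lies in L^r L^q as soon as 2 + delta < 2/r + 3/q, if e_k decreases geometrically.
   For each m, infinitely many swirls are centred at time T_m and shrink to xi_m, so V blows up there, and
   elsewhere only finitely many swirls are seen locally. Uniqueness: a Leray-Hopf solution W is compared with
   the finite partial sums of V, which are admissible test fields; the sum over k of
   e_k^2 e_k^(-2 delta), a bound for the time integral of the squared sup norm of V, keeps the Gronwall
   factor bounded. *)
theory Submission
  imports Defs
begin

section \<open>Calculus of smooth functions\<close>

abbreviation smooth :: "('a::euclidean_space \<Rightarrow> 'b::real_normed_vector) \<Rightarrow> bool" where
  "smooth u \<equiv> smooth_open UNIV u"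

lemma dir_derivI: "(u has_derivative u') (at x) \<Longrightarrow> dir_deriv v u x = u' v"
  unfolding dir_deriv_def using frechet_derivative_at by metis

lemma has_derivative_dir_deriv:
  "u differentiable (at x) \<Longrightarrow> (u has_derivative (\<lambda>v. dir_deriv v u x)) (at x)"
  unfolding dir_deriv_def using frechet_derivative_works by blast

lemma dir_deriv_cong_open:
  assumes "open U" "x \<in> U" "\<And>y. y \<in> U \<Longrightarrow> u y = v y"
  shows "dir_deriv b u x = dir_deriv b v x" "u differentiable (at x) \<longleftrightarrow> v differentiable (at x)"
proof -
  have eq: "(u has_derivative D) (at x) \<longleftrightarrow> (v has_derivative D) (at x)" for D
    using has_derivative_transform_within_open[where f=u and g=v and f'=D, OF _ assms(1,2)]
      has_derivative_transform_within_open[where f=v and g=u and f'=D, OF _ assms(1,2)] assms(3) by auto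
  \<comment> \<open>\<open>frechet_derivative\<close> is a choice among the derivatives at the
    point. Both functions have the same derivatives there, so the choices agree even if none
    exists.\<close>
  show "dir_deriv b u x = dir_deriv b v x"
    by (simp add: dir_deriv_def frechet_derivative_def eq)
  show "u differentiable (at x) \<longleftrightarrow> v differentiable (at x)"
    by (simp add: differentiable_def eq)
qed

lemma Ck_open_cong:
  assumes "open U" "\<And>y. y \<in> U \<Longrightarrow> u y = v y" "Ck_open k U u"
  shows "Ck_open k U v"
  using assms(2,3)
proof (induction k arbitrary: u v)
  case 0
  then show ?case using continuous_on_cong[OF refl, of U u v] by simp
next
  case (Suc k)
  have "Ck_open k U (dir_deriv b v)" if "b \<in> Basis" for b
  proof (rule Suc.IH)
    show "dir_deriv b u y = dir_deriv b v y" if "y \<in> U" for y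
      using dir_deriv_cong_open(1)[where u=u and v=v, OF assms(1) that] Suc.prems(1) by blast
    show "Ck_open k U (dir_deriv b u)" using Suc.prems(2) \<open>b \<in> Basis\<close> by simp
  qed
  moreover have "v differentiable at x" if "x \<in> U" for x
    using dir_deriv_cong_open(2)[where u=u and v=v, OF assms(1) that] Suc.prems that by simp
  ultimately show ?case by simp
qed

lemma Ck_open_subset: "Ck_open k U u \<Longrightarrow> U' \<subseteq> U \<Longrightarrow> Ck_open k U' u"
  by (induction k arbitrary: u) (auto intro: continuous_on_subset)

text \<open>Fields in \<open>sol_test_fun\<close> are smooth only in the sense of local smooth
  extensions. As \<open>dir_deriv\<close> depends on a neighbourhood of the point alone, the local
  extensions decide the regularity on the whole open set.\<close>

lemma Ck_open_local:
  assumes "open U" "\<And>x. x \<in> U \<Longrightarrow> \<exists>N v. open N \<and> x \<in> N \<and> Ck_open k N v \<and> (\<forall>y\<in>U \<inter> N. v y = u y)"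
  shows "Ck_open k U u"
  using assms(2)
proof (induction k arbitrary: u)
  case 0
  have "isCont u x" if "x \<in> U" for x
  proof -
    obtain N v where N: "open N" "x \<in> N" "continuous_on N v" "\<forall>y\<in>U \<inter> N. v y = u y"
      using 0 \<open>x \<in> U\<close> by (force simp: Ck_open.simps)
    have "continuous_on (U \<inter> N) v" using N by (auto intro: continuous_on_subset)
    then have "continuous_on (U \<inter> N) u" using N(4) continuous_on_cong[of "U \<inter> N" "U \<inter> N" v u] by simp
    then show ?thesis using N assms(1) that by (simp add: continuous_on_eq_continuous_at open_Int)
  qed
  then show ?case by (simp add: continuous_at_imp_continuous_on)
next
  case (Suc k)
  have *: "\<exists>N v. open N \<and> x \<in> N \<and> N \<subseteq> U \<and> Ck_open (Suc k) N v \<and> (\<forall>y\<in>N. v y = u y)" if x: "x \<in> U" for x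
  proof -
    obtain N v where N: "open N" "x \<in> N" "Ck_open (Suc k) N v" "\<forall>y\<in>U \<inter> N. v y = u y"
      using Suc.prems x by blast
    show ?thesis
      using N x assms(1) by (intro exI[of _ "U \<inter> N"] exI[of _ v]) (auto intro: Ck_open_subset[OF N(3)] simp del: Ck_open.simps)
  qed
  have "u differentiable (at x)" if x: "x \<in> U" for x
  proof -
    obtain N v where N: "open N" "x \<in> N" "Ck_open (Suc k) N v" "\<forall>y\<in>N. v y = u y" using *[OF x] by blast
    then have "v differentiable at x" by simp
    then show ?thesis using dir_deriv_cong_open(2)[OF N(1,2), of v u] N(4) by blast
  qed
  moreover have "Ck_open k U (dir_deriv b u)" if b: "b \<in> Basis" for b
  proof (rule Suc.IH)
    fix x assume x: "x \<in> U"
    obtain N v where N: "open N" "x \<in> N" "N \<subseteq> U" "Ck_open (Suc k) N v" "\<forall>y\<in>N. v y = u y" using *[OF x] by blast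
    have "Ck_open k N (dir_deriv b v)" using N(4) b by simp
    moreover have "dir_deriv b v y = dir_deriv b u y" if "y \<in> N" for y
      using dir_deriv_cong_open(1)[OF N(1) that, of v u b] N(5) by blast
    ultimately show "\<exists>N v. open N \<and> x \<in> N \<and> Ck_open k N v \<and> (\<forall>y\<in>U \<inter> N. v y = dir_deriv b u y)"
      using N(1,2) by blast
  qed
  ultimately show ?case by simp
qed

lemma Ck_open_imp_continuous: "Ck_open k U u \<Longrightarrow> continuous_on U u"
proof (cases k)
  case (Suc n)
  moreover assume "Ck_open k U u"
  ultimately show ?thesis
    by (auto intro!: continuous_at_imp_continuous_on differentiable_imp_continuous_within)
qed simp

text \<open>The recursion of \<open>Ck_open\<close> records continuity only at the last order; at
  the lower orders it comes from differentiability.\<close>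

lemma Ck_open_SucD: "Ck_open (Suc k) U u \<Longrightarrow> Ck_open k U u"
proof (induction k arbitrary: u)
  case 0
  then show ?case using Ck_open_imp_continuous[of "Suc 0" U u] by simp
next
  case (Suc k)
  then have "Ck_open k U (dir_deriv b u)" if "b \<in> Basis" for b using that by simp
  with Suc.prems show ?case by simp
qed

lemma smooth_imp_continuous: "smooth u \<Longrightarrow> continuous_on UNIV u"
  using Ck_open_imp_continuous smooth_open_def by blast

lemma smooth_imp_differentiable: "smooth u \<Longrightarrow> u differentiable (at x)"
  using Ck_open.simps(2)[of 0 UNIV u] unfolding smooth_open_def by blast

lemma smooth_dir_deriv: "smooth u \<Longrightarrow> b \<in> Basis \<Longrightarrow> smooth (dir_deriv b u)"
  using Ck_open.simps(2)[of _ UNIV u] unfolding smooth_open_def by blast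

text \<open>Trades the chosen derivative \<open>dir_deriv\<close> for an explicit formula, so that
  inductions on k can work with formulas.\<close>

lemma Ck_open_SucI:
  assumes "open U" "\<And>x. x \<in> U \<Longrightarrow> (u has_derivative u' x) (at x)"
    "\<And>b. b \<in> Basis \<Longrightarrow> Ck_open k U (\<lambda>x. u' x b)"
  shows "Ck_open (Suc k) U u"
proof -
  have "Ck_open k U (dir_deriv b u)" if "b \<in> Basis" for b
    using Ck_open_cong[OF assms(1) _ assms(3)[OF that]] dir_derivI[OF assms(2), of _ b] by simp
  then show ?thesis using assms(2) by (auto simp: differentiable_def)
qed

text \<open>Bootstrapping for solutions of a differential equation: if the derivative is an
  expression in u, regularity of order k passes to the derivative and gives order k + 1 for
  u.\<close>

lemma smooth_sol:
  assumes "\<And>k. (\<And>x. Ck_open k UNIV u) \<Longrightarrow> Ck_open (Suc k) UNIV u" "continuous_on UNIV u"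
  shows "smooth u"
proof -
  have "Ck_open k UNIV u" for k
    by (induction k) (use assms in auto)
  then show ?thesis by (simp add: smooth_open_def)
qed

lemma Ck_const: "open U \<Longrightarrow> Ck_open k U (\<lambda>x. c)"
proof (induction k arbitrary: c)
  case (Suc k)
  then show ?case
    by (intro Ck_open_SucI[where u'="\<lambda>x v. 0"]) auto
qed auto

lemma smooth_const: "smooth (\<lambda>x. c)"
  by (simp add: smooth_open_def Ck_const)

lemma smooth_linear:
  assumes "bounded_linear f" shows "smooth f"
proof -
  have "Ck_open k UNIV f" for k
  proof (cases k)
    case 0
    then show ?thesis using assms by (simp add: linear_continuous_on)
  next
    case (Suc n)
    show ?thesis unfolding Suc
      by (rule Ck_open_SucI[where u'="\<lambda>x. f"])
        (auto intro: bounded_linear_imp_has_derivative assms Ck_const)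
  qed
  then show ?thesis by (simp add: smooth_open_def)
qed

lemma Ck_add:
  assumes "open U" "Ck_open k U u" "Ck_open k U v"
  shows "Ck_open k U (\<lambda>x. u x + v x)"
  using assms(2,3)
proof (induction k arbitrary: u v)
  case (Suc k)
  show ?case
    by (rule Ck_open_SucI[OF assms(1), where u'="\<lambda>x b. dir_deriv b u x + dir_deriv b v x"])
      (use Suc in \<open>auto intro!: has_derivative_add has_derivative_dir_deriv\<close>)
qed (auto intro: continuous_on_add)

lemma smooth_add: "smooth u \<Longrightarrow> smooth v \<Longrightarrow> smooth (\<lambda>x. u x + v x)"
  by (auto simp: smooth_open_def intro: Ck_add)

lemma smooth_sum: "finite A \<Longrightarrow> (\<And>i. i \<in> A \<Longrightarrow> smooth (u i)) \<Longrightarrow> smooth (\<lambda>x. \<Sum>i\<in>A. u i x)"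
  by (induction A rule: finite_induct) (auto intro: smooth_add smooth_const)

text \<open>One product rule serves scaling, multiplication and inner product. Both factors stay
  general in the induction, since each term of the derivative differentiates only one of
  them.\<close>

lemma Ck_bilinear:
  fixes u :: "'a::euclidean_space \<Rightarrow> 'b::real_normed_vector" and v :: "'a \<Rightarrow> 'c::real_normed_vector"
  assumes bl: "bounded_bilinear prd" and "open U" "Ck_open k U u" "Ck_open k U v"
  shows "Ck_open k U (\<lambda>x. prd (u x) (v x))"
  using assms(3,4)
proof (induction k arbitrary: u v)
  case 0
  then show ?case using bounded_bilinear.continuous_on[OF bl] by auto
next
  case (Suc k)
  show ?case
  proof (rule Ck_open_SucI[OF assms(2), where u'="\<lambda>x b. prd (u x) (dir_deriv b v x) + prd (dir_deriv b u x) (v x)"])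
    fix x assume "x \<in> U"
    then show "((\<lambda>x. prd (u x) (v x)) has_derivative
       (\<lambda>b. prd (u x) (dir_deriv b v x) + prd (dir_deriv b u x) (v x))) (at x)"
      using Suc.prems by (intro bounded_bilinear.FDERIV[OF bl]) (auto intro!: has_derivative_dir_deriv)
  next
    fix b :: 'a assume b: "b \<in> Basis"
    show "Ck_open k U (\<lambda>x. prd (u x) (dir_deriv b v x) + prd (dir_deriv b u x) (v x))"
      using Suc.prems[THEN Ck_open_SucD] Suc.prems b
      by (intro Ck_add[OF assms(2)] Suc.IH) auto
  qed
qed

lemma smooth_scaleR: "smooth u \<Longrightarrow> smooth v \<Longrightarrow> smooth (\<lambda>x. u x *\<^sub>R v x)"
  by (auto simp: smooth_open_def intro: Ck_bilinear[OF bounded_bilinear_scaleR])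

lemma smooth_mult:
  fixes u v :: "'a::euclidean_space \<Rightarrow> real"
  shows "smooth u \<Longrightarrow> smooth v \<Longrightarrow> smooth (\<lambda>x. u x * v x)"
  by (auto simp: smooth_open_def intro: Ck_bilinear[OF bounded_bilinear_mult])

lemma smooth_inner:
  fixes u v :: "'a::euclidean_space \<Rightarrow> 'b::real_inner"
  shows "smooth u \<Longrightarrow> smooth v \<Longrightarrow> smooth (\<lambda>x. u x \<bullet> v x)"
  by (auto simp: smooth_open_def intro: Ck_bilinear[OF bounded_bilinear_inner])

lemma smooth_bounded_linear:
  assumes "bounded_linear f" "smooth u" shows "smooth (\<lambda>x. f (u x))"
proof -
  have "Ck_open k UNIV (\<lambda>x. f (u x))" if "Ck_open k UNIV u" for k
    using that
  proof (induction k arbitrary: u)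
    case 0
    then show ?case using assms(1) by (auto intro: bounded_linear.continuous_on)
  next
    case (Suc k)
    then show ?case
      by (intro Ck_open_SucI[where u'="\<lambda>x b. f (dir_deriv b u x)"])
        (auto intro!: bounded_linear.has_derivative[OF assms(1)] has_derivative_dir_deriv)
  qed
  then show ?thesis using assms(2) by (simp add: smooth_open_def)
qed

lemma smooth_diff: "smooth u \<Longrightarrow> smooth v \<Longrightarrow> smooth (\<lambda>x. u x - v x)"
  using smooth_add[OF _ smooth_bounded_linear[OF bounded_linear_minus[OF bounded_linear_ident]], of u v] by simp

text \<open>The induction varies the outer function only: the derivative of the composition is that
  of g times the derivative of f composed with the same g, and the derivative of f is again
  smooth.\<close>

lemma smooth_compose_real:
  fixes f :: "real \<Rightarrow> real" and g :: "'a::euclidean_space \<Rightarrow> real"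
  assumes "smooth f" "smooth g" shows "smooth (\<lambda>x. f (g x))"
proof -
  have "Ck_open k UNIV (\<lambda>x. f (g x))" if "smooth f" for k
    using that
  proof (induction k arbitrary: f)
    case 0
    have "continuous_on UNIV g" by (simp add: assms(2) smooth_imp_continuous)
    then show ?case using smooth_imp_continuous[OF 0]
      by (auto intro: continuous_on_compose2)
  next
    case (Suc k)
    show ?case
    proof (rule Ck_open_SucI[where u'="\<lambda>x b. dir_deriv b g x * dir_deriv 1 f (g x)"])
      fix x
      have "(f has_derivative (\<lambda>v. dir_deriv v f (g x))) (at (g x))"
        by (rule has_derivative_dir_deriv[OF smooth_imp_differentiable[OF Suc.prems]])
      moreover have "(g has_derivative (\<lambda>v. dir_deriv v g x)) (at x)"
        by (rule has_derivative_dir_deriv[OF smooth_imp_differentiable[OF assms(2)]])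
      ultimately have cmp: "((\<lambda>x. f (g x)) has_derivative (\<lambda>v. dir_deriv (dir_deriv v g x) f (g x))) (at x)"
        by (rule has_derivative_compose[rotated])
      have hom: "dir_deriv c f y = c * dir_deriv 1 f y" for c y
      proof -
        have "linear (\<lambda>v. dir_deriv v f y)"
          using has_derivative_dir_deriv[OF smooth_imp_differentiable[OF Suc.prems], of y] has_derivative_linear by blast
        from linear_cmul[OF this, of c 1] show ?thesis by simp
      qed
      show "((\<lambda>x. f (g x)) has_derivative (\<lambda>b. dir_deriv b g x * dir_deriv 1 f (g x))) (at x)"
        by (intro has_derivative_eq_rhs[OF cmp] ext hom)
    next
      fix b :: 'a assume b: "b \<in> Basis"
      have "Ck_open k UNIV (\<lambda>x. dir_deriv 1 f (g x))"
        by (intro Suc.IH smooth_dir_deriv Suc.prems) simp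
      moreover have "Ck_open k UNIV (dir_deriv b g)"
        using smooth_dir_deriv[OF assms(2) b] by (simp add: smooth_open_def)
      ultimately show "Ck_open k UNIV (\<lambda>x. dir_deriv b g x * dir_deriv 1 f (g x))"
        by (intro Ck_bilinear[OF bounded_bilinear_mult]) auto
    qed simp
  qed
  with assms(1) show ?thesis by (simp add: smooth_open_def)
qed

lemma Ck_open_Suc_real:
  fixes f :: "real \<Rightarrow> real"
  assumes "\<And>x. (f has_real_derivative f' x) (at x)" "Ck_open k UNIV f'"
  shows "Ck_open (Suc k) UNIV f"
  using assms by (intro Ck_open_SucI[where u'="\<lambda>x b. f' x * b"]) (auto simp: has_field_derivative_def)

lemma smooth_real_derivative:
  fixes f :: "real \<Rightarrow> real"
  assumes "\<And>x. (f has_real_derivative f' x) (at x)" "smooth f'"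
  shows "smooth f"
proof -
  have "Ck_open (Suc k) UNIV f" for k
    using assms(2) by (intro Ck_open_Suc_real[OF assms(1)]) (simp add: smooth_open_def)
  then have "Ck_open k UNIV f" for k using Ck_open_SucD by blast
  then show ?thesis by (simp add: smooth_open_def)
qed

lemma smooth_exp: "smooth (exp :: real \<Rightarrow> real)"
  by (rule smooth_sol) (rule Ck_open_Suc_real[OF DERIV_exp], auto intro: continuous_intros)

text \<open>u = 1/(1 + s^2) solves u' = -2 s u^2. Its primitive \<open>arctan\<close>, smooth,
  bounded and increasing, later builds the Gronwall weights.\<close>

lemma smooth_inverse_1_plus_square: "smooth (\<lambda>s::real. inverse (1 + s\<^sup>2))"
proof (rule smooth_sol)
  fix k assume IH: "\<And>x::real. Ck_open k UNIV (\<lambda>s::real. inverse (1 + s\<^sup>2))"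
  have nz: "1 + s\<^sup>2 \<noteq> 0" for s::real by (metis add_pos_nonneg less_irrefl zero_le_power2 zero_less_one)
  have "Ck_open k UNIV (\<lambda>s::real. (- 2 * s) * (inverse (1 + s\<^sup>2) * inverse (1 + s\<^sup>2)))"
    using smooth_linear[OF bounded_linear_mult_right[of "- 2 :: real"]] IH
    by (intro Ck_bilinear[OF bounded_bilinear_mult, where u="\<lambda>s. - 2 * s"]
        Ck_bilinear[OF bounded_bilinear_mult, where u="\<lambda>s. inverse (1 + s\<^sup>2)"])
      (simp_all only: smooth_open_def open_UNIV)
  then show "Ck_open (Suc k) UNIV (\<lambda>s::real. inverse (1 + s\<^sup>2))"
    by (rule Ck_open_Suc_real[rotated])
      (use nz in \<open>auto intro!: derivative_eq_intros simp: power2_eq_square\<close>)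
next
  have nz: "1 + s\<^sup>2 \<noteq> 0" for s::real by (metis add_pos_nonneg less_irrefl zero_le_power2 zero_less_one)
  then show "continuous_on UNIV (\<lambda>s::real. inverse (1 + s\<^sup>2))"
    by (intro continuous_intros) auto
qed

lemma smooth_arctan: "smooth (arctan :: real \<Rightarrow> real)"
  by (rule smooth_real_derivative[OF DERIV_arctan smooth_inverse_1_plus_square])

section \<open>Bump functions\<close>

text \<open>The powers of 1/s are included because this family, unlike exp(-1/s) alone, is closed
  under differentiation up to linear combinations; one induction then covers all orders.\<close>

definition exp_inv :: "nat \<Rightarrow> real \<Rightarrow> real" where
  "exp_inv n s = (if s > 0 then inverse s ^ n * exp (- inverse s) else 0)"

lemma exp_inv_tendsto: "((\<lambda>s. exp_inv n s) \<longlongrightarrow> 0) (at 0)"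
proof -
  have "((\<lambda>s. exp_inv n s) \<longlongrightarrow> 0) (at_right 0)"
  proof -
    have "((\<lambda>x::real. x ^ n * exp (- x)) \<longlongrightarrow> 0) at_top"
      using tendsto_power_div_exp_0[of n] by (simp add: exp_minus field_simps)
    then have "((\<lambda>s::real. inverse s ^ n * exp (- inverse s)) \<longlongrightarrow> 0) (at_right 0)"
      using filterlim_compose filterlim_inverse_at_top_right by blast
    then show ?thesis
      by (rule Lim_transform_eventually) (auto simp: eventually_at_filter exp_inv_def)
  qed
  moreover have "((\<lambda>s. exp_inv n s) \<longlongrightarrow> 0) (at_left 0)"
    by (rule Lim_transform_eventually[OF tendsto_const]) (auto simp: eventually_at_filter exp_inv_def)
  ultimately show ?thesis by (simp add: filterlim_split_at)
qed

lemma exp_inv_deriv: "(exp_inv n has_real_derivative exp_inv (n + 2) s - n * exp_inv (n + 1) s) (at s)"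
proof (cases s "0::real" rule: linorder_cases)
  case equal
  \<comment> \<open>The difference quotient of \<open>exp_inv n\<close> at 0 is
    \<open>exp_inv (Suc n)\<close>, whose limit at 0 is known.\<close>
  have "((\<lambda>h. (exp_inv n (0 + h) - exp_inv n 0) / h) \<longlongrightarrow> 0) (at 0)"
    by (rule Lim_transform_eventually[OF exp_inv_tendsto[of "Suc n"]])
      (auto simp: eventually_at_filter exp_inv_def field_simps)
  then show ?thesis using equal by (simp add: DERIV_def exp_inv_def)
next
  case less
  have "((\<lambda>x. 0) has_real_derivative 0) (at s)" by simp
  then have "(exp_inv n has_real_derivative 0) (at s)"
    by (rule has_field_derivative_transform_within_open[where S="{..<0}"]) (use less in \<open>auto simp: exp_inv_def\<close>)
  then show ?thesis using less by (simp add: exp_inv_def)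
next
  case greater
  have "((\<lambda>s. inverse s ^ n * exp (- inverse s)) has_real_derivative exp_inv (n + 2) s - n * exp_inv (n + 1) s) (at s)"
  proof -
    have i: "(inverse has_real_derivative - (inverse s)\<^sup>2) (at s)"
      using DERIV_inverse[of s] greater by (simp add: power2_eq_square)
    \<comment> \<open>For n = 0 the exponent \<open>n - Suc 0\<close> is cut off at 0, which is
      harmless because the factor n vanishes.\<close>
    have e: "real n * (- (inverse s)\<^sup>2 * inverse s ^ (n - Suc 0)) = - real n * inverse s ^ (n + 1)"
      by (cases n) (simp_all add: power2_eq_square algebra_simps)
    have "((\<lambda>s. inverse s ^ n) has_real_derivative - real n * inverse s ^ (n + 1)) (at s)"
      using DERIV_power[OF i, of n] unfolding e .
    moreover have "((\<lambda>s. exp (- inverse s)) has_real_derivative exp (- inverse s) * (inverse s)\<^sup>2) (at s)"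
      using DERIV_chain2[OF DERIV_exp DERIV_minus[OF i]] by simp
    ultimately show ?thesis
      by (rule DERIV_cong[OF DERIV_mult]) (use greater in \<open>simp add: exp_inv_def power_add algebra_simps power2_eq_square\<close>)
  qed
  then show ?thesis
    by (rule has_field_derivative_transform_within_open[where S="{0<..}"]) (use greater in \<open>auto simp: exp_inv_def\<close>)
qed

lemma smooth_exp_inv: "smooth (exp_inv n)"
proof -
  have "Ck_open k UNIV (exp_inv n)" for k
  proof (induction k arbitrary: n)
    case 0
    show ?case using exp_inv_deriv by (auto intro!: continuous_at_imp_continuous_on DERIV_isCont)
  next
    case (Suc k)
    show ?case
    proof (rule Ck_open_Suc_real[OF exp_inv_deriv])
      have "Ck_open k UNIV (\<lambda>s. exp_inv (n + 2) s + (- real n) * exp_inv (n + 1) s)"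
        by (intro Ck_add Ck_bilinear[OF bounded_bilinear_mult] Ck_const Suc.IH) auto
      then show "Ck_open k UNIV (\<lambda>s. exp_inv (n + 2) s - real n * exp_inv (n + 1) s)" by simp
    qed
  qed
  then show ?thesis by (simp add: smooth_open_def)
qed

lemma exp_inv_0: "exp_inv 0 s \<ge> 0" "exp_inv 0 s \<le> 1" "s > 0 \<Longrightarrow> exp_inv 0 s > 0" "s \<le> 0 \<Longrightarrow> exp_inv n s = 0"
  by (auto simp: exp_inv_def)

text \<open>It is applied to squared distances, so it gives a smooth bump also at the centre. Its
  derivative is strictly negative below 1, which lets the same function serve as time weight in the
  uniqueness proof.\<close>

definition cutoff :: "real \<Rightarrow> real" where "cutoff s = exp_inv 0 (1 - s)"
definition cutoff' :: "real \<Rightarrow> real" where "cutoff' s = - exp_inv 2 (1 - s)"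
definition cutoff'' :: "real \<Rightarrow> real" where "cutoff'' s = exp_inv 4 (1 - s) - 2 * exp_inv 3 (1 - s)"

lemma cutoff_deriv: "(cutoff has_real_derivative cutoff' s) (at s)"
  unfolding cutoff_def cutoff'_def
  by (rule DERIV_cong[OF DERIV_chain2[OF exp_inv_deriv[of 0]]]) (auto intro!: derivative_eq_intros simp: eval_nat_numeral)

lemma cutoff'_deriv: "(cutoff' has_real_derivative cutoff'' s) (at s)"
  unfolding cutoff'_def cutoff''_def
  by (rule DERIV_cong[OF DERIV_minus[OF DERIV_chain2[OF exp_inv_deriv[of 2]]]])
    (auto intro!: derivative_eq_intros simp: eval_nat_numeral)

lemma smooth_exp_inv_compl: "smooth (\<lambda>s. exp_inv n (1 - s))"
  by (rule smooth_compose_real[OF smooth_exp_inv smooth_diff[OF smooth_const smooth_linear[OF bounded_linear_ident]]])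

lemma smooth_cutoff: "smooth cutoff"
  unfolding cutoff_def[abs_def] by (rule smooth_exp_inv_compl)

lemma smooth_cutoff': "smooth cutoff'"
proof -
  have "smooth (\<lambda>s. (- 1) *\<^sub>R exp_inv 2 (1 - s))"
    by (intro smooth_exp_inv_compl smooth_scaleR smooth_const)
  moreover have "cutoff' = (\<lambda>s. (- 1) *\<^sub>R exp_inv 2 (1 - s))"
    by (rule ext) (simp add: cutoff'_def)
  ultimately show ?thesis by simp
qed

lemma smooth_cutoff'': "smooth cutoff''"
proof -
  have "smooth (\<lambda>s. exp_inv 4 (1 - s) - (2 *\<^sub>R exp_inv 3 (1 - s)))"
    by (intro smooth_diff smooth_exp_inv_compl smooth_scaleR smooth_const)
  moreover have "cutoff'' = (\<lambda>s. exp_inv 4 (1 - s) - (2 *\<^sub>R exp_inv 3 (1 - s)))"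
    by (rule ext) (simp add: cutoff''_def)
  ultimately show ?thesis by simp
qed

lemma cutoff_bounds: "0 \<le> cutoff s" "cutoff s \<le> 1" "s < 1 \<Longrightarrow> 0 < cutoff s" "s < 1 \<Longrightarrow> cutoff' s < 0"
  "cutoff' s \<le> 0"
  by (simp_all add: cutoff_def cutoff'_def exp_inv_def)

lemma cutoff_eq_0: "1 \<le> s \<Longrightarrow> cutoff s = 0" "1 \<le> s \<Longrightarrow> cutoff' s = 0" "1 \<le> s \<Longrightarrow> cutoff'' s = 0"
  by (auto simp: cutoff_def cutoff'_def cutoff''_def exp_inv_0)

section \<open>Integration of smooth functions\<close>

lemma continuous_borel: "continuous_on UNIV f \<Longrightarrow> f \<in> borel_measurable borel"
  by (rule borel_measurable_continuous_onI)

lemma integrable_compact_support: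
  fixes f :: "'a::euclidean_space \<Rightarrow> 'b::{banach, second_countable_topology}"
  assumes "continuous_on UNIV f" "compact K" "\<And>x. x \<notin> K \<Longrightarrow> f x = 0"
  shows "integrable lborel f"
proof -
  have "integrable lborel (\<lambda>x. indicator K x *\<^sub>R f x)"
    using assms by (intro borel_integrable_compact) (auto intro: continuous_on_subset)
  moreover have "(\<lambda>x. indicator K x *\<^sub>R f x) = f"
    using assms(3) by (auto simp: indicator_def fun_eq_iff)
  ultimately show ?thesis by simp
qed

lemma integrable_lebesgue_iff:
  fixes f :: "'a::euclidean_space \<Rightarrow> 'b::{banach, second_countable_topology}"
  shows "f \<in> borel_measurable borel \<Longrightarrow> integrable lebesgue f \<longleftrightarrow> integrable lborel f"
  by (rule integrable_completion) simp

lemma integral_lebesgue_eq: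
  fixes f :: "'a::euclidean_space \<Rightarrow> 'b::{banach, second_countable_topology}"
  shows "f \<in> borel_measurable borel \<Longrightarrow> integral\<^sup>L lebesgue f = integral\<^sup>L lborel f"
  by (rule integral_completion) simp

lemma dir_deriv_outside:
  assumes "closed K" "\<And>x. x \<notin> K \<Longrightarrow> u x = 0" "x \<notin> K"
  shows "dir_deriv b u x = 0"
proof -
  have "dir_deriv b u x = dir_deriv b (\<lambda>x. 0) x"
    by (rule dir_deriv_cong_open(1)[of "- K"]) (use assms in auto)
  also have "\<dots> = 0" by (rule dir_derivI[where u'="\<lambda>v. 0"]) simp
  finally show ?thesis .
qed

lemma continuous_compact_support_bounded:
  fixes f :: "'a::euclidean_space \<Rightarrow> 'b::real_normed_vector"
  assumes "continuous_on UNIV f" "compact K" "\<And>x. x \<notin> K \<Longrightarrow> f x = 0"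
  obtains C where "C > 0" "\<And>x. norm (f x) \<le> C"
proof -
  have "bounded (f ` K)"
    using assms compact_continuous_image continuous_on_subset compact_imp_bounded by blast
  then obtain C where "C > 0" "\<forall>y\<in>f ` K. norm y \<le> C" using bounded_pos by blast
  then show ?thesis using assms(3) by (intro that[of C]) (force intro: less_imp_le)+
qed

text \<open>By translation invariance each difference quotient along b has integral 0, and dominated
  convergence passes to the derivative. No coordinates have to be singled out.\<close>

lemma integral_dir_deriv_eq_0:
  fixes g :: "'a::euclidean_space \<Rightarrow> real"
  assumes diff: "\<And>x. g differentiable (at x)" and cont: "continuous_on UNIV (dir_deriv b g)"
    and K: "compact K" "\<And>x. x \<notin> K \<Longrightarrow> g x = 0"
  shows "(\<integral>x. dir_deriv b g x \<partial>lborel) = 0"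
proof -
  have out: "dir_deriv b g x = 0" if "x \<notin> K" for x
    using dir_deriv_outside[OF compact_imp_closed[OF K(1)] K(2) that] by simp
  have gcont: "continuous_on UNIV g"
    using diff by (auto intro!: continuous_at_imp_continuous_on differentiable_imp_continuous_within)
  obtain C where C: "C > 0" "\<And>x. norm (dir_deriv b g x) \<le> C"
    using continuous_compact_support_bounded[OF cont K(1) out] by blast
  obtain R where R: "R > 0" "\<And>x. x \<in> K \<Longrightarrow> norm x \<le> R"
    using compact_imp_bounded[OF K(1)] bounded_pos by blast
  \<comment> \<open>The steps \<open>h n\<close> are at most 1, so every difference quotient
    vanishes outside the ball enlarged by \<open>norm b\<close>; a constant on that ball dominates
    them all.\<close>
  define K' where "K' = cball (0::'a) (R + norm b)"
  define h where "h n = inverse (real (Suc n))" for n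
  have h: "h n > 0" "h n \<le> 1" for n by (auto simp: h_def field_simps)
  have deriv: "((\<lambda>s. g (x + s *\<^sub>R b)) has_real_derivative dir_deriv b g (x + s *\<^sub>R b)) (at s)" for x s
  proof -
    have "(g has_derivative (\<lambda>v. dir_deriv v g (x + s *\<^sub>R b))) (at (x + s *\<^sub>R b))"
      by (rule has_derivative_dir_deriv[OF diff])
    then have cmp: "((\<lambda>s. g (x + s *\<^sub>R b)) has_derivative (\<lambda>c. dir_deriv (c *\<^sub>R b) g (x + s *\<^sub>R b))) (at s)"
      by (rule has_derivative_compose[rotated]) (auto intro!: derivative_eq_intros)
    have "linear (\<lambda>v. dir_deriv v g (x + s *\<^sub>R b))"
      using has_derivative_dir_deriv[OF diff] has_derivative_linear by blast
    then have lin: "dir_deriv (c *\<^sub>R b) g (x + s *\<^sub>R b) = dir_deriv b g (x + s *\<^sub>R b) * c" for c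
      using linear_cmul by fastforce
    show ?thesis unfolding has_field_derivative_def
      by (intro has_derivative_eq_rhs[OF cmp] ext lin)
  qed
  have lim: "(\<lambda>n. (g (x + h n *\<^sub>R b) - g x) / h n) \<longlonglongrightarrow> dir_deriv b g x" for x
  proof -
    have "((\<lambda>k. (g (x + k *\<^sub>R b) - g x) / k) \<longlongrightarrow> dir_deriv b g x) (at 0)"
      using deriv[of x 0] by (simp add: DERIV_def)
    moreover have "filterlim h (at 0) sequentially"
      using LIMSEQ_inverse_real_of_nat by (simp add: filterlim_at h_def[abs_def])
    ultimately show ?thesis by (rule filterlim_compose)
  qed
  have bd: "norm ((g (x + h n *\<^sub>R b) - g x) / h n) \<le> C * indicator K' x" for x n
  proof (cases "x \<in> K'")
    case True
    have "norm (g (x + h n *\<^sub>R b) - g (x + 0 *\<^sub>R b)) \<le> C * norm (h n - 0)"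
      by (rule field_differentiable_bound[where S=UNIV and f="\<lambda>s. g (x + s *\<^sub>R b)" and f'="\<lambda>s. dir_deriv b g (x + s *\<^sub>R b)"])
        (use C deriv in auto)
    then show ?thesis using True h[of n] by (simp add: divide_simps)
  next
    case False
    then have nx: "norm x > R + norm b" by (simp add: K'_def)
    then have "norm (x + h n *\<^sub>R b) > R"
      using norm_triangle_ineq2[of x "- (h n *\<^sub>R b)"] h[of n] mult_left_le_one_le[of "norm b" "h n"] by simp
    then have "x + h n *\<^sub>R b \<notin> K" "x \<notin> K" using R nx norm_ge_zero[of b] by (meson not_less, smt (verit))
    then show ?thesis using K(2) False by simp
  qed
  have lims: "(\<lambda>n. \<integral>x. (g (x + h n *\<^sub>R b) - g x) / h n \<partial>lborel) \<longlonglongrightarrow> (\<integral>x. dir_deriv b g x \<partial>lborel)"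
  proof (rule integral_dominated_convergence[where w="\<lambda>x. C * indicator K' x"])
    have "integrable lborel (\<lambda>x. indicator K' x *\<^sub>R C)"
      unfolding K'_def by (rule borel_integrable_compact) auto
    then show "integrable lborel (\<lambda>x. C * indicator K' x)" by (simp add: mult.commute)
    show "(\<lambda>x. (g (x + h i *\<^sub>R b) - g x) / h i) \<in> borel_measurable lborel" for i
      using gcont by (auto intro!: continuous_borel continuous_intros continuous_on_compose2[OF gcont] simp: h_def)
  qed (use cont lim bd in \<open>auto intro!: continuous_borel\<close>)
  have gi: "integrable lborel g" by (rule integrable_compact_support[OF gcont K])
  have "(\<integral>x. (g (x + h n *\<^sub>R b) - g x) / h n \<partial>lborel) = 0" for n
  proof -
    have e: "distr lborel borel (\<lambda>x. x + h n *\<^sub>R b) = lborel"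
      using lborel_distr_plus[of "h n *\<^sub>R b"] by (simp add: add.commute cong: distr_cong)
    have gi': "integrable lborel (\<lambda>x. g (x + h n *\<^sub>R b))"
      using integrable_distr[of "\<lambda>x. x + h n *\<^sub>R b" lborel borel g] gi e by simp
    have "(\<integral>x. g x \<partial>lborel) = (\<integral>x. g (x + h n *\<^sub>R b) \<partial>lborel)"
      using integral_distr[of "\<lambda>x. x + h n *\<^sub>R b" lborel borel g] gi e by simp
    then show ?thesis using gi gi' by simp
  qed
  then have "(\<lambda>n. \<integral>x. (g (x + h n *\<^sub>R b) - g x) / h n \<partial>lborel) = (\<lambda>n. 0)" by (rule ext)
  with lims show ?thesis unfolding LIMSEQ_const_iff by (metis LIMSEQ_const_iff)
qed

lemma dir_deriv_inner:
  assumes "u differentiable (at x)" "v differentiable (at x)"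
  shows "dir_deriv b (\<lambda>x. u x \<bullet> v x) x = u x \<bullet> dir_deriv b v x + dir_deriv b u x \<bullet> v x"
  by (rule dir_derivI[OF has_derivative_inner[OF assms[THEN has_derivative_dir_deriv]]])

lemma integral_by_parts:
  fixes u v :: "'a::euclidean_space \<Rightarrow> 'b::euclidean_space"
  assumes u: "\<And>x. u differentiable (at x)" "continuous_on UNIV (dir_deriv b u)"
    and v: "\<And>x. v differentiable (at x)" "continuous_on UNIV (dir_deriv b v)"
    and K: "compact K" "\<And>x. x \<notin> K \<Longrightarrow> u x = 0"
  shows "(\<integral>x. dir_deriv b u x \<bullet> v x \<partial>lborel) = - (\<integral>x. u x \<bullet> dir_deriv b v x \<partial>lborel)"
    "integrable lborel (\<lambda>x. dir_deriv b u x \<bullet> v x)" "integrable lborel (\<lambda>x. u x \<bullet> dir_deriv b v x)"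
proof -
  have cont: "continuous_on UNIV u" "continuous_on UNIV v"
    using u v by (auto intro!: continuous_at_imp_continuous_on differentiable_imp_continuous_within)
  have out: "dir_deriv b u x = 0" if "x \<notin> K" for x
    using dir_deriv_outside[OF compact_imp_closed[OF K(1)] K(2) that] by simp
  show i: "integrable lborel (\<lambda>x. dir_deriv b u x \<bullet> v x)" "integrable lborel (\<lambda>x. u x \<bullet> dir_deriv b v x)"
    by (rule integrable_compact_support[OF _ K(1)]; use cont u v out K in \<open>auto intro!: continuous_intros\<close>)+
  have "(\<integral>x. dir_deriv b (\<lambda>x. u x \<bullet> v x) x \<partial>lborel) = 0"
  proof (rule integral_dir_deriv_eq_0[OF _ _ K(1)])
    show "(\<lambda>x. u x \<bullet> v x) differentiable (at x)" for x
      using u(1)[of x] v(1)[of x] by (rule differentiable_inner)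
    have "continuous_on UNIV (\<lambda>x. u x \<bullet> dir_deriv b v x + dir_deriv b u x \<bullet> v x)"
      using u v cont by (intro continuous_intros)
    then show "continuous_on UNIV (dir_deriv b (\<lambda>x. u x \<bullet> v x))"
      using dir_deriv_inner[OF u(1) v(1)] by simp
  qed (use K in simp)
  then show "(\<integral>x. dir_deriv b u x \<bullet> v x \<partial>lborel) = - (\<integral>x. u x \<bullet> dir_deriv b v x \<partial>lborel)"
    using i by (simp add: dir_deriv_inner[OF u(1) v(1)])
qed

section \<open>Weak derivatives\<close>

lemma smooth_prod: 
  fixes u :: "'i \<Rightarrow> 'a::euclidean_space \<Rightarrow> real"
  shows "finite A \<Longrightarrow> (\<And>i. i \<in> A \<Longrightarrow> smooth (u i)) \<Longrightarrow> smooth (\<lambda>x. \<Prod>i\<in>A. u i x)"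
  by (induction A rule: finite_induct) (auto intro: smooth_mult smooth_const)

text \<open>Each function vanishes off the box, and n sharpens the edges from inside: the limit is
  the indicator of the open box, with no enlargement of the support.\<close>

definition box_bump :: "'a::euclidean_space \<Rightarrow> 'a \<Rightarrow> nat \<Rightarrow> 'a \<Rightarrow> real" where
  "box_bump a b n x = (\<Prod>i\<in>Basis. exp_inv 0 (n * (x \<bullet> i - a \<bullet> i)) * exp_inv 0 (n * (b \<bullet> i - x \<bullet> i)))"

lemma box_bump_test_fun: "box_bump a b n \<in> test_fun UNIV"
proof -
  have lin: "smooth (\<lambda>x::'a. c * (x \<bullet> i - d))" "smooth (\<lambda>x::'a. c * (d - x \<bullet> i))" for c d i
    by (intro smooth_mult smooth_diff smooth_const smooth_linear bounded_linear_inner_left)+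
  have "smooth (box_bump a b n)" unfolding box_bump_def[abs_def]
    by (intro smooth_prod smooth_mult smooth_compose_real[OF smooth_exp_inv] lin) simp
  moreover have "box_bump a b n x = 0" if "x \<notin> cbox a b" for x
  proof -
    obtain i where i: "i \<in> Basis" "x \<bullet> i < a \<bullet> i \<or> b \<bullet> i < x \<bullet> i"
      using \<open>x \<notin> cbox a b\<close> by (auto simp: mem_box not_le)
    then have "exp_inv 0 (n * (x \<bullet> i - a \<bullet> i)) * exp_inv 0 (n * (b \<bullet> i - x \<bullet> i)) = 0"
      by (auto simp: exp_inv_def zero_less_mult_iff)
    then show ?thesis unfolding box_bump_def using i(1) by (intro prod_zero) auto
  qed
  ultimately show ?thesis unfolding test_fun_def using compact_cbox[of a b] by blast
qed

lemma box_bump_bounds: "0 \<le> box_bump a b n x" "box_bump a b n x \<le> 1"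
  by (auto simp: box_bump_def exp_inv_0 intro!: prod_nonneg prod_le_1 mult_le_one)

lemma box_bump_lim: "(\<lambda>n. box_bump a b n x) \<longlonglongrightarrow> indicator (box a b) x"
proof -
  have lim1: "(\<lambda>n. exp_inv 0 (real n * s)) \<longlonglongrightarrow> (if s > 0 then 1 else 0)" for s
  proof (cases "s > 0")
    case True
    have "(\<lambda>n. exp (- inverse (real n * s))) \<longlonglongrightarrow> exp (- 0)"
      using tendsto_mult[OF lim_inverse_n tendsto_const[of "inverse s"]]
      by (intro tendsto_intros) (simp add: inverse_mult_distrib mult.commute)
    moreover have "eventually (\<lambda>n. exp (- inverse (real n * s)) = exp_inv 0 (real n * s)) sequentially"
      using eventually_gt_at_top[of 0] by eventually_elim (use True in \<open>simp add: exp_inv_def\<close>)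
    ultimately show ?thesis using True by (simp add: Lim_transform_eventually)
  next
    case False
    then show ?thesis by (simp add: exp_inv_0 mult_nonneg_nonpos)
  qed
  have "(\<lambda>n. box_bump a b n x) \<longlonglongrightarrow> (\<Prod>i\<in>Basis. (if x \<bullet> i - a \<bullet> i > 0 then 1 else 0) * (if b \<bullet> i - x \<bullet> i > 0 then 1 else 0))"
    unfolding box_bump_def by (intro tendsto_intros lim1)
  also have "(\<Prod>i\<in>Basis. (if x \<bullet> i - a \<bullet> i > 0 then 1 else 0) * (if b \<bullet> i - x \<bullet> i > 0 then 1 else 0)) = (indicator (box a b) x :: real)"
  proof (cases "x \<in> box a b")
    case True
    then show ?thesis by (auto simp: mem_box intro!: prod.neutral)
  next
    case False
    then obtain i where "i \<in> Basis" "\<not> (a \<bullet> i < x \<bullet> i \<and> x \<bullet> i < b \<bullet> i)" by (auto simp: mem_box)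
    then show ?thesis using False by (auto intro!: prod_zero)
  qed
  finally show ?thesis .
qed

text \<open>The pi-lambda theorem for the intersection-stable generator of open boxes.\<close>

lemma borel_box_induct [consumes 1, case_names box compl union]:
  fixes A :: "'a::euclidean_space set"
  assumes A: "A \<in> sets borel"
    and "\<And>a b. P (box a b)"
    and "\<And>A. A \<in> sets borel \<Longrightarrow> P A \<Longrightarrow> P (- A)"
    and "\<And>A. disjoint_family A \<Longrightarrow> range A \<subseteq> sets borel \<Longrightarrow> (\<And>i. P (A i)) \<Longrightarrow> P (\<Union>i::nat. A i)"
  shows "P A"
proof -
  let ?G = "range (\<lambda>(a, b). box a b :: 'a set)"
  have sb: "sets borel = sigma_sets UNIV ?G" by (simp add: borel_eq_box)
  show ?thesis
  proof (rule sigma_sets_induct_disjoint[of ?G UNIV A P])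
    show "Int_stable ?G" by (auto simp: Int_stable_def box_Int_box)
    have "P (box 0 0)" by fact
    then show "P {}" by simp
    show "P (UNIV - B)" if "B \<in> sigma_sets UNIV ?G" "P B" for B
      using assms(3)[of B] that by (simp add: Compl_eq_Diff_UNIV sb)
    show "P (\<Union>i. B i)" if "disjoint_family B" "range B \<subseteq> sigma_sets UNIV ?G" "\<And>i. P (B i)" for B :: "nat \<Rightarrow> 'a set"
      using assms(4)[of B] that by (simp add: sb)
  qed (use A assms(2) sb in auto)
qed

lemma loc_integrable_mult_indicator:
  fixes w :: "'a::euclidean_space \<Rightarrow> 'b::{banach, second_countable_topology}"
  assumes "loc_integrable UNIV w" "\<psi> \<in> borel_measurable borel" "\<And>x. \<bar>\<psi> x\<bar> \<le> c * indicator (box a b) x"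
  shows "integrable lebesgue (\<lambda>x. \<psi> x *\<^sub>R w x)"
proof -
  have i: "integrable lebesgue (\<lambda>x. indicator (cbox a b) x *\<^sub>R w x)"
    using assms(1) by (simp add: loc_integrable_def set_integrable_def)
  have "integrable lebesgue (\<lambda>x. \<psi> x *\<^sub>R (indicator (cbox a b) x *\<^sub>R w x))"
  proof (rule Bochner_Integration.integrable_bound)
    show "integrable lebesgue (\<lambda>x. c *\<^sub>R (indicator (cbox a b) x *\<^sub>R w x))"
      by (rule integrable_scaleR_right[OF i])
    have "\<psi> \<in> borel_measurable lebesgue" using assms(2) by (simp add: measurable_completion)
    then show "(\<lambda>x. \<psi> x *\<^sub>R (indicator (cbox a b) x *\<^sub>R w x)) \<in> borel_measurable lebesgue"
      by (rule borel_measurable_scaleR[OF _ borel_measurable_integrable[OF i]])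
    have "\<bar>\<psi> x\<bar> \<le> \<bar>c\<bar>" for x
      using assms(3)[of x] by (cases "x \<in> box a b") auto
    then show "AE x in lebesgue. norm (\<psi> x *\<^sub>R (indicator (cbox a b) x *\<^sub>R w x))
        \<le> norm (c *\<^sub>R (indicator (cbox a b) x *\<^sub>R w x))"
      by (auto simp: abs_mult intro!: mult_right_mono AE_I2)
  qed
  moreover have "\<psi> x *\<^sub>R (indicator (cbox a b) x *\<^sub>R w x) = \<psi> x *\<^sub>R w x" for x
    using assms(3)[of x] box_subset_cbox[of a b] by (cases "x \<in> box a b") auto
  ultimately show ?thesis by (simp only:)
qed

text \<open>
  The class \<open>C\<close> will be either the functions vanishing on a set or the measurable ones: the first choice
  gives the du Bois-Reymond lemma, the second the measurability in time of integrals
  against a weak derivative, which need not be jointly measurable.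
\<close>

lemma weak_integral_class:
  fixes D :: "'t::euclidean_space \<Rightarrow> 'a::euclidean_space \<Rightarrow> real" and C :: "('t \<Rightarrow> real) set"
  assumes loc: "\<And>t. t \<in> T \<Longrightarrow> loc_integrable UNIV (D t)"
    and base: "\<And>\<phi>. \<phi> \<in> test_fun UNIV \<Longrightarrow> (\<lambda>t. \<integral>x. \<phi> x * D t x \<partial>lebesgue) \<in> C"
    and C_diff: "\<And>u v. u \<in> C \<Longrightarrow> v \<in> C \<Longrightarrow> (\<lambda>t. u t - v t) \<in> C"
    and C_scale: "\<And>c u. u \<in> C \<Longrightarrow> (\<lambda>t. c * u t) \<in> C"
    and C_lim: "\<And>u f. (\<And>n::nat. u n \<in> C) \<Longrightarrow> (\<And>t. t \<in> T \<Longrightarrow> (\<lambda>n. u n t) \<longlonglongrightarrow> f t) \<Longrightarrow> f \<in> C"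
    and C_ind: "\<And>a b u. u \<in> C \<Longrightarrow> (\<lambda>t. indicator (box a b) t * u t) \<in> C"
    and G: "G \<in> borel_measurable borel" "\<And>t. t \<in> T \<Longrightarrow> integrable lebesgue (\<lambda>x. G (x, t) * D t x)"
  shows "(\<lambda>t. \<integral>x. G (x, t) * D t x \<partial>lebesgue) \<in> C"
proof -
  \<comment> \<open>A constant sequence in \<open>C_lim\<close>: membership in C depends on the
    values over T only.\<close>
  have C_cong: "f \<in> C" if "u \<in> C" "\<And>t. t \<in> T \<Longrightarrow> u t = f t" for u f
    using C_lim[of "\<lambda>n. u" f] that by simp
  have C_0: "(\<lambda>t. 0) \<in> C"
    using C_scale[OF base[OF box_bump_test_fun], of 0] by simp
  have C_add: "(\<lambda>t. u t + v t) \<in> C" if "u \<in> C" "v \<in> C" for u v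
    using C_diff[OF that(1) C_diff[OF C_0 that(2)]] by simp
  have C_sum: "(\<lambda>t. \<Sum>i\<in>I. u i t) \<in> C" if "finite I" "\<And>i. i \<in> I \<Longrightarrow> u i \<in> C" for I :: "'i set" and u
    using that by (induction I rule: finite_induct) (auto intro: C_0 C_add)
  have slice_meas: "(\<lambda>x. F (x, t)) \<in> borel_measurable borel" if "F \<in> borel_measurable borel"
    for F :: "'a \<times> 't \<Rightarrow> real" and t
    using that by (rule measurable_compose[rotated]) (simp add: borel_prod[symmetric])
  have Dm: "(\<lambda>x. \<psi> x * (indicator (box (a::'a) b) x * D t x)) \<in> borel_measurable lebesgue"
    if t: "t \<in> T" and \<psi>: "\<psi> \<in> borel_measurable borel" for t \<psi> a b
  proof -
    have "integrable lebesgue (\<lambda>x. indicator (box a b) x *\<^sub>R D t x)"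
      by (rule loc_integrable_mult_indicator[where c=1 and a=a and b=b, OF loc[OF t]]) auto
    then have "(\<lambda>x. indicator (box a b) x * D t x) \<in> borel_measurable lebesgue"
      by (auto dest: borel_measurable_integrable)
    moreover have "\<psi> \<in> borel_measurable lebesgue" using \<psi> by (simp add: measurable_completion)
    ultimately show ?thesis by (rule borel_measurable_times[rotated])
  qed
  \<comment> \<open>D t is only locally integrable; the truncation to a box makes indicators of
    unbounded Borel sets integrable against it.\<close>
  let ?K = "\<lambda>n::nat. box (- (real n *\<^sub>R One)) (real n *\<^sub>R One) :: 'a set"
  have ind_int: "integrable lebesgue (\<lambda>x. \<psi> x * (indicator (?K n) x * D t x))"
    if "t \<in> T" "\<psi> \<in> borel_measurable borel" "\<And>x. \<bar>\<psi> x\<bar> \<le> 1" for t n and \<psi> :: "'a \<Rightarrow> real"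
  proof -
    have "integrable lebesgue (\<lambda>x. (\<psi> x * indicator (?K n) x) *\<^sub>R D t x)"
      by (rule loc_integrable_mult_indicator[where c=1 and a="- (real n *\<^sub>R One)" and b="real n *\<^sub>R One", OF loc[OF that(1)]])
        (use that(2,3) in \<open>auto simp: indicator_def\<close>)
    then show ?thesis by (simp add: mult.assoc)
  qed
  \<comment> \<open>Here test functions enter: bumps approximate the indicator of a box in
    space.\<close>
  have 1: "(\<lambda>t. \<integral>x. indicator (box c d) x * D t x \<partial>lebesgue) \<in> C" for c d :: 'a
  proof (rule C_lim[of "\<lambda>m t. \<integral>x. box_bump c d m x * D t x \<partial>lebesgue"])
    fix t assume t: "t \<in> T"
    let ?w = "\<lambda>x. \<bar>indicator (cbox c d) x *\<^sub>R D t x\<bar>"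
    have i: "integrable lebesgue (\<lambda>x. indicator (cbox c d) x *\<^sub>R D t x)"
      using loc[OF t] by (simp add: loc_integrable_def set_integrable_def)
    have out: "box_bump c d m x = 0" if "x \<notin> box c d" for m x
    proof -
      obtain i where i: "i \<in> Basis" "\<not> (c \<bullet> i < x \<bullet> i \<and> x \<bullet> i < d \<bullet> i)" using \<open>x \<notin> box c d\<close> by (auto simp: mem_box)
      then have "exp_inv 0 (m * (x \<bullet> i - c \<bullet> i)) * exp_inv 0 (m * (d \<bullet> i - x \<bullet> i)) = 0"
        by (auto simp: exp_inv_def zero_less_mult_iff)
      then show ?thesis unfolding box_bump_def using i(1) by (intro prod_zero) auto
    qed
    have bm: "box_bump c d m \<in> borel_measurable borel" for m
      using box_bump_test_fun[of c d m] by (auto simp: test_fun_def intro!: continuous_borel smooth_imp_continuous)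
    have eq: "box_bump c d m x * D t x = box_bump c d m x * (indicator (box c d) x * D t x)" for m x
      using out[of x m] by (auto simp: indicator_def)
    show "(\<lambda>m. \<integral>x. box_bump c d m x * D t x \<partial>lebesgue) \<longlonglongrightarrow> (\<integral>x. indicator (box c d) x * D t x \<partial>lebesgue)"
    proof (rule integral_dominated_convergence[where w="?w"])
      show "integrable lebesgue ?w" using i by (rule integrable_abs)
      show "(\<lambda>x. indicator (box c d) x * D t x) \<in> borel_measurable lebesgue"
        using Dm[OF t, of "\<lambda>x. 1" c d] by simp
      show "(\<lambda>x. box_bump c d m x * D t x) \<in> borel_measurable lebesgue" for m
        using Dm[OF t bm[of m], of c d] by (simp only: eq[symmetric])
      show "AE x in lebesgue. (\<lambda>m. box_bump c d m x * D t x) \<longlonglongrightarrow> indicator (box c d) x * D t x"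
        by (intro AE_I2 tendsto_intros box_bump_lim)
      show "AE x in lebesgue. norm (box_bump c d m x * D t x) \<le> ?w x" for m
      proof (rule AE_I2)
        fix x show "norm (box_bump c d m x * D t x) \<le> ?w x"
          using out[of x m] box_bump_bounds[of c d m x] box_subset_cbox[of c d]
          by (cases "x \<in> box c d") (auto simp: abs_mult indicator_def mult_left_le_one_le)
      qed
    qed
  qed (rule base[OF box_bump_test_fun])
  have indA: "(\<lambda>t. \<integral>x. indicator A (x, t) * (indicator (?K n) x * D t x) \<partial>lebesgue) \<in> C"
    if "A \<in> sets borel" for A :: "('a \<times> 't) set" and n
    using that
  proof (induction A rule: borel_box_induct)
    case (box a b)
    obtain a1 a2 b1 b2 where ab: "a = (a1, a2)" "b = (b1, b2)" by (cases a; cases b)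
    obtain c d where cd: "box a1 b1 \<inter> ?K n = box c d" using box_Int_box by blast
    have "(\<integral>x. indicator (box a b) (x, t) * (indicator (?K n) x * D t x) \<partial>lebesgue)
      = indicator (box a2 b2) t * (\<integral>x. indicator (box c d) x * D t x \<partial>lebesgue)" for t
    proof -
      have "(\<lambda>x. indicator (box a b) (x, t) * (indicator (?K n) x * D t x))
          = (\<lambda>x. indicator (box a2 b2) t * (indicator (box c d) x * D t x))"
        unfolding cd[symmetric] ab by (auto simp: indicator_def fun_eq_iff mem_box Basis_prod_def ball_Un)
      then show ?thesis by simp
    qed
    then show ?case using C_ind[OF 1] by simp
  next
    case (compl A)
    have "(\<lambda>t. (\<integral>x. indicator (?K n) x * D t x \<partial>lebesgue)
       - (\<integral>x. indicator A (x, t) * (indicator (?K n) x * D t x) \<partial>lebesgue)) \<in> C"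
      by (rule C_diff[OF 1 compl(2)])
    then show ?case
    proof (rule C_cong)
      fix t assume t: "t \<in> T"
      have m: "(\<lambda>x. indicator A (x, t) :: real) \<in> borel_measurable borel"
        by (rule slice_meas) (use compl(1) in simp)
      have "integrable lebesgue (\<lambda>x. indicator A (x, t) * (indicator (?K n) x * D t x))"
        by (rule ind_int[OF t m]) (simp add: indicator_def)
      moreover have "integrable lebesgue (\<lambda>x. indicator (?K n) x * D t x)"
        using ind_int[OF t, of "\<lambda>x. 1" n] by simp
      moreover have "indicator (- A) (x, t) * (indicator (?K n) x * D t x)
          = indicator (?K n) x * D t x - indicator A (x, t) * (indicator (?K n) x * D t x)" for x
        by (simp add: indicator_def)
      ultimately show "(\<integral>x. indicator (?K n) x * D t x \<partial>lebesgue)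
         - (\<integral>x. indicator A (x, t) * (indicator (?K n) x * D t x) \<partial>lebesgue)
         = (\<integral>x. indicator (- A) (x, t) * (indicator (?K n) x * D t x) \<partial>lebesgue)" by simp
    qed
  next
    case (union A)
    have Am: "A i \<in> sets borel" for i using union(2) by auto
    have m: "(\<lambda>x. indicator B (x, t) :: real) \<in> borel_measurable borel" if "B \<in> sets borel" for B :: "('a \<times> 't) set" and t
      by (rule slice_meas) (use that in simp)
    have B: "(\<Union>i<k. A i) \<in> sets borel" for k using Am by auto
    show ?case
    proof (rule C_lim)
      fix k show "(\<lambda>t. \<Sum>i<k. (\<integral>x. indicator (A i) (x, t) * (indicator (?K n) x * D t x) \<partial>lebesgue)) \<in> C"
        by (intro C_sum union(3)) simp
    next
      fix t assume t: "t \<in> T"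
      let ?w = "\<lambda>x. indicator (?K n) x * D t x"
      have "(\<Sum>i<k. (\<integral>x. indicator (A i) (x, t) * ?w x \<partial>lebesgue))
         = (\<integral>x. indicator (\<Union>i<k. A i) (x, t) * ?w x \<partial>lebesgue)" for k
      proof -
        have "(\<Sum>i<k. (\<integral>x. indicator (A i) (x, t) * ?w x \<partial>lebesgue))
          = (\<integral>x. (\<Sum>i<k. indicator (A i) (x, t) * ?w x) \<partial>lebesgue)"
          by (rule Bochner_Integration.integral_sum[symmetric]) (rule ind_int[OF t m[OF Am]], simp add: indicator_def)
        also have "(\<lambda>x. \<Sum>i<k. indicator (A i) (x, t) * ?w x) = (\<lambda>x. indicator (\<Union>i<k. A i) (x, t) * ?w x)"
          using union(1) unfolding sum_distrib_right[symmetric]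
          by (subst indicator_UN_disjoint) (auto simp: disjoint_family_on_def)
        finally show ?thesis .
      qed
      moreover have "(\<lambda>k. \<integral>x. indicator (\<Union>i<k. A i) (x, t) * ?w x \<partial>lebesgue)
         \<longlonglongrightarrow> (\<integral>x. indicator (\<Union>i. A i) (x, t) * ?w x \<partial>lebesgue)"
      proof (rule integral_dominated_convergence[where w="\<lambda>x. \<bar>?w x\<bar>"])
        show "integrable lebesgue (\<lambda>x. \<bar>?w x\<bar>)"
          using ind_int[OF t, of "\<lambda>x. 1" n] by (intro integrable_abs) simp
        show "(\<lambda>x. indicator (\<Union>i. A i) (x, t) * ?w x) \<in> borel_measurable lebesgue"
          using Am by (intro Dm[OF t m]) auto
        show "(\<lambda>x. indicator (\<Union>i<k. A i) (x, t) * ?w x) \<in> borel_measurable lebesgue" for k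
          by (rule Dm[OF t m[OF B]])
        show "AE x in lebesgue. (\<lambda>k. indicator (\<Union>i<k. A i) (x, t) * ?w x) \<longlonglongrightarrow> indicator (\<Union>i. A i) (x, t) * ?w x"
          by (intro AE_I2 tendsto_intros LIMSEQ_indicator_UN)
        show "AE x in lebesgue. norm (indicator (\<Union>i<k. A i) (x, t) * ?w x) \<le> \<bar>?w x\<bar>" for k
          by (intro AE_I2) (simp add: indicator_def)
      qed
      ultimately show "(\<lambda>k. \<Sum>i<k. (\<integral>x. indicator (A i) (x, t) * ?w x \<partial>lebesgue))
         \<longlonglongrightarrow> (\<integral>x. indicator (\<Union>i. A i) (x, t) * ?w x \<partial>lebesgue)" by simp
    qed
  qed
  \<comment> \<open>Each simple function is a finite combination of indicators, and the bound by
    twice the size of G provides the dominating function.\<close>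
  obtain F where F: "\<And>i. simple_function borel (F i)" "\<And>z. (\<lambda>i. F i z) \<longlonglongrightarrow> G z"
      "\<And>i z. norm (F i z) \<le> 2 * norm (G z)"
    using borel_measurable_implies_sequence_metric[OF G(1), of 0] by (auto simp: dist_real_def)
  have Fm: "F i \<in> borel_measurable borel" for i
    using F(1) by (rule borel_measurable_simple_function)
  show ?thesis
  proof (rule C_lim)
    fix n
    have fin: "finite (range (F n))" using F(1)[of n] by (simp add: simple_function_def)
    have "(\<lambda>t. \<Sum>y\<in>range (F n). y * (\<integral>x. indicator (F n -` {y}) (x, t) * (indicator (?K n) x * D t x) \<partial>lebesgue)) \<in> C"
      using measurable_sets[OF Fm[of n]] by (intro C_sum fin C_scale indA) force
    then show "(\<lambda>t. \<integral>x. F n (x, t) * (indicator (?K n) x * D t x) \<partial>lebesgue) \<in> C"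
    proof (rule C_cong)
      fix t assume t: "t \<in> T"
      have i: "integrable lebesgue (\<lambda>x. indicator (F n -` {y}) (x, t) * (indicator (?K n) x * D t x))" for y
      proof (rule ind_int[OF t])
        have "F n -` {y} \<in> sets borel" using measurable_sets[OF Fm, of "{y}" n] by simp
        then show "(\<lambda>x. indicator (F n -` {y}) (x, t) :: real) \<in> borel_measurable borel"
          by - (rule slice_meas, simp)
      qed (simp add: indicator_def)
      have "(\<Sum>y\<in>range (F n). y * (indicator (F n -` {y}) (x, t) * (indicator (?K n) x * D t x)))
          = F n (x, t) * (indicator (?K n) x * D t x)" for x
      proof -
        have "(\<Sum>y\<in>range (F n). y * indicator (F n -` {y}) (x, t)) = (\<Sum>y\<in>range (F n). if F n (x, t) = y then y else 0)"
          by (rule sum.cong) (auto simp: indicator_def)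
        also have "\<dots> = F n (x, t)" using fin by (simp add: sum.delta')
        finally have e: "(\<Sum>y\<in>range (F n). y * indicator (F n -` {y}) (x, t)) = F n (x, t)" .
        have "(\<Sum>y\<in>range (F n). y * (indicator (F n -` {y}) (x, t) * (indicator (?K n) x * D t x)))
          = (\<Sum>y\<in>range (F n). y * indicator (F n -` {y}) (x, t)) * (indicator (?K n) x * D t x)"
          by (simp only: sum_distrib_right mult.assoc)
        then show ?thesis by (simp only: e)
      qed
      then show "(\<Sum>y\<in>range (F n). y * (\<integral>x. indicator (F n -` {y}) (x, t) * (indicator (?K n) x * D t x) \<partial>lebesgue))
        = (\<integral>x. F n (x, t) * (indicator (?K n) x * D t x) \<partial>lebesgue)"
        using i by (subst Bochner_Integration.integral_mult_right_zero[symmetric])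
          (subst Bochner_Integration.integral_sum[symmetric], auto)
    qed
  next
    fix t assume t: "t \<in> T"
    show "(\<lambda>n. \<integral>x. F n (x, t) * (indicator (?K n) x * D t x) \<partial>lebesgue) \<longlonglongrightarrow> (\<integral>x. G (x, t) * D t x \<partial>lebesgue)"
    proof (rule integral_dominated_convergence[where w="\<lambda>x. 2 * \<bar>G (x, t) * D t x\<bar>"])
      show "integrable lebesgue (\<lambda>x. 2 * \<bar>G (x, t) * D t x\<bar>)" using G(2)[OF t] by simp
      show "(\<lambda>x. G (x, t) * D t x) \<in> borel_measurable lebesgue" using G(2)[OF t] by simp
      show "(\<lambda>x. F n (x, t) * (indicator (?K n) x * D t x)) \<in> borel_measurable lebesgue" for n
        by (rule Dm[OF t slice_meas[OF Fm]])
      show "AE x in lebesgue. (\<lambda>n. F n (x, t) * (indicator (?K n) x * D t x)) \<longlonglongrightarrow> G (x, t) * D t x"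
      proof (rule AE_I2)
        fix x :: 'a
        obtain N where N: "x \<in> ?K N" using UN_box_eq_UNIV by blast
        have "(\<lambda>n. F n (x, t) * D t x) \<longlonglongrightarrow> G (x, t) * D t x" by (intro tendsto_intros F(2))
        moreover have "eventually (\<lambda>n. F n (x, t) * D t x = F n (x, t) * (indicator (?K n) x * D t x)) sequentially"
          using eventually_ge_at_top[of N]
        proof eventually_elim
          case (elim n)
          have "\<bar>x \<bullet> i\<bar> < n" if "i \<in> Basis" for i
            using N that elim by (auto simp: mem_box inner_minus_left)
          then have "x \<in> ?K n" by (simp add: mem_box abs_less_iff) (simp add: minus_less_iff)
          then show ?case by simp
        qed
        ultimately show "(\<lambda>n. F n (x, t) * (indicator (?K n) x * D t x)) \<longlonglongrightarrow> G (x, t) * D t x"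
          by (rule Lim_transform_eventually)
      qed
      show "AE x in lebesgue. norm (F n (x, t) * (indicator (?K n) x * D t x)) \<le> 2 * \<bar>G (x, t) * D t x\<bar>" for n
        using F(3)[of n] by (intro AE_I2) (auto simp: abs_mult indicator_def mult_right_mono mult.assoc[symmetric])
    qed
  qed
qed

lemma integral_inner_const:
  "integrable M f \<Longrightarrow> (\<integral>x. f x \<bullet> c \<partial>M) = (\<integral>x. f x \<partial>M) \<bullet> c"
  by (rule integral_inner_left[where f=f and c=c]) simp

lemma loc_integrable_test:
  fixes w :: "'a::euclidean_space \<Rightarrow> 'b::{banach, second_countable_topology}"
  assumes "loc_integrable UNIV w" "continuous_on UNIV \<psi>" "compact K" "\<And>x. x \<notin> K \<Longrightarrow> \<psi> x = 0"
  shows "integrable lebesgue (\<lambda>x. \<psi> x *\<^sub>R w x)"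
proof -
  obtain C where C: "C > 0" "\<And>x. norm (\<psi> x :: real) \<le> C"
    using continuous_compact_support_bounded[OF assms(2,3)] assms(4) by blast
  obtain b where b: "K \<subseteq> box (- b) b"
    using bounded_subset_box_symmetric[OF compact_imp_bounded[OF assms(3)]] by blast
  show ?thesis
  proof (rule loc_integrable_mult_indicator[OF assms(1) continuous_borel[OF assms(2)]])
    show "\<bar>\<psi> x\<bar> \<le> C * indicator (box (- b) b) x" for x
      using C(1) C(2)[of x] assms(4)[of x] b by (cases "x \<in> K") (auto simp: indicator_def)
  qed
qed

lemma loc_integrable_inner:
  fixes w :: "'a::euclidean_space \<Rightarrow> 'b::euclidean_space"
  assumes "loc_integrable UNIV w" shows "loc_integrable UNIV (\<lambda>x. w x \<bullet> j)"
  unfolding loc_integrable_def set_integrable_def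
proof (intro allI impI)
  fix K assume "compact K \<and> K \<subseteq> (UNIV :: 'a set)"
  then have "integrable lebesgue (\<lambda>x. indicator K x *\<^sub>R w x)"
    using assms by (simp add: loc_integrable_def set_integrable_def)
  then have "integrable lebesgue (\<lambda>x. (indicator K x *\<^sub>R w x) \<bullet> j)" by (rule integrable_inner_left)
  then show "integrable lebesgue (\<lambda>x. indicator K x *\<^sub>R (w x \<bullet> j))" by simp
qed

lemma test_funD:
  assumes "\<phi> \<in> test_fun U"
  obtains K where "smooth \<phi>" "compact K" "K \<subseteq> U" "\<And>x. x \<notin> K \<Longrightarrow> \<phi> x = 0"
proof -
  from assms obtain K where "smooth \<phi> \<and> compact K \<and> K \<subseteq> U \<and> (\<forall>x. x \<notin> K \<longrightarrow> \<phi> x = 0)"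
    unfolding test_fun_def mem_Collect_eq by (elim conjE exE) simp
  then show thesis by (intro that[of K]) simp_all
qed

text \<open>On a box, w is tested with the sign of a Borel representative.
  \<open>weak_integral_class\<close> extends the hypothesis from smooth test functions to this
  merely measurable one, and the integral becomes that of the absolute value.\<close>

lemma du_Bois_Reymond_real:
  fixes w :: "'a::euclidean_space \<Rightarrow> real"
  assumes w: "loc_integrable UNIV w" and 0: "\<And>\<phi>. \<phi> \<in> test_fun UNIV \<Longrightarrow> (\<integral>x. \<phi> x * w x \<partial>lebesgue) = 0"
  shows "AE x in lebesgue. w x = 0"
proof -
  let ?K = "\<lambda>n::nat. box (- (real n *\<^sub>R One)) (real n *\<^sub>R One) :: 'a set"
  have "AE x in lebesgue. indicator (?K n) x * w x = 0" for n
  proof -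
    have int: "integrable lebesgue (\<lambda>x. indicator (?K n) x *\<^sub>R w x)"
      by (rule loc_integrable_mult_indicator[where c=1 and a="- (real n *\<^sub>R One)" and b="real n *\<^sub>R One", OF w]) auto
    then have "(\<lambda>x. indicator (?K n) x * w x) \<in> borel_measurable lebesgue"
      by (auto dest: borel_measurable_integrable)
    then obtain g where g: "g \<in> borel_measurable lborel" "AE x in lborel. indicator (?K n) x * w x = g x"
      using completion_ex_borel_measurable_real by blast
    then have gAE: "AE x in lebesgue. indicator (?K n) x * w x = g x" by (simp add: AE_completion)
    have gm: "g \<in> borel_measurable borel" using g(1) by simp
    have sm: "(\<lambda>x. indicator (?K n) x * sgn (g x)) \<in> borel_measurable borel" using gm by simp
    have sm': "(\<lambda>z::'a \<times> real. indicator (?K n) (fst z) * sgn (g (fst z))) \<in> borel_measurable borel"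
      by (rule measurable_compose[OF _ sm]) (simp add: borel_prod[symmetric])
    have i: "integrable lebesgue (\<lambda>x. indicator (?K n) x * sgn (g x) * w x)"
      using loc_integrable_mult_indicator[where c=1 and a="- (real n *\<^sub>R One)" and b="real n *\<^sub>R One", OF w sm]
      by (auto simp: indicator_def sgn_real_def abs_mult)
    \<comment> \<open>The time variable is a dummy: T consists of the time 0, and C of the functions
      that vanish there.\<close>
    have "(\<lambda>t. \<integral>x. (indicator (?K n) (fst (x, t)) * sgn (g (fst (x, t)))) * w x \<partial>lebesgue) \<in> {u. u (0::real) = (0::real)}"
    proof (rule weak_integral_class[where T="{0}" and D="\<lambda>t. w"])
      fix u :: "nat \<Rightarrow> real \<Rightarrow> real" and f :: "real \<Rightarrow> real"
      assume "\<And>n. u n \<in> {u. u 0 = 0}" "\<And>t. t \<in> {0} \<Longrightarrow> (\<lambda>n. u n t) \<longlonglongrightarrow> f t"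
      then have "(\<lambda>n. 0) \<longlonglongrightarrow> f 0" by simp
      then show "f \<in> {u. u 0 = 0}" by (simp add: LIMSEQ_const_iff)
    qed (use w 0 i sm' in simp_all)
    then have "(\<integral>x. indicator (?K n) x * sgn (g x) * w x \<partial>lebesgue) = 0" by simp
    moreover have "AE x in lebesgue. indicator (?K n) x * sgn (g x) * w x = \<bar>indicator (?K n) x * w x\<bar>"
      using gAE by eventually_elim (auto simp: indicator_def sgn_real_def abs_real_def)
    ultimately have "(\<integral>x. \<bar>indicator (?K n) x * w x\<bar> \<partial>lebesgue) = 0"
      by (subst (asm) integral_cong_AE) (use i int in \<open>auto dest!: borel_measurable_integrable\<close>)
    then show ?thesis
      using int by (subst (asm) integral_nonneg_eq_0_iff_AE) auto
  qed
  then have "AE x in lebesgue. \<forall>n. indicator (?K n) x * w x = 0" unfolding AE_all_countable by (rule allI)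
  then show ?thesis
  proof eventually_elim
    case (elim x)
    obtain N where "x \<in> ?K N" using UN_box_eq_UNIV by blast
    then show ?case using elim[rule_format, of N] by simp
  qed
qed

lemma du_Bois_Reymond:
  fixes w :: "'a::euclidean_space \<Rightarrow> 'b::euclidean_space"
  assumes w: "loc_integrable UNIV w" and 0: "\<And>\<phi>. \<phi> \<in> test_fun UNIV \<Longrightarrow> (\<integral>x. \<phi> x *\<^sub>R w x \<partial>lebesgue) = 0"
  shows "AE x in lebesgue. w x = 0"
proof -
  have "AE x in lebesgue. \<forall>j\<in>Basis. w x \<bullet> j = 0"
  proof (rule AE_finite_allI)
    fix j :: 'b
    show "AE x in lebesgue. w x \<bullet> j = 0"
    proof (rule du_Bois_Reymond_real[OF loc_integrable_inner[OF w]])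
      fix \<phi> :: "'a \<Rightarrow> real" assume \<phi>: "\<phi> \<in> test_fun UNIV"
      obtain K where K: "smooth \<phi>" "compact K" "\<And>x. x \<notin> K \<Longrightarrow> \<phi> x = 0" using test_funD[OF \<phi>] by metis
      have "integrable lebesgue (\<lambda>x. \<phi> x *\<^sub>R w x)"
        by (rule loc_integrable_test[OF w smooth_imp_continuous[OF K(1)] K(2,3)])
      from integral_inner_const[OF this, of j] show "(\<integral>x. \<phi> x * (w x \<bullet> j) \<partial>lebesgue) = 0"
        using 0[OF \<phi>] by simp
    qed
  qed simp
  then show ?thesis by eventually_elim (auto intro: euclidean_eqI)
qed

lemma loc_integrable_diff:
  "loc_integrable U u \<Longrightarrow> loc_integrable U v \<Longrightarrow> loc_integrable U (\<lambda>x. u x - v x)"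
  by (auto simp: loc_integrable_def set_integrable_def scaleR_diff_right)

lemma weak_deriv_unique:
  fixes u w w' :: "'a::euclidean_space \<Rightarrow> 'b::euclidean_space"
  assumes w: "weak_deriv bs u w" and w': "weak_deriv bs u w'"
  shows "AE x in lebesgue. w x = w' x"
proof -
  have l: "loc_integrable UNIV w" "loc_integrable UNIV w'" using assms by (auto simp: weak_deriv_def)
  have "AE x in lebesgue. w x - w' x = 0"
  proof (rule du_Bois_Reymond[OF loc_integrable_diff[OF l]])
    fix \<phi> :: "'a \<Rightarrow> real" assume \<phi>: "\<phi> \<in> test_fun UNIV"
    obtain K where K: "smooth \<phi>" "compact K" "\<And>x. x \<notin> K \<Longrightarrow> \<phi> x = 0" using test_funD[OF \<phi>] by metis
    have "(-1) ^ length bs *\<^sub>R (\<integral>x. \<phi> x *\<^sub>R w x \<partial>lebesgue) = (-1) ^ length bs *\<^sub>R (\<integral>x. \<phi> x *\<^sub>R w' x \<partial>lebesgue)"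
      using w[unfolded weak_deriv_def] w'[unfolded weak_deriv_def] \<phi> by simp
    then have "(\<integral>x. \<phi> x *\<^sub>R w x \<partial>lebesgue) = (\<integral>x. \<phi> x *\<^sub>R w' x \<partial>lebesgue)" by simp
    then show "(\<integral>x. \<phi> x *\<^sub>R (w x - w' x) \<partial>lebesgue) = 0"
      using loc_integrable_test[OF l(1) smooth_imp_continuous[OF K(1)] K(2,3)]
        loc_integrable_test[OF l(2) smooth_imp_continuous[OF K(1)] K(2,3)]
      by (simp add: scaleR_diff_right)
  qed
  then show ?thesis by eventually_elim simp
qed

section \<open>Square integrable fields\<close>

lemma Lp_2_iff: "u \<in> Lp M 2 \<longleftrightarrow> u \<in> borel_measurable M \<and> integrable M (\<lambda>x. (norm (u x))\<^sup>2)"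
  by (simp add: Lp_def)

lemma Lp_norm_2_square: "(Lp_norm M 2 u)\<^sup>2 = (\<integral>x. (norm (u x))\<^sup>2 \<partial>M)"
proof -
  have "0 \<le> (\<integral>x. (norm (u x))\<^sup>2 \<partial>M)" by simp
  then show ?thesis unfolding Lp_norm_def by (simp add: powr_half_sqrt)
qed

lemma Lp_norm_nonneg: "0 \<le> Lp_norm M 2 u"
  unfolding Lp_norm_def by simp

lemma loc_integrable_L2:
  fixes u :: "'a::euclidean_space \<Rightarrow> 'b::{banach, second_countable_topology}"
  assumes "u \<in> Lp lebesgue 2" shows "loc_integrable UNIV u"
  unfolding loc_integrable_def set_integrable_def
proof (intro allI impI)
  fix K assume "compact K \<and> K \<subseteq> (UNIV :: 'a set)"
  then have K: "K \<in> lmeasurable" using lmeasurable_compact by blast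
  show "integrable lebesgue (\<lambda>x. indicator K x *\<^sub>R u x)"
  proof (rule Bochner_Integration.integrable_bound)
    show "integrable lebesgue (\<lambda>x. indicator K x + (norm (u x))\<^sup>2)"
      using K assms by (auto simp: Lp_2_iff fmeasurable_def)
    show "(\<lambda>x. indicator K x *\<^sub>R u x) \<in> borel_measurable lebesgue"
      using K assms by (auto simp: Lp_2_iff fmeasurable_def)
    have "a \<le> 1 + a\<^sup>2" for a :: real
      using zero_le_power2[of "a - 1"] zero_le_power2[of a] unfolding power2_diff power_one mult_1_right by linarith
    then show "AE x in lebesgue. norm (indicator K x *\<^sub>R u x) \<le> norm (indicator K x + (norm (u x))\<^sup>2)"
      by (auto simp: indicator_def)
  qed
qed

lemma integrable_inner_L2:
  fixes u v :: "'a \<Rightarrow> 'b::euclidean_space"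
  assumes "u \<in> Lp M 2" "v \<in> Lp M 2" shows "integrable M (\<lambda>x. u x \<bullet> v x)"
proof (rule Bochner_Integration.integrable_bound)
  show "integrable M (\<lambda>x. (norm (u x))\<^sup>2 + (norm (v x))\<^sup>2)" using assms by (auto simp: Lp_2_iff)
  show "(\<lambda>x. u x \<bullet> v x) \<in> borel_measurable M" using assms by (auto simp: Lp_2_iff)
  have "\<bar>u x \<bullet> v x\<bar> \<le> (norm (u x))\<^sup>2 + (norm (v x))\<^sup>2" for x
  proof -
    have "\<bar>u x \<bullet> v x\<bar> \<le> norm (u x) * norm (v x)" by (rule Cauchy_Schwarz_ineq2)
    moreover have "2 * (norm (u x) * norm (v x)) \<le> (norm (u x))\<^sup>2 + (norm (v x))\<^sup>2"
      using zero_le_power2[of "norm (u x) - norm (v x)"] by (simp add: power2_diff)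
    moreover have "0 \<le> norm (u x) * norm (v x)" by simp
    ultimately show ?thesis by linarith
  qed
  then show "AE x in M. norm (u x \<bullet> v x) \<le> norm ((norm (u x))\<^sup>2 + (norm (v x))\<^sup>2)" by auto
qed

lemma Lp_2_add: "u \<in> Lp M 2 \<Longrightarrow> v \<in> Lp M 2 \<Longrightarrow> (\<lambda>x. u x + v x) \<in> Lp M 2"
  for u v :: "'a \<Rightarrow> 'b::euclidean_space"
  unfolding Lp_2_iff
proof (intro conjI)
  assume uv: "u \<in> borel_measurable M \<and> integrable M (\<lambda>x. (norm (u x))\<^sup>2)"
    "v \<in> borel_measurable M \<and> integrable M (\<lambda>x. (norm (v x))\<^sup>2)"
  then show "(\<lambda>x. u x + v x) \<in> borel_measurable M" by auto
  have "integrable M (\<lambda>x. u x \<bullet> v x)" by (rule integrable_inner_L2) (use uv in \<open>auto simp: Lp_2_iff\<close>)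
  with uv have "integrable M (\<lambda>x. (norm (u x))\<^sup>2 + 2 * (u x \<bullet> v x) + (norm (v x))\<^sup>2)" by auto
  moreover have "(norm (u x + v x))\<^sup>2 = (norm (u x))\<^sup>2 + 2 * (u x \<bullet> v x) + (norm (v x))\<^sup>2" for x
    by (simp add: power2_norm_eq_inner inner_add inner_commute)
  ultimately show "integrable M (\<lambda>x. (norm (u x + v x))\<^sup>2)" by simp
qed

lemma Lp_2_minus: "u \<in> Lp M 2 \<Longrightarrow> (\<lambda>x. - u x) \<in> Lp M 2"
  for u :: "'a \<Rightarrow> 'b::euclidean_space"
  by (auto simp: Lp_2_iff)

lemma Lp_2_diff: "u \<in> Lp M 2 \<Longrightarrow> v \<in> Lp M 2 \<Longrightarrow> (\<lambda>x. u x - v x) \<in> Lp M 2"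
  for u v :: "'a \<Rightarrow> 'b::euclidean_space"
  using Lp_2_add[OF _ Lp_2_minus, of u M v] by simp

lemma Lp_2_cong_AE:
  fixes u v :: "'a::euclidean_space \<Rightarrow> 'b::euclidean_space"
  assumes "AE x in lebesgue. u x = v x" "u \<in> Lp lebesgue 2"
  shows "v \<in> Lp lebesgue 2"
proof -
  have um: "u \<in> borel_measurable lebesgue" using assms(2) by (simp add: Lp_2_iff)
  have vm: "v \<in> borel_measurable lebesgue"
    by (rule borel_measurable_AE[OF um assms(1)])
  have "integrable lebesgue (\<lambda>x. (norm (v x))\<^sup>2)"
    by (rule integrable_cong_AE_imp[where g="\<lambda>x. (norm (u x))\<^sup>2"]) (use assms vm in \<open>auto simp: Lp_2_iff\<close>)
  with vm show ?thesis by (simp add: Lp_2_iff)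
qed

section \<open>Sobolev functions on space\<close>

lemma axis_Basis: "axis i (1::real) \<in> Basis"
  by (auto simp: Basis_vec_def)

lemma Basis_axis: "b \<in> (Basis :: space set) \<Longrightarrow> \<exists>i. b = axis i 1"
  by (auto simp: Basis_vec_def)

lemma smooth_partial: "smooth u \<Longrightarrow> smooth (partial i u)"
  unfolding partial_def by (rule smooth_dir_deriv[OF _ axis_Basis])

lemma H1_iff: "u \<in> H1 \<longleftrightarrow> u \<in> Lp lebesgue 2 \<and> (\<exists>w\<in>Lp lebesgue 2. weak_deriv [] u w) \<and>
    (\<forall>i. \<exists>w\<in>Lp lebesgue 2. weak_deriv [axis i 1] u w)"
proof -
  have "(\<forall>bs. set bs \<subseteq> Basis \<and> length bs \<le> 1 \<longrightarrow> P bs) \<longleftrightarrow> P [] \<and> (\<forall>i. P [axis i 1])" for P :: "space list \<Rightarrow> bool"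
  proof (intro iffI conjI allI impI)
    fix bs :: "space list" assume P: "P [] \<and> (\<forall>i. P [axis i 1])" and bs: "set bs \<subseteq> Basis \<and> length bs \<le> 1"
    then consider "bs = []" | b where "bs = [b]" "b \<in> Basis"
      by (cases bs) auto
    then show "P bs" using P Basis_axis by cases auto
  qed (auto simp: axis_Basis)
  then show ?thesis unfolding sobolev_def by (simp only: mem_Collect_eq)
qed

text \<open>\<open>wpartial\<close> picks an arbitrary weak derivative, while \<open>sobolev\<close>
  promises that some weak derivative is square integrable; uniqueness carries this over to the
  chosen one.\<close>

lemma wpartial_H1:
  assumes "u \<in> H1"
  shows "weak_deriv [axis i 1] u (wpartial i u)" "wpartial i u \<in> Lp lebesgue 2"
proof -
  obtain w where w: "w \<in> Lp lebesgue 2" "weak_deriv [axis i 1] u w" using assms H1_iff by blast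
  then show wd: "weak_deriv [axis i 1] u (wpartial i u)" unfolding wpartial_def by (metis someI)
  show "wpartial i u \<in> Lp lebesgue 2"
    by (rule Lp_2_cong_AE[OF weak_deriv_unique[OF w(2) wd] w(1)])
qed

lemma wpartial_eqI:
  "weak_deriv [axis i 1] u w \<Longrightarrow> AE x in lebesgue. wpartial i u x = w x"
  for u w :: "space \<Rightarrow> space"
  unfolding wpartial_def by (rule weak_deriv_unique[OF someI[of "weak_deriv [axis i 1] u" w]])

definition C1c :: "(space \<Rightarrow> 'b::euclidean_space) \<Rightarrow> bool" where
  "C1c v \<longleftrightarrow> (\<forall>x. v differentiable (at x)) \<and> (\<forall>i. continuous_on UNIV (partial i v)) \<and>
     (\<exists>K. compact K \<and> (\<forall>x. x \<notin> K \<longrightarrow> v x = 0))"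

lemma C1c_cont: "C1c v \<Longrightarrow> continuous_on UNIV v"
  by (auto simp: C1c_def intro!: continuous_at_imp_continuous_on differentiable_imp_continuous_within)

lemma C1c_obtain:
  assumes "C1c v"
  obtains K where "compact K" "\<And>x. x \<notin> K \<Longrightarrow> v x = 0" "\<And>x i. x \<notin> K \<Longrightarrow> partial i v x = 0"
proof -
  obtain K where K: "compact K" "\<And>x. x \<notin> K \<Longrightarrow> v x = 0" using assms by (auto simp: C1c_def)
  show thesis
  proof (rule that[OF K])
    show "partial i v x = 0" if "x \<notin> K" for x i
      unfolding partial_def by (rule dir_deriv_outside[OF compact_imp_closed[OF K(1)] K(2) that])
  qed
qed

lemma smooth_C1c: "smooth v \<Longrightarrow> compact K \<Longrightarrow> (\<And>x. x \<notin> K \<Longrightarrow> v x = 0) \<Longrightarrow> C1c v"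
  unfolding C1c_def
  by (intro conjI allI exI[of _ K] smooth_imp_differentiable smooth_imp_continuous smooth_partial) auto

lemma compact_support_Lp_2:
  fixes v :: "'a::euclidean_space \<Rightarrow> 'b::euclidean_space"
  assumes "continuous_on UNIV v" "compact K" "\<And>x. x \<notin> K \<Longrightarrow> v x = 0"
  shows "v \<in> Lp lebesgue 2"
proof -
  have "integrable lborel (\<lambda>x. (norm (v x))\<^sup>2)"
    by (rule integrable_compact_support[OF _ assms(2)]) (use assms in \<open>auto intro!: continuous_intros\<close>)
  moreover have "(\<lambda>x. (norm (v x))\<^sup>2) \<in> borel_measurable borel"
    using assms(1) by (auto intro!: continuous_borel continuous_intros)
  ultimately show ?thesis
    using continuous_borel[OF assms(1)] by (simp add: Lp_2_iff integrable_lebesgue_iff measurable_completion)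
qed

lemma C1c_L2: assumes "C1c v" shows "v \<in> Lp lebesgue 2" "partial i v \<in> Lp lebesgue 2"
proof -
  obtain K where K: "compact K" "\<And>x. x \<notin> K \<Longrightarrow> v x = 0" "\<And>x i. x \<notin> K \<Longrightarrow> partial i v x = 0"
    using C1c_obtain[OF assms] by metis
  show "v \<in> Lp lebesgue 2" by (rule compact_support_Lp_2[OF C1c_cont[OF assms] K(1,2)])
  show "partial i v \<in> Lp lebesgue 2"
    by (rule compact_support_Lp_2[OF _ K(1) K(3)]) (use assms in \<open>simp_all add: C1c_def\<close>)
qed

lemma by_parts:
  fixes u v :: "space \<Rightarrow> 'b::euclidean_space"
  assumes u: "C1c u" and v: "\<And>x. v differentiable (at x)" "continuous_on UNIV (partial i v)"
  shows "(\<integral>x. partial i u x \<bullet> v x \<partial>lebesgue) = - (\<integral>x. u x \<bullet> partial i v x \<partial>lebesgue)"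
    "integrable lebesgue (\<lambda>x. partial i u x \<bullet> v x)" "integrable lebesgue (\<lambda>x. u x \<bullet> partial i v x)"
proof -
  obtain K where K: "compact K" "\<And>x. x \<notin> K \<Longrightarrow> u x = 0" using C1c_obtain[OF u] by metis
  have vc: "continuous_on UNIV v"
    using v by (auto intro!: continuous_at_imp_continuous_on differentiable_imp_continuous_within)
  have m: "(\<lambda>x. partial i u x \<bullet> v x) \<in> borel_measurable borel" "(\<lambda>x. u x \<bullet> partial i v x) \<in> borel_measurable borel"
    using u v vc C1c_cont[OF u] by (auto simp: C1c_def intro!: continuous_borel continuous_intros)
  note p = integral_by_parts[of u "axis i 1" v K, folded partial_def, OF _ _ v K]
  have d: "u differentiable (at x)" "continuous_on UNIV (partial i u)" for x using u by (auto simp: C1c_def)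
  show "(\<integral>x. partial i u x \<bullet> v x \<partial>lebesgue) = - (\<integral>x. u x \<bullet> partial i v x \<partial>lebesgue)"
    "integrable lebesgue (\<lambda>x. partial i u x \<bullet> v x)" "integrable lebesgue (\<lambda>x. u x \<bullet> partial i v x)"
    using p[OF d] m by (simp_all add: integral_lebesgue_eq integrable_lebesgue_iff)
qed

lemma dir_deriv_inner_right:
  "v differentiable (at x) \<Longrightarrow> dir_deriv b (\<lambda>x. v x \<bullet> j) x = dir_deriv b v x \<bullet> j"
  by (rule dir_derivI[OF has_derivative_inner_left[OF has_derivative_dir_deriv]])

lemma C1c_weak_deriv:
  fixes v :: "space \<Rightarrow> 'b::euclidean_space"
  assumes v: "C1c v" shows "weak_deriv [axis i 1] v (partial i v)"
  unfolding weak_deriv_def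
proof (intro conjI ballI)
  show l: "loc_integrable UNIV v" "loc_integrable UNIV (partial i v)" using C1c_L2[OF v] loc_integrable_L2 by blast+
  fix \<phi> :: "space \<Rightarrow> real" assume \<phi>: "\<phi> \<in> test_fun UNIV"
  obtain K where K: "smooth \<phi>" "compact K" "\<And>x. x \<notin> K \<Longrightarrow> \<phi> x = 0" using test_funD[OF \<phi>] by metis
  have \<phi>1: "C1c \<phi>" by (rule smooth_C1c[OF K])
  obtain K' where K': "compact K'" "\<And>x. x \<notin> K' \<Longrightarrow> \<phi> x = 0" "\<And>x i. x \<notin> K' \<Longrightarrow> partial i \<phi> x = 0"
    using C1c_obtain[OF \<phi>1] by metis
  have i1: "integrable lebesgue (\<lambda>x. partial i \<phi> x *\<^sub>R v x)"
    by (rule loc_integrable_test[OF l(1) _ K'(1,3)]) (use \<phi>1 in \<open>simp add: C1c_def\<close>)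
  have i2: "integrable lebesgue (\<lambda>x. \<phi> x *\<^sub>R partial i v x)"
    by (rule loc_integrable_test[OF l(2) C1c_cont[OF \<phi>1] K'(1,2)])
  have "(\<integral>x. partial i \<phi> x *\<^sub>R v x \<partial>lebesgue) = - (\<integral>x. \<phi> x *\<^sub>R partial i v x \<partial>lebesgue)"
  proof (rule euclidean_eqI)
    fix j :: 'b
    have pv: "partial i (\<lambda>x. v x \<bullet> j) = (\<lambda>x. partial i v x \<bullet> j)"
      by (rule ext, unfold partial_def, rule dir_deriv_inner_right) (use v in \<open>simp add: C1c_def\<close>)
    have vj: "(\<lambda>x. v x \<bullet> j) differentiable (at x)" for x
      using v by (auto simp: C1c_def intro: differentiable_inner)
    have "(\<integral>x. partial i \<phi> x \<bullet> (v x \<bullet> j) \<partial>lebesgue) = - (\<integral>x. \<phi> x \<bullet> partial i (\<lambda>x. v x \<bullet> j) x \<partial>lebesgue)"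
      by (rule by_parts[OF \<phi>1 vj]) (use v in \<open>auto simp: pv C1c_def intro!: continuous_intros\<close>)
    then show "(\<integral>x. partial i \<phi> x *\<^sub>R v x \<partial>lebesgue) \<bullet> j = (- (\<integral>x. \<phi> x *\<^sub>R partial i v x \<partial>lebesgue)) \<bullet> j"
      using integral_inner_const[OF i1, of j] integral_inner_const[OF i2, of j] by (simp add: pv)
  qed
  then show "(\<integral>x. iter_deriv [axis i 1] \<phi> x *\<^sub>R v x \<partial>lebesgue)
      = (-1) ^ length [axis i (1::real)] *\<^sub>R (\<integral>x. \<phi> x *\<^sub>R partial i v x \<partial>lebesgue)"
    by (simp add: iter_deriv_def partial_def)
qed

lemma C1c_H1: assumes "C1c v" shows "v \<in> H1"
  unfolding H1_iff
proof (intro conjI allI)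
  show l: "v \<in> Lp lebesgue 2" using C1c_L2 assms by blast
  have "weak_deriv [] v v" using loc_integrable_L2[OF l] by (simp add: weak_deriv_def iter_deriv_def)
  then show "\<exists>w\<in>Lp lebesgue 2. weak_deriv [] v w" using l by blast
  show "\<exists>w\<in>Lp lebesgue 2. weak_deriv [axis i 1] v w" for i using C1c_weak_deriv C1c_L2 assms by blast
qed

lemma C1c_wpartial: "C1c v \<Longrightarrow> AE x in lebesgue. wpartial i v x = partial i v x" for v :: "space \<Rightarrow> space"
  by (rule wpartial_eqI[OF C1c_weak_deriv])

text \<open>Weak derivatives are defined with scalar test functions; summing over the components of
  v gives the pairing with a vector field.\<close>

lemma weak_deriv_inner:
  fixes w D v :: "space \<Rightarrow> space"
  assumes wd: "weak_deriv [axis i 1] w D" and v: "smooth v" "compact K" "\<And>x. x \<notin> K \<Longrightarrow> v x = 0"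
  shows "(\<integral>x. partial i v x \<bullet> w x \<partial>lebesgue) = - (\<integral>x. v x \<bullet> D x \<partial>lebesgue)"
    "integrable lebesgue (\<lambda>x. partial i v x \<bullet> w x)" "integrable lebesgue (\<lambda>x. v x \<bullet> D x)"
proof -
  have l: "loc_integrable UNIV w" "loc_integrable UNIV D" using wd by (auto simp: weak_deriv_def)
  have vj: "smooth (\<lambda>x. v x \<bullet> j)" for j by (intro smooth_inner smooth_const v)
  have vt: "(\<lambda>x. v x \<bullet> j) \<in> test_fun UNIV" for j
    unfolding test_fun_def using vj v(2,3) by auto
  have pv: "partial i (\<lambda>x. v x \<bullet> j) = (\<lambda>x. partial i v x \<bullet> j)" for j
    by (rule ext, unfold partial_def, rule dir_deriv_inner_right[OF smooth_imp_differentiable[OF v(1)]])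
  have pvo: "partial i v x = 0" if "x \<notin> K" for x
    unfolding partial_def by (rule dir_deriv_outside[OF compact_imp_closed[OF v(2)] v(3) that])
  have 1: "integrable lebesgue (\<lambda>x. (partial i v x \<bullet> j) *\<^sub>R (w x \<bullet> j))" for j
    by (rule loc_integrable_test[OF loc_integrable_inner[OF l(1)] _ v(2)])
      (use smooth_imp_continuous[OF smooth_partial[OF v(1)]] pvo in \<open>auto intro!: continuous_intros\<close>)
  have 2: "integrable lebesgue (\<lambda>x. (v x \<bullet> j) *\<^sub>R (D x \<bullet> j))" for j
    by (rule loc_integrable_test[OF loc_integrable_inner[OF l(2)] _ v(2)])
      (use smooth_imp_continuous[OF v(1)] v(3) in \<open>auto intro!: continuous_intros\<close>)
  have eq: "(\<integral>x. (partial i v x \<bullet> j) * (w x \<bullet> j) \<partial>lebesgue) = - (\<integral>x. (v x \<bullet> j) * (D x \<bullet> j) \<partial>lebesgue)" for j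
  proof -
    have "(\<integral>x. partial i (\<lambda>x. v x \<bullet> j) x *\<^sub>R w x \<partial>lebesgue) = - (\<integral>x. (v x \<bullet> j) *\<^sub>R D x \<partial>lebesgue)"
      using wd vt[of j] by (simp add: weak_deriv_def iter_deriv_def partial_def)
    then have "(\<integral>x. (partial i v x \<bullet> j) *\<^sub>R w x \<partial>lebesgue) \<bullet> j = - (\<integral>x. (v x \<bullet> j) *\<^sub>R D x \<partial>lebesgue) \<bullet> j"
      by (simp add: pv)
    moreover have "integrable lebesgue (\<lambda>x. (partial i v x \<bullet> j) *\<^sub>R w x)"
      by (rule loc_integrable_test[OF l(1) _ v(2)])
        (use smooth_imp_continuous[OF smooth_partial[OF v(1)]] pvo in \<open>auto intro!: continuous_intros\<close>)
    moreover have "integrable lebesgue (\<lambda>x. (v x \<bullet> j) *\<^sub>R D x)"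
      by (rule loc_integrable_test[OF l(2) _ v(2)])
        (use smooth_imp_continuous[OF v(1)] v(3) in \<open>auto intro!: continuous_intros\<close>)
    ultimately show ?thesis by (simp flip: integral_inner_const)
  qed
  have e: "partial i v x \<bullet> w x = (\<Sum>j\<in>Basis. (partial i v x \<bullet> j) *\<^sub>R (w x \<bullet> j))"
    "v x \<bullet> D x = (\<Sum>j\<in>Basis. (v x \<bullet> j) *\<^sub>R (D x \<bullet> j))" for x
    using euclidean_inner[of "partial i v x" "w x"] euclidean_inner[of "v x" "D x"] by simp_all
  show "integrable lebesgue (\<lambda>x. partial i v x \<bullet> w x)" "integrable lebesgue (\<lambda>x. v x \<bullet> D x)"
    unfolding e by (rule Bochner_Integration.integrable_sum, rule 1) (rule Bochner_Integration.integrable_sum, rule 2)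
  show "(\<integral>x. partial i v x \<bullet> w x \<partial>lebesgue) = - (\<integral>x. v x \<bullet> D x \<partial>lebesgue)"
    unfolding e Bochner_Integration.integral_sum[OF 1] Bochner_Integration.integral_sum[OF 2]
    using eq by (simp add: sum_negf)
qed

section \<open>The energy inequality for the difference at a fixed time\<close>

lemma vec_nth_inner: "(v::space) $ i = v \<bullet> axis i 1"
  by (simp add: inner_axis)

lemma norm_sum_components: "(norm (u::space))\<^sup>2 = (\<Sum>i\<in>UNIV. (u $ i)\<^sup>2)"
  unfolding power2_norm_eq_inner inner_vec_def by (simp add: power2_eq_square)

lemma smooth_nth: "smooth v \<Longrightarrow> smooth (\<lambda>x. (v x :: space) $ i)"
  by (rule smooth_bounded_linear[OF bounded_linear_vec_nth])

lemma partial_nth: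
  "v differentiable (at x) \<Longrightarrow> partial j (\<lambda>x. (v x :: space) $ i) x = partial j v x $ i"
  unfolding partial_def
  by (rule dir_derivI[OF bounded_linear.has_derivative[OF bounded_linear_vec_nth has_derivative_dir_deriv]])

lemma partial_scaleR:
  fixes v :: "space \<Rightarrow> 'b::real_normed_vector"
  assumes "f differentiable (at x)" "v differentiable (at x)"
  shows "partial j (\<lambda>x. f x *\<^sub>R v x) x = f x *\<^sub>R partial j v x + partial j f x *\<^sub>R v x"
  unfolding partial_def
  by (rule dir_derivI[OF has_derivative_scaleR[OF assms[THEN has_derivative_dir_deriv]]])

lemma divfree_gradient:
  assumes v: "C1c v" "\<And>x. divergence v x = 0" and \<phi>: "smooth \<phi>"
  shows "(\<integral>x. v x \<bullet> gradient \<phi> x \<partial>lebesgue) = 0"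
proof -
  have vi: "C1c (\<lambda>x. v x $ i)" for i
  proof -
    obtain K where K: "compact K" "\<And>x. x \<notin> K \<Longrightarrow> v x = 0" using C1c_obtain[OF v(1)] by metis
    have d: "v differentiable (at x)" for x using v(1) by (simp add: C1c_def)
    have "partial j (\<lambda>x. v x $ i) = (\<lambda>x. partial j v x $ i)" for j
      by (rule ext, rule partial_nth[OF d])
    moreover have "(\<lambda>x. v x $ i) differentiable (at x)" for x
      using bounded_linear.has_derivative[OF bounded_linear_vec_nth has_derivative_dir_deriv[OF d]] differentiable_def by blast
    ultimately show ?thesis unfolding C1c_def
      using v(1) K by (auto simp: C1c_def intro!: continuous_on_component exI[of _ K])
  qed
  have d: "v differentiable (at x)" for x using v(1) by (simp add: C1c_def)
  note bp = by_parts[OF vi smooth_imp_differentiable[OF \<phi>] smooth_imp_continuous[OF smooth_partial[OF \<phi>]]]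
  have "(\<integral>x. v x \<bullet> gradient \<phi> x \<partial>lebesgue) = (\<integral>x. (\<Sum>i\<in>UNIV. (v x $ i) \<bullet> partial i \<phi> x) \<partial>lebesgue)"
    by (simp add: inner_vec_def gradient_def)
  also have "\<dots> = (\<Sum>i\<in>UNIV. (\<integral>x. (v x $ i) \<bullet> partial i \<phi> x \<partial>lebesgue))"
    by (rule Bochner_Integration.integral_sum) (rule bp)
  also have "\<dots> = (\<Sum>i\<in>UNIV. - (\<integral>x. partial i (\<lambda>x. v x $ i) x \<bullet> \<phi> x \<partial>lebesgue))"
    using bp(1) by simp
  also have "\<dots> = - (\<integral>x. (\<Sum>i\<in>UNIV. partial i (\<lambda>x. v x $ i) x \<bullet> \<phi> x) \<partial>lebesgue)"
    by (simp only: sum_negf) (subst Bochner_Integration.integral_sum, rule bp, rule refl)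
  also have "(\<lambda>x. \<Sum>i\<in>UNIV. partial i (\<lambda>x. v x $ i) x \<bullet> \<phi> x) = (\<lambda>x. divergence v x * \<phi> x)"
    by (simp add: divergence_def sum_distrib_right partial_nth[OF d])
  finally show ?thesis using v(2) by simp
qed

lemma divfree_L2_sigma:
  assumes "C1c v" "\<And>x. divergence v x = 0" shows "v \<in> L2_sigma"
  unfolding L2_sigma_def using C1c_L2(1)[OF assms(1)] divfree_gradient[OF assms] by (auto simp: test_fun_def)

text \<open>The counterpart of \<open>convection\<close> with classical derivatives.\<close>

definition self_adv :: "(space \<Rightarrow> space) \<Rightarrow> space \<Rightarrow> space" where
  "self_adv v x = (\<Sum>i\<in>UNIV. (v x $ i) *\<^sub>R partial i v x)"

lemma integrable_mult_bounded:
  fixes u D v :: "space \<Rightarrow> space"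
  assumes u: "u \<in> Lp lebesgue 2" and D: "D \<in> Lp lebesgue 2" and v: "v \<in> borel_measurable lebesgue"
    and M: "\<And>x. norm (v x) \<le> M"
  shows "integrable lebesgue (\<lambda>x. (u x $ i) * (D x \<bullet> v x))"
proof (rule Bochner_Integration.integrable_bound)
  show "integrable lebesgue (\<lambda>x. M * ((norm (u x))\<^sup>2 + (norm (D x))\<^sup>2))" using u D by (auto simp: Lp_2_iff)
  have "(\<lambda>x. u x \<bullet> axis i 1) \<in> borel_measurable lebesgue" using u by (auto simp: Lp_2_iff)
  moreover have "(\<lambda>x. D x \<bullet> v x) \<in> borel_measurable lebesgue" using D v by (auto simp: Lp_2_iff)
  ultimately show "(\<lambda>x. (u x $ i) * (D x \<bullet> v x)) \<in> borel_measurable lebesgue"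
    unfolding vec_nth_inner by (rule borel_measurable_times)
  show "AE x in lebesgue. norm ((u x $ i) * (D x \<bullet> v x)) \<le> norm (M * ((norm (u x))\<^sup>2 + (norm (D x))\<^sup>2))"
  proof (rule AE_I2)
    fix x
    have M0: "0 \<le> M" using M[of x] norm_ge_zero order_trans by blast
    have "\<bar>D x \<bullet> v x\<bar> \<le> norm (D x) * M"
      using Cauchy_Schwarz_ineq2[of "D x" "v x"] mult_left_mono[OF M norm_ge_zero[of "D x"], of x] by linarith
    then have "\<bar>u x $ i\<bar> * \<bar>D x \<bullet> v x\<bar> \<le> norm (u x) * (norm (D x) * M)"
      by (intro mult_mono component_le_norm_cart) auto
    also have "\<dots> = M * (norm (u x) * norm (D x))" by simp
    also have "\<dots> \<le> M * ((norm (u x))\<^sup>2 + (norm (D x))\<^sup>2)"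
    proof (rule mult_left_mono[OF _ M0])
      have "2 * (norm (u x) * norm (D x)) \<le> (norm (u x))\<^sup>2 + (norm (D x))\<^sup>2"
        using zero_le_power2[of "norm (u x) - norm (D x)"] by (simp add: power2_diff)
      moreover have "0 \<le> norm (u x) * norm (D x)" by simp
      ultimately show "norm (u x) * norm (D x) \<le> (norm (u x))\<^sup>2 + (norm (D x))\<^sup>2" by linarith
    qed
    finally show "norm ((u x $ i) * (D x \<bullet> v x)) \<le> norm (M * ((norm (u x))\<^sup>2 + (norm (D x))\<^sup>2))"
      using M0 by (simp add: abs_mult)
  qed
qed

text \<open>Young's inequality, weighted so that b, which will be a gradient, carries the
  coefficient 1. This is exactly what the dissipation in the energy balance of a difference
  absorbs.\<close>

lemma AM_GM_quarter:
  fixes a b M y :: real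
  assumes "\<bar>y\<bar> \<le> b * M" "0 \<le> b" "0 \<le> M"
  shows "a * y \<le> b\<^sup>2 + M\<^sup>2 / 4 * a\<^sup>2"
proof -
  have "a * y \<le> \<bar>a\<bar> * (b * M)"
    using mult_left_mono[OF assms(1) abs_ge_zero[of a]] abs_ge_self[of "a * y"] by (simp add: abs_mult)
  also have "\<dots> \<le> b\<^sup>2 + M\<^sup>2 / 4 * a\<^sup>2"
    using zero_le_power2[of "b - M / 2 * \<bar>a\<bar>"] by (simp add: power2_diff power_mult_distrib power_divide ac_simps)
  finally show ?thesis .
qed

lemma wgrad_sqnorm_eq: "wgrad_sqnorm w = (\<Sum>i\<in>UNIV. \<integral>x. (norm (wpartial i w x))\<^sup>2 \<partial>lebesgue)"
  by (simp add: wgrad_sqnorm_def Lp_norm_2_square)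

lemma
  assumes w: "w \<in> H1" and v: "smooth v" "compact K" "\<And>x. x \<notin> K \<Longrightarrow> v x = 0"
  shows integral_wgrad: "(\<integral>x. (\<Sum>i\<in>UNIV. wpartial i w x \<bullet> partial i v x) \<partial>lebesgue) = - (\<integral>x. w x \<bullet> laplacian v x \<partial>lebesgue)"
    and integrable_wgrad: "integrable lebesgue (\<lambda>x. wpartial i w x \<bullet> partial i v x)"
    and integrable_lap: "integrable lebesgue (\<lambda>x. w x \<bullet> laplacian v x)"
proof -
  have po: "partial i v x = 0" if "x \<notin> K" for i x
    unfolding partial_def by (rule dir_deriv_outside[OF compact_imp_closed[OF v(2)] v(3) that])
  note p = weak_deriv_inner[OF wpartial_H1(1)[OF w] smooth_partial[OF v(1)] v(2) po]
  show i: "integrable lebesgue (\<lambda>x. wpartial i w x \<bullet> partial i v x)" for i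
    using p(3)[of i i] by (simp add: inner_commute)
  have j: "integrable lebesgue (\<lambda>x. w x \<bullet> partial i (partial i v) x)" for i
    using p(2)[of i i] by (simp add: inner_commute)
  have e: "w x \<bullet> laplacian v x = (\<Sum>i\<in>UNIV. w x \<bullet> partial i (partial i v) x)" for x
    by (simp add: laplacian_def inner_sum_right)
  show "integrable lebesgue (\<lambda>x. w x \<bullet> laplacian v x)" unfolding e by (rule Bochner_Integration.integrable_sum) (rule j)
  have q: "(\<integral>x. wpartial i w x \<bullet> partial i v x \<partial>lebesgue) = - (\<integral>x. w x \<bullet> partial i (partial i v) x \<partial>lebesgue)" for i
    using p(1)[of i i] by (simp add: inner_commute)
  show "(\<integral>x. (\<Sum>i\<in>UNIV. wpartial i w x \<bullet> partial i v x) \<partial>lebesgue) = - (\<integral>x. w x \<bullet> laplacian v x \<partial>lebesgue)"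
    unfolding e Bochner_Integration.integral_sum[OF i] Bochner_Integration.integral_sum[OF j] q by (simp add: sum_negf)
qed

text \<open>With u = w - v the integrals on the left add up to that of (u . grad)u . v: an
  integration by parts moves the derivative from v to w, and the extra terms are pairings of
  divergence-free fields with a gradient. \<open>AM_GM_quarter\<close> bounds the result by the
  squares of grad u and of (M/2) u. The square of grad u is then expanded, so that its parts can be
  matched with energy identities.\<close>

lemma
  assumes w: "w \<in> H1" "w \<in> L2_sigma"
    and v: "smooth v" "compact K" "\<And>x. x \<notin> K \<Longrightarrow> v x = 0" "\<And>x. divergence v x = 0"
    and M: "\<And>x. norm (v x) \<le> M"
  shows integrable_convection: "integrable lebesgue (\<lambda>x. convection w x \<bullet> v x)"
    and integrable_self_adv: "integrable lebesgue (\<lambda>x. w x \<bullet> self_adv v x)"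
    and convection_ineq: "(\<integral>x. convection w x \<bullet> v x \<partial>lebesgue) + (\<integral>x. w x \<bullet> self_adv v x \<partial>lebesgue)
      \<le> wgrad_sqnorm w - 2 * (\<integral>x. (\<Sum>i\<in>UNIV. wpartial i w x \<bullet> partial i v x) \<partial>lebesgue)
        + (\<integral>x. (\<Sum>i\<in>UNIV. (norm (partial i v x))\<^sup>2) \<partial>lebesgue)
        + M\<^sup>2 / 4 * (\<integral>x. (norm (w x - v x))\<^sup>2 \<partial>lebesgue)"
proof -
  have M0: "0 \<le> M" using M norm_ge_zero order_trans by blast
  have v1: "C1c v" by (rule smooth_C1c[OF v(1-3)])
  have wL: "w \<in> Lp lebesgue 2" using w by (simp add: L2_sigma_def)
  note DL = wpartial_H1(2)[OF w(1)]
  note vL = C1c_L2[OF v1]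
  have vm: "v \<in> borel_measurable lebesgue" using vL by (simp add: Lp_2_iff)
  have vd: "v differentiable (at x)" for x by (rule smooth_imp_differentiable[OF v(1)])
  note I = integrable_mult_bounded[OF _ _ vm M]
  have ce: "convection w x \<bullet> v x = (\<Sum>i\<in>UNIV. (w x $ i) * (wpartial i w x \<bullet> v x))" for x
    by (simp add: convection_def inner_sum_left)
  show ic: "integrable lebesgue (\<lambda>x. convection w x \<bullet> v x)"
    unfolding ce by (rule Bochner_Integration.integrable_sum) (rule I[OF wL DL])
  have vis: "smooth (\<lambda>x. (v x $ i) *\<^sub>R v x)" for i by (intro smooth_scaleR smooth_nth v(1))
  have vi0: "(v x $ i) *\<^sub>R v x = 0" if "x \<notin> K" for x i using v(3)[OF that] by simp
  note wi = weak_deriv_inner[OF wpartial_H1(1)[OF w(1)] vis v(2) vi0]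
  have pvi: "partial i (\<lambda>x. (v x $ i) *\<^sub>R v x) x \<bullet> w x = (v x $ i) * (partial i v x \<bullet> w x) + partial i v x $ i * (v x \<bullet> w x)" for i x
  proof -
    have "partial i (\<lambda>x. (v x $ i) *\<^sub>R v x) x = (v x $ i) *\<^sub>R partial i v x + partial i v x $ i *\<^sub>R v x"
      using partial_scaleR[OF smooth_imp_differentiable[OF smooth_nth[OF v(1)]] vd] partial_nth[OF vd] by metis
    then show ?thesis by (simp add: inner_add_left)
  qed
  \<comment> \<open>As v is divergence free, (v . grad)v is the sum of the i-th derivatives of v_i
    v, which can be tested against the weak derivatives of w.\<close>
  have se: "w x \<bullet> self_adv v x = (\<Sum>i\<in>UNIV. partial i (\<lambda>x. (v x $ i) *\<^sub>R v x) x \<bullet> w x)" for x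
  proof -
    have "(\<Sum>i\<in>UNIV. partial i v x $ i * (v x \<bullet> w x)) = 0"
      unfolding sum_distrib_right[symmetric] using v(4)[of x] by (simp add: divergence_def)
    then show ?thesis
      unfolding pvi sum.distrib by (simp add: self_adv_def inner_sum_right inner_commute)
  qed
  show isa: "integrable lebesgue (\<lambda>x. w x \<bullet> self_adv v x)"
    unfolding se by (rule Bochner_Integration.integrable_sum) (rule wi)
  have I2: "(\<integral>x. w x \<bullet> self_adv v x \<partial>lebesgue) = - (\<integral>x. (\<Sum>i\<in>UNIV. (v x $ i) * (wpartial i w x \<bullet> v x)) \<partial>lebesgue)"
  proof -
    have i: "integrable lebesgue (\<lambda>x. (v x $ i) * (wpartial i w x \<bullet> v x))" for i by (rule I[OF vL(1) DL])
    have "(\<integral>x. partial i (\<lambda>x. (v x $ i) *\<^sub>R v x) x \<bullet> w x \<partial>lebesgue) = - (\<integral>x. (v x $ i) * (wpartial i w x \<bullet> v x) \<partial>lebesgue)" for i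
      using wi(1)[of i i] by (simp add: inner_commute)
    moreover have i2: "integrable lebesgue (\<lambda>x. partial i (\<lambda>x. (v x $ i) *\<^sub>R v x) x \<bullet> w x)" for i by (rule wi)
    ultimately show ?thesis
      unfolding se Bochner_Integration.integral_sum[OF i2] Bochner_Integration.integral_sum[OF i] by (simp add: sum_negf)
  qed
  \<comment> \<open>(a . grad)v . v is a . grad \<phi>, which integrates to 0 for the
    divergence-free fields a = w and a = v.\<close>
  define \<phi> where "\<phi> x = (1/2) * (v x \<bullet> v x)" for x
  have \<phi>s: "smooth \<phi>" unfolding \<phi>_def[abs_def] by (intro smooth_mult smooth_const smooth_inner v(1))
  have \<phi>t: "\<phi> \<in> test_fun UNIV" unfolding test_fun_def using \<phi>s v(2,3) by (auto simp: \<phi>_def)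
  have g: "gradient \<phi> x $ i = partial i v x \<bullet> v x" for x i
  proof -
    have "(\<phi> has_derivative (\<lambda>b. (1/2) * (v x \<bullet> dir_deriv b v x + dir_deriv b v x \<bullet> v x))) (at x)"
      unfolding \<phi>_def[abs_def]
      by (intro has_derivative_mult_right has_derivative_inner has_derivative_dir_deriv vd)
    from dir_derivI[OF this] show ?thesis by (simp add: gradient_def partial_def inner_commute)
  qed
  have ge: "u \<bullet> gradient \<phi> x = (\<Sum>i\<in>UNIV. u $ i * (partial i v x \<bullet> v x))" for u x
    by (simp add: inner_vec_def g)
  have I3: "(\<integral>x. (\<Sum>i\<in>UNIV. w x $ i * (partial i v x \<bullet> v x)) \<partial>lebesgue) = 0"
    using w(2) \<phi>t unfolding L2_sigma_def ge[symmetric] by simp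
  have I4: "(\<integral>x. (\<Sum>i\<in>UNIV. v x $ i * (partial i v x \<bullet> v x)) \<partial>lebesgue) = 0"
    using divfree_L2_sigma[OF v1 v(4)] \<phi>t unfolding L2_sigma_def ge[symmetric] by simp
  define u where "u x = w x - v x" for x
  define E where "E i x = wpartial i w x - partial i v x" for i x
  have uL: "u \<in> Lp lebesgue 2" unfolding u_def[abs_def] by (rule Lp_2_diff[OF wL vL(1)])
  have EL: "E i \<in> Lp lebesgue 2" for i unfolding E_def[abs_def] by (rule Lp_2_diff[OF DL vL(2)])
  have int: "integrable lebesgue (\<lambda>x. \<Sum>i\<in>UNIV. a x $ i * (b i x \<bullet> v x))"
    if "a \<in> Lp lebesgue 2" "\<And>i. b i \<in> Lp lebesgue 2" for a :: "space \<Rightarrow> space" and b :: "3 \<Rightarrow> space \<Rightarrow> space"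
    by (rule Bochner_Integration.integrable_sum) (rule I[OF that])
  have exp: "(\<Sum>i\<in>UNIV. u x $ i * (E i x \<bullet> v x)) = convection w x \<bullet> v x
      - (\<Sum>i\<in>UNIV. (v x $ i) * (wpartial i w x \<bullet> v x))
      - (\<Sum>i\<in>UNIV. w x $ i * (partial i v x \<bullet> v x)) + (\<Sum>i\<in>UNIV. v x $ i * (partial i v x \<bullet> v x))" for x
    unfolding ce sum_subtractf[symmetric] sum.distrib[symmetric] u_def E_def
    by (rule sum.cong) (simp_all add: inner_diff_left algebra_simps)
  have "(\<integral>x. convection w x \<bullet> v x \<partial>lebesgue) + (\<integral>x. w x \<bullet> self_adv v x \<partial>lebesgue)
      = (\<integral>x. (\<Sum>i\<in>UNIV. u x $ i * (E i x \<bullet> v x)) \<partial>lebesgue)"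
    unfolding exp I2 using ic int[OF vL(1) DL] int[OF wL vL(2)] int[OF vL(1) vL(2)] I3 I4 by simp
  also have "\<dots> \<le> (\<integral>x. (\<Sum>i\<in>UNIV. (norm (E i x))\<^sup>2) + M\<^sup>2 / 4 * (norm (u x))\<^sup>2 \<partial>lebesgue)"
  proof (rule integral_mono[OF int[OF uL EL]])
    show "integrable lebesgue (\<lambda>x. (\<Sum>i\<in>UNIV. (norm (E i x))\<^sup>2) + M\<^sup>2 / 4 * (norm (u x))\<^sup>2)"
      using EL uL by (auto simp: Lp_2_iff)
    fix x
    have "u x $ i * (E i x \<bullet> v x) \<le> (norm (E i x))\<^sup>2 + M\<^sup>2 / 4 * (u x $ i)\<^sup>2" for i
    proof (rule AM_GM_quarter[OF _ norm_ge_zero M0])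
      show "\<bar>E i x \<bullet> v x\<bar> \<le> norm (E i x) * M"
        using Cauchy_Schwarz_ineq2[of "E i x" "v x"] mult_left_mono[OF M norm_ge_zero[of "E i x"], of x] by linarith
    qed
    then have "(\<Sum>i\<in>UNIV. u x $ i * (E i x \<bullet> v x)) \<le> (\<Sum>i\<in>UNIV. (norm (E i x))\<^sup>2 + M\<^sup>2 / 4 * (u x $ i)\<^sup>2)"
      by (rule sum_mono)
    then show "(\<Sum>i\<in>UNIV. u x $ i * (E i x \<bullet> v x)) \<le> (\<Sum>i\<in>UNIV. (norm (E i x))\<^sup>2) + M\<^sup>2 / 4 * (norm (u x))\<^sup>2"
      by (simp add: sum.distrib norm_sum_components sum_distrib_left)
  qed
  also have "\<dots> = (\<Sum>i\<in>UNIV. \<integral>x. (norm (E i x))\<^sup>2 \<partial>lebesgue) + M\<^sup>2 / 4 * (\<integral>x. (norm (u x))\<^sup>2 \<partial>lebesgue)"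
    using EL uL by (simp add: Lp_2_iff)
  also have "(\<Sum>i\<in>UNIV. \<integral>x. (norm (E i x))\<^sup>2 \<partial>lebesgue)
     = (\<Sum>i\<in>UNIV. (\<integral>x. (norm (wpartial i w x))\<^sup>2 \<partial>lebesgue) - 2 * (\<integral>x. wpartial i w x \<bullet> partial i v x \<partial>lebesgue)
        + (\<integral>x. (norm (partial i v x))\<^sup>2 \<partial>lebesgue))"
  proof (rule sum.cong[OF refl])
    fix i
    have "(norm (E i x))\<^sup>2 = (norm (wpartial i w x))\<^sup>2 - 2 * (wpartial i w x \<bullet> partial i v x) + (norm (partial i v x))\<^sup>2" for x
      by (simp add: E_def power2_norm_eq_inner inner_diff inner_commute)
    then show "(\<integral>x. (norm (E i x))\<^sup>2 \<partial>lebesgue) = (\<integral>x. (norm (wpartial i w x))\<^sup>2 \<partial>lebesgue) - 2 * (\<integral>x. wpartial i w x \<bullet> partial i v x \<partial>lebesgue)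
        + (\<integral>x. (norm (partial i v x))\<^sup>2 \<partial>lebesgue)"
      using DL[of i] vL(2)[of i] integrable_inner_L2[OF DL vL(2), of i i] by (simp add: Lp_2_iff)
  qed
  also have "\<dots> = wgrad_sqnorm w - 2 * (\<integral>x. (\<Sum>i\<in>UNIV. wpartial i w x \<bullet> partial i v x) \<partial>lebesgue)
        + (\<integral>x. (\<Sum>i\<in>UNIV. (norm (partial i v x))\<^sup>2) \<partial>lebesgue)"
    using integrable_inner_L2[OF DL vL(2)] vL(2)
    by (simp add: wgrad_sqnorm_eq sum.distrib sum_subtractf Lp_2_iff sum_distrib_left)
  finally show "(\<integral>x. convection w x \<bullet> v x \<partial>lebesgue) + (\<integral>x. w x \<bullet> self_adv v x \<partial>lebesgue)
      \<le> wgrad_sqnorm w - 2 * (\<integral>x. (\<Sum>i\<in>UNIV. wpartial i w x \<bullet> partial i v x) \<partial>lebesgue)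
        + (\<integral>x. (\<Sum>i\<in>UNIV. (norm (partial i v x))\<^sup>2) \<partial>lebesgue)
        + M\<^sup>2 / 4 * (\<integral>x. (norm (w x - v x))\<^sup>2 \<partial>lebesgue)" unfolding u_def .
qed

section \<open>Fields dominated by a product\<close>

lemma AE_lborel_lebesgue_on:
  fixes A :: "'a::euclidean_space set"
  assumes "AE t in lborel. P t" "A \<in> sets borel" shows "AE t in lebesgue_on A. P t"
proof -
  have "AE t in lebesgue. P t" using assms(1) by (rule AE_completion)
  then show ?thesis using assms(2) by (subst AE_restrict_space_iff) auto
qed

lemma borel_slice_space: "u \<in> borel_measurable borel \<Longrightarrow> (\<lambda>x. u (x, t)) \<in> borel_measurable borel"
  for u :: "'a::euclidean_space \<times> 'b::euclidean_space \<Rightarrow> 'c::topological_space"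
  by (rule measurable_compose[rotated], assumption) (simp add: borel_prod[symmetric])

lemma borel_slice_time: "u \<in> borel_measurable borel \<Longrightarrow> (\<lambda>t. u (x, t)) \<in> borel_measurable borel"
  for u :: "'a::euclidean_space \<times> 'b::euclidean_space \<Rightarrow> 'c::topological_space"
  by (rule measurable_compose[rotated], assumption) (simp add: borel_prod[symmetric])

lemma borel_integral_space:
  fixes u :: "'a::euclidean_space \<times> 'b::euclidean_space \<Rightarrow> 'c::{banach, second_countable_topology}"
  assumes "u \<in> borel_measurable borel"
  shows "(\<lambda>t. \<integral>x. u (x, t) \<partial>lborel) \<in> borel_measurable borel"
proof -
  have "(\<lambda>z. u (snd z, fst z)) \<in> borel_measurable (borel \<Otimes>\<^sub>M borel)"
    using assms by (intro measurable_compose[OF _ assms]) (simp add: borel_prod[symmetric])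
  then have "(\<lambda>(t, x). u (x, t)) \<in> borel_measurable (borel \<Otimes>\<^sub>M lborel)" 
    by (simp add: case_prod_unfold cong: measurable_cong_sets sets_pair_measure_cong)
  then show ?thesis by (rule lborel.borel_measurable_lebesgue_integral)
qed

text \<open>A product bound splits the mixed norm into two integrals of one variable each. It is
  asked for at almost every time only, since a cascade obeys such a bound only when finitely many
  swirls are active.\<close>

lemma LrLq_dominated:
  fixes u :: "space \<times> real \<Rightarrow> 'b::{banach, second_countable_topology}"
  assumes u: "u \<in> borel_measurable borel" and le: "AE t in lborel. \<forall>x. norm (u (x, t)) \<le> \<alpha> x * \<beta> t"
    and \<alpha>: "\<alpha> \<in> borel_measurable borel" "\<And>x. 0 \<le> \<alpha> x" "integrable lborel (\<lambda>x. \<alpha> x powr q)"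
    and \<beta>: "\<beta> \<in> borel_measurable borel" "\<And>t. 0 \<le> \<beta> t" "integrable lborel (\<lambda>t. \<beta> t powr r)"
    and rq: "0 < r" "0 < q"
  shows "u \<in> LrLq (ennreal r) (ennreal q) S"
proof -
  let ?A = "\<integral>x. \<alpha> x powr q \<partial>lborel"
  have [simp]: "ennreal r \<noteq> \<infinity>" "ennreal q \<noteq> \<infinity>" "enn2real (ennreal r) = r" "enn2real (ennreal q) = q"
    using rq by auto
  have s: "(\<lambda>x. u (x, t)) \<in> borel_measurable borel" for t by (rule borel_slice_space[OF u])
  have nm: "(\<lambda>z. norm (u z) powr q) \<in> borel_measurable borel" using u by simp
  have ns: "(\<lambda>x. norm (u (x, t)) powr q) \<in> borel_measurable borel" for t using s by simp
  have ptw: "norm (u (x, t)) powr q \<le> \<beta> t powr q * \<alpha> x powr q" if "\<forall>x. norm (u (x, t)) \<le> \<alpha> x * \<beta> t" for x t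
  proof -
    have "norm (u (x, t)) powr q \<le> (\<alpha> x * \<beta> t) powr q" using that rq by (intro powr_mono2) auto
    then show ?thesis using \<alpha>(2) \<beta>(2) by (simp add: powr_mult mult.commute)
  qed
  have int: "integrable lborel (\<lambda>x. norm (u (x, t)) powr q)" if "\<forall>x. norm (u (x, t)) \<le> \<alpha> x * \<beta> t" for t
  proof (rule Bochner_Integration.integrable_bound)
    show "integrable lborel (\<lambda>x. \<beta> t powr q * \<alpha> x powr q)" using \<alpha>(3) by simp
  qed (use ns ptw[OF that] in auto)
  have inn: "Lp_norm lebesgue (ennreal q) (slice u t) = (\<integral>x. norm (u (x, t)) powr q \<partial>lborel) powr (1 / q)" for t
    by (simp add: Lp_norm_def integral_lebesgue_eq[OF ns])
  have m: "(\<lambda>t. Lp_norm lebesgue (ennreal q) (slice u t)) \<in> borel_measurable borel"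
    unfolding inn using borel_integral_space[OF nm] by simp
  have bd: "Lp_norm lebesgue (ennreal q) (slice u t) \<le> ?A powr (1 / q) * \<beta> t"
    if t: "\<forall>x. norm (u (x, t)) \<le> \<alpha> x * \<beta> t" for t
  proof -
    have "(\<integral>x. norm (u (x, t)) powr q \<partial>lborel) \<le> (\<integral>x. \<beta> t powr q * \<alpha> x powr q \<partial>lborel)"
      using \<alpha>(3) ptw[OF t] by (intro integral_mono int[OF t]) auto
    then have "(\<integral>x. norm (u (x, t)) powr q \<partial>lborel) \<le> \<beta> t powr q * ?A" by simp
    then have "(\<integral>x. norm (u (x, t)) powr q \<partial>lborel) powr (1/q) \<le> (\<beta> t powr q * ?A) powr (1/q)"
      using rq by (intro powr_mono2) (auto intro: integral_nonneg)
    also have "\<dots> = ?A powr (1/q) * \<beta> t"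
      using rq \<beta>(2)[of t] by (simp add: powr_mult powr_powr mult.commute)
    finally show ?thesis by (simp add: inn)
  qed
  have AE1: "AE t in lebesgue_on {0<..<S}. \<forall>x. norm (u (x, t)) \<le> \<alpha> x * \<beta> t"
    by (rule AE_lborel_lebesgue_on[OF le]) simp
  show ?thesis unfolding LrLq_def bochner_def mem_Collect_eq
  proof (intro conjI)
    show "u \<in> borel_measurable (lebesgue_on (UNIV \<times> {0<..<S}))"
      using u by (intro measurable_restrict_space1 measurable_completion) simp
    show "AE t in lebesgue_on {0<..<S}. slice u t \<in> Lp lebesgue (ennreal q)"
      using AE1
    proof eventually_elim
      case (elim t)
      then show ?case using int[OF elim] s[of t] integrable_lebesgue_iff[OF ns]
        by (simp add: Lp_def measurable_completion)
    qed
    have mS: "(\<lambda>t. Lp_norm lebesgue (ennreal q) (slice u t)) \<in> borel_measurable (lebesgue_on {0<..<S})"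
      using m by (intro measurable_restrict_space1 measurable_completion) simp
    have bi: "integrable (lebesgue_on {0<..<S}) (\<lambda>t. (?A powr (1/q)) powr r * \<beta> t powr r)"
    proof -
      have "integrable lebesgue (\<lambda>t. \<beta> t powr r)" using \<beta> by (subst integrable_lebesgue_iff) auto
      then have "integrable (lebesgue_on {0<..<S}) (\<lambda>t. \<beta> t powr r)"
        by (subst integrable_restrict_space) (auto intro: integrable_real_mult_indicator simp: mult.commute)
      then show ?thesis by simp
    qed
    have "integrable (lebesgue_on {0<..<S}) (\<lambda>t. norm (Lp_norm lebesgue (ennreal q) (slice u t)) powr r)"
    proof (rule Bochner_Integration.integrable_bound[OF bi])
      show "AE t in lebesgue_on {0<..<S}. norm (norm (Lp_norm lebesgue (ennreal q) (slice u t)) powr r)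
          \<le> norm ((?A powr (1/q)) powr r * \<beta> t powr r)"
        using AE1
      proof eventually_elim
        case (elim t)
        have "norm (Lp_norm lebesgue (ennreal q) (slice u t)) powr r \<le> (?A powr (1/q) * \<beta> t) powr r"
          using bd[OF elim] rq by (intro powr_mono2) (auto simp: inn)
        then show ?case using \<beta>(2)[of t] by (simp add: powr_mult)
      qed
    qed (use mS in simp)
    then show "(\<lambda>t. Lp_norm lebesgue (ennreal q) (slice u t)) \<in> Lp (lebesgue_on {0<..<S}) (ennreal r)"
      using mS by (simp add: Lp_def)
  qed
qed

lemma integrable_dominated:
  fixes u :: "'a::euclidean_space \<times> 'b::euclidean_space \<Rightarrow> 'c::{banach, second_countable_topology}"
  assumes u: "u \<in> borel_measurable borel" and le: "AE t in lborel. \<forall>x. norm (u (x, t)) \<le> \<alpha> x * \<beta> t"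
    and \<alpha>: "integrable lborel \<alpha>" "\<And>x. 0 \<le> \<alpha> x" and \<beta>: "integrable lborel \<beta>" "\<And>t. 0 \<le> \<beta> t"
  shows "integrable lborel u"
proof -
  have um: "u \<in> borel_measurable (lborel \<Otimes>\<^sub>M lborel)" using u by (simp add: lborel_prod)
  have le': "AE t in lborel. norm (u (x, t)) \<le> \<alpha> x * \<beta> t" for x using le by eventually_elim simp
  have i: "integrable lborel (\<lambda>t. u (x, t))" for x
  proof (rule Bochner_Integration.integrable_bound)
    show "integrable lborel (\<lambda>t. \<alpha> x * \<beta> t)" using \<beta> by simp
  qed (use borel_slice_time[OF u] le'[of x] \<alpha>(2)[of x] \<beta>(2) in auto)
  have "integrable (lborel \<Otimes>\<^sub>M lborel) u"
  proof (rule lborel_pair.Fubini_integrable[OF um])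
    show "AE x in lborel. integrable lborel (\<lambda>t. u (x, t))" using i by simp
    show "integrable lborel (\<lambda>x. \<integral>t. norm (u (x, t)) \<partial>lborel)"
    proof (rule Bochner_Integration.integrable_bound)
      show "integrable lborel (\<lambda>x. \<alpha> x * (\<integral>t. \<beta> t \<partial>lborel))" using \<alpha> by simp
      show "(\<lambda>x. \<integral>t. norm (u (x, t)) \<partial>lborel) \<in> borel_measurable lborel"
        using um by (intro lborel.borel_measurable_lebesgue_integral) (simp add: case_prod_unfold)
      have "(\<integral>t. norm (u (x, t)) \<partial>lborel) \<le> \<alpha> x * (\<integral>t. \<beta> t \<partial>lborel)" for x
      proof -
        have "(\<integral>t. norm (u (x, t)) \<partial>lborel) \<le> (\<integral>t. \<alpha> x * \<beta> t \<partial>lborel)"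
          using le'[of x] i \<beta> by (intro integral_mono_AE) auto
        then show ?thesis by simp
      qed
      then show "AE x in lborel. norm (\<integral>t. norm (u (x, t)) \<partial>lborel) \<le> norm (\<alpha> x * (\<integral>t. \<beta> t \<partial>lborel))"
        using \<alpha>(2) \<beta>(2) by (auto intro!: AE_I2 simp: abs_mult integral_nonneg)
    qed
  qed
  then show ?thesis by (simp add: lborel_prod)
qed

section \<open>Swirls\<close>

text \<open>The cross product of the third unit vector with y, the velocity of a rigid rotation
  about the third axis.\<close>

definition rot :: "space \<Rightarrow> space" where
  "rot y = (\<chi> i. if i = 1 then - (y $ 2) else if i = 2 then y $ 1 else 0)"

definition swirl :: "(real \<Rightarrow> real) \<Rightarrow> space \<Rightarrow> space" where
  "swirl g y = g (y \<bullet> y) *\<^sub>R rot y"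

lemma inner_rot: "y \<bullet> rot y = 0"
  by (simp add: inner_vec_def rot_def sum_3)

lemma linear_rot: "linear rot"
  by (rule linearI) (simp_all add: rot_def vec_eq_iff)

lemma bounded_linear_rot: "bounded_linear rot"
  using linear_rot by (simp add: linear_conv_bounded_linear)

lemma norm_rot: "norm (rot y) \<le> norm y"
proof (rule power2_le_imp_le)
  show "(norm (rot y))\<^sup>2 \<le> (norm y)\<^sup>2"
    by (simp add: norm_sum_components sum_3 rot_def)
qed simp

lemma rot_components: "rot y = (\<Sum>i\<in>UNIV. y $ i *\<^sub>R rot (axis i 1))"
  by (simp add: vec_eq_iff rot_def sum_3 axis_def forall_3)

definition scaled_swirl :: "(real \<Rightarrow> real) \<Rightarrow> space \<Rightarrow> real \<Rightarrow> space \<Rightarrow> space" where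
  "scaled_swirl g p e x = swirl g ((1 / e) *\<^sub>R (x - p))"

text \<open>The i-th partial derivative of \<open>swirl g\<close> if g' is the derivative of
  g.\<close>

definition swirl_partial :: "3 \<Rightarrow> (real \<Rightarrow> real) \<Rightarrow> (real \<Rightarrow> real) \<Rightarrow> space \<Rightarrow> space" where
  "swirl_partial i g g' y = g (y \<bullet> y) *\<^sub>R rot (axis i 1) + (2 * g' (y \<bullet> y) * (y $ i)) *\<^sub>R rot y"

lemma scaling_deriv: "((\<lambda>x. (1 / e) *\<^sub>R (x - p)) has_derivative (\<lambda>v. (1 / e) *\<^sub>R v)) (at x)"
  by (auto intro!: derivative_eq_intros)

lemma partial_scaled:
  assumes "\<And>y. (u has_derivative u' y) (at y)"
  shows "partial i (\<lambda>x. c *\<^sub>R u ((1 / e) *\<^sub>R (x - p))) x = (c / e) *\<^sub>R u' ((1 / e) *\<^sub>R (x - p)) (axis i 1)"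
proof -
  let ?y = "(1 / e) *\<^sub>R (x - p)"
  have "((\<lambda>x. c *\<^sub>R u ((1 / e) *\<^sub>R (x - p))) has_derivative (\<lambda>v. c *\<^sub>R u' ?y ((1 / e) *\<^sub>R v))) (at x)"
    by (intro has_derivative_scaleR_right has_derivative_compose[OF scaling_deriv assms])
  moreover have "linear (u' ?y)" using assms has_derivative_linear by blast
  ultimately show ?thesis
    unfolding partial_def by (simp add: dir_derivI linear_cmul)
qed

lemma inner_self_deriv: "((\<lambda>y::space. y \<bullet> y) has_derivative (\<lambda>v. 2 * (y \<bullet> v))) (at y)"
  by (auto intro!: derivative_eq_intros simp: inner_commute)

lemma compose_inner_deriv:
  assumes "\<And>s. (g has_real_derivative g' s) (at s)"
  shows "((\<lambda>y::space. g (y \<bullet> y)) has_derivative (\<lambda>v. 2 * g' (y \<bullet> y) * (y \<bullet> v))) (at y)"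
proof -
  have "(g has_derivative (\<lambda>h. g' (y \<bullet> y) * h)) (at (y \<bullet> y))"
    using assms by (simp add: has_field_derivative_def)
  from has_derivative_compose[OF inner_self_deriv this] show ?thesis
    by (rule has_derivative_eq_rhs) (simp add: ac_simps)
qed

lemma swirl_deriv:
  assumes "\<And>s. (g has_real_derivative g' s) (at s)"
  shows "(swirl g has_derivative (\<lambda>v. g (y \<bullet> y) *\<^sub>R rot v + (2 * g' (y \<bullet> y) * (y \<bullet> v)) *\<^sub>R rot y)) (at y)"
  unfolding swirl_def[abs_def]
  by (rule has_derivative_scaleR[OF compose_inner_deriv[OF assms] bounded_linear_imp_has_derivative[OF bounded_linear_rot]])

lemma swirl_partial_deriv:
  assumes g: "\<And>s. (g has_real_derivative g' s) (at s)" and g': "\<And>s. (g' has_real_derivative g'' s) (at s)"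
  shows "(swirl_partial i g g' has_derivative (\<lambda>v. (2 * g' (y \<bullet> y) * (y \<bullet> v)) *\<^sub>R rot (axis i 1)
     + ((2 * g' (y \<bullet> y) * (y $ i)) *\<^sub>R rot v
     + (2 * (g' (y \<bullet> y) * (v $ i) + 2 * g'' (y \<bullet> y) * (y \<bullet> v) * (y $ i))) *\<^sub>R rot y))) (at y)"
proof -
  have "((\<lambda>y. y $ i) has_derivative (\<lambda>v. v $ i)) (at y)"
    by (rule bounded_linear_imp_has_derivative[OF bounded_linear_vec_nth])
  from has_derivative_mult[OF compose_inner_deriv[OF g'] this]
  have "((\<lambda>y. g' (y \<bullet> y) * (y $ i)) has_derivative (\<lambda>v. g' (y \<bullet> y) * (v $ i) + 2 * g'' (y \<bullet> y) * (y \<bullet> v) * (y $ i))) (at y)" .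
  from has_derivative_mult_right[OF this, of 2]
  have d: "((\<lambda>y. 2 * g' (y \<bullet> y) * (y $ i)) has_derivative (\<lambda>v. 2 * (g' (y \<bullet> y) * (v $ i) + 2 * g'' (y \<bullet> y) * (y \<bullet> v) * (y $ i)))) (at y)"
    by (simp add: mult.assoc)
  show ?thesis
    unfolding swirl_partial_def[abs_def]
    by (intro has_derivative_add has_derivative_scaleR[OF d] has_derivative_scaleR_left compose_inner_deriv[OF g]
        bounded_linear_imp_has_derivative[OF bounded_linear_rot])
qed

lemma scaled_swirl_partial:
  assumes g: "\<And>s. (g has_real_derivative g' s) (at s)"
  shows "partial i (\<lambda>x. c *\<^sub>R scaled_swirl g p e x) x = (c / e) *\<^sub>R swirl_partial i g g' ((1 / e) *\<^sub>R (x - p))"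
  unfolding scaled_swirl_def partial_scaled[OF swirl_deriv[OF g]]
  by (simp add: swirl_partial_def inner_axis)

text \<open>\<open>rot\<close> has trace 0, and the derivative of the profile contributes a multiple
  of y . rot y = 0. Hence every profile gives a divergence-free field.\<close>

lemma scaled_swirl_divergence:
  assumes g: "\<And>s. (g has_real_derivative g' s) (at s)"
  shows "divergence (\<lambda>x. c *\<^sub>R scaled_swirl g p e x) x = 0"
proof -
  have a: "axis i (1::real) $ i = 1" for i :: 3 by simp
  have "(\<Sum>i\<in>UNIV. swirl_partial i g g' y $ i) = 0" for y
    by (simp add: swirl_partial_def sum_3 rot_def axis_def)
  then show ?thesis
    unfolding divergence_def scaled_swirl_partial[OF g] vector_scaleR_component
    unfolding scaleR_sum_right[symmetric] by simp
qed

lemma scaleR_collect: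
  "(2 * a * y) *\<^sub>R r + ((2 * a * y) *\<^sub>R r + (2 * (a + 2 * b * y * y)) *\<^sub>R s)
    = (4 * a) *\<^sub>R (y *\<^sub>R r) + (2 * a + 4 * b * (y * y)) *\<^sub>R (s::'a::real_vector)"
proof -
  have "(2 * a * y) *\<^sub>R r + (2 * a * y) *\<^sub>R r = (4 * a) *\<^sub>R (y *\<^sub>R r)"
    unfolding scaleR_add_left[symmetric] by simp
  moreover have "2 * (a + 2 * b * y * y) = 2 * a + 4 * b * (y * y)" by simp
  ultimately show ?thesis by (simp only: add.assoc[symmetric])
qed

text \<open>With s = |y|^2, the scalar Laplacian of g(s) in three dimensions is 4 s g'' + 6 g', and
  the cross term with the linear field \<open>rot\<close> adds 4 g'. So the Laplacian is again a
  swirl, hence again divergence free.\<close>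

lemma scaled_swirl_laplacian:
  assumes g: "\<And>s. (g has_real_derivative g' s) (at s)" and g': "\<And>s. (g' has_real_derivative g'' s) (at s)"
  shows "laplacian (\<lambda>x. c *\<^sub>R scaled_swirl g p e x) x
    = (c / e\<^sup>2) *\<^sub>R scaled_swirl (\<lambda>s. 4 * s * g'' s + 10 * g' s) p e x"
proof -
  let ?y = "(1 / e) *\<^sub>R (x - p)"
  have pe: "partial i (\<lambda>x. c *\<^sub>R scaled_swirl g p e x) = (\<lambda>x. (c / e) *\<^sub>R swirl_partial i g g' ((1 / e) *\<^sub>R (x - p)))" for i
    by (rule ext, rule scaled_swirl_partial[OF g])
  let ?d = "\<lambda>i. (2 * g' (?y \<bullet> ?y) * (?y $ i)) *\<^sub>R rot (axis i 1)
     + ((2 * g' (?y \<bullet> ?y) * (?y $ i)) *\<^sub>R rot (axis i 1)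
     + (2 * (g' (?y \<bullet> ?y) + 2 * g'' (?y \<bullet> ?y) * (?y $ i) * (?y $ i))) *\<^sub>R rot ?y)"
  have p2: "partial i (partial i (\<lambda>x. c *\<^sub>R scaled_swirl g p e x)) x = (c / e / e) *\<^sub>R ?d i" for i
    unfolding pe partial_scaled[OF swirl_partial_deriv[OF g g']] by (simp add: inner_axis)
  have "(\<Sum>i\<in>UNIV. ?d i) = (4 * g' (?y \<bullet> ?y)) *\<^sub>R (\<Sum>i\<in>UNIV. ?y $ i *\<^sub>R rot (axis i 1))
     + (6 * g' (?y \<bullet> ?y) + 4 * g'' (?y \<bullet> ?y) * (?y \<bullet> ?y)) *\<^sub>R rot ?y"
  proof -
    have 1: "?d i = (4 * g' (?y \<bullet> ?y)) *\<^sub>R (?y $ i *\<^sub>R rot (axis i 1))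
       + (2 * g' (?y \<bullet> ?y) + 4 * g'' (?y \<bullet> ?y) * (?y $ i * ?y $ i)) *\<^sub>R rot ?y" for i
      by (rule scaleR_collect)
    have 2: "(\<Sum>i\<in>UNIV. ?y $ i * ?y $ i) = ?y \<bullet> ?y" by (simp add: inner_vec_def)
    show ?thesis
      unfolding 1 sum.distrib scaleR_sum_right[symmetric] scaleR_sum_left[symmetric] sum_distrib_left[symmetric] 2
      by (simp add: mult.assoc)
  qed
  also have "\<dots> = (4 * (?y \<bullet> ?y) * g'' (?y \<bullet> ?y) + 10 * g' (?y \<bullet> ?y)) *\<^sub>R rot ?y"
    unfolding rot_components[of ?y, symmetric] scaleR_add_left[symmetric] by (rule arg_cong[where f="\<lambda>a. a *\<^sub>R rot ?y"]) simp
  finally have "(\<Sum>i\<in>UNIV. ?d i) = (4 * (?y \<bullet> ?y) * g'' (?y \<bullet> ?y) + 10 * g' (?y \<bullet> ?y)) *\<^sub>R rot ?y" .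
  then show ?thesis
    unfolding laplacian_def p2 scaleR_sum_right[symmetric]
    by (simp add: scaled_swirl_def swirl_def power2_eq_square)
qed

text \<open>The velocity is orthogonal to y, so the derivative of the radial profile drops out. What
  remains is the centripetal acceleration towards the axis.\<close>

lemma scaled_swirl_self_adv:
  assumes g: "\<And>s. (g has_real_derivative g' s) (at s)"
  shows "self_adv (\<lambda>x. c *\<^sub>R scaled_swirl g p e x) x
    = (c\<^sup>2 / e) *\<^sub>R ((g (((1 / e) *\<^sub>R (x - p)) \<bullet> ((1 / e) *\<^sub>R (x - p))))\<^sup>2 *\<^sub>R rot (rot ((1 / e) *\<^sub>R (x - p))))"
proof -
  let ?y = "(1 / e) *\<^sub>R (x - p)"
  have "(\<Sum>i\<in>UNIV. (rot ?y $ i) *\<^sub>R swirl_partial i g g' ?y)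
     = g (?y \<bullet> ?y) *\<^sub>R (\<Sum>i\<in>UNIV. rot ?y $ i *\<^sub>R rot (axis i 1)) + (2 * g' (?y \<bullet> ?y) * (?y \<bullet> rot ?y)) *\<^sub>R rot ?y"
  proof -
    have 1: "(rot ?y $ i) *\<^sub>R swirl_partial i g g' ?y
      = g (?y \<bullet> ?y) *\<^sub>R (rot ?y $ i *\<^sub>R rot (axis i 1)) + (2 * g' (?y \<bullet> ?y) * (?y $ i * rot ?y $ i)) *\<^sub>R rot ?y" for i
      by (simp add: swirl_partial_def algebra_simps)
    have 2: "(\<Sum>i\<in>UNIV. ?y $ i * rot ?y $ i) = ?y \<bullet> rot ?y" unfolding inner_vec_def by simp
    show ?thesis
      unfolding 1 sum.distrib scaleR_sum_right[symmetric] scaleR_sum_left[symmetric] sum_distrib_left[symmetric] 2 by (rule refl)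
  qed
  also have "\<dots> = g (?y \<bullet> ?y) *\<^sub>R rot (rot ?y)"
    unfolding rot_components[of "rot ?y", symmetric] inner_rot by simp
  finally have *: "(\<Sum>i\<in>UNIV. (rot ?y $ i) *\<^sub>R swirl_partial i g g' ?y) = g (?y \<bullet> ?y) *\<^sub>R rot (rot ?y)" .
  have "self_adv (\<lambda>x. c *\<^sub>R scaled_swirl g p e x) x
     = (\<Sum>i\<in>UNIV. (c\<^sup>2 / e * g (?y \<bullet> ?y)) *\<^sub>R ((rot ?y $ i) *\<^sub>R swirl_partial i g g' ?y))"
    unfolding self_adv_def scaled_swirl_partial[OF g]
    by (rule sum.cong) (simp_all add: scaled_swirl_def swirl_def power2_eq_square ac_simps)
  also have "\<dots> = (c\<^sup>2 / e) *\<^sub>R ((g (?y \<bullet> ?y))\<^sup>2 *\<^sub>R rot (rot ?y))"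
    unfolding scaleR_sum_right[symmetric] * by (simp add: power2_eq_square)
  finally show ?thesis .
qed

lemma smooth_scaled_swirl:
  assumes g: "smooth g" and P: "smooth P" 
  shows "smooth (\<lambda>z. scaled_swirl g p e (P z))"
proof -
  have y: "smooth (\<lambda>z. (1 / e) *\<^sub>R (P z - p))" by (intro smooth_scaleR smooth_const smooth_diff P)
  show ?thesis unfolding scaled_swirl_def swirl_def
    by (intro smooth_scaleR smooth_compose_real[OF g] smooth_inner smooth_bounded_linear[OF bounded_linear_rot] y)
qed

lemma compose_bounded_01:
  fixes g :: "real \<Rightarrow> real"
  assumes "continuous_on UNIV g" "\<And>s. 1 \<le> s \<Longrightarrow> g s = 0"
  shows "\<exists>C\<ge>0. \<forall>s\<ge>0. \<bar>g s\<bar> \<le> C"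
proof -
  have "compact (g ` {0..1})"
    by (intro compact_continuous_image continuous_on_subset[OF assms(1)]) auto
  then obtain C where C: "C > 0" "\<forall>y\<in>g ` {0..1}. norm y \<le> C"
    using bounded_pos compact_imp_bounded by blast
  have "\<bar>g s\<bar> \<le> C" if "s \<ge> 0" for s
  proof (cases "s \<le> 1")
    case True then show ?thesis using C(2) that by auto
  next
    case False then show ?thesis using C(1) assms(2)[of s] by simp
  qed
  then show ?thesis using C(1) by (intro exI[of _ C]) auto
qed

section \<open>Cascades of disjointly supported fields\<close>

text \<open>Disjointness concerns the balls in space; the time windows may overlap.
  \<open>t0\<close> keeps all windows away from time 0, so that the initial value is 0. The value
  1/4 for \<delta> is a round number that settles the comparisons of exponents below.\<close>

locale cascade =
  fixes p :: "nat \<Rightarrow> space" and \<tau> \<epsilon> :: "nat \<Rightarrow> real" and \<delta> t0 :: real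
  assumes eps: "0 < \<epsilon> k" "\<epsilon> k \<le> 1"
    and eps_summable: "0 < e \<Longrightarrow> summable (\<lambda>k. \<epsilon> k powr e)"
    and balls_disjoint: "k \<noteq> l \<Longrightarrow> cball (p k) (\<epsilon> k) \<inter> cball (p l) (\<epsilon> l) = {}"
    and delta: "0 < \<delta>" "\<delta> \<le> 1/4"
    and t0: "0 < t0" "t0 \<le> \<tau> k - (\<epsilon> k)\<^sup>2"
    and finitely_many_active: "AE t in lborel. \<exists>n. \<forall>k\<ge>n. t \<notin> cball (\<tau> k) ((\<epsilon> k)\<^sup>2)"
begin

definition blob :: "nat \<Rightarrow> space set" where "blob k = cball (p k) (\<epsilon> k)"
definition win :: "nat \<Rightarrow> real set" where "win k = cball (\<tau> k) ((\<epsilon> k)\<^sup>2)"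
text \<open>At such a time the solution is a finite partial sum, hence smooth in space with compact
  support.\<close>

definition good :: "real \<Rightarrow> bool" where "good t \<longleftrightarrow> (\<exists>n. \<forall>k\<ge>n. t \<notin> win k)"

lemma AE_good: "AE t in lborel. good t"
  using finitely_many_active by (simp add: good_def win_def)

definition localized :: "(nat \<Rightarrow> space \<times> real \<Rightarrow> 'b::real_normed_vector) \<Rightarrow> bool" where
  "localized U \<longleftrightarrow> (\<forall>k x t. x \<notin> blob k \<or> t \<notin> win k \<longrightarrow> U k (x, t) = 0)"

definition dominated :: "real \<Rightarrow> (nat \<Rightarrow> space \<times> real \<Rightarrow> 'b::real_normed_vector) \<Rightarrow> bool" where
  "dominated d U \<longleftrightarrow> (\<exists>C\<ge>0. \<forall>k z. norm (U k z) \<le> C * \<epsilon> k powr (- d))"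

definition part :: "nat \<Rightarrow> (nat \<Rightarrow> space \<times> real \<Rightarrow> 'b::real_normed_vector) \<Rightarrow> space \<times> real \<Rightarrow> 'b" where
  "part n U z = (\<Sum>k<n. U k z)"

text \<open>For localized U at most one term is nonzero at each point, so the series is a selection
  and its convergence is no issue.\<close>

definition glue :: "(nat \<Rightarrow> space \<times> real \<Rightarrow> 'b::real_normed_vector) \<Rightarrow> space \<times> real \<Rightarrow> 'b" where
  "glue U z = (\<Sum>k. U k z)"

lemma blob_unique: "x \<in> blob k \<Longrightarrow> x \<in> blob l \<Longrightarrow> k = l"
  using balls_disjoint[of k l] by (cases "k = l") (auto simp: blob_def disjoint_iff)

lemma localized_other: "localized U \<Longrightarrow> x \<in> blob k \<Longrightarrow> l \<noteq> k \<Longrightarrow> U l (x, t) = 0"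
  using blob_unique unfolding localized_def by metis

lemma glue_in: assumes "localized U" "x \<in> blob k" shows "glue U (x, t) = U k (x, t)"
proof -
  have "(\<Sum>l. U l (x, t)) = (\<Sum>l\<in>{k}. U l (x, t))"
    by (rule suminf_finite) (use localized_other[OF assms] in auto)
  then show ?thesis by (simp add: glue_def)
qed

lemma glue_out: assumes "localized U" "\<And>k. x \<notin> blob k" shows "glue U (x, t) = 0"
  using assms unfolding glue_def localized_def by simp

lemma part_in: assumes "localized U" "x \<in> blob k" shows "part n U (x, t) = (if k < n then U k (x, t) else 0)"
proof -
  have "(\<Sum>l<n. U l (x, t)) = (\<Sum>l<n. if l = k then U k (x, t) else 0)"
    by (rule sum.cong) (use localized_other[OF assms] in auto)
  then show ?thesis by (simp add: part_def sum.delta)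
qed

lemma part_out: assumes "localized U" "\<And>k. x \<notin> blob k" shows "part n U (x, t) = 0"
  using assms unfolding part_def localized_def by simp

lemma glue_part:
  assumes U: "localized U" and n: "\<And>k. k \<ge> n \<Longrightarrow> t \<notin> win k" and "m \<ge> n"
  shows "glue U (x, t) = part m U (x, t)"
proof (cases "\<exists>k. x \<in> blob k")
  case True
  then obtain k where k: "x \<in> blob k" by blast
  have "U k (x, t) = 0" if "\<not> k < m" using n[of k] U that \<open>m \<ge> n\<close> by (auto simp: localized_def)
  then show ?thesis by (simp add: glue_in[OF U k] part_in[OF U k])
next
  case False
  then show ?thesis using glue_out[OF U] part_out[OF U] by simp
qed

lemma glue_eventually_part: "localized U \<Longrightarrow> eventually (\<lambda>n. part n U (x, t) = glue U (x, t)) sequentially"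
proof (cases "\<exists>k. x \<in> blob k")
  case True
  assume U: "localized U"
  from True obtain k where k: "x \<in> blob k" by blast
  show ?thesis using eventually_gt_at_top[of k]
    by eventually_elim (simp add: glue_in[OF U k] part_in[OF U k])
next
  case False
  assume U: "localized U"
  show ?thesis using False glue_out[OF U] part_out[OF U] by simp
qed

lemma part_borel:
  fixes U :: "nat \<Rightarrow> space \<times> real \<Rightarrow> 'b::{second_countable_topology, real_normed_vector}"
  shows "(\<And>k. U k \<in> borel_measurable borel) \<Longrightarrow> part n U \<in> borel_measurable borel"
  unfolding part_def[abs_def] by (rule borel_measurable_sum)

lemma glue_borel:
  fixes U :: "nat \<Rightarrow> space \<times> real \<Rightarrow> 'b::{second_countable_topology, real_normed_vector}"
  assumes "localized U" "\<And>k. U k \<in> borel_measurable borel" shows "glue U \<in> borel_measurable borel"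
proof (rule borel_measurable_LIMSEQ_metric)
  show "part n U \<in> borel_measurable borel" for n by (rule part_borel[OF assms(2)])
  show "(\<lambda>n. part n U z) \<longlonglongrightarrow> glue U z" for z
    using glue_eventually_part[OF assms(1), of "fst z" "snd z"] by (simp add: tendsto_eventually)
qed

text \<open>Only one index matters at a point, so even nonlinear pointwise operations commute with
  gluing, provided that they map zeros to zero.\<close>

lemma glue_pointwise:
  assumes U: "localized U" and W: "localized W" and Z: "localized Z"
    and eq: "\<And>k. Z k (x, t) = g (U k (x, t)) (W k (x, t))" and g0: "g 0 0 = 0"
  shows "glue Z (x, t) = g (glue U (x, t)) (glue W (x, t))" "part n Z (x, t) = g (part n U (x, t)) (part n W (x, t))"
proof -
  show "glue Z (x, t) = g (glue U (x, t)) (glue W (x, t))"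
  proof (cases "\<exists>k. x \<in> blob k")
    case True
    then obtain k where k: "x \<in> blob k" by blast
    show ?thesis by (simp add: glue_in[OF U k] glue_in[OF W k] glue_in[OF Z k] eq)
  next
    case False then show ?thesis using glue_out[OF U] glue_out[OF W] glue_out[OF Z] g0 by simp
  qed
  show "part n Z (x, t) = g (part n U (x, t)) (part n W (x, t))"
  proof (cases "\<exists>k. x \<in> blob k")
    case True
    then obtain k where k: "x \<in> blob k" by blast
    show ?thesis by (simp add: part_in[OF U k] part_in[OF W k] part_in[OF Z k] eq g0)
  next
    case False then show ?thesis using part_out[OF U] part_out[OF W] part_out[OF Z] g0 by simp
  qed
qed

text \<open>The balls are disjoint, so this is a step function with the value eps_k^(-e) on ball k,
  and powers act on e alone.\<close>

definition alpha :: "real \<Rightarrow> space \<Rightarrow> real" where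
  "alpha e x = (\<Sum>k. \<epsilon> k powr (- e) * indicator (blob k) x)"

text \<open>Windows overlap, so this is a true sum. It may diverge at times that are not good, where
  \<open>suminf\<close> is unspecified; the absolute value keeps \<open>beta\<close> nonnegative
  everywhere.\<close>

definition beta :: "real \<Rightarrow> real \<Rightarrow> real" where
  "beta e t = \<bar>\<Sum>k. \<epsilon> k powr (- e) * indicator (win k) t\<bar>"

lemma alpha_in: "x \<in> blob k \<Longrightarrow> alpha e x = \<epsilon> k powr (- e)"
proof -
  assume k: "x \<in> blob k"
  have "alpha e x = (\<Sum>l\<in>{k}. \<epsilon> l powr (- e) * indicator (blob l) x)"
    unfolding alpha_def by (rule suminf_finite) (use blob_unique[OF k] in \<open>auto simp: indicator_def\<close>)
  then show ?thesis using k by simp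
qed

lemma alpha_out: "(\<And>k. x \<notin> blob k) \<Longrightarrow> alpha e x = 0"
  by (simp add: alpha_def)

lemma alpha_nonneg: "0 \<le> alpha e x"
proof (cases "\<exists>k. x \<in> blob k")
  case True
  then obtain k where "x \<in> blob k" by blast
  then show ?thesis by (simp add: alpha_in)
next
  case False
  then show ?thesis by (simp add: alpha_out)
qed

lemma alpha_powr: assumes "q \<noteq> 0" shows "alpha e x powr q = alpha (e * q) x"
proof (cases "\<exists>k. x \<in> blob k")
  case True
  then obtain k where "x \<in> blob k" by blast
  then show ?thesis by (simp add: alpha_in powr_powr)
next
  case False
  then show ?thesis using assms by (simp add: alpha_out)
qed

lemma summable_eps_mult: "0 < e \<Longrightarrow> summable (\<lambda>k. c * \<epsilon> k powr e)"
  by (rule summable_mult[OF eps_summable])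

text \<open>The volume of ball k is a multiple of eps_k^3, which leaves the series of eps_k^(3 -
  e).\<close>

lemma alpha_integrable: assumes "e < 3" shows "integrable lborel (alpha e)"
  unfolding alpha_def[abs_def]
proof (rule integrable_suminf)
  have int: "integrable lborel (\<lambda>x. \<epsilon> k powr (- e) * indicator (blob k) x)" for k
    unfolding blob_def by (intro integrable_mult_right integrable_real_indicator) (simp_all add: emeasure_bounded_finite[OF bounded_cball, simplified])
  show "integrable lborel (\<lambda>x. \<epsilon> k powr (- e) * indicator (blob k) x)" for k by (rule int)
  have sums: "summable (\<lambda>k. \<epsilon> k powr (- e) * indicator (blob k) x)" for x
  proof (rule summable_finite)
    show "finite {k. x \<in> blob k}"
    proof (cases "\<exists>k. x \<in> blob k")
      case True
      then obtain k where "x \<in> blob k" by blast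
      then have "{k. x \<in> blob k} \<subseteq> {k}" using blob_unique by auto
      then show ?thesis by (rule finite_subset) simp
    qed simp
  qed simp
  show "AE x in lborel. summable (\<lambda>k. norm (\<epsilon> k powr (- e) * indicator (blob k) x))"
    using sums by (simp add: abs_mult)
  have m: "measure lborel (blob k) = unit_ball_vol 3 * \<epsilon> k ^ 3" for k
    using content_cball[of "\<epsilon> k" "p k"] eps(1)[of k] by (simp add: blob_def)
  have "(\<integral>x. norm (\<epsilon> k powr (- e) * indicator (blob k) x) \<partial>lborel) = unit_ball_vol 3 * \<epsilon> k powr (3 - e)" for k
  proof -
    have "(\<integral>x. norm (\<epsilon> k powr (- e) * indicator (blob k) x) \<partial>lborel) = \<epsilon> k powr (- e) * measure lborel (blob k)"
      by (simp add: abs_mult)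
    also have "\<dots> = unit_ball_vol 3 * (\<epsilon> k powr (- e) * \<epsilon> k powr 3)"
      using eps(1)[of k] by (simp add: m powr_realpow)
    finally show ?thesis by (simp add: powr_add[symmetric])
  qed
  then show "summable (\<lambda>k. \<integral>x. norm (\<epsilon> k powr (- e) * indicator (blob k) x) \<partial>lborel)"
    using summable_eps_mult[of "3 - e" "unit_ball_vol 3"] assms by simp
qed

lemma good_summable: "good t \<Longrightarrow> summable (\<lambda>k. c k * indicator (win k) t :: real)"
proof -
  assume "good t"
  then obtain n where n: "\<And>k. k \<ge> n \<Longrightarrow> t \<notin> win k" by (auto simp: good_def)
  show ?thesis by (rule summable_finite[of "{..<n}"]) (use n in \<open>auto simp: indicator_def not_less\<close>)
qed

lemma beta_nonneg: "0 \<le> beta e t"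
  by (simp add: beta_def)

lemma beta_ge: assumes "good t" "t \<in> win k" shows "\<epsilon> k powr (- e) \<le> beta e t"
proof -
  have "(\<Sum>l\<in>{k}. \<epsilon> l powr (- e) * indicator (win l) t) \<le> (\<Sum>l. \<epsilon> l powr (- e) * indicator (win l) t)"
    by (rule sum_le_suminf[OF good_summable[OF assms(1)]]) simp_all
  also have "\<dots> \<le> beta e t" by (simp add: beta_def)
  finally show ?thesis using assms(2) by simp
qed

lemma beta_borel: "beta e \<in> borel_measurable borel"
  unfolding beta_def[abs_def] win_def
  by (intro borel_measurable_abs borel_measurable_suminf borel_measurable_times borel_measurable_const
      borel_measurable_indicator borel_closed closed_cball)

text \<open>Window k has length 2 eps_k^2, which leaves the series of eps_k^(2 - e). Convergence of
  the defining sum is known at good times, that is, almost everywhere.\<close>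

lemma beta_integrable: assumes "e < 2" shows "integrable lborel (beta e)"
  unfolding beta_def[abs_def]
proof (rule integrable_abs, rule integrable_suminf)
  show "integrable lborel (\<lambda>x. \<epsilon> k powr (- e) * indicator (win k) x)" for k
    unfolding win_def by (intro integrable_mult_right integrable_real_indicator) (simp_all add: emeasure_bounded_finite[OF bounded_cball, simplified])
  show "AE x in lborel. summable (\<lambda>k. norm (\<epsilon> k powr (- e) * indicator (win k) x))"
    using AE_good by eventually_elim (use good_summable in \<open>simp add: abs_mult\<close>)
  have "(\<integral>x. norm (\<epsilon> k powr (- e) * indicator (win k) x) \<partial>lborel) = 2 * \<epsilon> k powr (2 - e)" for k
  proof -
    have "(\<integral>x. norm (\<epsilon> k powr (- e) * indicator (win k) x) \<partial>lborel) = \<epsilon> k powr (- e) * measure lborel (win k)"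
      by (simp add: abs_mult)
    also have "\<dots> = 2 * (\<epsilon> k powr (- e) * \<epsilon> k powr 2)"
      using eps(1)[of k] by (simp add: win_def cball_eq_atLeastAtMost powr_realpow)
    finally show ?thesis by (simp add: powr_add[symmetric])
  qed
  then show "summable (\<lambda>k. \<integral>x. norm (\<epsilon> k powr (- e) * indicator (win k) x) \<partial>lborel)"
    using summable_eps_mult[of "2 - e" 2] assms by simp
qed

lemma alpha_borel: "alpha e \<in> borel_measurable borel"
  unfolding alpha_def[abs_def] blob_def
  by (intro borel_measurable_suminf borel_measurable_times borel_measurable_const
      borel_measurable_indicator borel_closed closed_cball)

lemma dominating_pair:
  assumes rq: "0 < r" "0 < q" and d: "d < 2 / r + 3 / q"
  obtains \<alpha> :: "space \<Rightarrow> real" and \<beta> :: "real \<Rightarrow> real" where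
    "\<alpha> \<in> borel_measurable borel" "\<And>x. 0 \<le> \<alpha> x" "integrable lborel (\<lambda>x. \<alpha> x powr q)"
    "\<beta> \<in> borel_measurable borel" "\<And>t. 0 \<le> \<beta> t" "integrable lborel (\<lambda>t. \<beta> t powr r)"
    "\<And>x t k. good t \<Longrightarrow> x \<in> blob k \<Longrightarrow> t \<in> win k \<Longrightarrow> \<epsilon> k powr (- d) \<le> \<alpha> x * \<beta> t"
proof -
  let ?s = "2 / r + 3 / q"
  \<comment> \<open>The order d is shared between space and time in the proportion 3/q to 2/r. Then
    a q and b r are the same fraction d/(2/r + 3/q) < 1 of the thresholds 3 and 2.\<close>
  define a where "a = d * (3 / q) / ?s"
  define b where "b = d * (2 / r) / ?s"
  have s: "?s > 0" using rq by (simp add: add_pos_pos)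
  have "a + b = d * ?s / ?s" unfolding a_def b_def
    by (simp only: add_divide_distrib[symmetric] distrib_left[symmetric] add.commute)
  then have ab: "a + b = d" using s by simp
  have ds: "d / ?s < 1" using d s by (simp add: divide_less_eq)
  have "a * q = 3 * (d / ?s)" "b * r = 2 * (d / ?s)" unfolding a_def b_def using rq by simp_all
  then have aq: "a * q < 3" and br: "b * r < 2" using ds by linarith+
  show thesis
  \<comment> \<open>The power of a sum over overlapping windows is not the sum of the powers: the
    sum is formed with the exponent b r, and the root of order r is taken afterwards.\<close>
  proof (rule that[of "alpha a" "\<lambda>t. beta (b * r) t powr (1 / r)"])
    show "integrable lborel (\<lambda>x. alpha a x powr q)" using alpha_integrable[OF aq] rq by (simp add: alpha_powr)
    show "integrable lborel (\<lambda>t. (beta (b * r) t powr (1 / r)) powr r)"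
      using beta_integrable[OF br] rq beta_nonneg by (simp add: powr_powr)
    show "\<epsilon> k powr (- d) \<le> alpha a x * beta (b * r) t powr (1 / r)" if "good t" "x \<in> blob k" "t \<in> win k" for x t k
    proof -
      have "\<epsilon> k powr (- d) = \<epsilon> k powr (- a) * (\<epsilon> k powr (- (b * r))) powr (1 / r)"
        using rq by (simp add: ab[symmetric] powr_powr powr_add[symmetric])
      also have "\<dots> \<le> alpha a x * beta (b * r) t powr (1 / r)"
        unfolding alpha_in[OF that(2)] using beta_ge[OF that(1,3)] rq by (intro mult_left_mono powr_mono2) auto
      finally show ?thesis .
    qed
  qed (use alpha_borel alpha_nonneg beta_borel in auto)
qed

lemma localized_bound:
  assumes U: "localized U" "\<And>k. norm (U k (x, t)) \<le> C * \<epsilon> k powr (- d)" "0 \<le> C"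
    and b: "\<And>k. x \<in> blob k \<Longrightarrow> t \<in> win k \<Longrightarrow> \<epsilon> k powr (- d) \<le> b" and "0 \<le> b"
  shows "norm (U k (x, t)) \<le> C * b" "norm (glue U (x, t)) \<le> C * b" "norm (part n U (x, t)) \<le> C * b"
proof -
  show *: "norm (U k (x, t)) \<le> C * b" for k
  proof (cases "x \<in> blob k \<and> t \<in> win k")
    case True
    then show ?thesis using U(2)[of k] mult_left_mono[OF b[of k] U(3)] by simp
  next
    case False
    then have "U k (x, t) = 0" using U(1) by (auto simp: localized_def)
    then show ?thesis using U(3) \<open>0 \<le> b\<close> by simp
  qed
  show "norm (glue U (x, t)) \<le> C * b"
    using * glue_in[OF U(1), of x _ t] glue_out[OF U(1), of x t] U(3) \<open>0 \<le> b\<close> by (cases "\<exists>k. x \<in> blob k") auto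
  show "norm (part n U (x, t)) \<le> C * b"
    using * part_in[OF U(1), of x _ n t] part_out[OF U(1), of x n t] U(3) \<open>0 \<le> b\<close> by (cases "\<exists>k. x \<in> blob k") auto
qed

text \<open>One pair dominates the limit together with all partial sums, as dominated convergence in
  n demands.\<close>

lemma product_bound:
  fixes U :: "nat \<Rightarrow> space \<times> real \<Rightarrow> 'b::real_normed_vector"
  assumes U: "localized U" "dominated d U" and rq: "0 < r" "0 < q" and d: "d < 2 / r + 3 / q"
  obtains \<alpha> :: "space \<Rightarrow> real" and \<beta> :: "real \<Rightarrow> real" where
    "\<alpha> \<in> borel_measurable borel" "\<And>x. 0 \<le> \<alpha> x" "integrable lborel (\<lambda>x. \<alpha> x powr q)"
    "\<beta> \<in> borel_measurable borel" "\<And>t. 0 \<le> \<beta> t" "integrable lborel (\<lambda>t. \<beta> t powr r)"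
    "\<And>x t. good t \<Longrightarrow> norm (glue U (x, t)) \<le> \<alpha> x * \<beta> t"
    "\<And>x t n. good t \<Longrightarrow> norm (part n U (x, t)) \<le> \<alpha> x * \<beta> t"
proof -
  obtain C where C: "C \<ge> 0" "\<And>k z. norm (U k z) \<le> C * \<epsilon> k powr (- d)" using U(2) by (auto simp: dominated_def)
  obtain \<alpha> :: "space \<Rightarrow> real" and \<beta> where ab: 
    "\<alpha> \<in> borel_measurable borel" "\<And>x. 0 \<le> \<alpha> x" "integrable lborel (\<lambda>x. \<alpha> x powr q)"
    "\<beta> \<in> borel_measurable borel" "\<And>t. 0 \<le> \<beta> t" "integrable lborel (\<lambda>t. \<beta> t powr r)"
    "\<And>x t k. good t \<Longrightarrow> x \<in> blob k \<Longrightarrow> t \<in> win k \<Longrightarrow> \<epsilon> k powr (- d) \<le> \<alpha> x * \<beta> t"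
    by (rule dominating_pair[OF rq d], rule that)
  have nn: "0 \<le> \<alpha> x * \<beta> t" for x t using ab(2,5) by simp
  have b: "norm (glue U (x, t)) \<le> C * (\<alpha> x * \<beta> t)" "norm (part n U (x, t)) \<le> C * (\<alpha> x * \<beta> t)" if "good t" for x t n
    by (rule localized_bound[OF U(1) C(2) C(1) ab(7)[OF that] nn], assumption+)+
  show thesis
  proof (rule that[of "\<lambda>x. C * \<alpha> x" \<beta>])
    show "(\<lambda>x. C * \<alpha> x) \<in> borel_measurable borel" using ab(1) by simp
    show "0 \<le> C * \<alpha> x" for x using C(1) ab(2) by simp
    show "integrable lborel (\<lambda>x. (C * \<alpha> x) powr q)" using ab(2,3) C(1) by (simp add: powr_mult)
    show "norm (glue U (x, t)) \<le> C * \<alpha> x * \<beta> t" if "good t" for x t using b(1)[OF that] by (simp add: mult.assoc)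
    show "norm (part n U (x, t)) \<le> C * \<alpha> x * \<beta> t" if "good t" for x t n using b(2)[OF that] by (simp add: mult.assoc)
  qed (rule ab)+
qed

lemma glue_LrLq:
  fixes U :: "nat \<Rightarrow> space \<times> real \<Rightarrow> 'b::{banach, second_countable_topology}"
  assumes U: "localized U" "dominated d U" "\<And>k. U k \<in> borel_measurable borel"
    and rq: "0 < r" "0 < q" and d: "d < 2 / r + 3 / q"
  shows "glue U \<in> LrLq (ennreal r) (ennreal q) S"
proof -
  obtain \<alpha> :: "space \<Rightarrow> real" and \<beta> where ab: 
    "\<alpha> \<in> borel_measurable borel" "\<And>x. 0 \<le> \<alpha> x" "integrable lborel (\<lambda>x. \<alpha> x powr q)"
    "\<beta> \<in> borel_measurable borel" "\<And>t. 0 \<le> \<beta> t" "integrable lborel (\<lambda>t. \<beta> t powr r)"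
    "\<And>x t. good t \<Longrightarrow> norm (glue U (x, t)) \<le> \<alpha> x * \<beta> t"
    "\<And>x t n. good t \<Longrightarrow> norm (part n U (x, t)) \<le> \<alpha> x * \<beta> t"
    by (rule product_bound[OF U(1,2) rq d], rule that)
  have "AE t in lborel. \<forall>x. norm (glue U (x, t)) \<le> \<alpha> x * \<beta> t"
    using AE_good by eventually_elim (use ab(7) in auto)
  then show ?thesis
    by (rule LrLq_dominated[OF glue_borel[OF U(1,3)] _ ab(1-6) rq])
qed

lemma glue_integrable:
  fixes U :: "nat \<Rightarrow> space \<times> real \<Rightarrow> 'b::{banach, second_countable_topology}"
  assumes U: "localized U" "dominated d U" "\<And>k. U k \<in> borel_measurable borel" and d: "d < 5"
  shows "integrable lborel (glue U)" "integrable lborel (part n U)"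
proof -
  have d': "d < 2 / 1 + 3 / (1::real)" using d by simp
  obtain \<alpha> :: "space \<Rightarrow> real" and \<beta> where ab: 
    "\<alpha> \<in> borel_measurable borel" "\<And>x. 0 \<le> \<alpha> x" "integrable lborel (\<lambda>x. \<alpha> x powr 1)"
    "\<beta> \<in> borel_measurable borel" "\<And>t. 0 \<le> \<beta> t" "integrable lborel (\<lambda>t. \<beta> t powr 1)"
    "\<And>x t. good t \<Longrightarrow> norm (glue U (x, t)) \<le> \<alpha> x * \<beta> t"
    "\<And>x t n. good t \<Longrightarrow> norm (part n U (x, t)) \<le> \<alpha> x * \<beta> t"
    by (rule product_bound[OF U(1,2) zero_less_one zero_less_one d'], rule that)
  have i: "integrable lborel \<alpha>" "integrable lborel \<beta>" using ab(2,3,5,6) by simp_all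
  have 1: "AE t in lborel. \<forall>x. norm (glue U (x, t)) \<le> \<alpha> x * \<beta> t"
    using AE_good by eventually_elim (use ab(7) in auto)
  have 2: "AE t in lborel. \<forall>x. norm (part n U (x, t)) \<le> \<alpha> x * \<beta> t"
    using AE_good by eventually_elim (use ab(8) in auto)
  show "integrable lborel (glue U)"
    by (rule integrable_dominated[OF glue_borel[OF U(1,3)] 1 i(1) ab(2) i(2) ab(5)])
  show "integrable lborel (part n U)"
    by (rule integrable_dominated[OF part_borel[OF U(3)] 2 i(1) ab(2) i(2) ab(5)])
qed

lemma localized_add: "localized U \<Longrightarrow> localized W \<Longrightarrow> localized (\<lambda>k z. U k z + W k z)"
  and localized_diff: "localized U \<Longrightarrow> localized W \<Longrightarrow> localized (\<lambda>k z. U k z - W k z)"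
  and localized_inner: "localized U' \<Longrightarrow> localized (\<lambda>k z. U' k z \<bullet> W' k z)"
  unfolding localized_def by simp_all

lemma dominated_mono:
  assumes "dominated d U" "d \<le> d'" shows "dominated d' U"
proof -
  obtain C where C: "C \<ge> 0" "\<And>k z. norm (U k z) \<le> C * \<epsilon> k powr (- d)" using assms by (auto simp: dominated_def)
  have "norm (U k z) \<le> C * \<epsilon> k powr (- d')" for k z
  proof -
    have "\<epsilon> k powr (- d) \<le> \<epsilon> k powr (- d')" using assms(2) eps[of k] by (intro powr_mono') auto
    from mult_left_mono[OF this C(1)] C(2)[of k z] show ?thesis by linarith
  qed
  then show ?thesis using C(1) unfolding dominated_def by (intro exI[of _ C]) simp
qed

lemma dominated_add: assumes "dominated d U" "dominated d W" shows "dominated d (\<lambda>k z. U k z + W k z)"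
proof -
  obtain C where C: "C \<ge> 0" "\<And>k z. norm (U k z) \<le> C * \<epsilon> k powr (- d)" using assms(1) by (auto simp: dominated_def)
  obtain C' where C': "C' \<ge> 0" "\<And>k z. norm (W k z) \<le> C' * \<epsilon> k powr (- d)" using assms(2) by (auto simp: dominated_def)
  have "norm (U k z + W k z) \<le> (C + C') * \<epsilon> k powr (- d)" for k z
    using norm_triangle_le[OF add_mono[OF C(2)[of k z] C'(2)[of k z]]] by (simp add: distrib_right)
  then show ?thesis using C(1) C'(1) unfolding dominated_def by (intro exI[of _ "C + C'"]) auto
qed

lemma dominated_diff: assumes "dominated d U" "dominated d W" shows "dominated d (\<lambda>k z. U k z - W k z)"
proof -
  have "dominated d (\<lambda>k z. - W k z)" using assms(2) by (simp add: dominated_def)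
  from dominated_add[OF assms(1) this] show ?thesis by simp
qed

lemma dominated_inner: assumes "dominated d U" "dominated d' W" shows "dominated (d + d') (\<lambda>k z. U k z \<bullet> W k z)"
proof -
  obtain C where C: "C \<ge> 0" "\<And>k z. norm (U k z) \<le> C * \<epsilon> k powr (- d)" using assms(1) by (auto simp: dominated_def)
  obtain C' where C': "C' \<ge> 0" "\<And>k z. norm (W k z) \<le> C' * \<epsilon> k powr (- d')" using assms(2) by (auto simp: dominated_def)
  have "norm (U k z \<bullet> W k z) \<le> (C * C') * \<epsilon> k powr (- (d + d'))" for k z
  proof -
    have "norm (U k z \<bullet> W k z) \<le> norm (U k z) * norm (W k z)" by (simp add: Cauchy_Schwarz_ineq2)
    also have "\<dots> \<le> (C * \<epsilon> k powr (- d)) * (C' * \<epsilon> k powr (- d'))"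
      using C(1) by (intro mult_mono C(2) C'(2)) auto
    also have "\<dots> = (C * C') * \<epsilon> k powr (- (d + d'))" by (simp add: powr_add[symmetric])
    finally show ?thesis .
  qed
  then show ?thesis using C(1) C'(1) unfolding dominated_def by (intro exI[of _ "C * C'"]) auto
qed

end

section \<open>Derivatives and sizes of the swirls in a cascade\<close>

definition lap_cutoff :: "real \<Rightarrow> real" where "lap_cutoff s = 4 * s * cutoff'' s + 10 * cutoff' s"

lemma smooth_ident: "smooth (\<lambda>s::real. s)"
  by (rule smooth_linear[OF bounded_linear_ident])

lemma smooth_lap_cutoff: "smooth lap_cutoff"
  unfolding lap_cutoff_def[abs_def]
  by (intro smooth_add smooth_mult smooth_const smooth_ident smooth_cutoff' smooth_cutoff'')

lemma lap_cutoff_eq_0: "1 \<le> s \<Longrightarrow> lap_cutoff s = 0"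
  by (simp add: lap_cutoff_def cutoff_eq_0)

lemma norm_swirl_le:
  assumes G: "\<And>s. 0 \<le> s \<Longrightarrow> \<bar>g s\<bar> \<le> G" "\<And>s. 1 \<le> s \<Longrightarrow> g s = 0"
  shows "norm (swirl g y) \<le> G" "1 \<le> y \<bullet> y \<Longrightarrow> swirl g y = 0"
proof -
  show 0: "swirl g y = 0" if "1 \<le> y \<bullet> y" using G(2)[OF that] by (simp add: swirl_def)
  have G0: "0 \<le> G" using G(1)[of 0] by simp
  show "norm (swirl g y) \<le> G"
  proof (cases "1 \<le> y \<bullet> y")
    case True then show ?thesis using 0 G0 by simp
  next
    case False
    then have "norm y \<le> 1" by (simp add: norm_le_square)
    then have "norm (rot y) \<le> 1" using norm_rot[of y] by linarith
    then have "\<bar>g (y \<bullet> y)\<bar> * norm (rot y) \<le> G * 1" using G(1)[of "y \<bullet> y"] G0 by (intro mult_mono) auto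
    then show ?thesis by (simp add: swirl_def)
  qed
qed

lemma norm_swirl_partial_le:
  assumes G: "\<And>s. 0 \<le> s \<Longrightarrow> \<bar>g s\<bar> \<le> G" "\<And>s. 1 \<le> s \<Longrightarrow> g s = 0"
    and G': "\<And>s. 0 \<le> s \<Longrightarrow> \<bar>g' s\<bar> \<le> G'" "\<And>s. 1 \<le> s \<Longrightarrow> g' s = 0"
  shows "norm (swirl_partial i g g' y) \<le> G + 2 * G'" "1 \<le> y \<bullet> y \<Longrightarrow> swirl_partial i g g' y = 0"
proof -
  show 0: "swirl_partial i g g' y = 0" if "1 \<le> y \<bullet> y" using G(2)[OF that] G'(2)[OF that] by (simp add: swirl_partial_def)
  have G0: "0 \<le> G" "0 \<le> G'" using G(1)[of 0] G'(1)[of 0] by simp_all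
  show "norm (swirl_partial i g g' y) \<le> G + 2 * G'"
  proof (cases "1 \<le> y \<bullet> y")
    case True then show ?thesis using 0 G0 by simp
  next
    case False
    then have y: "norm y \<le> 1" by (simp add: norm_le_square)
    have "norm (rot (axis i 1)) \<le> 1" using norm_rot[of "axis i 1"] by simp
    then have 1: "\<bar>g (y \<bullet> y)\<bar> * norm (rot (axis i 1)) \<le> G * 1" using G(1)[of "y \<bullet> y"] G0 by (intro mult_mono) auto
    have "norm (rot y) \<le> 1" using norm_rot[of y] y by linarith
    moreover have "\<bar>y $ i\<bar> \<le> 1" using component_le_norm_cart[of y i] y by linarith
    ultimately have "\<bar>2 * g' (y \<bullet> y) * (y $ i)\<bar> * norm (rot y) \<le> (2 * G' * 1) * 1"
      unfolding abs_mult using G'(1)[of "y \<bullet> y"] G0 by (intro mult_mono) auto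
    then show ?thesis
      unfolding swirl_partial_def using 1 by (intro norm_triangle_le) simp
  qed
qed

lemma partial_sum:
  assumes "finite A" "\<And>k. k \<in> A \<Longrightarrow> u k differentiable (at x)"
  shows "partial i (\<lambda>x. \<Sum>k\<in>A. u k x) x = (\<Sum>k\<in>A. partial i (u k) x)"
  unfolding partial_def
  by (rule dir_derivI, rule has_derivative_sum, rule has_derivative_dir_deriv, rule assms(2))

context cascade
begin

definition amp :: "nat \<Rightarrow> real" where "amp k = \<epsilon> k powr (- \<delta>)"
text \<open>Time in parabolic units: window k becomes the interval [-1, 1].\<close>

definition sc :: "nat \<Rightarrow> real \<Rightarrow> real" where "sc k t = (1 / (\<epsilon> k)\<^sup>2) * (t - \<tau> k)"
definition tp :: "nat \<Rightarrow> real \<Rightarrow> real" where "tp k t = cutoff (sc k t * sc k t)"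
definition tp' :: "nat \<Rightarrow> real \<Rightarrow> real" where "tp' k t = cutoff' (sc k t * sc k t) * (2 * sc k t) * (1 / (\<epsilon> k)\<^sup>2)"
definition yy :: "nat \<Rightarrow> space \<Rightarrow> space" where "yy k x = (1 / \<epsilon> k) *\<^sub>R (x - p k)"

definition B :: "nat \<Rightarrow> space \<times> real \<Rightarrow> space" where
  "B k z = (amp k * tp k (snd z)) *\<^sub>R scaled_swirl cutoff (p k) (\<epsilon> k) (fst z)"
text \<open>\<open>DB i\<close>, \<open>TB\<close>, \<open>LB\<close> and \<open>AB\<close> are the derivatives \<open>\<partial>\<^sub>i B\<close> and \<open>\<partial>\<^sub>t B\<close>, the Laplacian and \<open>(B \<bullet> \<nabla>) B\<close>.\<close>

definition DB :: "3 \<Rightarrow> nat \<Rightarrow> space \<times> real \<Rightarrow> space" where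
  "DB i k z = (amp k * tp k (snd z) / \<epsilon> k) *\<^sub>R swirl_partial i cutoff cutoff' (yy k (fst z))"
definition TB :: "nat \<Rightarrow> space \<times> real \<Rightarrow> space" where
  "TB k z = (amp k * tp' k (snd z)) *\<^sub>R scaled_swirl cutoff (p k) (\<epsilon> k) (fst z)"
definition LB :: "nat \<Rightarrow> space \<times> real \<Rightarrow> space" where
  "LB k z = (amp k * tp k (snd z) / (\<epsilon> k)\<^sup>2) *\<^sub>R scaled_swirl lap_cutoff (p k) (\<epsilon> k) (fst z)"
definition AB :: "nat \<Rightarrow> space \<times> real \<Rightarrow> space" where
  "AB k z = ((amp k * tp k (snd z))\<^sup>2 / \<epsilon> k) *\<^sub>R ((cutoff (yy k (fst z) \<bullet> yy k (fst z)))\<^sup>2 *\<^sub>R rot (rot (yy k (fst z))))"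
definition fB :: "nat \<Rightarrow> space \<times> real \<Rightarrow> space" where
  "fB k z = TB k z - LB k z + AB k z"

lemma win_iff: "t \<in> win k \<longleftrightarrow> \<bar>sc k t\<bar> \<le> 1"
proof -
  have "(\<epsilon> k)\<^sup>2 > 0" using eps(1)[of k] by simp
  then show ?thesis by (simp add: win_def sc_def dist_real_def abs_mult divide_le_eq abs_minus_commute)
qed

lemma sc_out: "t \<notin> win k \<Longrightarrow> 1 \<le> sc k t * sc k t"
proof -
  assume "t \<notin> win k"
  then have "1 \<le> \<bar>sc k t\<bar>" by (simp add: win_iff)
  then have "1 * 1 \<le> \<bar>sc k t\<bar> * \<bar>sc k t\<bar>" by (intro mult_mono) auto
  then show ?thesis by simp
qed

lemma yy_out: "x \<notin> blob k \<Longrightarrow> 1 \<le> yy k x \<bullet> yy k x"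
proof -
  assume "x \<notin> blob k"
  then have "\<epsilon> k < norm (x - p k)" by (simp add: blob_def dist_norm norm_minus_commute)
  then have "1 \<le> norm (yy k x)" using eps(1)[of k] by (simp add: yy_def divide_simps)
  then have "1 * 1 \<le> norm (yy k x) * norm (yy k x)" by (intro mult_mono) auto
  then show ?thesis by (simp add: norm_eq_sqrt_inner)
qed

lemma swirl_yy: "scaled_swirl g (p k) (\<epsilon> k) x = swirl g (yy k x)"
  by (simp add: scaled_swirl_def yy_def)

lemma tp_out: "t \<notin> win k \<Longrightarrow> tp k t = 0" "t \<notin> win k \<Longrightarrow> tp' k t = 0"
  using sc_out[of t k] by (simp_all add: tp_def tp'_def cutoff_eq_0)

lemma swirl_out: "x \<notin> blob k \<Longrightarrow> (\<And>s. 1 \<le> s \<Longrightarrow> g s = 0) \<Longrightarrow> scaled_swirl g (p k) (\<epsilon> k) x = 0"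
  using yy_out[of x k] by (simp add: swirl_yy swirl_def)

lemma localized_B: "localized B" "localized TB" "localized LB" "localized (DB i)" "localized AB"
proof -
  have 0: "scaled_swirl cutoff (p k) (\<epsilon> k) x = 0" "scaled_swirl lap_cutoff (p k) (\<epsilon> k) x = 0"
    "swirl_partial i cutoff cutoff' (yy k x) = 0" "cutoff (yy k x \<bullet> yy k x) = 0" if "x \<notin> blob k" for x k
    using swirl_out[OF that cutoff_eq_0(1)] swirl_out[OF that lap_cutoff_eq_0] yy_out[OF that]
    by (simp_all add: swirl_partial_def cutoff_eq_0)
  show "localized B" "localized TB" "localized LB" "localized (DB i)" "localized AB"
    unfolding localized_def B_def TB_def LB_def DB_def AB_def using 0 tp_out by auto
qed

lemma localized_fB: "localized fB"
  unfolding fB_def[abs_def] by (intro localized_add localized_diff localized_B)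

lemma tp_bounds: "0 \<le> tp k t" "tp k t \<le> 1"
  by (simp_all add: tp_def cutoff_bounds)

lemma cutoff_derivs_bounded: "\<exists>G\<ge>1. \<forall>s\<ge>0. \<bar>cutoff s\<bar> \<le> G \<and> \<bar>cutoff' s\<bar> \<le> G \<and> \<bar>lap_cutoff s\<bar> \<le> G"
proof -
  obtain a where a: "\<forall>s\<ge>0. \<bar>cutoff s\<bar> \<le> a"
    using compose_bounded_01[OF smooth_imp_continuous[OF smooth_cutoff] cutoff_eq_0(1)] by blast
  obtain b where b: "\<forall>s\<ge>0. \<bar>cutoff' s\<bar> \<le> b"
    using compose_bounded_01[OF smooth_imp_continuous[OF smooth_cutoff'] cutoff_eq_0(2)] by blast
  obtain c where c: "\<forall>s\<ge>0. \<bar>lap_cutoff s\<bar> \<le> c"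
    using compose_bounded_01[OF smooth_imp_continuous[OF smooth_lap_cutoff] lap_cutoff_eq_0] by blast
  show ?thesis
    by (rule exI[of _ "max 1 (max a (max b c))"]) (use a b c in \<open>auto simp: le_max_iff_disj\<close>)
qed

lemma tp'_bound: assumes "\<forall>s\<ge>0. \<bar>cutoff' s\<bar> \<le> G" "0 \<le> G" shows "\<bar>tp' k t\<bar> \<le> 2 * G / (\<epsilon> k)\<^sup>2"
proof (cases "t \<in> win k")
  case True
  then have "\<bar>cutoff' (sc k t * sc k t)\<bar> * \<bar>2 * sc k t\<bar> \<le> G * 2"
    using assms by (intro mult_mono) (auto simp: win_iff abs_mult)
  then have "(\<bar>cutoff' (sc k t * sc k t)\<bar> * \<bar>2 * sc k t\<bar>) * (1 / (\<epsilon> k)\<^sup>2) \<le> (G * 2) * (1 / (\<epsilon> k)\<^sup>2)"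
    by (intro mult_right_mono) auto
  then show ?thesis unfolding tp'_def abs_mult[of _ "1 / (\<epsilon> k)\<^sup>2"] abs_mult[of "cutoff' _"] by (simp add: mult.commute)
next
  case False
  then show ?thesis using assms tp_out(2) by simp
qed

lemma amp_powr: "amp k / \<epsilon> k = \<epsilon> k powr (- (1 + \<delta>))" "amp k / (\<epsilon> k)\<^sup>2 = \<epsilon> k powr (- (2 + \<delta>))"
  "(amp k)\<^sup>2 / \<epsilon> k = \<epsilon> k powr (- (1 + 2 * \<delta>))" "0 < amp k"
proof -
  have e: "\<epsilon> k > 0" by (rule eps)
  have "\<epsilon> k powr (- (1 + \<delta>)) = \<epsilon> k powr (- \<delta>) * \<epsilon> k powr (- 1)"
    unfolding powr_add[symmetric] by (simp add: algebra_simps)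
  then show "amp k / \<epsilon> k = \<epsilon> k powr (- (1 + \<delta>))"
    using e by (simp add: amp_def powr_minus divide_inverse)
  have "\<epsilon> k powr (- (2 + \<delta>)) = \<epsilon> k powr (- \<delta>) * \<epsilon> k powr (- 2)"
    unfolding powr_add[symmetric] by (simp add: algebra_simps)
  then show "amp k / (\<epsilon> k)\<^sup>2 = \<epsilon> k powr (- (2 + \<delta>))"
    using e by (simp add: amp_def powr_minus divide_inverse)
  have "\<epsilon> k powr (- (1 + 2 * \<delta>)) = \<epsilon> k powr (- \<delta>) * \<epsilon> k powr (- \<delta>) * \<epsilon> k powr (- 1)"
    unfolding powr_add[symmetric] by (simp add: algebra_simps)
  then show "(amp k)\<^sup>2 / \<epsilon> k = \<epsilon> k powr (- (1 + 2 * \<delta>))"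
    using e by (simp add: amp_def powr_minus divide_inverse power2_eq_square)
  show "0 < amp k" using e by (simp add: amp_def)
qed

text \<open>A space derivative costs a factor 1/eps_k, a time derivative or a Laplacian 1/eps_k^2,
  and the quadratic term has the squared amplitude over eps_k.\<close>

lemma dominated_B: "dominated \<delta> B" "dominated (2 + \<delta>) TB" "dominated (2 + \<delta>) LB" "dominated (1 + \<delta>) (DB i)"
  "dominated (1 + 2 * \<delta>) AB"
proof -
  obtain G where G: "G \<ge> 1" "\<And>s. s \<ge> 0 \<Longrightarrow> \<bar>cutoff s\<bar> \<le> G" "\<And>s. s \<ge> 0 \<Longrightarrow> \<bar>cutoff' s\<bar> \<le> G"
    "\<And>s. s \<ge> 0 \<Longrightarrow> \<bar>lap_cutoff s\<bar> \<le> G" using cutoff_derivs_bounded by metis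
  have sw: "norm (scaled_swirl cutoff (p k) (\<epsilon> k) x) \<le> G" "norm (scaled_swirl lap_cutoff (p k) (\<epsilon> k) x) \<le> G" for k x
    unfolding swirl_yy by (rule norm_swirl_le[OF G(2) cutoff_eq_0(1)] norm_swirl_le[OF G(4) lap_cutoff_eq_0]; assumption)+
  have sp: "norm (swirl_partial i cutoff cutoff' y) \<le> 3 * G" for y
    using norm_swirl_partial_le(1)[OF G(2) cutoff_eq_0(1) G(3) cutoff_eq_0(2), where i=i and y=y] by simp
  have at: "\<bar>amp k * tp k t\<bar> \<le> amp k" for k t
    using tp_bounds[of k t] amp_powr(4)[of k] by (simp add: abs_mult mult_left_le)
  have e: "\<epsilon> k > 0" for k by (rule eps)
  show "dominated \<delta> B" unfolding dominated_def
  proof (intro exI[of _ G] conjI allI)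
    show "norm (B k z) \<le> G * \<epsilon> k powr - \<delta>" for k z
      using mult_mono[OF at[of k "snd z"] sw(1)[of k "fst z"]] amp_powr(4)[of k] by (simp add: B_def amp_def mult.commute)
  qed (use G in simp)
  show "dominated (2 + \<delta>) TB" unfolding dominated_def
  proof (intro exI[of _ "2 * G * G"] conjI allI)
    fix k :: nat and z :: "space \<times> real"
    have "\<bar>tp' k (snd z)\<bar> \<le> 2 * G / (\<epsilon> k)\<^sup>2" by (rule tp'_bound) (use G in auto)
    then have "\<bar>amp k * tp' k (snd z)\<bar> \<le> amp k * (2 * G / (\<epsilon> k)\<^sup>2)"
      unfolding abs_mult using amp_powr(4)[of k] by (intro mult_mono) auto
    then have "norm (TB k z) \<le> (amp k * (2 * G / (\<epsilon> k)\<^sup>2)) * G"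
      unfolding TB_def norm_scaleR using sw(1)[of k "fst z"] G(1) amp_powr(4)[of k] by (intro mult_mono) auto
    also have "\<dots> = 2 * G * G * (amp k / (\<epsilon> k)\<^sup>2)" by simp
    finally show "norm (TB k z) \<le> 2 * G * G * \<epsilon> k powr (- (2 + \<delta>))" by (simp only: amp_powr)
  qed (use G in simp)
  show "dominated (2 + \<delta>) LB" unfolding dominated_def
  proof (intro exI[of _ G] conjI allI)
    fix k :: nat and z :: "space \<times> real"
    have "\<bar>amp k * tp k (snd z) / (\<epsilon> k)\<^sup>2\<bar> \<le> amp k / (\<epsilon> k)\<^sup>2" using at[of k "snd z"] by (simp add: divide_right_mono)
    then have "norm (LB k z) \<le> (amp k / (\<epsilon> k)\<^sup>2) * G"
      unfolding LB_def norm_scaleR using sw(2)[of k "fst z"] G(1) amp_powr(4)[of k] by (intro mult_mono) auto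
    then show "norm (LB k z) \<le> G * \<epsilon> k powr (- (2 + \<delta>))" by (simp only: amp_powr mult.commute)
  qed (use G in simp)
  show "dominated (1 + \<delta>) (DB i)" unfolding dominated_def
  proof (intro exI[of _ "3 * G"] conjI allI)
    fix k :: nat and z :: "space \<times> real"
    have "\<bar>amp k * tp k (snd z) / \<epsilon> k\<bar> \<le> amp k / \<epsilon> k" using at[of k "snd z"] e[of k] by (simp add: divide_right_mono)
    then have "norm (DB i k z) \<le> (amp k / \<epsilon> k) * (3 * G)"
      unfolding DB_def norm_scaleR using sp[of "yy k (fst z)"] G(1) amp_powr(4)[of k] e[of k] by (intro mult_mono) auto
    then show "norm (DB i k z) \<le> 3 * G * \<epsilon> k powr (- (1 + \<delta>))" by (simp only: amp_powr mult.commute)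
  qed (use G in simp)
  show "dominated (1 + 2 * \<delta>) AB" unfolding dominated_def
  proof (intro exI[of _ "G * G"] conjI allI)
    fix k :: nat and z :: "space \<times> real"
    let ?y = "yy k (fst z)"
    have "(amp k * tp k (snd z))\<^sup>2 \<le> (amp k)\<^sup>2" using at[of k "snd z"] amp_powr(4)[of k] by (simp add: abs_le_square_iff[symmetric])
    then have 1: "\<bar>(amp k * tp k (snd z))\<^sup>2 / \<epsilon> k\<bar> \<le> (amp k)\<^sup>2 / \<epsilon> k" using e[of k] by (simp add: divide_right_mono)
    have "norm (swirl cutoff ?y) \<le> G" by (rule norm_swirl_le[OF G(2) cutoff_eq_0(1)])
    then have "\<bar>cutoff (?y \<bullet> ?y)\<bar> * norm (rot ?y) \<le> G" by (simp add: swirl_def)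
    moreover have "norm (rot (rot ?y)) \<le> norm (rot ?y)" by (rule norm_rot)
    ultimately have "\<bar>cutoff (?y \<bullet> ?y)\<bar> * norm (rot (rot ?y)) \<le> G" by (meson abs_ge_zero mult_left_mono order_trans)
    then have "\<bar>cutoff (?y \<bullet> ?y)\<bar> * (\<bar>cutoff (?y \<bullet> ?y)\<bar> * norm (rot (rot ?y))) \<le> G * G"
      using G(1) G(2)[of "?y \<bullet> ?y"] by (intro mult_mono) auto
    then have "norm ((cutoff (?y \<bullet> ?y))\<^sup>2 *\<^sub>R rot (rot ?y)) \<le> G * G" by (simp add: power2_eq_square abs_mult)
    then have "norm (AB k z) \<le> ((amp k)\<^sup>2 / \<epsilon> k) * (G * G)"
      unfolding AB_def norm_scaleR[of "(amp k * tp k (snd z))\<^sup>2 / \<epsilon> k"]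
      using 1 G(1) e[of k] by (intro mult_mono) auto
    then show "norm (AB k z) \<le> G * G * \<epsilon> k powr (- (1 + 2 * \<delta>))" by (simp only: amp_powr mult.commute)
  qed (use G in simp)
qed

text \<open>For small \<delta> the convective order 1 + 2\<delta> stays below 2 + \<delta>, so the
  size of the force is that of its linear part.\<close>

lemma dominated_fB: "dominated (2 + \<delta>) fB"
  unfolding fB_def[abs_def]
  using delta by (intro dominated_add dominated_diff dominated_B dominated_mono[OF dominated_B(5)]) simp

lemma smooth_sc: "smooth (\<lambda>z::space \<times> real. sc k (snd z))"
  unfolding sc_def
  by (intro smooth_mult smooth_const smooth_diff smooth_linear bounded_linear_snd)

lemma smooth_tp: "smooth (\<lambda>z::space \<times> real. tp k (snd z))" "smooth (\<lambda>z::space \<times> real. tp' k (snd z))"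
  unfolding tp_def tp'_def
  by (intro smooth_mult smooth_const smooth_compose_real[OF smooth_cutoff] smooth_compose_real[OF smooth_cutoff'] smooth_sc)+

lemma smooth_fst: "smooth (fst :: space \<times> real \<Rightarrow> space)"
  by (rule smooth_linear[OF bounded_linear_fst])

lemma smooth_yy: "smooth P \<Longrightarrow> smooth (\<lambda>z. yy k (P z))"
  unfolding yy_def by (intro smooth_scaleR smooth_const smooth_diff)

lemma smooth_swirl_partial: "smooth P \<Longrightarrow> smooth (\<lambda>z. swirl_partial i cutoff cutoff' (yy k (P z)))"
  unfolding swirl_partial_def
  by (intro smooth_add smooth_scaleR smooth_mult smooth_const smooth_compose_real[OF smooth_cutoff]
      smooth_compose_real[OF smooth_cutoff'] smooth_inner smooth_nth smooth_bounded_linear[OF bounded_linear_rot] smooth_yy)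

lemma smooth_B: "smooth (B k)" "smooth (TB k)" "smooth (LB k)" "smooth (DB i k)" "smooth (AB k)"
  unfolding B_def[abs_def] TB_def[abs_def] LB_def[abs_def] DB_def[abs_def] AB_def[abs_def] divide_inverse power2_eq_square
  by (intro smooth_scaleR smooth_mult smooth_const smooth_tp smooth_scaled_swirl smooth_cutoff smooth_lap_cutoff smooth_fst
      smooth_swirl_partial smooth_compose_real[OF smooth_cutoff] smooth_inner smooth_bounded_linear[OF bounded_linear_rot] smooth_yy)+

lemma B_borel: "B k \<in> borel_measurable borel" "TB k \<in> borel_measurable borel" "LB k \<in> borel_measurable borel"
  "DB i k \<in> borel_measurable borel" "AB k \<in> borel_measurable borel" "fB k \<in> borel_measurable borel"
proof -
  show *: "B k \<in> borel_measurable borel" "TB k \<in> borel_measurable borel" "LB k \<in> borel_measurable borel"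
    "DB i k \<in> borel_measurable borel" "AB k \<in> borel_measurable borel"
    by (intro continuous_borel smooth_imp_continuous smooth_B)+
  show "fB k \<in> borel_measurable borel" unfolding fB_def[abs_def] using * by simp
qed

lemma smooth_part_B: "smooth (part n B)"
  unfolding part_def[abs_def] by (intro smooth_sum smooth_B) simp

lemma smooth_slice_B: "smooth (slice (B k) t)" "smooth (slice (TB k) t)" "smooth (slice (LB k) t)" "smooth (slice (DB i k) t)"
  unfolding B_def TB_def LB_def DB_def fst_conv snd_conv
  by (intro smooth_scaleR smooth_const smooth_scaled_swirl smooth_cutoff smooth_lap_cutoff smooth_ident
      smooth_swirl_partial smooth_linear[OF bounded_linear_ident])+

lemma smooth_slice_part: "smooth (slice (part n B) t)" "smooth (slice (part n TB) t)" "smooth (slice (part n LB) t)"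
  unfolding part_def by (intro smooth_sum smooth_slice_B finite_lessThan)+

lemma partial_B: "partial i (slice (B k) t) x = DB i k (x, t)"
  unfolding B_def DB_def fst_conv snd_conv yy_def by (rule scaled_swirl_partial[OF cutoff_deriv])

lemma laplacian_B: "laplacian (slice (B k) t) x = LB k (x, t)"
  unfolding B_def LB_def fst_conv snd_conv lap_cutoff_def[abs_def]
  by (rule scaled_swirl_laplacian[OF cutoff_deriv cutoff'_deriv])

lemma self_adv_B: "self_adv (slice (B k) t) x = AB k (x, t)"
  unfolding B_def AB_def fst_conv snd_conv yy_def by (rule scaled_swirl_self_adv[OF cutoff_deriv])

text \<open>\<open>scaled_swirl_divergence\<close> asks for some derivative of the profile, whatever
  its value; the abstract one avoids computing a third derivative of the cutoff.\<close>

lemma lap_cutoff_deriv: "(lap_cutoff has_real_derivative dir_deriv 1 lap_cutoff s) (at s)"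
  using has_derivative_dir_deriv[OF smooth_imp_differentiable[OF smooth_lap_cutoff], of s]
  by (simp add: differentiable_def has_field_derivative_def) (metis dir_derivI has_real_derivative has_field_derivative_def mult.right_neutral)

lemma divergence_B: "divergence (slice (B k) t) x = 0" "divergence (slice (TB k) t) x = 0" "divergence (slice (LB k) t) x = 0"
  unfolding B_def TB_def LB_def fst_conv snd_conv
  by (rule scaled_swirl_divergence[OF cutoff_deriv] scaled_swirl_divergence[OF lap_cutoff_deriv])+

lemma partial_part: "partial i (slice (part n B) t) x = part n (DB i) (x, t)"
  unfolding part_def by (subst partial_sum) (auto intro: smooth_imp_differentiable smooth_slice_B simp: partial_B)

lemma laplacian_part: "laplacian (slice (part n B) t) x = part n LB (x, t)"
proof -
  have e: "partial i (slice (part n B) t) = (\<lambda>x. \<Sum>k<n. DB i k (x, t))" for i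
    by (rule ext, simp add: partial_part, simp add: part_def)
  have "partial i (partial i (slice (part n B) t)) x = (\<Sum>k<n. partial i (slice (DB i k) t) x)" for i
    unfolding e by (rule partial_sum) (auto intro: smooth_imp_differentiable smooth_slice_B)
  then have "laplacian (slice (part n B) t) x = (\<Sum>k<n. \<Sum>i\<in>UNIV. partial i (slice (DB i k) t) x)"
    unfolding laplacian_def by (simp add: sum.swap[of _ _ UNIV])
  moreover have "slice (DB i k) t = partial i (slice (B k) t)" for i k by (rule ext, rule partial_B[symmetric])
  ultimately show ?thesis by (simp add: part_def laplacian_def flip: laplacian_B)
qed

lemma divergence_part_sum:
  assumes "\<And>k. smooth (slice (U k) t)" "\<And>k x. divergence (slice (U k) t) x = 0"
  shows "divergence (slice (part n U) t) x = 0"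
proof -
  have "divergence (slice (part n U) t) x = (\<Sum>i\<in>UNIV. (\<Sum>k<n. partial i (slice (U k) t) x) $ i)"
    unfolding divergence_def part_def
    by (subst partial_sum) (auto intro: smooth_imp_differentiable[OF assms(1)])
  also have "\<dots> = (\<Sum>k<n. divergence (slice (U k) t) x)"
    by (simp add: divergence_def sum.swap[of _ _ UNIV])
  finally show ?thesis using assms(2) by simp
qed

lemma divergence_part: "divergence (slice (part n B) t) x = 0" "divergence (slice (part n TB) t) x = 0"
  "divergence (slice (part n LB) t) x = 0"
  by (rule divergence_part_sum; rule smooth_slice_B divergence_B)+

text \<open>The quadratic term is additive because the balls are disjoint: a swirl is not
  transported by the others.\<close>

lemma self_adv_part: "self_adv (slice (part n B) t) x = part n AB (x, t)"
proof (cases "\<exists>k. x \<in> blob k")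
  case True
  then obtain k where k: "x \<in> blob k" by blast
  show ?thesis
    unfolding self_adv_def partial_part part_in[OF localized_B(1) k] part_in[OF localized_B(4) k] part_in[OF localized_B(5) k]
    using self_adv_B[of k t x] by (simp add: self_adv_def partial_B)
next
  case False
  then show ?thesis unfolding self_adv_def using part_out[OF localized_B(1)] part_out[OF localized_B(5)] by simp
qed

lemma compact_support_part:
  assumes "localized U" shows "compact (\<Union>k<n. blob k)" "x \<notin> (\<Union>k<n. blob k) \<Longrightarrow> part n U (x, t) = 0"
  using assms by (auto simp: part_def localized_def blob_def intro!: compact_UN sum.neutral)

lemma C1c_part: "C1c (slice (part n B) t)" "C1c (slice (part n TB) t)" "C1c (slice (part n LB) t)"
proof -
  show "C1c (slice (part n B) t)"
    by (rule smooth_C1c[OF smooth_slice_part(1) compact_support_part[OF localized_B(1)]])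
  show "C1c (slice (part n TB) t)"
    by (rule smooth_C1c[OF smooth_slice_part(2) compact_support_part[OF localized_B(2)]])
  show "C1c (slice (part n LB) t)"
    by (rule smooth_C1c[OF smooth_slice_part(3) compact_support_part[OF localized_B(3)]])
qed

lemma part_fB: "part n fB z = part n TB z - part n LB z + part n AB z"
  by (simp add: part_def fB_def sum.distrib sum_subtractf)

lemma tp_deriv: "(tp k has_real_derivative tp' k t) (at t)"
proof -
  have "((\<lambda>t. sc k t * sc k t) has_real_derivative 2 * sc k t * (1 / (\<epsilon> k)\<^sup>2)) (at t)"
  proof -
    have d: "(sc k has_real_derivative 1 / (\<epsilon> k)\<^sup>2) (at t)"
      unfolding sc_def[abs_def] by (rule DERIV_cong[OF DERIV_cmult]) (auto intro!: derivative_eq_intros)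
    show ?thesis by (rule DERIV_cong[OF DERIV_mult[OF d d]]) simp
  qed
  from DERIV_chain2[OF cutoff_deriv this] show ?thesis
    unfolding tp_def[abs_def] tp'_def by (simp add: mult.assoc)
qed

lemma B_time_deriv: "((\<lambda>t. B k (x, t)) has_vector_derivative TB k (x, t)) (at t)"
  unfolding B_def TB_def fst_conv snd_conv
  by (rule has_vector_derivative_scaleR[OF DERIV_cmult[OF tp_deriv] has_vector_derivative_const, THEN has_vector_derivative_eq_rhs]) simp

lemma glue_time_deriv: "((\<lambda>t. glue B (x, t)) has_vector_derivative glue TB (x, t)) (at t)"
proof (cases "\<exists>k. x \<in> blob k")
  case True
  then obtain k where k: "x \<in> blob k" by blast
  show ?thesis unfolding glue_in[OF localized_B(1) k] glue_in[OF localized_B(2) k] by (rule B_time_deriv)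
next
  case False
  then show ?thesis using glue_out[OF localized_B(1)] glue_out[OF localized_B(2)] by simp
qed

lemma part_time_deriv: "((\<lambda>t. part n B (x, t)) has_vector_derivative part n TB (x, t)) (at t)"
  unfolding part_def by (rule has_vector_derivative_sum) (rule B_time_deriv)

text \<open>Closed windows may begin at \<open>t0\<close> itself; half of it leaves a whole interval
  after time 0 on which everything vanishes.\<close>

lemma early_0: assumes "localized U" "t \<le> t0/2" shows "glue U (x, t) = 0" "part n U (x, t) = 0"
proof -
  have "t \<notin> win k" for k
    using t0(1) t0(2)[of k] assms(2) by (auto simp: win_def dist_real_def abs_le_iff)
  then have 0: "U k (x, t) = 0" for k using assms(1) by (simp add: localized_def)
  show "glue U (x, t) = 0" "part n U (x, t) = 0" by (simp_all add: glue_def part_def 0)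
qed

end

section \<open>Green's formulas, Fubini's theorem and integration by parts in time\<close>

lemma integrable_inner_compact_support:
  fixes u \<phi> :: "'a::euclidean_space \<Rightarrow> 'b::euclidean_space"
  assumes "continuous_on UNIV u" "continuous_on UNIV \<phi>" "compact K" "\<And>x. x \<notin> K \<Longrightarrow> u x = 0"
  shows "integrable lebesgue (\<lambda>x. u x \<bullet> \<phi> x)"
proof -
  have c: "continuous_on UNIV (\<lambda>x. u x \<bullet> \<phi> x)" using assms by (intro continuous_intros)
  have "integrable lborel (\<lambda>x. u x \<bullet> \<phi> x)"
    by (rule integrable_compact_support[OF c assms(3)]) (simp add: assms(4))
  then show ?thesis using integrable_lebesgue_iff[OF continuous_borel[OF c]] by simp
qed

lemma C1c_partial: assumes "smooth v" "compact K" "\<And>x. x \<notin> K \<Longrightarrow> v x = 0" shows "C1c (partial i v)"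
proof (rule smooth_C1c[OF smooth_partial[OF assms(1)] assms(2)])
  show "partial i v x = 0" if "x \<notin> K" for x
    unfolding partial_def by (rule dir_deriv_outside[OF compact_imp_closed[OF assms(2)] assms(3) that])
qed

text \<open>Both derivatives fall on the compactly supported v, so \<phi> may be merely C^1 and
  needs no decay.\<close>

lemma
  fixes v \<phi> :: "space \<Rightarrow> space"
  assumes v: "smooth v" "compact K" "\<And>x. x \<notin> K \<Longrightarrow> v x = 0"
    and \<phi>: "\<And>x. \<phi> differentiable (at x)" "\<And>i. continuous_on UNIV (partial i \<phi>)"
  shows green1: "(\<integral>x. (\<Sum>i\<in>UNIV. partial i v x \<bullet> partial i \<phi> x) \<partial>lebesgue) = - (\<integral>x. laplacian v x \<bullet> \<phi> x \<partial>lebesgue)"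
    and green1_int: "integrable lebesgue (\<lambda>x. partial i v x \<bullet> partial i \<phi> x)"
      "integrable lebesgue (\<lambda>x. laplacian v x \<bullet> \<phi> x)"
proof -
  note p = by_parts[OF C1c_partial[OF v] \<phi>]
  have e: "laplacian v x \<bullet> \<phi> x = (\<Sum>i\<in>UNIV. partial i (partial i v) x \<bullet> \<phi> x)" for x
    by (simp add: laplacian_def inner_sum_left)
  have i1: "integrable lebesgue (\<lambda>x. partial i v x \<bullet> partial i \<phi> x)" for i by (rule p(3))
  have i2: "integrable lebesgue (\<lambda>x. partial i (partial i v) x \<bullet> \<phi> x)" for i by (rule p(2))
  show "integrable lebesgue (\<lambda>x. partial i v x \<bullet> partial i \<phi> x)" by (rule i1)
  show "integrable lebesgue (\<lambda>x. laplacian v x \<bullet> \<phi> x)" unfolding e by (rule Bochner_Integration.integrable_sum) (rule i2)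
  have q: "(\<integral>x. partial i v x \<bullet> partial i \<phi> x \<partial>lebesgue) = - (\<integral>x. partial i (partial i v) x \<bullet> \<phi> x \<partial>lebesgue)" for i
    using p(1)[of i i] by simp
  show "(\<integral>x. (\<Sum>i\<in>UNIV. partial i v x \<bullet> partial i \<phi> x) \<partial>lebesgue) = - (\<integral>x. laplacian v x \<bullet> \<phi> x \<partial>lebesgue)"
    unfolding e Bochner_Integration.integral_sum[OF i1] Bochner_Integration.integral_sum[OF i2] q by (simp add: sum_negf)
qed

lemma green2:
  fixes v \<phi> :: "space \<Rightarrow> space"
  assumes v: "smooth v" "compact K" "\<And>x. x \<notin> K \<Longrightarrow> v x = 0" and \<phi>: "smooth \<phi>"
  shows "(\<integral>x. v x \<bullet> laplacian \<phi> x \<partial>lebesgue) = (\<integral>x. laplacian v x \<bullet> \<phi> x \<partial>lebesgue)"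
    "integrable lebesgue (\<lambda>x. v x \<bullet> laplacian \<phi> x)"
proof -
  have \<phi>c: "\<And>x. \<phi> differentiable (at x)" "\<And>i. continuous_on UNIV (partial i \<phi>)"
    using \<phi> by (auto intro: smooth_imp_differentiable smooth_imp_continuous smooth_partial)
  have pc: "\<And>x. partial i \<phi> differentiable (at x)" "continuous_on UNIV (partial i (partial i \<phi>))" for i
    using \<phi> by (auto intro: smooth_imp_differentiable smooth_imp_continuous smooth_partial)
  note p = by_parts[OF smooth_C1c[OF v] pc]
  have e: "v x \<bullet> laplacian \<phi> x = (\<Sum>i\<in>UNIV. v x \<bullet> partial i (partial i \<phi>) x)" for x
    by (simp add: laplacian_def inner_sum_right)
  have i1: "integrable lebesgue (\<lambda>x. v x \<bullet> partial i (partial i \<phi>) x)" for i by (rule p(3))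
  show "integrable lebesgue (\<lambda>x. v x \<bullet> laplacian \<phi> x)" unfolding e by (rule Bochner_Integration.integrable_sum) (rule i1)
  have q: "(\<integral>x. v x \<bullet> partial i (partial i \<phi>) x \<partial>lebesgue) = - (\<integral>x. partial i v x \<bullet> partial i \<phi> x \<partial>lebesgue)" for i
    using p(1)[of i] by simp
  have "(\<integral>x. v x \<bullet> laplacian \<phi> x \<partial>lebesgue) = - (\<integral>x. (\<Sum>i\<in>UNIV. partial i v x \<bullet> partial i \<phi> x) \<partial>lebesgue)"
    unfolding e Bochner_Integration.integral_sum[OF i1] q
    by (simp add: sum_negf Bochner_Integration.integral_sum[OF green1_int(1)[OF v \<phi>c]])
  then show "(\<integral>x. v x \<bullet> laplacian \<phi> x \<partial>lebesgue) = (\<integral>x. laplacian v x \<bullet> \<phi> x \<partial>lebesgue)"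
    using green1[OF v \<phi>c] by simp
qed

text \<open>(v . grad)v . v is v . grad |v|^2/2, and a divergence-free field is orthogonal to
  gradients.\<close>

lemma self_adv_orthogonal:
  assumes v: "smooth v" "compact K" "\<And>x. x \<notin> K \<Longrightarrow> v x = 0" "\<And>x. divergence v x = 0"
  shows "(\<integral>x. self_adv v x \<bullet> v x \<partial>lebesgue) = 0"
proof -
  define \<phi> where "\<phi> x = (1/2) * (v x \<bullet> v x)" for x
  have \<phi>s: "smooth \<phi>" unfolding \<phi>_def[abs_def] by (intro smooth_mult smooth_const smooth_inner v(1))
  have g: "gradient \<phi> x $ i = partial i v x \<bullet> v x" for x i
  proof -
    have "(\<phi> has_derivative (\<lambda>b. (1/2) * (v x \<bullet> dir_deriv b v x + dir_deriv b v x \<bullet> v x))) (at x)"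
      unfolding \<phi>_def[abs_def]
      by (intro has_derivative_mult_right has_derivative_inner has_derivative_dir_deriv smooth_imp_differentiable v(1))
    from dir_derivI[OF this] show ?thesis by (simp add: gradient_def partial_def inner_commute)
  qed
  have "self_adv v x \<bullet> v x = v x \<bullet> gradient \<phi> x" for x
    by (simp add: self_adv_def inner_sum_left inner_vec_def[of "v x" "gradient \<phi> x"] g)
  then show ?thesis using divfree_gradient[OF smooth_C1c[OF v(1-3)] v(4) \<phi>s] by simp
qed

lemma borel_measurable_lebesgue_on_AE:
  fixes f g :: "'a::euclidean_space \<Rightarrow> 'b::euclidean_space"
  assumes f: "f \<in> borel_measurable (lebesgue_on A)" and A: "A \<in> sets lebesgue" and ae: "AE x in lebesgue_on A. f x = g x"
  shows "g \<in> borel_measurable (lebesgue_on A)"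
proof -
  have "(\<lambda>x. if x \<in> A then f x else 0) \<in> borel_measurable lebesgue"
    using f A by (simp add: borel_measurable_if)
  moreover have "AE x in lebesgue. (if x \<in> A then f x else 0) = (if x \<in> A then g x else 0)"
    using ae A by (simp add: AE_restrict_space_iff)
  ultimately have "(\<lambda>x. if x \<in> A then g x else 0) \<in> borel_measurable lebesgue"
    by (rule borel_measurable_AE)
  then show ?thesis using A by (simp add: borel_measurable_if)
qed

text \<open>The definitions integrate over \<open>lebesgue\<close>, the Fubini arguments over
  \<open>lborel\<close>. At exceptional times g may take arbitrary values, so it is only compared
  almost everywhere with an integrable h.\<close>

lemma set_integral_lebesgue_indicator:
  fixes g h :: "real \<Rightarrow> real"
  assumes h: "integrable lborel h" and eq: "AE t in lborel. t \<in> A \<longrightarrow> g t = h t" and 0: "\<And>t. t \<notin> A \<Longrightarrow> h t = 0"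
  shows "set_integrable lebesgue A g" "(LINT t:A|lebesgue. g t) = (\<integral>t. h t \<partial>lborel)"
proof -
  have hm: "h \<in> borel_measurable borel" using h by simp
  have hi: "integrable lebesgue h" using h by (simp add: integrable_lebesgue_iff[OF hm])
  have ae: "AE t in lebesgue. h t = indicator A t *\<^sub>R g t"
    using AE_completion[OF eq] by eventually_elim (use 0 in \<open>auto simp: indicator_def\<close>)
  have gm: "(\<lambda>t. indicator A t *\<^sub>R g t) \<in> borel_measurable lebesgue"
    by (rule borel_measurable_AE[OF borel_measurable_integrable[OF hi] ae])
  show "set_integrable lebesgue A g"
    unfolding set_integrable_def by (rule integrable_cong_AE_imp[OF hi gm]) (use ae in auto)
  have "(LINT t:A|lebesgue. g t) = (\<integral>t. h t \<partial>lebesgue)"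
    unfolding set_lebesgue_integral_def
    by (rule integral_cong_AE[OF gm borel_measurable_integrable[OF hi]]) (use ae in auto)
  then show "(LINT t:A|lebesgue. g t) = (\<integral>t. h t \<partial>lborel)" by (simp add: integral_lebesgue_eq[OF hm])
qed

lemma Fubini_space_time:
  fixes H :: "'a::euclidean_space \<times> 'b::euclidean_space \<Rightarrow> real"
  assumes "integrable lborel H"
  shows "integrable lborel (\<lambda>t. \<integral>x. H (x, t) \<partial>lborel)" "(\<integral>t. (\<integral>x. H (x, t) \<partial>lborel) \<partial>lborel) = (\<integral>z. H z \<partial>lborel)"
    "integrable lborel (\<lambda>x. \<integral>t. H (x, t) \<partial>lborel)" "(\<integral>x. (\<integral>t. H (x, t) \<partial>lborel) \<partial>lborel) = (\<integral>z. H z \<partial>lborel)"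
    "AE t in lborel. integrable lborel (\<lambda>x. H (x, t))" "AE x in lborel. integrable lborel (\<lambda>t. H (x, t))"
proof -
  have i: "integrable (lborel \<Otimes>\<^sub>M lborel) (case_prod (\<lambda>x t. H (x, t)))" using assms by (simp add: lborel_prod)
  have i': "integrable (lborel \<Otimes>\<^sub>M lborel) H" using assms by (simp add: lborel_prod)
  show "integrable lborel (\<lambda>t. \<integral>x. H (x, t) \<partial>lborel)" "(\<integral>t. (\<integral>x. H (x, t) \<partial>lborel) \<partial>lborel) = (\<integral>z. H z \<partial>lborel)"
    "AE t in lborel. integrable lborel (\<lambda>x. H (x, t))"
    using lborel_pair.integrable_snd[OF i] lborel_pair.integral_snd[OF i] lborel_pair.AE_integrable_snd[OF i]
    by (simp_all add: lborel_prod)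
  show "integrable lborel (\<lambda>x. \<integral>t. H (x, t) \<partial>lborel)" "(\<integral>x. (\<integral>t. H (x, t) \<partial>lborel) \<partial>lborel) = (\<integral>z. H z \<partial>lborel)"
    "AE x in lborel. integrable lborel (\<lambda>t. H (x, t))"
    using lborel_pair.integrable_fst'[OF i'] lborel_pair.integral_fst'[OF i'] lborel_pair.AE_integrable_fst'[OF i']
    by (simp_all add: lborel_prod)
qed

text \<open>
  The test fields of both weak formulations, on the open slab where they are smooth. They need
  not vanish at time \<open>0\<close>, but the fields they are paired with do so near that time.
\<close>

locale slab_test =
  fixes \<phi> :: "space \<times> real \<Rightarrow> space" and S :: real and K :: "(space \<times> real) set"
  assumes S: "0 < S" and K: "compact K" "K \<subseteq> UNIV \<times> {0..<S}"
    and vanish: "\<And>z. z \<in> UNIV \<times> {0<..<S} \<Longrightarrow> z \<notin> K \<Longrightarrow> \<phi> z = 0"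
    and Ck: "\<And>k. Ck_open k (UNIV \<times> {0<..<S}) \<phi>"
begin

abbreviation slab :: "(space \<times> real) set" where "slab \<equiv> UNIV \<times> {0<..<S}"

lemma open_slab: "open slab" by (intro open_Times) auto

lemma vanish_dir_deriv: assumes "z \<in> slab" "z \<notin> K" shows "dir_deriv b \<phi> z = 0"
proof -
  have o: "open (slab - K)" using open_slab compact_imp_closed[OF K(1)] by (rule open_Diff)
  have "dir_deriv b \<phi> z = dir_deriv b (\<lambda>x. 0) z"
    by (rule dir_deriv_cong_open(1)[OF o]) (use assms vanish in auto)
  also have "\<dots> = 0" by (rule dir_derivI[where u'="\<lambda>v. 0"]) simp
  finally show ?thesis .
qed

lemma diff: "z \<in> slab \<Longrightarrow> \<phi> differentiable (at z)"
  using Ck[of 1] by (cases z) simp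

lemma Ck_dir_deriv: "b \<in> Basis \<Longrightarrow> Ck_open k slab (dir_deriv b \<phi>)"
  using Ck[of "Suc k"] by simp

lemma time_Basis: "(0::space, 1::real) \<in> Basis" "(axis i 1 :: space, 0::real) \<in> Basis"
  by (auto simp: Basis_prod_def axis_Basis)

lemma cont: "continuous_on slab \<phi>" "continuous_on slab (time_deriv \<phi>)"
  using Ck_open_imp_continuous[OF Ck] Ck_open_imp_continuous[OF Ck_dir_deriv[OF time_Basis(1)]]
  by (auto simp: time_deriv_def)

lemma slice_deriv:
  assumes t: "t \<in> {0<..<S}"
  shows "slice \<phi> t differentiable (at x)" "partial i (slice \<phi> t) x = dir_deriv (axis i 1, 0) \<phi> (x, t)"
    "((\<lambda>s. \<phi> (x, s)) has_vector_derivative time_deriv \<phi> (x, t)) (at t)"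
proof -
  have "(\<phi> has_derivative (\<lambda>v. dir_deriv v \<phi> (x, t))) (at (x, t))"
    by (rule has_derivative_dir_deriv[OF diff]) (use t in auto)
  then have d: "((\<lambda>y. \<phi> (y, t)) has_derivative (\<lambda>v. dir_deriv (v, 0) \<phi> (x, t))) (at x)"
    and d': "((\<lambda>s. \<phi> (x, s)) has_derivative (\<lambda>v. dir_deriv (0, v) \<phi> (x, t))) (at t)"
    by (rule has_derivative_compose[rotated], auto intro!: derivative_eq_intros)+
  show "slice \<phi> t differentiable (at x)" using d by (auto simp: differentiable_def)
  show "partial i (slice \<phi> t) x = dir_deriv (axis i 1, 0) \<phi> (x, t)"
    unfolding partial_def by (rule dir_derivI[OF d])
  have l: "linear (\<lambda>v. dir_deriv v \<phi> (x, t))"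
    using has_derivative_dir_deriv[OF diff, of "(x, t)"] t has_derivative_linear by auto
  have "dir_deriv (0, v) \<phi> (x, t) = v *\<^sub>R time_deriv \<phi> (x, t)" for v
    using linear_cmul[OF l, of v "(0, 1)"] by (simp add: time_deriv_def)
  then show "((\<lambda>s. \<phi> (x, s)) has_vector_derivative time_deriv \<phi> (x, t)) (at t)"
    using d' by (simp add: has_vector_derivative_def)
qed

lemma slice_cont:
  assumes t: "t \<in> {0<..<S}" and c: "continuous_on slab h"
  shows "continuous_on UNIV (slice h t)"
  by (rule continuous_on_compose2[OF c]) (use t in \<open>auto intro!: continuous_intros\<close>)

lemma slice_partial_cont: assumes t: "t \<in> {0<..<S}" shows "continuous_on UNIV (partial i (slice \<phi> t))"
  using slice_cont[OF t Ck_open_imp_continuous[OF Ck_dir_deriv[OF time_Basis(2)]]]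
  by (simp add: slice_deriv(2)[OF t, abs_def])

text \<open>h is continuous on the open slab only and could be unbounded near time 0. But u vanishes
  up to time c, and the part of K from c on is a compact subset of the slab, where h is
  bounded.\<close>

lemma pairing:
  fixes u :: "space \<times> real \<Rightarrow> space"
  assumes u: "integrable lborel u" and c: "0 < c" "\<And>x t. t \<le> c \<Longrightarrow> u (x, t) = 0"
    and h: "continuous_on slab h" "\<And>z. z \<in> slab \<Longrightarrow> z \<notin> K \<Longrightarrow> h z = 0"
  shows "integrable lborel (\<lambda>z. indicator slab z * (u z \<bullet> h z))"
    "set_integrable lebesgue {0<..<S} (\<lambda>t. \<integral>x. u (x, t) \<bullet> h (x, t) \<partial>lebesgue)"
    "(LINT t:{0<..<S}|lebesgue. \<integral>x. u (x, t) \<bullet> h (x, t) \<partial>lebesgue) = (\<integral>z. indicator slab z * (u z \<bullet> h z) \<partial>lborel)"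
    "AE t in lborel. t \<in> {0<..<S} \<longrightarrow> integrable lebesgue (\<lambda>x. u (x, t) \<bullet> h (x, t))"
proof -
  define H where "H z = indicator slab z * (u z \<bullet> h z)" for z
  have um: "u \<in> borel_measurable borel" using u by simp
  have hm: "(\<lambda>z. indicator slab z *\<^sub>R h z) \<in> borel_measurable borel"
    by (rule borel_measurable_continuous_on_indicator[OF _ h(1)]) (use open_slab in simp)
  have He: "H z = u z \<bullet> (indicator slab z *\<^sub>R h z)" for z by (simp add: H_def)
  have Hm: "H \<in> borel_measurable borel" unfolding He[abs_def] by (rule borel_measurable_inner[OF um hm])
  have "compact (K \<inter> UNIV \<times> {c..})" by (intro compact_Int_closed K(1) closed_Times) auto
  moreover have "K \<inter> UNIV \<times> {c..} \<subseteq> slab" using K(2) c(1) by auto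
  ultimately have "bounded (h ` (K \<inter> UNIV \<times> {c..}))"
    by (intro compact_imp_bounded compact_continuous_image continuous_on_subset[OF h(1)])
  then obtain C where C: "C > 0" "\<forall>y\<in>h ` (K \<inter> UNIV \<times> {c..}). norm y \<le> C" using bounded_pos by blast
  have bd: "norm (H z) \<le> C * norm (u z)" for z
  proof (cases "z \<in> slab \<and> z \<in> K \<and> c \<le> snd z")
    case True
    then have "norm (h z) \<le> C" using C(2) by (cases z) auto
    then have "norm (u z) * norm (h z) \<le> norm (u z) * C" by (intro mult_left_mono) auto
    moreover have "\<bar>u z \<bullet> h z\<bar> \<le> norm (u z) * norm (h z)" by (rule Cauchy_Schwarz_ineq2)
    ultimately show ?thesis using True by (simp add: H_def mult.commute)
  next
    case False
    then have "H z = 0" using h(2)[of z] c(2)[of "snd z" "fst z"] by (cases "z \<in> slab") (auto simp: H_def)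
    then show ?thesis using C(1) by simp
  qed
  show i: "integrable lborel (\<lambda>z. indicator slab z * (u z \<bullet> h z))"
    unfolding H_def[symmetric]
    by (rule Bochner_Integration.integrable_bound[where f="\<lambda>z. C *\<^sub>R u z"]) (use u Hm bd C(1) in auto)
  note Fub = Fubini_space_time[OF this, folded H_def]
  have sl: "(\<lambda>x. u (x, t) \<bullet> h (x, t)) \<in> borel_measurable borel" if t: "t \<in> {0<..<S}" for t
    using borel_slice_space[OF um, of t] continuous_borel[OF slice_cont[OF t h(1)]] by simp
  have Hs: "H (x, t) = (if t \<in> {0<..<S} then u (x, t) \<bullet> h (x, t) else 0)" for x t by (simp add: H_def)
  have eq: "AE t in lborel. t \<in> {0<..<S} \<longrightarrow> (\<integral>x. u (x, t) \<bullet> h (x, t) \<partial>lebesgue) = (\<integral>x. H (x, t) \<partial>lborel)"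
    using sl by (auto simp: Hs integral_lebesgue_eq)
  have H0: "(\<integral>x. H (x, t) \<partial>lborel) = 0" if "t \<notin> {0<..<S}" for t
    unfolding Hs if_not_P[OF that] by simp
  note si = set_integral_lebesgue_indicator[OF Fub(1) eq H0]
  show "set_integrable lebesgue {0<..<S} (\<lambda>t. \<integral>x. u (x, t) \<bullet> h (x, t) \<partial>lebesgue)"
    by (rule si(1))
  show "(LINT t:{0<..<S}|lebesgue. \<integral>x. u (x, t) \<bullet> h (x, t) \<partial>lebesgue) = (\<integral>z. indicator slab z * (u z \<bullet> h z) \<partial>lborel)"
    unfolding H_def[symmetric] Fub(2)[symmetric] by (rule si(2))
  show "AE t in lborel. t \<in> {0<..<S} \<longrightarrow> integrable lebesgue (\<lambda>x. u (x, t) \<bullet> h (x, t))"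
    using Fub(5)
  proof eventually_elim
    case (elim t)
    show ?case
    proof
      assume t: "t \<in> {0<..<S}"
      from elim have "integrable lborel (\<lambda>x. u (x, t) \<bullet> h (x, t))" unfolding Hs if_P[OF t] .
      then show "integrable lebesgue (\<lambda>x. u (x, t) \<bullet> h (x, t))" by (simp add: integrable_lebesgue_iff[OF sl[OF t]])
    qed
  qed
qed

text \<open>The fundamental theorem of calculus in t at each fixed x, followed by Fubini's theorem.
  There are no boundary terms: u vanishes at early times and \<phi> at late ones.\<close>

lemma time_parts:
  fixes u ut :: "space \<times> real \<Rightarrow> space"
  assumes u: "integrable lborel u" "integrable lborel ut"
    and c: "0 < c" "\<And>x t. t \<le> c \<Longrightarrow> u (x, t) = 0" "\<And>x t. t \<le> c \<Longrightarrow> ut (x, t) = 0"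
    and d: "\<And>x t. ((\<lambda>t. u (x, t)) has_vector_derivative ut (x, t)) (at t)"
  shows "(LINT t:{0<..<S}|lebesgue. \<integral>x. ut (x, t) \<bullet> \<phi> (x, t) \<partial>lebesgue)
    + (LINT t:{0<..<S}|lebesgue. \<integral>x. u (x, t) \<bullet> time_deriv \<phi> (x, t) \<partial>lebesgue) = 0"
proof -
  have h1: "time_deriv \<phi> z = 0" if "z \<in> slab" "z \<notin> K" for z
    unfolding time_deriv_def by (rule vanish_dir_deriv[OF that])
  note p1 = pairing[OF u(2) c(1,3) cont(1) vanish]
  note p2 = pairing[OF u(1) c(1,2) cont(2) h1]
  define H where "H z = indicator slab z * (ut z \<bullet> \<phi> z) + indicator slab z * (u z \<bullet> time_deriv \<phi> z)" for z
  have Hi: "integrable lborel H" unfolding H_def[abs_def] using p1(1) p2(1) by simp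
  \<comment> \<open>K is compact with times below S, hence it has a last time.\<close>
  obtain S' where S': "S' < S" "\<And>z. z \<in> K \<Longrightarrow> snd z \<le> S'"
  proof (cases "K = {}")
    case True
    show ?thesis by (rule that[of "S - 1"]) (use True in auto)
  next
    case False
    have "compact (snd ` K)" by (intro compact_continuous_image K(1) continuous_on_snd continuous_on_id)
    then obtain m where m: "m \<in> snd ` K" "\<forall>y\<in>snd ` K. y \<le> m" using compact_attains_sup[of "snd ` K"] False by auto
    show ?thesis by (rule that[of m]) (use m K(2) in auto)
  qed
  \<comment> \<open>On [a, b], strictly inside (0, S), all is differentiable; a is early enough for
    u to vanish, and b is later than K.\<close>
  define a where "a = min c (S / 2)"
  define b where "b = (max S' a + S) / 2"
  have ab: "0 < a" "a < b" "b < S" "S' < b" "a \<le> c" using S c(1) S'(1) by (auto simp: a_def b_def)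
  have zero: "H (x, t) = 0" if "t \<notin> {a..b}" for x t
  proof (cases "t \<in> {0<..<S}")
    case True
    have "t \<le> c \<or> t > b" using \<open>t \<notin> {a..b}\<close> ab by auto
    then consider "t \<le> c" | "t > b" by blast
    then show ?thesis
    proof cases
      case 1 then show ?thesis using c(2,3) by (simp add: H_def)
    next
      case 2
      then have "(x, t) \<notin> K" using S'(2)[of "(x, t)"] ab by auto
      then show ?thesis using True vanish[of "(x, t)"] h1[of "(x, t)"] by (simp add: H_def)
    qed
  qed (simp add: H_def)
  have hi: "((\<lambda>t. H (x, t)) has_integral 0) UNIV" for x
  proof -
    have "((\<lambda>t. H (x, t)) has_integral (u (x, b) \<bullet> \<phi> (x, b) - u (x, a) \<bullet> \<phi> (x, a))) {a..b}"
    proof (rule fundamental_theorem_of_calculus)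
      fix t assume "t \<in> {a..b}"
      then have t: "t \<in> {0<..<S}" using ab by auto
      have "((\<lambda>s. u (x, s) \<bullet> \<phi> (x, s)) has_vector_derivative (u (x, t) \<bullet> time_deriv \<phi> (x, t) + ut (x, t) \<bullet> \<phi> (x, t))) (at t)"
        by (rule bounded_bilinear.has_vector_derivative[OF bounded_bilinear_inner d slice_deriv(3)[OF t]])
      then show "((\<lambda>s. u (x, s) \<bullet> \<phi> (x, s)) has_vector_derivative H (x, t)) (at t within {a..b})"
        using t by (auto simp: H_def add.commute intro: has_vector_derivative_at_within)
    qed (use ab in simp)
    moreover have "u (x, a) = 0" using c(2) ab by simp
    moreover have "\<phi> (x, b) = 0" using vanish[of "(x, b)"] S'(2)[of "(x, b)"] ab by auto
    ultimately have "((\<lambda>t. H (x, t)) has_integral 0) {a..b}" by simp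
    then have "((\<lambda>t. if t \<in> {a..b} then H (x, t) else 0) has_integral 0) UNIV" by (simp only: has_integral_restrict_UNIV)
    moreover have "(\<lambda>t. if t \<in> {a..b} then H (x, t) else 0) = (\<lambda>t. H (x, t))" using zero by auto
    ultimately show ?thesis by simp
  qed
  have "AE x in lborel. (\<integral>t. H (x, t) \<partial>lborel) = 0"
    using Fubini_space_time(6)[OF Hi]
  proof eventually_elim
    case (elim x)
    from has_integral_integral_lborel[OF elim] hi[of x] show ?case by (rule has_integral_unique)
  qed
  then have "(\<integral>x. (\<integral>t. H (x, t) \<partial>lborel) \<partial>lborel) = 0" by (rule integral_eq_zero_AE)
  then have "(\<integral>z. H z \<partial>lborel) = 0" by (simp add: Fubini_space_time(4)[OF Hi])
  then have "(\<integral>z. indicator slab z * (ut z \<bullet> \<phi> z) \<partial>lborel) + (\<integral>z. indicator slab z * (u z \<bullet> time_deriv \<phi> z) \<partial>lborel) = 0"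
    unfolding H_def using p1(1) p2(1) by simp
  with p1(3) p2(3) show ?thesis by linarith
qed

end

lemma integral_cong_AE_lebesgue:
  fixes f g :: "'a::euclidean_space \<Rightarrow> 'b::euclidean_space"
  assumes "AE x in lebesgue. f x = g x" "integrable lebesgue g"
  shows "(\<integral>x. f x \<partial>lebesgue) = (\<integral>x. g x \<partial>lebesgue)" "integrable lebesgue f"
proof -
  have ae: "AE x in lebesgue. g x = f x" using assms(1) by eventually_elim simp
  have fm: "f \<in> borel_measurable lebesgue"
    by (rule borel_measurable_AE[OF borel_measurable_integrable[OF assms(2)] ae])
  show "(\<integral>x. f x \<partial>lebesgue) = (\<integral>x. g x \<partial>lebesgue)"
    by (rule integral_cong_AE[OF fm borel_measurable_integrable[OF assms(2)] assms(1)])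
  show "integrable lebesgue f" by (rule integrable_cong_AE_imp[OF assms(2) fm ae])
qed

lemma Lp_lebesgue_on_const: "(\<lambda>t. c) \<in> Lp (lebesgue_on {0<..<S::real}) 2"
proof -
  have "finite_measure (lebesgue_on {0<..<S})"
    by (rule finite_measure_lebesgue_on) auto
  then show ?thesis by (simp add: Lp_2_iff finite_measure.integrable_const)
qed

lemma Lp_norm_2_sqrt:
  fixes u :: "space \<Rightarrow> space"
  assumes "u \<in> borel_measurable borel"
  shows "Lp_norm lebesgue 2 u = sqrt (\<integral>x. (norm (u x))\<^sup>2 \<partial>lborel)"
proof -
  have m: "(\<lambda>x. (norm (u x))\<^sup>2) \<in> borel_measurable borel" using assms by simp
  have "(Lp_norm lebesgue 2 u)\<^sup>2 = (\<integral>x. (norm (u x))\<^sup>2 \<partial>lborel)"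
    by (simp add: Lp_norm_2_square integral_lebesgue_eq[OF m])
  then show ?thesis using Lp_norm_nonneg by (metis real_sqrt_unique)
qed

lemma C1c_convection:
  fixes v :: "space \<Rightarrow> space"
  assumes "C1c v" shows "AE x in lebesgue. (\<forall>i. wpartial i v x = partial i v x) \<and> convection v x = self_adv v x"
proof -
  have "AE x in lebesgue. \<forall>i. wpartial i v x = partial i v x"
    unfolding AE_all_countable using C1c_wpartial[OF assms] by blast
  then show ?thesis by eventually_elim (simp add: convection_def self_adv_def)
qed

lemma zero_L2_sigma: "(\<lambda>x. 0) \<in> L2_sigma"
  by (simp add: L2_sigma_def Lp_2_iff)

section \<open>The glued field at good times, and the energy equality\<close>

context cascade
begin

abbreviation V :: "space \<times> real \<Rightarrow> space" where "V \<equiv> glue B"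
abbreviation f :: "space \<times> real \<Rightarrow> space" where "f \<equiv> glue fB"

definition force :: "real \<Rightarrow> (space \<Rightarrow> space) \<Rightarrow> real" where
  "force t u = L2_inner (slice f t) u"

text \<open>One n serves for all the glued fields, since their k-th terms vanish outside the same
  window.\<close>

lemma goodE:
  assumes "good t"
  obtains n where "\<And>m. n \<le> m \<Longrightarrow> slice V t = slice (part m B) t" "\<And>m. n \<le> m \<Longrightarrow> slice (glue TB) t = slice (part m TB) t"
    "\<And>m. n \<le> m \<Longrightarrow> slice (glue LB) t = slice (part m LB) t" "\<And>m. n \<le> m \<Longrightarrow> slice (glue AB) t = slice (part m AB) t"
    "\<And>m. n \<le> m \<Longrightarrow> slice f t = slice (part m fB) t" "\<And>m i. n \<le> m \<Longrightarrow> slice (glue (DB i)) t = slice (part m (DB i)) t"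
proof -
  obtain n where n: "\<And>k. k \<ge> n \<Longrightarrow> t \<notin> win k" using assms by (auto simp: good_def)
  show thesis
    by (rule that[of n]; rule ext; rule glue_part[OF _ n]; (rule localized_B localized_fB | assumption))
qed

lemma part_slice_cont:
  fixes U :: "nat \<Rightarrow> space \<times> real \<Rightarrow> space"
  assumes "\<And>k. smooth (U k)" shows "continuous_on UNIV (slice (part n U) t)"
proof -
  have "continuous_on UNIV (slice (U k) t)" for k
    by (rule continuous_on_compose2[OF smooth_imp_continuous[OF assms]]) (auto intro!: continuous_intros)
  then show ?thesis unfolding part_def by (intro continuous_on_sum)
qed

lemma smooth_fB: "smooth (fB k)"
  unfolding fB_def[abs_def] by (intro smooth_add smooth_diff smooth_B)

lemma part_integrable:
  fixes U :: "nat \<Rightarrow> space \<times> real \<Rightarrow> space"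
  assumes "\<And>k. smooth (U k)" "localized U" "continuous_on UNIV \<phi>"
  shows "integrable lebesgue (\<lambda>x. part n U (x, t) \<bullet> \<phi> x)"
  by (rule integrable_inner_compact_support[OF part_slice_cont[OF assms(1)] assms(3) compact_support_part[OF assms(2)]])

text \<open>\<psi> stands for the time derivative of the test field. The terms with
  \<open>TB\<close> and \<psi> are kept as a separate sum because they cancel only after integration
  in time.\<close>

lemma weak_identity_part:
  fixes \<phi> \<psi> :: "space \<Rightarrow> space"
  assumes \<phi>: "\<And>x. \<phi> differentiable (at x)" "\<And>i. continuous_on UNIV (partial i \<phi>)" and \<psi>: "continuous_on UNIV \<psi>"
  shows "(\<integral>x. (\<Sum>i\<in>UNIV. wpartial i (slice (part n B) t) x \<bullet> partial i \<phi> x) + convection (slice (part n B) t) x \<bullet> \<phi> x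
      - part n B (x, t) \<bullet> \<psi> x \<partial>lebesgue)
    = (\<integral>x. part n fB (x, t) \<bullet> \<phi> x \<partial>lebesgue) - ((\<integral>x. part n TB (x, t) \<bullet> \<phi> x \<partial>lebesgue) + (\<integral>x. part n B (x, t) \<bullet> \<psi> x \<partial>lebesgue))"
proof -
  let ?v = "slice (part n B) t"
  note v = smooth_slice_part(1)[of n t] compact_support_part[OF localized_B(1)]
  have \<phi>c: "continuous_on UNIV \<phi>"
    using \<phi>(1) by (auto intro!: continuous_at_imp_continuous_on differentiable_imp_continuous_within)
  have gi: "integrable lebesgue (\<lambda>x. partial i ?v x \<bullet> partial i \<phi> x)" for i by (rule green1_int(1)[OF v \<phi>])
  have i: "integrable lebesgue (\<lambda>x. part n AB (x, t) \<bullet> \<phi> x)" "integrable lebesgue (\<lambda>x. part n B (x, t) \<bullet> \<psi> x)"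
    "integrable lebesgue (\<lambda>x. part n TB (x, t) \<bullet> \<phi> x)" "integrable lebesgue (\<lambda>x. part n LB (x, t) \<bullet> \<phi> x)"
    by (rule part_integrable; rule smooth_B localized_B \<phi>c \<psi>)+
  let ?g = "\<lambda>x. (\<Sum>i\<in>UNIV. partial i ?v x \<bullet> partial i \<phi> x) + part n AB (x, t) \<bullet> \<phi> x - part n B (x, t) \<bullet> \<psi> x"
  have gint: "integrable lebesgue ?g"
    by (intro Bochner_Integration.integrable_add Bochner_Integration.integrable_diff Bochner_Integration.integrable_sum gi i)
  have ae: "AE x in lebesgue. (\<Sum>i\<in>UNIV. wpartial i ?v x \<bullet> partial i \<phi> x) + convection ?v x \<bullet> \<phi> x - part n B (x, t) \<bullet> \<psi> x = ?g x"
    using C1c_convection[OF C1c_part(1)[of n t]] by eventually_elim (simp add: self_adv_part)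
  have gs: "integrable lebesgue (\<lambda>x. \<Sum>i\<in>UNIV. partial i ?v x \<bullet> partial i \<phi> x)"
    by (rule Bochner_Integration.integrable_sum) (rule gi)
  have g1: "(\<integral>x. (\<Sum>i\<in>UNIV. partial i ?v x \<bullet> partial i \<phi> x) \<partial>lebesgue) = - (\<integral>x. part n LB (x, t) \<bullet> \<phi> x \<partial>lebesgue)"
    using green1[OF v \<phi>] by (simp add: laplacian_part)
  have "(\<integral>x. ?g x \<partial>lebesgue) = - (\<integral>x. part n LB (x, t) \<bullet> \<phi> x \<partial>lebesgue) + (\<integral>x. part n AB (x, t) \<bullet> \<phi> x \<partial>lebesgue)
      - (\<integral>x. part n B (x, t) \<bullet> \<psi> x \<partial>lebesgue)"
    unfolding g1[symmetric] using i gs by simp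
  moreover have "(\<integral>x. part n fB (x, t) \<bullet> \<phi> x \<partial>lebesgue) = (\<integral>x. part n TB (x, t) \<bullet> \<phi> x \<partial>lebesgue)
     - (\<integral>x. part n LB (x, t) \<bullet> \<phi> x \<partial>lebesgue) + (\<integral>x. part n AB (x, t) \<bullet> \<phi> x \<partial>lebesgue)"
    using i by (simp add: part_fB inner_add_left inner_diff_left)
  ultimately show ?thesis using integral_cong_AE_lebesgue(1)[OF ae gint] by simp
qed

lemma weak_identity:
  fixes \<phi> \<psi> :: "space \<Rightarrow> space"
  assumes t: "good t"
    and \<phi>: "\<And>x. \<phi> differentiable (at x)" "\<And>i. continuous_on UNIV (partial i \<phi>)" and \<psi>: "continuous_on UNIV \<psi>"
  shows "(\<integral>x. (\<Sum>i\<in>UNIV. wpartial i (slice V t) x \<bullet> partial i \<phi> x) + convection (slice V t) x \<bullet> \<phi> x - V (x, t) \<bullet> \<psi> x \<partial>lebesgue)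
    = (\<integral>x. f (x, t) \<bullet> \<phi> x \<partial>lebesgue) - ((\<integral>x. glue TB (x, t) \<bullet> \<phi> x \<partial>lebesgue) + (\<integral>x. V (x, t) \<bullet> \<psi> x \<partial>lebesgue))"
proof -
  obtain n where n: "\<And>m. n \<le> m \<Longrightarrow> slice V t = slice (part m B) t" "\<And>m. n \<le> m \<Longrightarrow> slice (glue TB) t = slice (part m TB) t"
    "\<And>m. n \<le> m \<Longrightarrow> slice f t = slice (part m fB) t" by (rule goodE[OF t]) (rule that)
  show ?thesis
    using weak_identity_part[OF \<phi> \<psi>, of n t] fun_cong[OF n(1)[OF order_refl]] fun_cong[OF n(2)[OF order_refl]] fun_cong[OF n(3)[OF order_refl]]
    by simp
qed

text \<open>The same balance with both derivatives of the Laplacian on the test field, as the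
  distributional momentum equation has it.\<close>

lemma pressure_identity:
  fixes \<phi> \<psi> :: "space \<Rightarrow> space"
  assumes t: "good t" and \<phi>: "smooth \<phi>" and \<psi>: "continuous_on UNIV \<psi>"
  shows "(\<integral>x. - (V (x, t) \<bullet> \<psi> x) - V (x, t) \<bullet> laplacian \<phi> x + convection (slice V t) x \<bullet> \<phi> x \<partial>lebesgue)
    = (\<integral>x. f (x, t) \<bullet> \<phi> x \<partial>lebesgue) - ((\<integral>x. glue TB (x, t) \<bullet> \<phi> x \<partial>lebesgue) + (\<integral>x. V (x, t) \<bullet> \<psi> x \<partial>lebesgue))"
proof -
  obtain n where n: "\<And>m. n \<le> m \<Longrightarrow> slice V t = slice (part m B) t" "\<And>m. n \<le> m \<Longrightarrow> slice (glue TB) t = slice (part m TB) t"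
    "\<And>m. n \<le> m \<Longrightarrow> slice f t = slice (part m fB) t" by (rule goodE[OF t]) (rule that)
  let ?v = "slice (part n B) t"
  note v = smooth_slice_part(1)[of n t] compact_support_part[OF localized_B(1)]
  have \<phi>c: "continuous_on UNIV \<phi>" by (rule smooth_imp_continuous[OF \<phi>])
  have i: "integrable lebesgue (\<lambda>x. part n AB (x, t) \<bullet> \<phi> x)" "integrable lebesgue (\<lambda>x. part n B (x, t) \<bullet> \<psi> x)"
    "integrable lebesgue (\<lambda>x. part n TB (x, t) \<bullet> \<phi> x)" "integrable lebesgue (\<lambda>x. part n LB (x, t) \<bullet> \<phi> x)"
    by (rule part_integrable; rule smooth_B localized_B \<phi>c \<psi>)+
  have j: "integrable lebesgue (\<lambda>x. part n B (x, t) \<bullet> laplacian \<phi> x)" by (rule green2(2)[OF v \<phi>])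
  have k: "(\<integral>x. part n B (x, t) \<bullet> laplacian \<phi> x \<partial>lebesgue) = (\<integral>x. part n LB (x, t) \<bullet> \<phi> x \<partial>lebesgue)"
    using green2(1)[OF v \<phi>] by (simp add: laplacian_part)
  let ?g = "\<lambda>x. - (part n B (x, t) \<bullet> \<psi> x) - part n B (x, t) \<bullet> laplacian \<phi> x + part n AB (x, t) \<bullet> \<phi> x"
  have gint: "integrable lebesgue ?g" using i j by simp
  have ae: "AE x in lebesgue. - (part n B (x, t) \<bullet> \<psi> x) - part n B (x, t) \<bullet> laplacian \<phi> x + convection ?v x \<bullet> \<phi> x = ?g x"
    using C1c_convection[OF C1c_part(1)[of n t]] by eventually_elim (simp add: self_adv_part)
  have "(\<integral>x. ?g x \<partial>lebesgue) = - (\<integral>x. part n B (x, t) \<bullet> \<psi> x \<partial>lebesgue) - (\<integral>x. part n LB (x, t) \<bullet> \<phi> x \<partial>lebesgue)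
     + (\<integral>x. part n AB (x, t) \<bullet> \<phi> x \<partial>lebesgue)"
    unfolding k[symmetric] using i j by simp
  moreover have "(\<integral>x. part n fB (x, t) \<bullet> \<phi> x \<partial>lebesgue) = (\<integral>x. part n TB (x, t) \<bullet> \<phi> x \<partial>lebesgue)
     - (\<integral>x. part n LB (x, t) \<bullet> \<phi> x \<partial>lebesgue) + (\<integral>x. part n AB (x, t) \<bullet> \<phi> x \<partial>lebesgue)"
    using i by (simp add: part_fB inner_add_left inner_diff_left)
  ultimately show ?thesis
    using integral_cong_AE_lebesgue(1)[OF ae gint] fun_cong[OF n(1)[OF order_refl]] fun_cong[OF n(2)[OF order_refl]] fun_cong[OF n(3)[OF order_refl]]
    by simp
qed

text \<open>The force minus the convection is the time derivative minus the Laplacian of V. Both are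
  sums of swirls, hence divergence free and orthogonal to gradients; this is why the pressure 0 is
  consistent.\<close>

lemma pressure_Poisson:
  assumes t: "good t" and \<phi>: "smooth \<phi>"
  shows "force t (gradient \<phi>) = L2_inner (convection (slice V t)) (gradient \<phi>)"
proof -
  obtain n where n: "\<And>m. n \<le> m \<Longrightarrow> slice V t = slice (part m B) t"
    "\<And>m. n \<le> m \<Longrightarrow> slice f t = slice (part m fB) t" by (rule goodE[OF t]) (rule that)
  have gc: "continuous_on UNIV (gradient \<phi>)"
    unfolding gradient_def[abs_def] by (intro continuous_on_vec_lambda smooth_imp_continuous smooth_partial \<phi>)
  have i: "integrable lebesgue (\<lambda>x. part n AB (x, t) \<bullet> gradient \<phi> x)"
    "integrable lebesgue (\<lambda>x. part n TB (x, t) \<bullet> gradient \<phi> x)" "integrable lebesgue (\<lambda>x. part n LB (x, t) \<bullet> gradient \<phi> x)"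
    by (rule part_integrable; rule smooth_B localized_B gc)+
  have 0: "(\<integral>x. part n TB (x, t) \<bullet> gradient \<phi> x \<partial>lebesgue) = 0" "(\<integral>x. part n LB (x, t) \<bullet> gradient \<phi> x \<partial>lebesgue) = 0"
    by (rule divfree_gradient[OF C1c_part(2) divergence_part(2) \<phi>] divfree_gradient[OF C1c_part(3) divergence_part(3) \<phi>])+
  have ae: "AE x in lebesgue. convection (slice (part n B) t) x \<bullet> gradient \<phi> x = part n AB (x, t) \<bullet> gradient \<phi> x"
    using C1c_convection[OF C1c_part(1)[of n t]] by eventually_elim (simp add: self_adv_part)
  have "(\<integral>x. part n fB (x, t) \<bullet> gradient \<phi> x \<partial>lebesgue) = (\<integral>x. part n AB (x, t) \<bullet> gradient \<phi> x \<partial>lebesgue)"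
    using i 0 by (simp add: part_fB inner_add_left inner_diff_left)
  then show ?thesis
    using integral_cong_AE_lebesgue(1)[OF ae i(1)] n(1)[OF order_refl] fun_cong[OF n(2)[OF order_refl]]
    by (simp add: force_def L2_inner_def)
qed

text \<open>The equation paired with the partial sum itself: the convective part is orthogonal to
  it, and the Laplacian yields the Dirichlet integral.\<close>

lemma energy_identity_part:
  "(\<integral>x. part n fB (x, t) \<bullet> part n B (x, t) \<partial>lebesgue) = (\<integral>x. part n TB (x, t) \<bullet> part n B (x, t) \<partial>lebesgue)
     + (\<Sum>i\<in>UNIV. \<integral>x. (norm (part n (DB i) (x, t)))\<^sup>2 \<partial>lebesgue)"
proof -
  let ?v = "slice (part n B) t"
  note v = smooth_slice_part(1)[of n t] compact_support_part[OF localized_B(1)]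
  have vc: "continuous_on UNIV ?v" by (rule smooth_imp_continuous[OF v(1)])
  have i: "integrable lebesgue (\<lambda>x. part n AB (x, t) \<bullet> part n B (x, t))"
    "integrable lebesgue (\<lambda>x. part n TB (x, t) \<bullet> part n B (x, t))" "integrable lebesgue (\<lambda>x. part n LB (x, t) \<bullet> part n B (x, t))"
    by (rule part_integrable; rule smooth_B localized_B vc)+
  have g: "(\<integral>x. (\<Sum>i\<in>UNIV. partial i ?v x \<bullet> partial i ?v x) \<partial>lebesgue) = - (\<integral>x. part n LB (x, t) \<bullet> part n B (x, t) \<partial>lebesgue)"
    using green1[OF v smooth_imp_differentiable[OF v(1)] smooth_imp_continuous[OF smooth_partial[OF v(1)]]] by (simp add: laplacian_part)
  have gi: "integrable lebesgue (\<lambda>x. partial i ?v x \<bullet> partial i ?v x)" for i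
    by (rule green1_int(1)[OF v smooth_imp_differentiable[OF v(1)] smooth_imp_continuous[OF smooth_partial[OF v(1)]]])
  have "(\<Sum>i\<in>UNIV. \<integral>x. (norm (part n (DB i) (x, t)))\<^sup>2 \<partial>lebesgue) = - (\<integral>x. part n LB (x, t) \<bullet> part n B (x, t) \<partial>lebesgue)"
    using g unfolding Bochner_Integration.integral_sum[OF gi] by (simp add: power2_norm_eq_inner partial_part)
  moreover have "(\<integral>x. part n AB (x, t) \<bullet> part n B (x, t) \<partial>lebesgue) = 0"
    using self_adv_orthogonal[OF v divergence_part(1)] by (simp add: self_adv_part)
  ultimately show ?thesis using i by (simp add: part_fB inner_add_left inner_diff_left)
qed

text \<open>The bound does not depend on time and covers the bad times too. As 2\<delta> < 3, it is
  square integrable in space, which gives the uniform L^2 bound and a dominating function for the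
  continuity in time.\<close>

lemma V_bound: obtains C where "0 \<le> C" "\<And>x t. norm (V (x, t)) \<le> C * alpha \<delta> x" "\<And>n x t. norm (part n B (x, t)) \<le> C * alpha \<delta> x"
proof -
  obtain C where C: "C \<ge> 0" "\<And>k z. norm (B k z) \<le> C * \<epsilon> k powr (- \<delta>)" using dominated_B(1) by (auto simp: dominated_def)
  have a: "\<epsilon> k powr (- \<delta>) \<le> alpha \<delta> x" if "x \<in> blob k" for x k using alpha_in[OF that] by simp
  show thesis
    by (rule that[OF C(1)]; rule localized_bound[OF localized_B(1) C(2) C(1) a alpha_nonneg])
qed

lemma alpha_square_integrable: "integrable lborel (\<lambda>x. (C * alpha \<delta> x)\<^sup>2)"
proof -
  have "(alpha \<delta> x)\<^sup>2 = alpha (\<delta> * 2) x" for x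
    using alpha_powr[of 2 \<delta> x] alpha_nonneg[of \<delta> x] by simp
  then show ?thesis using alpha_integrable[of "\<delta> * 2"] delta by (simp add: power_mult_distrib)
qed

lemma glue_B_borel: "V \<in> borel_measurable borel" "glue TB \<in> borel_measurable borel" "f \<in> borel_measurable borel"
  "glue (DB i) \<in> borel_measurable borel" "part n B \<in> borel_measurable borel" "part n TB \<in> borel_measurable borel"
  "part n fB \<in> borel_measurable borel" "part n (DB i) \<in> borel_measurable borel"
  by (intro glue_borel part_borel localized_B localized_fB B_borel)+

lemma bounded_L2:
  fixes u :: "space \<Rightarrow> space"
  assumes "u \<in> borel_measurable borel" "\<And>x. norm (u x) \<le> C * alpha \<delta> x"
  shows "u \<in> Lp lebesgue 2" "(\<integral>x. (norm (u x))\<^sup>2 \<partial>lborel) \<le> (\<integral>x. (C * alpha \<delta> x)\<^sup>2 \<partial>lborel)" "integrable lborel (\<lambda>x. (norm (u x))\<^sup>2)"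
proof -
  have le: "(norm (u x))\<^sup>2 \<le> (C * alpha \<delta> x)\<^sup>2" for x by (rule power_mono[OF assms(2)]) simp
  have m: "(\<lambda>x. (norm (u x))\<^sup>2) \<in> borel_measurable borel" using assms(1) by simp
  show i: "integrable lborel (\<lambda>x. (norm (u x))\<^sup>2)"
    by (rule Bochner_Integration.integrable_bound[OF alpha_square_integrable]) (use m le in auto)
  show "u \<in> Lp lebesgue 2" using i assms(1) by (simp add: Lp_2_iff integrable_lebesgue_iff[OF m] measurable_completion)
  show "(\<integral>x. (norm (u x))\<^sup>2 \<partial>lborel) \<le> (\<integral>x. (C * alpha \<delta> x)\<^sup>2 \<partial>lborel)"
    by (rule integral_mono[OF i alpha_square_integrable le])
qed

lemma V_L2: "slice V t \<in> Lp lebesgue 2" "slice (part n B) t \<in> Lp lebesgue 2"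
proof -
  obtain C where C: "0 \<le> C" "\<And>x t. norm (V (x, t)) \<le> C * alpha \<delta> x" "\<And>n x t. norm (part n B (x, t)) \<le> C * alpha \<delta> x"
    by (rule V_bound, rule that)
  show "slice V t \<in> Lp lebesgue 2" "slice (part n B) t \<in> Lp lebesgue 2"
    by (rule bounded_L2[OF borel_slice_space[OF glue_B_borel(1)] C(2)] bounded_L2[OF borel_slice_space[OF glue_B_borel(5)] C(3)])+
qed

definition grad_sq :: "real \<Rightarrow> real" where
  "grad_sq t = (\<Sum>i\<in>UNIV. \<integral>x. (norm (glue (DB i) (x, t)))\<^sup>2 \<partial>lborel)"

text \<open>Inner products of glued fields are glued fields of order d + d'; the threshold 5 is 2/r
  + 3/q for r = q = 1.\<close>

lemma inner_glue_integrable: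
  fixes U W :: "nat \<Rightarrow> space \<times> real \<Rightarrow> space"
  assumes "localized U" "localized W" "dominated d U" "dominated d' W" "\<And>k. U k \<in> borel_measurable borel" "\<And>k. W k \<in> borel_measurable borel"
    and "d + d' < 5"
  shows "integrable lborel (\<lambda>z. glue U z \<bullet> glue W z)" "integrable lborel (\<lambda>z. part n U z \<bullet> part n W z)"
proof -
  let ?Z = "\<lambda>k z. U k z \<bullet> W k z"
  have Z: "localized ?Z" by (rule localized_inner[OF assms(1)])
  have m: "?Z k \<in> borel_measurable borel" for k using assms(5,6) by simp
  note i = glue_integrable[OF Z dominated_inner[OF assms(3,4)] m assms(7)]
  note p = glue_pointwise[OF assms(1,2) Z, where g="(\<bullet>)", OF refl inner_zero_left]
  have e: "glue ?Z = (\<lambda>z. glue U z \<bullet> glue W z)" "part n ?Z = (\<lambda>z. part n U z \<bullet> part n W z)"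
    by (rule ext, rename_tac z, case_tac z, simp add: p)+
  show "integrable lborel (\<lambda>z. glue U z \<bullet> glue W z)"
    using i(1) unfolding e(1) .
  show "integrable lborel (\<lambda>z. part n U z \<bullet> part n W z)"
    using i(2)[of n] unfolding e(2) .
qed

lemma grad_sq_integrable: "integrable lborel grad_sq" and part_grad_sq_integrable: "integrable lborel (\<lambda>t. \<integral>x. (norm (part n (DB i) (x, t)))\<^sup>2 \<partial>lborel)"
proof -
  have d: "(1 + \<delta>) + (1 + \<delta>) < 5" using delta by simp
  note i = inner_glue_integrable[OF localized_B(4) localized_B(4) dominated_B(4) dominated_B(4) B_borel(4) B_borel(4) d]
  show "integrable lborel grad_sq"
    unfolding grad_sq_def[abs_def] power2_norm_eq_inner
    by (rule Bochner_Integration.integrable_sum) (rule Fubini_space_time(1)[OF i(1)])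
  show "integrable lborel (\<lambda>t. \<integral>x. (norm (part n (DB i) (x, t)))\<^sup>2 \<partial>lborel)"
    unfolding power2_norm_eq_inner by (rule Fubini_space_time(1)[OF i(2)])
qed

lemma wgrad_part: "wgrad_sqnorm (slice (part n B) t) = (\<Sum>i\<in>UNIV. \<integral>x. (norm (part n (DB i) (x, t)))\<^sup>2 \<partial>lborel)"
proof -
  have m: "(\<lambda>x. (norm (part n (DB i) (x, t)))\<^sup>2) \<in> borel_measurable borel" for i
    using borel_slice_space[OF glue_B_borel(8), of n i t] by simp
  have L: "partial i (slice (part n B) t) \<in> Lp lebesgue 2" for i by (rule C1c_L2(2)[OF C1c_part(1)])
  have "(\<integral>x. (norm (wpartial i (slice (part n B) t) x))\<^sup>2 \<partial>lebesgue) = (\<integral>x. (norm (part n (DB i) (x, t)))\<^sup>2 \<partial>lebesgue)" for i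
  proof (rule integral_cong_AE_lebesgue(1))
    show "AE x in lebesgue. (norm (wpartial i (slice (part n B) t) x))\<^sup>2 = (norm (part n (DB i) (x, t)))\<^sup>2"
      using C1c_wpartial[OF C1c_part(1)[of n t], of i] by eventually_elim (simp add: partial_part)
    show "integrable lebesgue (\<lambda>x. (norm (part n (DB i) (x, t)))\<^sup>2)"
      using L[of i] by (simp add: Lp_2_iff partial_part)
  qed
  then show ?thesis by (simp add: wgrad_sqnorm_eq integral_lebesgue_eq[OF m])
qed

lemma wgrad_V: assumes "good t" shows "wgrad_sqnorm (slice V t) = grad_sq t"
proof -
  obtain n where n: "\<And>m. n \<le> m \<Longrightarrow> slice V t = slice (part m B) t"
    "\<And>m i. n \<le> m \<Longrightarrow> slice (glue (DB i)) t = slice (part m (DB i)) t" by (rule goodE[OF assms]) (rule that)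
  show ?thesis unfolding n(1)[OF order_refl] wgrad_part grad_sq_def using fun_cong[OF n(2)[OF order_refl]] by simp
qed

lemma force_V: assumes "good t"
  shows "force t (slice V t) = (\<integral>x. V (x, t) \<bullet> glue TB (x, t) \<partial>lborel) + grad_sq t"
proof -
  obtain n where n: "\<And>m. n \<le> m \<Longrightarrow> slice V t = slice (part m B) t" "\<And>m. n \<le> m \<Longrightarrow> slice (glue TB) t = slice (part m TB) t"
    "\<And>m. n \<le> m \<Longrightarrow> slice f t = slice (part m fB) t" 
    "\<And>m i. n \<le> m \<Longrightarrow> slice (glue (DB i)) t = slice (part m (DB i)) t" by (rule goodE[OF assms]) (rule that)
  have m: "(\<lambda>x. (norm (part n (DB i) (x, t)))\<^sup>2) \<in> borel_measurable borel" for i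
    using borel_slice_space[OF glue_B_borel(8), of n i t] by simp
  have m': "(\<lambda>x. part n B (x, t) \<bullet> part n TB (x, t)) \<in> borel_measurable borel"
    using borel_slice_space[OF glue_B_borel(5), of n t] borel_slice_space[OF glue_B_borel(6), of n t] by simp
  show ?thesis
    using energy_identity_part[of n t] fun_cong[OF n(1)[OF order_refl]] fun_cong[OF n(2)[OF order_refl]] fun_cong[OF n(3)[OF order_refl]]
      fun_cong[OF n(4)[OF order_refl]] 
    by (simp add: force_def L2_inner_def grad_sq_def integral_lebesgue_eq[OF m] inner_commute[of "part n TB _"] integral_lebesgue_eq[OF m'])
qed

text \<open>For fixed x the field is one swirl, so the fundamental theorem of calculus applies to
  its squared norm on [0, t] for every t, good or bad. Integration over x and the energy identity at
  good times do the rest.\<close>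

lemma energy_equality:
  assumes t: "0 < t"
  shows "energy_lhs V t = energy_rhs (\<lambda>x. 0) force V t"
proof -
  have d: "\<delta> + (2 + \<delta>) < 5" using delta by simp
  have i0: "integrable lborel (\<lambda>z. V z \<bullet> glue TB z)"
    by (rule inner_glue_integrable(1)[OF localized_B(1,2) dominated_B(1,2) B_borel(1,2) d])
  define H where "H z = indicator (UNIV \<times> {0<..<t}) z * (V z \<bullet> glue TB z)" for z
  have Hi: "integrable lborel H"
    unfolding H_def by (rule integrable_real_mult_indicator[OF _ i0, unfolded mult.commute[of _ "indicator _ _"]]) (simp add: open_Times borel_open)
  have Hs: "H (x, s) = (if s \<in> {0<..<t} then V (x, s) \<bullet> glue TB (x, s) else 0)" for x s by (simp add: H_def)
  have hi: "((\<lambda>s. H (x, s)) has_integral (1/2) * (norm (V (x, t)))\<^sup>2) UNIV" for x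
  proof -
    have "((\<lambda>s. V (x, s) \<bullet> glue TB (x, s)) has_integral ((1/2) * (V (x, t) \<bullet> V (x, t)) - (1/2) * (V (x, 0) \<bullet> V (x, 0)))) {0..t}"
    proof (rule fundamental_theorem_of_calculus)
      fix s
      have "((\<lambda>s. V (x, s) \<bullet> V (x, s)) has_vector_derivative (V (x, s) \<bullet> glue TB (x, s) + glue TB (x, s) \<bullet> V (x, s))) (at s)"
        by (rule bounded_bilinear.has_vector_derivative[OF bounded_bilinear_inner glue_time_deriv glue_time_deriv])
      then have "((\<lambda>s. V (x, s) \<bullet> V (x, s)) has_real_derivative 2 * (V (x, s) \<bullet> glue TB (x, s))) (at s)"
        by (simp add: has_real_derivative_iff_has_vector_derivative inner_commute)
      from DERIV_cmult[OF this, of "1/2"]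
      have "((\<lambda>s. (1/2) * (V (x, s) \<bullet> V (x, s))) has_vector_derivative V (x, s) \<bullet> glue TB (x, s)) (at s)"
        by (simp add: has_real_derivative_iff_has_vector_derivative)
      then show "((\<lambda>s. (1/2) * (V (x, s) \<bullet> V (x, s))) has_vector_derivative V (x, s) \<bullet> glue TB (x, s)) (at s within {0..t})"
        by (rule has_vector_derivative_at_within)
    qed (use t in simp)
    moreover have "V (x, 0) = 0" by (rule early_0(1)[OF localized_B(1)]) (use t0(1) in simp)
    ultimately have "((\<lambda>s. V (x, s) \<bullet> glue TB (x, s)) has_integral (1/2) * (norm (V (x, t)))\<^sup>2) {0<..<t}"
      by (simp add: has_integral_Icc_iff_Ioo power2_norm_eq_inner)
    then show ?thesis unfolding Hs by (simp only: has_integral_restrict_UNIV)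
  qed
  have "AE x in lborel. (\<integral>s. H (x, s) \<partial>lborel) = (1/2) * (norm (V (x, t)))\<^sup>2"
    using Fubini_space_time(6)[OF Hi]
  proof eventually_elim
    case (elim x)
    from has_integral_integral_lborel[OF elim] hi[of x] show ?case by (rule has_integral_unique)
  qed
  then have "(\<integral>x. (\<integral>s. H (x, s) \<partial>lborel) \<partial>lborel) = (\<integral>x. (1/2) * (norm (V (x, t)))\<^sup>2 \<partial>lborel)"
    using borel_slice_space[OF glue_B_borel(1), of t] Fubini_space_time(3)[OF Hi] by (intro integral_cong_AE) auto
  then have e1: "(\<integral>s. (\<integral>x. H (x, s) \<partial>lborel) \<partial>lborel) = (1/2) * (\<integral>x. (norm (V (x, t)))\<^sup>2 \<partial>lborel)"
    by (simp add: Fubini_space_time(2,4)[OF Hi])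
  have gi: "integrable lborel (\<lambda>s. indicator {0<..<t} s * grad_sq s)"
    using integrable_real_mult_indicator[OF _ grad_sq_integrable, of "{0<..<t}"] by (simp add: mult.commute)
  have a1: "AE s in lborel. s \<in> {0<..<t} \<longrightarrow> wgrad_sqnorm (slice V s) = indicator {0<..<t} s * grad_sq s"
    using AE_good by eventually_elim (simp add: wgrad_V)
  have e2: "(LINT s:{0<..<t}|lebesgue. wgrad_sqnorm (slice V s)) = (\<integral>s. indicator {0<..<t} s * grad_sq s \<partial>lborel)"
    by (rule set_integral_lebesgue_indicator(2)[OF gi a1]) simp
  have a2: "AE s in lborel. s \<in> {0<..<t} \<longrightarrow> force s (slice V s) = (\<integral>x. H (x, s) \<partial>lborel) + indicator {0<..<t} s * grad_sq s"
    using AE_good by eventually_elim (simp add: force_V Hs)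
  have H0: "(\<integral>x. H (x, s) \<partial>lborel) = 0" if "s \<notin> {0<..<t}" for s unfolding Hs if_not_P[OF that] by simp
  have "(LINT s:{0<..<t}|lebesgue. force s (slice V s)) = (\<integral>s. (\<integral>x. H (x, s) \<partial>lborel) + indicator {0<..<t} s * grad_sq s \<partial>lborel)"
    by (rule set_integral_lebesgue_indicator(2)[OF Bochner_Integration.integrable_add[OF Fubini_space_time(1)[OF Hi] gi] a2])
      (use H0 in simp)
  then have e3: "(LINT s:{0<..<t}|lebesgue. force s (slice V s)) = (1/2) * (\<integral>x. (norm (V (x, t)))\<^sup>2 \<partial>lborel) + (\<integral>s. indicator {0<..<t} s * grad_sq s \<partial>lborel)"
    using Fubini_space_time(1)[OF Hi] gi by (simp add: e1)
  have m: "(\<lambda>x. (norm (V (x, t)))\<^sup>2) \<in> borel_measurable borel" using borel_slice_space[OF glue_B_borel(1), of t] by simp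
  show ?thesis
    unfolding energy_lhs_def energy_rhs_def e2 e3 Lp_norm_2_square integral_lebesgue_eq[OF m] by simp
qed

end

lemma set_integral_cong_AE_lebesgue:
  fixes g h :: "real \<Rightarrow> real"
  assumes "set_integrable lebesgue A h" "AE t in lebesgue. t \<in> A \<longrightarrow> g t = h t"
  shows "(LINT t:A|lebesgue. g t) = (LINT t:A|lebesgue. h t)" "set_integrable lebesgue A g"
proof -
  have ae: "AE t in lebesgue. indicator A t *\<^sub>R g t = indicator A t *\<^sub>R h t"
    using assms(2) by eventually_elim (auto simp: indicator_def)
  have i: "integrable lebesgue (\<lambda>t. indicator A t *\<^sub>R h t)" using assms(1) by (simp add: set_integrable_def)
  show "(LINT t:A|lebesgue. g t) = (LINT t:A|lebesgue. h t)" "set_integrable lebesgue A g"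
    using integral_cong_AE_lebesgue[OF ae i] by (simp_all add: set_lebesgue_integral_def set_integrable_def)
qed

lemma sol_test_fun_slab:
  assumes "\<phi> \<in> sol_test_fun S" "0 < S"
  obtains K where "slab_test \<phi> S K"
proof -
  obtain K where K: "compact K" "K \<subseteq> UNIV \<times> {0..<S}" "\<forall>x \<in> UNIV \<times> {0..<S} - K. \<phi> x = 0"
    and s: "smooth_on (UNIV \<times> {0..<S}) \<phi>" using assms(1) by (auto simp: sol_test_fun_def)
  have o: "open (UNIV \<times> {0<..<S} :: (space \<times> real) set)" by (intro open_Times) auto
  have "slab_test \<phi> S K"
  proof
    fix k show "Ck_open k (UNIV \<times> {0<..<S}) \<phi>"
    proof (rule Ck_open_local[OF o])
      fix z :: "space \<times> real" assume "z \<in> UNIV \<times> {0<..<S}"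
      then have "z \<in> UNIV \<times> {0..<S}" by auto
      then obtain N v where N: "z \<in> N" "smooth_open N v" "\<forall>y\<in>UNIV \<times> {0..<S} \<inter> N. v y = \<phi> y"
        using s unfolding smooth_on_def by meson
      have "\<forall>y\<in>UNIV \<times> {0<..<S} \<inter> N. v y = \<phi> y" using N(3) by force
      then show "\<exists>N v. open N \<and> z \<in> N \<and> Ck_open k N v \<and> (\<forall>y\<in>UNIV \<times> {0<..<S} \<inter> N. v y = \<phi> y)"
        using N(1,2) by (intro exI[of _ N] exI[of _ v]) (simp add: smooth_open_def)
    qed
  next
    fix z assume "z \<in> (UNIV :: space set) \<times> {0<..<S}" "z \<notin> K"
    then show "\<phi> z = 0" using K(3) by (cases z) auto
  qed (use K assms(2) in auto)
  then show thesis by (rule that)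
qed

lemma test_fun_slab:
  fixes \<phi> :: "space \<times> real \<Rightarrow> space"
  assumes "\<phi> \<in> test_fun (UNIV \<times> {0<..})"
  obtains S K where "slab_test \<phi> S K" "\<And>x t. S \<le> t \<Longrightarrow> \<phi> (x, t) = 0" "\<And>x t. S \<le> t \<Longrightarrow> time_deriv \<phi> (x, t) = 0" "smooth \<phi>"
proof -
  obtain K where K: "smooth \<phi>" "compact K" "K \<subseteq> UNIV \<times> {0<..}" "\<And>z. z \<notin> K \<Longrightarrow> \<phi> z = 0"
    using assms by (rule test_funD) (rule that)
  obtain S where S: "S > 0" "\<And>z. z \<in> K \<Longrightarrow> snd z < S"
  proof -
    have "bounded (snd ` K)" by (intro compact_imp_bounded compact_continuous_image K(2) continuous_on_snd continuous_on_id)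
    then obtain b where b: "\<forall>y\<in>snd ` K. norm y \<le> b" "b > 0" using bounded_pos by blast
    show thesis
    proof (rule that[of "b + 1"])
      show "snd z < b + 1" if "z \<in> K" for z
      proof -
        have "\<bar>snd z\<bar> \<le> b" using b(1) that by (auto simp: real_norm_def)
        then show ?thesis by simp
      qed
    qed (use b in simp)
  qed
  have nK: "(x, t) \<notin> K" if "S \<le> t" for x t using S(2)[of "(x, t)"] that by auto
  show thesis
  proof (rule that[of S K])
    show "slab_test \<phi> S K"
    proof
      show "K \<subseteq> UNIV \<times> {0..<S}"
      proof
        fix z assume z: "z \<in> K"
        then have "0 < snd z" "snd z < S" using K(3) S(2) by auto
        then show "z \<in> UNIV \<times> {0..<S}" by (cases z) auto
      qed
      show "Ck_open k (UNIV \<times> {0<..<S}) \<phi>" for k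
        using K(1) Ck_open_subset[of k UNIV \<phi> "UNIV \<times> {0<..<S}"] by (simp add: smooth_open_def)
    qed (use S K in auto)
    show "\<phi> (x, t) = 0" if "S \<le> t" for x t using K(4)[OF nK[OF that]] .
    show "time_deriv \<phi> (x, t) = 0" if "S \<le> t" for x t
      unfolding time_deriv_def by (rule dir_deriv_outside[OF compact_imp_closed[OF K(2)] K(4) nK[OF that]])
  qed (rule K(1))
qed

lemma smooth_slice:
  fixes \<phi> :: "space \<times> real \<Rightarrow> space"
  assumes "smooth \<phi>" shows "smooth (slice \<phi> t)"
proof -
  have "Ck_open k UNIV (slice \<phi> t)" if "smooth \<phi>" for k and \<phi> :: "space \<times> real \<Rightarrow> space"
    using that
  proof (induction k arbitrary: \<phi>)
    case 0
    have "continuous_on UNIV (slice \<phi> t)"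
      by (rule continuous_on_compose2[OF smooth_imp_continuous[OF 0]]) (auto intro!: continuous_intros)
    then show ?case by simp
  next
    case (Suc k)
    show ?case
    proof (rule Ck_open_SucI[where u'="\<lambda>x b. dir_deriv (b, 0) \<phi> (x, t)"])
      fix x
      show "(slice \<phi> t has_derivative (\<lambda>b. dir_deriv (b, 0) \<phi> (x, t))) (at x)"
        by (rule has_derivative_compose[OF _ has_derivative_dir_deriv[OF smooth_imp_differentiable[OF Suc.prems]]])
          (auto intro!: derivative_eq_intros)
    next
      fix b :: space assume b: "b \<in> Basis"
      have "smooth (dir_deriv (b, 0) \<phi>)" by (rule smooth_dir_deriv[OF Suc.prems]) (use b in \<open>auto simp: Basis_prod_def\<close>)
      from Suc.IH[OF this] show "Ck_open k UNIV (\<lambda>x. dir_deriv (b, 0) \<phi> (x, t))" .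
    qed simp
  qed
  with assms show ?thesis by (simp add: smooth_open_def)
qed

section \<open>The glued field as a continuous Leray-Hopf solution with zero pressure\<close>

context cascade
begin

lemma glue_B_integrable: "integrable lborel V" "integrable lborel (glue TB)" "integrable lborel f"
  "integrable lborel (part n B)" "integrable lborel (part n TB)" "integrable lborel (part n fB)"
proof -
  have d: "\<delta> < 5" "2 + \<delta> < 5" using delta by simp_all
  note i1 = glue_integrable[OF localized_B(1) dominated_B(1) B_borel(1) d(1)]
  note i2 = glue_integrable[OF localized_B(2) dominated_B(2) B_borel(2) d(2)]
  note i3 = glue_integrable[OF localized_fB dominated_fB B_borel(6) d(2)]
  show "integrable lborel V" "integrable lborel (glue TB)" "integrable lborel f"
    "integrable lborel (part n B)" "integrable lborel (part n TB)" "integrable lborel (part n fB)"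
    by (rule i1 i2 i3)+
qed

lemma half_t0: "0 < t0 / 2" using t0(1) by simp

lemma force_slice: "force t (slice \<phi> t) = (\<integral>x. f (x, t) \<bullet> \<phi> (x, t) \<partial>lebesgue)"
  by (simp add: force_def L2_inner_def)

lemma AE_good_lebesgue: "AE t in lebesgue. good t"
  by (rule AE_completion[OF AE_good])

text \<open>Shared by the weak formulation and the distributional momentum equation: I is the space
  integral of either at time t. The two subtracted terms have total time integral 0 by
  \<open>time_parts\<close>.\<close>

lemma weak_formulation_slab:
  assumes sl: "slab_test \<phi> S K"
    and I: "\<And>t. good t \<Longrightarrow> t \<in> {0<..<S} \<Longrightarrow> I t = (\<integral>x. f (x, t) \<bullet> \<phi> (x, t) \<partial>lebesgue)
      - ((\<integral>x. glue TB (x, t) \<bullet> \<phi> (x, t) \<partial>lebesgue) + (\<integral>x. V (x, t) \<bullet> time_deriv \<phi> (x, t) \<partial>lebesgue))"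
  shows "(LINT t:{0<..<S}|lebesgue. I t) = (LINT t:{0<..<S}|lebesgue. force t (slice \<phi> t))"
proof -
  interpret slab_test \<phi> S K by (rule sl)
  have h1: "time_deriv \<phi> z = 0" if "z \<in> slab" "z \<notin> K" for z
    unfolding time_deriv_def by (rule vanish_dir_deriv[OF that])
  note p1 = pairing[OF glue_B_integrable(3) half_t0 early_0(1)[OF localized_fB] cont(1) vanish]
  note p2 = pairing[OF glue_B_integrable(2) half_t0 early_0(1)[OF localized_B(2)] cont(1) vanish]
  note p3 = pairing[OF glue_B_integrable(1) half_t0 early_0(1)[OF localized_B(1)] cont(2) h1]
  let ?a = "\<lambda>t. \<integral>x. f (x, t) \<bullet> \<phi> (x, t) \<partial>lebesgue"
  let ?b = "\<lambda>t. \<integral>x. glue TB (x, t) \<bullet> \<phi> (x, t) \<partial>lebesgue"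
  let ?c = "\<lambda>t. \<integral>x. V (x, t) \<bullet> time_deriv \<phi> (x, t) \<partial>lebesgue"
  have i: "set_integrable lebesgue {0<..<S} (\<lambda>t. ?b t + ?c t)" by (rule set_integral_add(1)[OF p2(2) p3(2)])
  have ae: "AE t in lebesgue. t \<in> {0<..<S} \<longrightarrow> I t = ?a t - (?b t + ?c t)"
    using AE_good_lebesgue by eventually_elim (simp add: I)
  have "(LINT t:{0<..<S}|lebesgue. I t) = (LINT t:{0<..<S}|lebesgue. ?a t - (?b t + ?c t))"
    by (rule set_integral_cong_AE_lebesgue(1)[OF set_integral_diff(1)[OF p1(2) i] ae])
  also have "\<dots> = (LINT t:{0<..<S}|lebesgue. ?a t) - ((LINT t:{0<..<S}|lebesgue. ?b t) + (LINT t:{0<..<S}|lebesgue. ?c t))"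
    using set_integral_diff(2)[OF p1(2) i] set_integral_add(2)[OF p2(2) p3(2)] by linarith
  also have "(LINT t:{0<..<S}|lebesgue. ?b t) + (LINT t:{0<..<S}|lebesgue. ?c t) = 0"
    by (rule time_parts[OF glue_B_integrable(1,2) half_t0 early_0(1)[OF localized_B(1)] early_0(1)[OF localized_B(2)] glue_time_deriv])
  finally show ?thesis by (simp add: force_slice)
qed

lemma good_C1c: assumes "good t" shows "C1c (slice V t)" "slice V t \<in> L2_sigma" "slice V t \<in> H1"
  "\<exists>C. \<forall>x. norm (V (x, t)) \<le> C" "loc_integrable UNIV (slice f t)"
proof -
  obtain n where n: "\<And>m. n \<le> m \<Longrightarrow> slice V t = slice (part m B) t"
    "\<And>m. n \<le> m \<Longrightarrow> slice f t = slice (part m fB) t" by (rule goodE[OF assms]) (rule that)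
  show c: "C1c (slice V t)" unfolding n(1)[OF order_refl] by (rule C1c_part)
  show "slice V t \<in> L2_sigma" unfolding n(1)[OF order_refl] by (rule divfree_L2_sigma[OF C1c_part(1) divergence_part(1)])
  show "slice V t \<in> H1" by (rule C1c_H1[OF c])
  obtain K where K: "compact K" "\<And>x. x \<notin> K \<Longrightarrow> V (x, t) = 0" using c by (auto simp: C1c_def)
  show "\<exists>C. \<forall>x. norm (V (x, t)) \<le> C"
  proof -
    obtain C where "\<And>x. norm (V (x, t)) \<le> C"
      by (rule continuous_compact_support_bounded[OF C1c_cont[OF c] K], assumption) (rule that)
    then show ?thesis by blast
  qed
  show "loc_integrable UNIV (slice f t)" unfolding n(2)[OF order_refl]
    by (rule loc_integrable_L2[OF compact_support_Lp_2[OF part_slice_cont[OF smooth_fB] compact_support_part[OF localized_fB]]])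
qed

lemma same_force: "same_force f force"
  unfolding same_force_def
proof (rule AE_lborel_lebesgue_on)
  show "AE t in lborel. loc_integrable UNIV (slice f t) \<and> (\<forall>\<phi>\<in>test_fun UNIV. force t \<phi> = L2_inner (slice f t) \<phi>)"
    using AE_good by eventually_elim (simp add: good_C1c force_def)
qed simp

lemma f_LrLq: "0 < r \<Longrightarrow> 0 < q \<Longrightarrow> 2 + \<delta> < 2 / r + 3 / q \<Longrightarrow> f \<in> LrLq (ennreal r) (ennreal q) S"
  by (rule glue_LrLq[OF localized_fB dominated_fB B_borel(6)])

lemma V_LrLq: "0 < r \<Longrightarrow> 0 < q \<Longrightarrow> \<delta> < 2 / r + 3 / q \<Longrightarrow> V \<in> LrLq (ennreal r) (ennreal q) S"
  by (rule glue_LrLq[OF localized_B(1) dominated_B(1) B_borel(1)])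

lemma f_L1L2: "f \<in> LrLq 1 2 S"
  using f_LrLq[of 1 2 S] delta by (simp add: ennreal_numeral)

text \<open>The force has order 2 + \<delta> < 2/1 + 3/2, so it lies in L^1(0,S;L^2), and the
  summand with values in H^-1 can be 0.\<close>

lemma force_forcing: "force \<in> forcing S"
  unfolding forcing_def mem_Collect_eq
proof (intro exI conjI)
  have "(\<lambda>u. 0) \<in> Hm1" unfolding Hm1_def by (simp, rule exI[of _ 0], simp)
  then show "(\<lambda>t u. 0) \<in> L2Hm1 S" unfolding L2Hm1_def by (simp add: Lp_lebesgue_on_const)
  show "f \<in> LrLq 1 2 S" by (rule f_L1L2)
  show "AE t in lebesgue_on {0<..<S}. \<forall>u\<in>H1. force t u = 0 + L2_inner (slice f t) u" by (simp add: force_def)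
qed

lemma V_sq_borel: "(\<lambda>t. \<integral>x. (norm (V (x, t)))\<^sup>2 \<partial>lborel) \<in> borel_measurable borel"
proof (rule borel_integral_space[of "\<lambda>z. (norm (V z))\<^sup>2"])
  show "(\<lambda>z. (norm (V z))\<^sup>2) \<in> borel_measurable borel" using glue_B_borel(1) by simp
qed

lemma Lp_norm_V: "Lp_norm lebesgue 2 (slice V t) = sqrt (\<integral>x. (norm (V (x, t)))\<^sup>2 \<partial>lborel)"
  by (rule Lp_norm_2_sqrt[OF borel_slice_space[OF glue_B_borel(1)]])

lemma borel_lebesgue_on: "h \<in> borel_measurable borel \<Longrightarrow> h \<in> borel_measurable (lebesgue_on A)" 
  for h :: "'a::euclidean_space \<Rightarrow> 'b::topological_space"
  by (intro measurable_restrict_space1 measurable_completion) simp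

lemma V_bochner_inf: "V \<in> bochner \<infinity> S L2_sigma (Lp_norm lebesgue 2)"
  unfolding bochner_def mem_Collect_eq
proof (intro conjI)
  show "V \<in> borel_measurable (lebesgue_on (UNIV \<times> {0<..<S}))" by (rule borel_lebesgue_on[OF glue_B_borel(1)])
  show "AE t in lebesgue_on {0<..<S}. slice V t \<in> L2_sigma"
    by (rule AE_lborel_lebesgue_on) (use AE_good good_C1c(2) in auto)
  obtain C where C: "0 \<le> C" "\<And>x t. norm (V (x, t)) \<le> C * alpha \<delta> x" "\<And>n x t. norm (part n B (x, t)) \<le> C * alpha \<delta> x"
    by (rule V_bound, rule that)
  have "norm (Lp_norm lebesgue 2 (slice V t)) \<le> sqrt (\<integral>x. (C * alpha \<delta> x)\<^sup>2 \<partial>lborel)" for t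
    unfolding Lp_norm_V using bounded_L2(2)[OF borel_slice_space[OF glue_B_borel(1)] C(2)] by simp
  moreover have "(\<lambda>t. Lp_norm lebesgue 2 (slice V t)) \<in> borel_measurable (lebesgue_on {0<..<S})"
    unfolding Lp_norm_V by (intro borel_lebesgue_on measurable_compose[OF V_sq_borel borel_measurable_sqrt])
  ultimately show "(\<lambda>t. Lp_norm lebesgue 2 (slice V t)) \<in> Lp (lebesgue_on {0<..<S}) \<infinity>"
    by (auto simp: Lp_def)
qed

lemma V_sq_integrable: "integrable lborel (\<lambda>t. \<integral>x. (norm (V (x, t)))\<^sup>2 \<partial>lborel)"
proof -
  have d: "\<delta> + \<delta> < 5" using delta by simp
  show ?thesis unfolding power2_norm_eq_inner
    by (rule Fubini_space_time(1)[OF inner_glue_integrable(1)[OF localized_B(1,1) dominated_B(1,1) B_borel(1,1) d]])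
qed

lemma integrable_lebesgue_on:
  fixes h :: "real \<Rightarrow> real"
  assumes "integrable lborel h" shows "integrable (lebesgue_on {0<..<S}) h"
proof -
  have "integrable lebesgue h" using assms by (subst integrable_lebesgue_iff) auto
  then show ?thesis by (subst integrable_restrict_space) (auto intro: integrable_real_mult_indicator simp: mult.commute)
qed

lemma V_bochner_2: "V \<in> bochner 2 S H1 H1_norm"
  unfolding bochner_def mem_Collect_eq
proof (intro conjI)
  show "V \<in> borel_measurable (lebesgue_on (UNIV \<times> {0<..<S}))" by (rule borel_lebesgue_on[OF glue_B_borel(1)])
  show "AE t in lebesgue_on {0<..<S}. slice V t \<in> H1"
    by (rule AE_lborel_lebesgue_on) (use AE_good good_C1c(3) in auto)
  let ?h = "\<lambda>t. (\<integral>x. (norm (V (x, t)))\<^sup>2 \<partial>lborel) + grad_sq t"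
  have ae: "AE t in lebesgue_on {0<..<S}. sqrt (?h t) = H1_norm (slice V t)"
  proof (rule AE_lborel_lebesgue_on)
    show "AE t in lborel. sqrt (?h t) = H1_norm (slice V t)"
      using AE_good by eventually_elim (simp add: H1_norm_def wgrad_V Lp_norm_V)
  qed simp
  have h0: "0 \<le> ?h t" for t unfolding grad_sq_def by (intro add_nonneg_nonneg sum_nonneg) auto
  have hm: "(\<lambda>t. sqrt (?h t)) \<in> borel_measurable (lebesgue_on {0<..<S})"
    using V_sq_borel borel_measurable_integrable[OF grad_sq_integrable]
    by (intro borel_lebesgue_on measurable_compose[OF _ borel_measurable_sqrt]) simp
  have m: "(\<lambda>t. H1_norm (slice V t)) \<in> borel_measurable (lebesgue_on {0<..<S})"
    by (rule borel_measurable_lebesgue_on_AE[OF hm _ ae]) simp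
  have i: "integrable (lebesgue_on {0<..<S}) ?h"
    by (rule integrable_lebesgue_on[OF Bochner_Integration.integrable_add[OF V_sq_integrable grad_sq_integrable]])
  have "integrable (lebesgue_on {0<..<S}) (\<lambda>t. (norm (H1_norm (slice V t)))\<^sup>2)"
  proof (rule integrable_cong_AE_imp[OF i])
    show "AE t in lebesgue_on {0<..<S}. ?h t = (norm (H1_norm (slice V t)))\<^sup>2"
      using ae by eventually_elim (use h0 in \<open>simp flip: power_abs\<close>, metis real_sqrt_pow2)
  qed (use m in simp)
  with m show "(\<lambda>t. H1_norm (slice V t)) \<in> Lp (lebesgue_on {0<..<S}) 2" by (simp add: Lp_2_iff)
qed

lemma leray_hopf_V: assumes S: "0 < S" shows "leray_hopf S (\<lambda>x. 0) force V"
  unfolding leray_hopf_def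
proof (intro conjI ballI)
  fix \<phi> assume \<phi>: "\<phi> \<in> sol_test_fun S"
  obtain K where sl: "slab_test \<phi> S K" by (rule sol_test_fun_slab[OF \<phi> S])
  interpret slab_test \<phi> S K by (rule sl)
  have "(LINT t:{0<..<S}|lebesgue. (\<integral>\<xi>. (\<Sum>i\<in>UNIV. wpartial i (slice V t) \<xi> \<bullet> partial i (slice \<phi> t) \<xi>)
             + convection (slice V t) \<xi> \<bullet> \<phi> (\<xi>, t) - V (\<xi>, t) \<bullet> time_deriv \<phi> (\<xi>, t) \<partial>lebesgue))
     = (LINT t:{0<..<S}|lebesgue. force t (slice \<phi> t))"
    by (rule weak_formulation_slab[OF sl], rule weak_identity)
      (auto intro: slice_deriv(1) slice_partial_cont slice_cont[OF _ cont(2)])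
  then show "(LINT t:{0<..<S}|lebesgue. (\<integral>\<xi>. (\<Sum>i\<in>UNIV. wpartial i (slice V t) \<xi> \<bullet> partial i (slice \<phi> t) \<xi>)
             + convection (slice V t) \<xi> \<bullet> \<phi> (\<xi>, t) - V (\<xi>, t) \<bullet> time_deriv \<phi> (\<xi>, t) \<partial>lebesgue))
     = (LINT t:{0<..<S}|lebesgue. force t (slice \<phi> t)) + L2_inner (\<lambda>x. 0) (slice \<phi> 0)"
    by (simp add: L2_inner_def)
next
  fix t assume "t \<in> {0<..S}"
  then show "slice V t \<in> Lp lebesgue 2" "energy_lhs V t \<le> energy_rhs (\<lambda>x. 0) force V t"
    using V_L2(1) energy_equality[of t] by simp_all
qed (rule zero_L2_sigma force_forcing V_bochner_inf V_bochner_2)+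

lemma zero_loc_integrable: "loc_integrable U (\<lambda>z. 0)"
  by (simp add: loc_integrable_def set_integrable_def)

lemma pressure_V: "associated_pressure force V (\<lambda>z. 0)"
  unfolding associated_pressure_def
proof (intro conjI ballI allI impI)
  fix \<phi> :: "space \<times> real \<Rightarrow> space" assume \<phi>: "\<phi> \<in> test_fun (UNIV \<times> {0<..})"
  obtain S K where sl: "slab_test \<phi> S K" and o: "\<And>x t. S \<le> t \<Longrightarrow> \<phi> (x, t) = 0" "\<And>x t. S \<le> t \<Longrightarrow> time_deriv \<phi> (x, t) = 0"
    and sm: "smooth \<phi>" by (rule test_fun_slab[OF \<phi>], rule that)
  interpret slab_test \<phi> S K by (rule sl)
  let ?I = "\<lambda>t. \<integral>x. - (V (x, t) \<bullet> time_deriv \<phi> (x, t)) - V (x, t) \<bullet> laplacian (slice \<phi> t) x + convection (slice V t) x \<bullet> \<phi> (x, t) \<partial>lebesgue"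
  have "(LINT t:{0<..<S}|lebesgue. ?I t) = (LINT t:{0<..<S}|lebesgue. force t (slice \<phi> t))"
    by (rule weak_formulation_slab[OF sl], rule pressure_identity)
      (auto intro: smooth_slice[OF sm] slice_cont[OF _ cont(2)])
  moreover have lap0: "laplacian (\<lambda>x::space. 0 :: space) = (\<lambda>x. 0)"
  proof -
    have "partial i (\<lambda>x::space. 0 :: space) = (\<lambda>x. 0)" for i
      unfolding partial_def by (rule ext, rule dir_derivI) simp
    then show ?thesis by (simp add: laplacian_def[abs_def])
  qed
  have "?I t = 0" "force t (slice \<phi> t) = 0" if "S \<le> t" for t
    using o[OF that] lap0 by (simp_all add: force_def L2_inner_def)
  then have "(LINT t:{0<..<S}|lebesgue. ?I t) = (LINT t:{0<..}|lebesgue. ?I t)"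
    "(LINT t:{0<..<S}|lebesgue. force t (slice \<phi> t)) = (LINT t:{0<..}|lebesgue. force t (slice \<phi> t))"
    unfolding set_lebesgue_integral_def by (auto intro!: Bochner_Integration.integral_cong simp: indicator_def not_less)
  ultimately show "(LINT t:{0<..}|lebesgue. (\<integral>\<xi>. - (V (\<xi>, t) \<bullet> time_deriv \<phi> (\<xi>, t)) - V (\<xi>, t) \<bullet> laplacian (slice \<phi> t) \<xi>
       + convection (slice V t) \<xi> \<bullet> \<phi> (\<xi>, t) - 0 * divergence (slice \<phi> t) \<xi> \<partial>lebesgue)) = (LINT t:{0<..}|lebesgue. force t (slice \<phi> t))"
    by simp
next
  show "AE t in lebesgue_on {0<..}. loc_integrable UNIV (\<lambda>x::space. 0::real) \<and>
    (\<forall>\<phi>\<in>test_fun UNIV. - (\<integral>\<xi>. 0 * laplacian \<phi> \<xi> \<partial>lebesgue) = force t (gradient \<phi>) - L2_inner (convection (slice V t)) (gradient \<phi>))"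
  proof (rule AE_lborel_lebesgue_on)
    show "AE t in lborel. loc_integrable UNIV (\<lambda>x::space. 0::real) \<and>
      (\<forall>\<phi>\<in>test_fun UNIV. - (\<integral>\<xi>. 0 * laplacian \<phi> \<xi> \<partial>lebesgue) = force t (gradient \<phi>) - L2_inner (convection (slice V t)) (gradient \<phi>))"
      using AE_good by eventually_elim (auto simp: zero_loc_integrable test_fun_def pressure_Poisson)
  qed simp
qed (rule zero_loc_integrable)

text \<open>Each point sees at most one swirl, so V is continuous in time pointwise, also at the
  blow-up times. The bound of \<open>V_bound\<close> is uniform in time and permits dominated
  convergence in L^2.\<close>

lemma V_C0L2: "V \<in> C0L2"
  unfolding C0L2_def mem_Collect_eq
proof (intro allI impI conjI)
  fix t :: real
  show "slice V t \<in> Lp lebesgue 2" by (rule V_L2)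
  obtain C where C: "0 \<le> C" "\<And>x t. norm (V (x, t)) \<le> C * alpha \<delta> x" "\<And>n x t. norm (part n B (x, t)) \<le> C * alpha \<delta> x"
    by (rule V_bound, rule that)
  have m: "(\<lambda>x. V (x, s) - V (x, t)) \<in> borel_measurable borel" for s
    using borel_slice_space[OF glue_B_borel(1)] by simp
  have N: "Lp_norm lebesgue 2 (\<lambda>x. V (x, s) - V (x, t)) = sqrt (\<integral>x. (norm (V (x, s) - V (x, t)))\<^sup>2 \<partial>lborel)" for s
    by (rule Lp_norm_2_sqrt[OF m])
  have bd: "norm (V (x, s) - V (x, t)) \<le> (2 * C) * alpha \<delta> x" for x s
    using norm_triangle_ineq4[of "V (x, s)" "V (x, t)"] C(2)[of x s] C(2)[of x t] by simp
  show "((\<lambda>s. Lp_norm lebesgue 2 (\<lambda>\<xi>. V (\<xi>, s) - V (\<xi>, t))) \<longlongrightarrow> 0) (at t within {0..})"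
    unfolding tendsto_at_iff_sequentially N comp_def
  proof (intro allI impI)
    fix X :: "nat \<Rightarrow> real" assume X: "X \<longlonglongrightarrow> t"
    have "(\<lambda>n. \<integral>x. (norm (V (x, X n) - V (x, t)))\<^sup>2 \<partial>lborel) \<longlonglongrightarrow> (\<integral>x. 0 \<partial>(lborel :: space measure))"
    proof (rule integral_dominated_convergence[OF _ _ alpha_square_integrable[of "2 * C"]])
      show "AE x in lborel. (\<lambda>n. (norm (V (x, X n) - V (x, t)))\<^sup>2) \<longlonglongrightarrow> 0"
      proof (rule AE_I2)
        fix x
        have "isCont (\<lambda>t. V (x, t)) t" using glue_time_deriv has_vector_derivative_continuous by blast
        then have "(\<lambda>n. V (x, X n)) \<longlonglongrightarrow> V (x, t)" using X by (rule isCont_tendsto_compose)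
        then have "(\<lambda>n. (norm (V (x, X n) - V (x, t)))\<^sup>2) \<longlonglongrightarrow> (norm (V (x, t) - V (x, t)))\<^sup>2"
          by (intro tendsto_intros)
        then show "(\<lambda>n. (norm (V (x, X n) - V (x, t)))\<^sup>2) \<longlonglongrightarrow> 0" by simp
      qed
      show "AE x in lborel. norm ((norm (V (x, X n) - V (x, t)))\<^sup>2) \<le> (2 * C * alpha \<delta> x)\<^sup>2" for n
        using power_mono[OF bd norm_ge_zero, of _ "X n" 2] by auto
      show "(\<lambda>x. (norm (V (x, X n) - V (x, t)))\<^sup>2) \<in> borel_measurable lborel" for n using m[of "X n"] by simp
    qed simp
    from tendsto_real_sqrt[OF this]
    show "(\<lambda>n. sqrt (\<integral>x. (norm (V (x, X n) - V (x, t)))\<^sup>2 \<partial>lborel)) \<longlonglongrightarrow> 0" by simp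
  qed
qed

end

section \<open>Time integrals\<close>

lemma AE_slices:
  fixes P :: "'a::euclidean_space \<times> 'b::euclidean_space \<Rightarrow> bool"
  assumes "AE z in lborel. P z" shows "AE t in lborel. AE x in lborel. P (x, t)"
proof -
  obtain N where N: "{z \<in> space lborel. \<not> P z} \<subseteq> N" "emeasure lborel N = 0" "N \<in> sets lborel"
    using AE_E[OF assms] by metis
  have Ns: "N \<in> sets (lborel \<Otimes>\<^sub>M lborel)" using N(3) unfolding lborel_prod .
  have "AE z in lborel \<Otimes>\<^sub>M lborel. z \<notin> N"
    unfolding lborel_prod by (rule AE_I[of _ _ N]) (use N in auto)
  then have 1: "AE x in lborel. AE t in lborel. (x, t) \<notin> N" by (rule lborel_pair.AE_pair)
  have m: "{z \<in> space (lborel \<Otimes>\<^sub>M lborel). (fst z, snd z) \<notin> N} \<in> sets (lborel \<Otimes>\<^sub>M lborel)"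
  proof -
    have "{z \<in> space (lborel \<Otimes>\<^sub>M lborel). (fst z, snd z) \<notin> N} = space (lborel \<Otimes>\<^sub>M lborel) - N" by auto
    then show ?thesis using sets.compl_sets[OF Ns] by (simp only:)
  qed
  have "AE t in lborel. AE x in lborel. (x, t) \<notin> N"
    using lborel_pair.AE_commute[OF m] 1 by simp
  then show ?thesis
  proof eventually_elim
    case (elim t)
    then show ?case by eventually_elim (use N(1) in auto)
  qed
qed

text \<open>A competitor is only Lebesgue measurable on space-time, which says little about single
  slices. A Borel representative has Borel slices and pairings that are measurable in time.\<close>

lemma borel_representative:
  fixes W :: "'a::euclidean_space \<Rightarrow> 'b::euclidean_space"
  assumes "W \<in> borel_measurable (lebesgue_on A)" "A \<in> sets borel"
  obtains W' where "W' \<in> borel_measurable borel" "AE z in lborel. z \<in> A \<longrightarrow> W z = W' z"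
proof -
  let ?W = "\<lambda>z. if z \<in> A then W z else 0"
  have Wm: "?W \<in> borel_measurable lebesgue" using assms by (simp add: borel_measurable_if)
  have "\<exists>g. g \<in> borel_measurable lborel \<and> (AE z in lborel. ?W z \<bullet> j = g z)" for j
  proof -
    have "(\<lambda>z. ?W z \<bullet> j) \<in> borel_measurable lebesgue" using Wm by (intro borel_measurable_inner) auto
    then show ?thesis using completion_ex_borel_measurable_real by blast
  qed
  then obtain g where g: "\<And>j. g j \<in> borel_measurable lborel" "\<And>j. AE z in lborel. ?W z \<bullet> j = g j z" by metis
  show thesis
  proof (rule that[of "\<lambda>z. \<Sum>j\<in>Basis. g j z *\<^sub>R j"])
    show "(\<lambda>z. \<Sum>j\<in>Basis. g j z *\<^sub>R j) \<in> borel_measurable borel" using g(1) by simp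
    have "AE z in lborel. \<forall>j\<in>Basis. ?W z \<bullet> j = g j z" by (rule AE_finite_allI) (use g(2) in auto)
    then show "AE z in lborel. z \<in> A \<longrightarrow> W z = (\<Sum>j\<in>Basis. g j z *\<^sub>R j)"
    proof eventually_elim
      case (elim z)
      have "(\<Sum>j\<in>Basis. g j z *\<^sub>R j) = (\<Sum>j\<in>Basis. (?W z \<bullet> j) *\<^sub>R j)"
        by (rule sum.cong) (use elim in auto)
      then show ?case by (simp add: euclidean_representation)
    qed
  qed
qed

text \<open>Collecting the admissible times in one measurable set T0 allows later arguments to treat
  every point of the measure space \<open>lebesgue_on T0\<close> alike.\<close>

lemma full_measure_set:
  fixes P :: "real \<Rightarrow> bool"
  assumes "AE t in lebesgue_on {0<..<S}. P t"
  obtains T0 where "T0 \<in> sets lebesgue" "T0 \<subseteq> {0<..<S}" "\<And>t. t \<in> T0 \<Longrightarrow> P t"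
    "AE t in lebesgue. t \<in> {0<..<S} \<longrightarrow> t \<in> T0"
proof -
  have ae: "AE t in lebesgue. t \<in> {0<..<S} \<longrightarrow> P t" using assms by (simp add: AE_restrict_space_iff)
  obtain N where N: "{t \<in> space lebesgue. \<not> (t \<in> {0<..<S} \<longrightarrow> P t)} \<subseteq> N" "emeasure lebesgue N = 0" "N \<in> sets lebesgue"
    using AE_E[OF ae] by metis
  show thesis
  proof (rule that[of "{0<..<S} - N"])
    show "P t" if "t \<in> {0<..<S} - N" for t using N(1) that by auto
    have "AE t in lebesgue. t \<notin> N" using N by (intro AE_I[of _ _ N]) auto
    then show "AE t in lebesgue. t \<in> {0<..<S} \<longrightarrow> t \<in> {0<..<S} - N" by eventually_elim auto
  qed (use N(3) in auto)
qed

lemma full_measure_integral: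
  fixes h :: "real \<Rightarrow> real"
  assumes T: "T0 \<in> sets lebesgue" "T0 \<subseteq> {0<..<S}" "AE t in lebesgue. t \<in> {0<..<S} \<longrightarrow> t \<in> T0"
  shows "integrable (lebesgue_on T0) h \<longleftrightarrow> set_integrable lebesgue {0<..<S} h"
    "integrable (lebesgue_on T0) h \<Longrightarrow> (LINT t:{0<..<S}|lebesgue. h t) = (\<integral>t. h t \<partial>lebesgue_on T0)"
proof -
  have ae: "AE t in lebesgue. indicator {0<..<S} t *\<^sub>R h t = indicator T0 t *\<^sub>R h t"
    using T(3) by eventually_elim (use T(2) in \<open>auto simp: indicator_def\<close>)
  have ae': "AE t in lebesgue. indicator T0 t *\<^sub>R h t = indicator {0<..<S} t *\<^sub>R h t"
    using ae by eventually_elim (rule sym)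
  have r: "integrable (lebesgue_on T0) h \<longleftrightarrow> integrable lebesgue (\<lambda>t. indicator T0 t *\<^sub>R h t)"
    "(\<integral>t. h t \<partial>lebesgue_on T0) = (\<integral>t. indicator T0 t *\<^sub>R h t \<partial>lebesgue)"
    using T(1) by (simp_all add: integrable_restrict_space integral_restrict_space)
  show "integrable (lebesgue_on T0) h \<longleftrightarrow> set_integrable lebesgue {0<..<S} h"
    unfolding r(1) set_integrable_def
    using integral_cong_AE_lebesgue(2)[OF ae] integral_cong_AE_lebesgue(2)[OF ae'] by blast
  show "(LINT t:{0<..<S}|lebesgue. h t) = (\<integral>t. h t \<partial>lebesgue_on T0)" if "integrable (lebesgue_on T0) h"
    unfolding r(2) set_lebesgue_integral_def
    using integral_cong_AE_lebesgue(1)[OF ae] that by (simp add: r(1))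
qed

text \<open>Exchange of the integrations over the triangle s < t; the inner integral of -\<theta>'
  from s to S is \<theta> s because \<theta> S = 0. It turns the energy inequality, stated for each
  t, into one weighted in time.\<close>

lemma integral_time_triangle:
  fixes h \<theta> \<theta>' :: "real \<Rightarrow> real"
  assumes S: "0 < S" and h: "set_integrable lebesgue {0<..<S} h"
    and \<theta>: "\<And>t. (\<theta> has_real_derivative \<theta>' t) (at t)" "continuous_on UNIV \<theta>'" "\<theta> S = 0"
  shows "set_integrable lebesgue {0<..<S} (\<lambda>t. - \<theta>' t * (LINT s:{0<..<t}|lebesgue. h s))"
    "(LINT t:{0<..<S}|lebesgue. - \<theta>' t * (LINT s:{0<..<t}|lebesgue. h s)) = (LINT s:{0<..<S}|lebesgue. \<theta> s * h s)"
proof -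
  have hi: "integrable lebesgue (\<lambda>t. indicator {0<..<S} t *\<^sub>R h t)" using h by (simp add: set_integrable_def)
  obtain k0 where k0: "k0 \<in> borel_measurable lborel" "AE t in lborel. indicator {0<..<S} t *\<^sub>R h t = k0 t"
    using completion_ex_borel_measurable_real[of "\<lambda>t. indicator {0<..<S} t *\<^sub>R h t" lborel] hi by auto
  define k where "k s = indicator {0<..<S} s * k0 s" for s
  have km: "k \<in> borel_measurable borel" unfolding k_def[abs_def] using k0(1) by simp
  have kae: "AE t in lborel. t \<in> {0<..<S} \<longrightarrow> h t = k t" using k0(2) by eventually_elim (auto simp: k_def)
  have kae': "AE t in lborel. indicator {0<..<S} t *\<^sub>R h t = k t" using k0(2)
  proof eventually_elim
    case (elim t)
    then show ?case by (cases "t \<in> {0<..<S}") (auto simp: k_def)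
  qed
  have "integrable lebesgue k"
    by (rule integrable_cong_AE_imp[OF hi _ AE_completion[OF kae']]) (use km in \<open>simp add: measurable_completion\<close>)
  then have ki: "integrable lborel k" by (simp add: integrable_lebesgue_iff[OF km])
  have \<theta>m: "\<theta>' \<in> borel_measurable borel" by (rule continuous_borel[OF \<theta>(2)])
  have "bounded (\<theta>' ` {0..S})"
    by (intro compact_imp_bounded compact_continuous_image continuous_on_subset[OF \<theta>(2)]) auto
  then obtain C where C: "C > 0" "\<forall>y\<in>\<theta>' ` {0..S}. norm y \<le> C" using bounded_pos by blast
  \<comment> \<open>The closed triangle has a Borel indicator; for each t it differs from the
    condition s < t at one point only.\<close>
  define G where "G z = indicator {z. fst z \<le> snd z} z * (indicator {0<..<S} (snd z) * - \<theta>' (snd z)) * k (fst z)" for z :: "real \<times> real"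
  have Gs: "G (s, t) = (if s \<le> t \<and> 0 < t \<and> t < S then - \<theta>' t * k s else 0)" for s t
    by (auto simp: G_def indicator_def)
  have Gm: "G \<in> borel_measurable borel"
  proof -
    have "closed {z :: real \<times> real. fst z \<le> snd z}" by (intro closed_Collect_le continuous_intros)
    then have 1: "(\<lambda>z. indicator {z. fst z \<le> snd z} z :: real) \<in> borel_measurable (borel :: (real \<times> real) measure)"
      by (intro borel_measurable_indicator borel_closed)
    have 2: "fst \<in> borel_measurable (borel :: (real \<times> real) measure)" "snd \<in> borel_measurable (borel :: (real \<times> real) measure)"
      by (auto intro!: continuous_borel continuous_intros)
    have 3: "(\<lambda>z. k (fst z)) \<in> borel_measurable (borel :: (real \<times> real) measure)" by (rule measurable_compose[OF 2(1) km])
    have "(\<lambda>t. indicator {0<..<S} t * - \<theta>' t) \<in> borel_measurable borel" using \<theta>m by simp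
    from borel_measurable_times[OF borel_measurable_times[OF 1 measurable_compose[OF 2(2) this]] 3]
    show ?thesis unfolding G_def[abs_def] .
  qed
  have Gi: "integrable lborel G"
  proof (rule integrable_dominated[OF Gm, where \<alpha>="\<lambda>s. \<bar>k s\<bar>" and \<beta>="\<lambda>t. C * indicator {0<..<S} t"])
    have "norm (G (s, t)) \<le> \<bar>k s\<bar> * (C * indicator {0<..<S} t)" for s t
    proof (cases "t \<in> {0<..<S}")
      case True
      then have "norm (\<theta>' t) \<le> C" using C(2) by auto
      then have "\<bar>\<theta>' t\<bar> * \<bar>k s\<bar> \<le> C * \<bar>k s\<bar>" by (intro mult_right_mono) auto
      then show ?thesis using True C(1) by (auto simp: Gs abs_mult mult.commute)
    next
      case False
      then show ?thesis by (auto simp: Gs)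
    qed
    then show "AE t in lborel. \<forall>s. norm (G (s, t)) \<le> \<bar>k s\<bar> * (C * indicator {0<..<S} t)" by simp
  qed (use ki C(1) S in \<open>auto intro!: integrable_real_indicator\<close>)
  note F = Fubini_space_time[OF Gi]
  have e1: "AE t in lborel. t \<in> {0<..<S} \<longrightarrow> - \<theta>' t * (LINT s:{0<..<t}|lebesgue. h s) = (\<integral>s. G (s, t) \<partial>lborel)"
  proof (rule AE_I2, rule impI)
    fix t assume t: "t \<in> {0<..<S}"
    have m: "(\<lambda>s. indicator {0<..<t} s * k s) \<in> borel_measurable borel" using km by simp
    have ii: "integrable lborel (\<lambda>s. indicator {0<..<t} s * k s)"
      using integrable_real_mult_indicator[OF _ ki, of "{0<..<t}"] by (simp add: mult.commute)
    have aeh: "AE s in lborel. s \<in> {0<..<t} \<longrightarrow> h s = indicator {0<..<t} s * k s"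
      using kae by eventually_elim (use t in auto)
    have "(LINT s:{0<..<t}|lebesgue. h s) = (\<integral>s. indicator {0<..<t} s * k s \<partial>lborel)"
      by (rule set_integral_lebesgue_indicator(2)[OF ii aeh]) simp
    moreover have "(\<integral>s. G (s, t) \<partial>lborel) = (\<integral>s. - \<theta>' t * (indicator {0<..<t} s * k s) \<partial>lborel)"
    proof (rule integral_cong_AE)
      show "(\<lambda>s. G (s, t)) \<in> borel_measurable lborel" using borel_slice_space[OF Gm] by simp
      show "(\<lambda>s. - \<theta>' t * (indicator {0<..<t} s * k s)) \<in> borel_measurable lborel" using m by simp
      show "AE s in lborel. G (s, t) = - \<theta>' t * (indicator {0<..<t} s * k s)"
        using AE_lborel_singleton[of t] by eventually_elim (use t in \<open>auto simp: Gs k_def indicator_def\<close>)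
    qed
    ultimately show "- \<theta>' t * (LINT s:{0<..<t}|lebesgue. h s) = (\<integral>s. G (s, t) \<partial>lborel)" by simp
  qed
  have z: "(\<integral>s. G (s, t) \<partial>lborel) = 0" if "t \<notin> {0<..<S}" for t
  proof -
    have "(\<lambda>s. G (s, t)) = (\<lambda>s. 0)" using that by (auto simp: Gs)
    then show ?thesis by simp
  qed
  note r = set_integral_lebesgue_indicator[OF F(1) e1 z]
  show "set_integrable lebesgue {0<..<S} (\<lambda>t. - \<theta>' t * (LINT s:{0<..<t}|lebesgue. h s))" by (rule r(1))
  have e2: "(\<integral>t. G (s, t) \<partial>lborel) = \<theta> s * k s" for s
  proof (cases "s \<in> {0<..<S}")
    case True
    have "(\<integral>t. G (s, t) \<partial>lborel) = (\<integral>t. (- k s) * (indicator {s..S} t *\<^sub>R \<theta>' t) \<partial>lborel)"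
    proof (rule integral_cong_AE)
      show "(\<lambda>t. G (s, t)) \<in> borel_measurable lborel" using borel_slice_time[OF Gm] by simp
      show "(\<lambda>t. (- k s) * (indicator {s..S} t *\<^sub>R \<theta>' t)) \<in> borel_measurable lborel" using \<theta>m by simp
      show "AE t in lborel. G (s, t) = (- k s) * (indicator {s..S} t *\<^sub>R \<theta>' t)"
        using AE_lborel_singleton[of S] by eventually_elim (use True in \<open>auto simp: Gs indicator_def\<close>)
    qed
    also have "\<dots> = (- k s) * (\<theta> S - \<theta> s)"
    proof -
      have "(\<integral>t. indicator {s..S} t *\<^sub>R \<theta>' t \<partial>lborel) = \<theta> S - \<theta> s"
        using True \<theta>(1) by (intro integral_FTC_atLeastAtMost continuous_on_subset[OF \<theta>(2)])
          (auto simp: has_real_derivative_iff_has_vector_derivative intro: has_vector_derivative_at_within)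
      then show ?thesis by simp
    qed
    finally show ?thesis using \<theta>(3) by simp
  next
    case False
    then have "k s = 0" by (simp add: k_def)
    then have "(\<lambda>t. G (s, t)) = (\<lambda>t. 0)" by (auto simp: Gs)
    then show ?thesis using \<open>k s = 0\<close> by simp
  qed
  have ae2: "AE s in lborel. s \<in> {0<..<S} \<longrightarrow> \<theta> s * h s = \<theta> s * k s" using kae by eventually_elim simp
  have i2: "integrable lborel (\<lambda>s. \<theta> s * k s)" using F(3) by (simp add: e2)
  have "(LINT s:{0<..<S}|lebesgue. \<theta> s * h s) = (\<integral>s. \<theta> s * k s \<partial>lborel)"
    by (rule set_integral_lebesgue_indicator(2)[OF i2 ae2]) (simp add: k_def)
  also have "\<dots> = (\<integral>t. (\<integral>s. G (s, t) \<partial>lborel) \<partial>lborel)" using F(2,4) by (simp add: e2)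
  also have "\<dots> = (LINT t:{0<..<S}|lebesgue. - \<theta>' t * (LINT s:{0<..<t}|lebesgue. h s))" by (rule r(2)[symmetric])
  finally show "(LINT t:{0<..<S}|lebesgue. - \<theta>' t * (LINT s:{0<..<t}|lebesgue. h s)) = (LINT s:{0<..<S}|lebesgue. \<theta> s * h s)"
    by (rule sym)
qed

section \<open>Weak-strong uniqueness\<close>

text \<open>The elementary bound of a product by the sum of the squares suffices here: the time
  dependence of u enters only through the factor b, which will be integrable in time.\<close>

lemma inner_dominated:
  fixes w u :: "space \<Rightarrow> space"
  assumes w: "w \<in> Lp lebesgue 2" and u: "u \<in> borel_measurable borel" "\<And>x. norm (u x) \<le> \<alpha> x * b" "0 \<le> b"
    and \<alpha>: "\<alpha> \<in> borel_measurable borel" "integrable lborel (\<lambda>x. (\<alpha> x)\<^sup>2)"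
  shows "integrable lebesgue (\<lambda>x. w x \<bullet> u x)"
    "\<bar>\<integral>x. w x \<bullet> u x \<partial>lebesgue\<bar> \<le> b * ((\<integral>x. (norm (w x))\<^sup>2 \<partial>lebesgue) + (\<integral>x. (\<alpha> x)\<^sup>2 \<partial>lborel))"
proof -
  have am: "(\<lambda>x. (\<alpha> x)\<^sup>2) \<in> borel_measurable borel" using \<alpha>(1) by simp
  have ai: "integrable lebesgue (\<lambda>x. (\<alpha> x)\<^sup>2)" using \<alpha>(2) by (simp add: integrable_lebesgue_iff[OF am])
  have wi: "integrable lebesgue (\<lambda>x. (norm (w x))\<^sup>2)" "w \<in> borel_measurable lebesgue" using w by (simp_all add: Lp_2_iff)
  have ji: "integrable lebesgue (\<lambda>x. b * ((norm (w x))\<^sup>2 + (\<alpha> x)\<^sup>2))" using ai wi by simp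
  have le: "\<bar>w x \<bullet> u x\<bar> \<le> b * ((norm (w x))\<^sup>2 + (\<alpha> x)\<^sup>2)" for x
  proof -
    have "\<bar>w x \<bullet> u x\<bar> \<le> norm (w x) * norm (u x)" by (rule Cauchy_Schwarz_ineq2)
    also have "\<dots> \<le> norm (w x) * (\<bar>\<alpha> x\<bar> * b)"
      using u(2)[of x] u(3) mult_right_mono[OF abs_ge_self u(3), of "\<alpha> x"] by (intro mult_left_mono) auto
    also have "\<dots> = b * (norm (w x) * \<bar>\<alpha> x\<bar>)" by simp
    also have "\<dots> \<le> b * ((norm (w x))\<^sup>2 + (\<alpha> x)\<^sup>2)"
    proof (rule mult_left_mono[OF _ u(3)])
      have "2 * (norm (w x) * \<bar>\<alpha> x\<bar>) \<le> (norm (w x))\<^sup>2 + (\<alpha> x)\<^sup>2"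
        using zero_le_power2[of "norm (w x) - \<bar>\<alpha> x\<bar>"] by (simp add: power2_diff)
      moreover have "0 \<le> norm (w x) * \<bar>\<alpha> x\<bar>" by simp
      ultimately show "norm (w x) * \<bar>\<alpha> x\<bar> \<le> (norm (w x))\<^sup>2 + (\<alpha> x)\<^sup>2" by linarith
    qed
    finally show ?thesis .
  qed
  have um: "u \<in> borel_measurable lebesgue" using u(1) by (simp add: measurable_completion)
  show i: "integrable lebesgue (\<lambda>x. w x \<bullet> u x)"
    by (rule Bochner_Integration.integrable_bound[OF ji borel_measurable_inner[OF wi(2) um]]) (use le in \<open>auto intro!: AE_I2 order_trans[OF _ abs_ge_self]\<close>)
  have "\<bar>\<integral>x. w x \<bullet> u x \<partial>lebesgue\<bar> \<le> (\<integral>x. \<bar>w x \<bullet> u x\<bar> \<partial>lebesgue)" by (rule integral_abs_bound)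
  also have "\<dots> \<le> (\<integral>x. b * ((norm (w x))\<^sup>2 + (\<alpha> x)\<^sup>2) \<partial>lebesgue)"
    by (rule integral_mono[OF integrable_abs[OF i] ji le])
  also have "\<dots> = b * ((\<integral>x. (norm (w x))\<^sup>2 \<partial>lebesgue) + (\<integral>x. (\<alpha> x)\<^sup>2 \<partial>lborel))"
    using ai wi by (simp add: integral_lebesgue_eq[OF am])
  finally show "\<bar>\<integral>x. w x \<bullet> u x \<partial>lebesgue\<bar> \<le> b * ((\<integral>x. (norm (w x))\<^sup>2 \<partial>lebesgue) + (\<integral>x. (\<alpha> x)\<^sup>2 \<partial>lborel))" .
qed

lemma partial_const_scaleR:
  "v differentiable (at x) \<Longrightarrow> partial i (\<lambda>x. c *\<^sub>R v x) x = c *\<^sub>R partial i v x"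
  unfolding partial_def
  by (rule dir_derivI, rule has_derivative_scaleR_right, rule has_derivative_dir_deriv)

context cascade
begin

text \<open>The case r = 1 and q = 2, where 2/r + 3/q = 7/2: what is needed for pairings with fields
  that are bounded in time with values in L^2.\<close>

lemma energy_product_bound:
  fixes U :: "nat \<Rightarrow> space \<times> real \<Rightarrow> space"
  assumes U: "localized U" "dominated d U" "d < 7/2"
  obtains \<alpha> :: "space \<Rightarrow> real" and \<beta> :: "real \<Rightarrow> real" where
    "\<alpha> \<in> borel_measurable borel" "integrable lborel (\<lambda>x. (\<alpha> x)\<^sup>2)" "\<And>t. 0 \<le> \<beta> t" "integrable lborel \<beta>"
    "\<And>x t. good t \<Longrightarrow> norm (glue U (x, t)) \<le> \<alpha> x * \<beta> t"
    "\<And>x t n. good t \<Longrightarrow> norm (part n U (x, t)) \<le> \<alpha> x * \<beta> t"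
proof -
  have d: "d < 2 / 1 + 3 / (2::real)" using U(3) by simp
  obtain \<alpha> :: "space \<Rightarrow> real" and \<beta> where ab: 
    "\<alpha> \<in> borel_measurable borel" "\<And>x. 0 \<le> \<alpha> x" "integrable lborel (\<lambda>x. \<alpha> x powr 2)"
    "\<beta> \<in> borel_measurable borel" "\<And>t. 0 \<le> \<beta> t" "integrable lborel (\<lambda>t. \<beta> t powr 1)"
    "\<And>x t. good t \<Longrightarrow> norm (glue U (x, t)) \<le> \<alpha> x * \<beta> t"
    "\<And>x t n. good t \<Longrightarrow> norm (part n U (x, t)) \<le> \<alpha> x * \<beta> t"
    by (rule product_bound[OF U(1,2) zero_less_one zero_less_numeral d], rule that)
  show thesis
  proof (rule that[of \<alpha> \<beta>])
    show "integrable lborel (\<lambda>x. (\<alpha> x)\<^sup>2)" using ab(2,3) by simp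
    show "integrable lborel \<beta>" using ab(5,6) by simp
  qed (rule ab, assumption?)+
qed

text \<open>The indicator functions of the time windows are not smooth; the derivatives of \<open>arctan (sc k t)\<close> replace them.\<close>

lemma Gronwall_weights:
  "\<exists>A0\<ge>0. \<forall>n. \<exists>A m. smooth A \<and> (\<forall>t. (A has_real_derivative m t / 2) (at t)) \<and> continuous_on UNIV m \<and>
     (\<forall>t. 0 \<le> m t \<and> \<bar>A t\<bar> \<le> A0) \<and> (\<forall>x t. (norm (part n B (x, t)))\<^sup>2 \<le> m t)"
proof -
  obtain C where C: "C \<ge> 0" "\<And>k z. norm (B k z) \<le> C * \<epsilon> k powr (- \<delta>)" using dominated_B(1) by (auto simp: dominated_def)
  \<comment> \<open>A bound for the squared sup norm of swirl k.\<close>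
  define w where "w k = (C * amp k)\<^sup>2" for k
  have w0: "w k \<ge> 0" for k by (simp add: w_def)
  have we: "w k * (\<epsilon> k)\<^sup>2 = C\<^sup>2 * \<epsilon> k powr (2 - 2 * \<delta>)" for k
  proof -
    have "\<epsilon> k powr (2 - 2 * \<delta>) = \<epsilon> k powr (- \<delta>) * \<epsilon> k powr (- \<delta>) * \<epsilon> k powr 2"
      unfolding powr_add[symmetric] by (simp add: algebra_simps)
    then show ?thesis using eps(1)[of k] by (simp add: w_def amp_def power_mult_distrib power2_eq_square[of "_ powr _"])
  qed
  have sw: "summable (\<lambda>k. w k * (\<epsilon> k)\<^sup>2)" unfolding we using delta by (intro summable_eps_mult) simp
  \<comment> \<open>The factor 2 bounds |\<open>arctan\<close>|, by \<pi> < 4. The series converges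
    because its terms are multiples of eps_k^(2 - 2\<delta>).\<close>
  define A0 where "A0 = (\<Sum>k. w k * (\<epsilon> k)\<^sup>2) * 2"
  have A0: "A0 \<ge> 0" unfolding A0_def using w0 sw by (intro mult_nonneg_nonneg suminf_nonneg) auto
  show ?thesis
  proof (intro exI[of _ A0] conjI allI A0)
    fix n
    define A where "A t = (\<Sum>k<n. (w k * (\<epsilon> k)\<^sup>2) * arctan (sc k t))" for t
    \<comment> \<open>Inside window k the denominator is at most 2, so the factor 2 makes the k-th
      term at least \<open>w k\<close> there.\<close>
    define m where "m t = (\<Sum>k<n. 2 * w k * inverse (1 + (sc k t)\<^sup>2))" for t
    have scd: "(sc k has_real_derivative 1 / (\<epsilon> k)\<^sup>2) (at t)" for k t
      unfolding sc_def[abs_def] by (rule DERIV_cong[OF DERIV_cmult]) (auto intro!: derivative_eq_intros)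
    have sms: "smooth (sc k)" for k
      unfolding sc_def[abs_def] by (intro smooth_mult smooth_const smooth_diff smooth_ident)
    have "smooth A" unfolding A_def[abs_def]
      by (intro smooth_sum smooth_mult smooth_const smooth_compose_real[OF smooth_arctan] sms finite_lessThan)
    moreover have "(A has_real_derivative m t / 2) (at t)" for t
    proof -
      have "((\<lambda>t. (w k * (\<epsilon> k)\<^sup>2) * arctan (sc k t)) has_real_derivative w k * inverse (1 + (sc k t)\<^sup>2)) (at t)" for k
        by (rule DERIV_cong[OF DERIV_cmult[OF DERIV_chain2[OF DERIV_arctan scd]]]) (use eps(1)[of k] in simp)
      then have "(A has_real_derivative (\<Sum>k<n. w k * inverse (1 + (sc k t)\<^sup>2))) (at t)"
        unfolding A_def[abs_def] by (intro DERIV_sum)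
      moreover have "m t / 2 = (\<Sum>k<n. w k * inverse (1 + (sc k t)\<^sup>2))"
        by (simp add: m_def sum_divide_distrib)
      ultimately show ?thesis by simp
    qed
    moreover have "continuous_on UNIV m"
    proof -
      have "continuous_on UNIV (\<lambda>t. inverse (1 + (sc k t)\<^sup>2))" for k
        by (rule continuous_on_compose2[OF smooth_imp_continuous[OF smooth_inverse_1_plus_square] smooth_imp_continuous[OF sms]]) simp
      then show ?thesis unfolding m_def[abs_def] by (intro continuous_on_sum continuous_on_mult continuous_on_const)
    qed
    moreover have "0 \<le> m t" for t unfolding m_def using w0 by (intro sum_nonneg mult_nonneg_nonneg) (auto intro: add_nonneg_nonneg)
    moreover have "\<bar>A t\<bar> \<le> A0" for t
    proof -
      have "\<bar>A t\<bar> \<le> (\<Sum>k<n. \<bar>(w k * (\<epsilon> k)\<^sup>2) * arctan (sc k t)\<bar>)" unfolding A_def by (rule sum_abs)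
      also have "\<dots> \<le> (\<Sum>k<n. (w k * (\<epsilon> k)\<^sup>2) * 2)"
      proof (rule sum_mono)
        fix k
        have "\<bar>arctan (sc k t)\<bar> \<le> 2"
          using arctan_bounded[of "sc k t"] pi_less_4 by (simp add: abs_le_iff)
        then have "(w k * (\<epsilon> k)\<^sup>2) * \<bar>arctan (sc k t)\<bar> \<le> (w k * (\<epsilon> k)\<^sup>2) * 2"
          using w0[of k] by (intro mult_left_mono) auto
        then show "\<bar>(w k * (\<epsilon> k)\<^sup>2) * arctan (sc k t)\<bar> \<le> (w k * (\<epsilon> k)\<^sup>2) * 2"
          using w0[of k] by (simp add: abs_mult)
      qed
      also have "\<dots> \<le> A0"
        unfolding A0_def sum_distrib_right[symmetric] using w0 by (intro mult_right_mono sum_le_suminf[OF sw]) auto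
      finally show ?thesis .
    qed
    moreover have "(norm (part n B (x, t)))\<^sup>2 \<le> m t" for x t
    proof (cases "\<exists>k<n. x \<in> blob k \<and> t \<in> win k")
      case True
      then obtain k where k: "k < n" "x \<in> blob k" "t \<in> win k" by blast
      have "norm (part n B (x, t)) \<le> C * amp k" using k C(2)[of k "(x, t)"] part_in[OF localized_B(1) k(2)] by (simp add: amp_def)
      then have "(norm (part n B (x, t)))\<^sup>2 \<le> w k" unfolding w_def by (intro power_mono) auto
      also have "\<dots> \<le> 2 * w k * inverse (1 + (sc k t)\<^sup>2)"
      proof -
        have "(sc k t)\<^sup>2 \<le> 1" using k(3) by (simp add: win_iff abs_square_le_1)
        then have "1 \<le> 2 * inverse (1 + (sc k t)\<^sup>2)" by (simp add: field_simps add_pos_nonneg)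
        from mult_left_mono[OF this w0[of k]] show ?thesis by (simp add: mult.assoc mult.left_commute)
      qed
      also have "\<dots> \<le> m t" unfolding m_def
      proof (rule member_le_sum)
        show "0 \<le> 2 * w k * inverse (1 + (sc k t)\<^sup>2)" for k
          using w0[of k] by (simp add: add_nonneg_nonneg)
      qed (use k in auto)
      finally show ?thesis .
    next
      case False
      have "part n B (x, t) = 0"
      proof (cases "\<exists>k. x \<in> blob k")
        case True
        then obtain k where k: "x \<in> blob k" by blast
        then have "k < n \<Longrightarrow> t \<notin> win k" using False by auto
        then show ?thesis using part_in[OF localized_B(1) k] localized_B(1) by (auto simp: localized_def)
      next
        case False
        then show ?thesis using part_out[OF localized_B(1)] by simp
      qed
      then show ?thesis using \<open>0 \<le> m t\<close> by simp
    qed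
    ultimately show "\<exists>A m. smooth A \<and> (\<forall>t. (A has_real_derivative m t / 2) (at t)) \<and> continuous_on UNIV m \<and>
       (\<forall>t. 0 \<le> m t \<and> \<bar>A t\<bar> \<le> A0) \<and> (\<forall>x t. (norm (part n B (x, t)))\<^sup>2 \<le> m t)"
      by (intro exI[of _ A] exI[of _ m]) simp
  qed
qed

text \<open>A factor that depends on time alone preserves the divergence constraint, and its
  vanishing from S' < S on makes the support compact in the half-open slab.\<close>

lemma weighted_test_fun:
  assumes S: "0 < S'" "S' < S" and \<theta>: "smooth \<theta>" "\<And>t. S' \<le> t \<Longrightarrow> \<theta> t = 0"
  shows "(\<lambda>z. \<theta> (snd z) *\<^sub>R part n B z) \<in> sol_test_fun S"
  unfolding sol_test_fun_def mem_Collect_eq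
proof (intro conjI ballI allI)
  let ?\<phi> = "\<lambda>z. \<theta> (snd z) *\<^sub>R part n B z"
  have sm: "smooth ?\<phi>"
    by (intro smooth_scaleR smooth_compose_real[OF \<theta>(1)] smooth_linear bounded_linear_snd smooth_part_B)
  show "smooth_on (UNIV \<times> {0..<S}) ?\<phi>"
    unfolding smooth_on_def by (intro ballI exI[of _ UNIV] exI[of _ ?\<phi>]) (simp add: sm)
  show "\<exists>K. compact K \<and> K \<subseteq> UNIV \<times> {0..<S} \<and> (\<forall>x\<in>UNIV \<times> {0..<S} - K. ?\<phi> x = 0)"
  proof (intro exI[of _ "(\<Union>k<n. blob k) \<times> {0..S'}"] conjI ballI)
    show "compact ((\<Union>k<n. blob k) \<times> {0..S'})"
      by (intro compact_Times compact_support_part(1)[OF localized_B(1)] compact_Icc)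
    show "(\<Union>k<n. blob k) \<times> {0..S'} \<subseteq> UNIV \<times> {0..<S}" using S by auto
    fix z assume z: "z \<in> UNIV \<times> {0..<S} - (\<Union>k<n. blob k) \<times> {0..S'}"
    obtain x t where xt: "z = (x, t)" by (cases z)
    have "x \<notin> (\<Union>k<n. blob k) \<or> S' \<le> t" using z by (auto simp: xt)
    then show "?\<phi> z = 0" using compact_support_part(2)[OF localized_B(1), of x n t] \<theta>(2)[of t] by (auto simp: xt)
  qed
  fix t x
  show "divergence (slice ?\<phi> t) x = 0"
    using divergence_part(1)[of n t x]
    by (simp add: divergence_def partial_const_scaleR[OF smooth_imp_differentiable[OF smooth_slice_part(1)]] sum_distrib_left[symmetric])
qed

end

text \<open>W is the other solution and \<open>W'\<close> a Borel representative. T0 removes the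
  null set of exceptional times once and for all, so that every property of W used below holds at
  each of its times.\<close>

locale competitor = cascade +
  fixes S :: real and W W' :: "space \<times> real \<Rightarrow> space" and T0 :: "real set" and CW :: real
  assumes S: "0 < S" and LH: "leray_hopf S (\<lambda>x. 0) force W" and W': "W' \<in> borel_measurable borel"
    and T0: "T0 \<in> sets lebesgue" "T0 \<subseteq> {0<..<S}" "AE t in lebesgue. t \<in> {0<..<S} \<longrightarrow> t \<in> T0"
    and W_good: "\<And>t. t \<in> T0 \<Longrightarrow> good t" "\<And>t. t \<in> T0 \<Longrightarrow> slice W t \<in> L2_sigma" "\<And>t. t \<in> T0 \<Longrightarrow> slice W t \<in> H1"
      "\<And>t. t \<in> T0 \<Longrightarrow> AE x in lebesgue. W (x, t) = W' (x, t)"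
      "\<And>t. t \<in> T0 \<Longrightarrow> (\<integral>x. (norm (W (x, t)))\<^sup>2 \<partial>lebesgue) \<le> CW"
begin

abbreviation M :: "real measure" where "M \<equiv> lebesgue_on T0"

lemma space_M: "space M = T0"
  by simp

lemma finite_M: "finite_measure M"
proof (rule finite_measure_lebesgue_on)
  have "T0 \<in> lmeasurable"
    by (rule fmeasurableI2[of "{0<..<S}"]) (use T0 in auto)
  then show "T0 \<in> lmeasurable" .
qed

lemma bounded_integrable_M:
  fixes h :: "real \<Rightarrow> real"
  assumes "h \<in> borel_measurable M" "\<And>t. t \<in> T0 \<Longrightarrow> \<bar>h t\<bar> \<le> c" shows "integrable M h"
  by (rule finite_measure.integrable_const_bound[OF finite_M, of _ c])
    (use assms in \<open>auto intro!: AE_I2\<close>)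

lemma borel_M: "h \<in> borel_measurable borel \<Longrightarrow> h \<in> borel_measurable M" for h :: "real \<Rightarrow> real"
  by (rule borel_lebesgue_on)

lemma lborel_integrable_M:
  fixes h :: "real \<Rightarrow> real"
  assumes "integrable lborel h" shows "integrable M h"
proof -
  have "integrable lebesgue h" using assms by (subst integrable_lebesgue_iff) auto
  then show ?thesis using T0(1)
    by (subst integrable_restrict_space) (auto intro: integrable_real_mult_indicator simp: mult.commute)
qed

lemma integrable_M_bounded_mult:
  fixes h :: "real \<Rightarrow> real"
  assumes h: "integrable M h" and \<theta>: "\<theta> \<in> borel_measurable borel" "\<And>t. t \<in> T0 \<Longrightarrow> \<bar>\<theta> t\<bar> \<le> c"
  shows "integrable M (\<lambda>t. \<theta> t * h t)"
proof (rule Bochner_Integration.integrable_bound)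
  show "integrable M (\<lambda>t. c * h t)" using h by simp
  show "(\<lambda>t. \<theta> t * h t) \<in> borel_measurable M" using borel_M[OF \<theta>(1)] h by simp
  have "\<bar>\<theta> t\<bar> * \<bar>h t\<bar> \<le> \<bar>c\<bar> * \<bar>h t\<bar>" if "t \<in> T0" for t using \<theta>(2)[OF that] by (intro mult_right_mono) auto
  then show "AE t in M. norm (\<theta> t * h t) \<le> norm (c * h t)" by (auto intro!: AE_I2 simp: abs_mult)
qed

lemma W_L2: "t \<in> T0 \<Longrightarrow> slice W t \<in> Lp lebesgue 2"
  using W_good(2) by (simp add: L2_sigma_def)

lemma W_pairing_measurable:
  assumes u: "u \<in> borel_measurable borel" shows "(\<lambda>t. \<integral>x. W (x, t) \<bullet> u (x, t) \<partial>lebesgue) \<in> borel_measurable M"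
proof -
  have um: "(\<lambda>z. W' z \<bullet> u z) \<in> borel_measurable borel" using W' u by simp
  have eq: "(\<integral>x. W (x, t) \<bullet> u (x, t) \<partial>lebesgue) = (\<integral>x. W' (x, t) \<bullet> u (x, t) \<partial>lborel)" if t: "t \<in> T0" for t
  proof -
    have m: "(\<lambda>x. W' (x, t) \<bullet> u (x, t)) \<in> borel_measurable borel" using borel_slice_space[OF um] .
    have ml: "(\<lambda>x. W' (x, t) \<bullet> u (x, t)) \<in> borel_measurable lebesgue" using m by (simp add: measurable_completion)
    have ae: "AE x in lebesgue. W' (x, t) \<bullet> u (x, t) = W (x, t) \<bullet> u (x, t)" using W_good(4)[OF t] by eventually_elim simp
    have "(\<integral>x. W' (x, t) \<bullet> u (x, t) \<partial>lebesgue) = (\<integral>x. W (x, t) \<bullet> u (x, t) \<partial>lebesgue)"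
      by (rule integral_cong_AE[OF ml borel_measurable_AE[OF ml ae] ae])
    then show ?thesis by (simp add: integral_lebesgue_eq[OF m])
  qed
  have "(\<lambda>t. \<integral>x. W' (x, t) \<bullet> u (x, t) \<partial>lborel) \<in> borel_measurable M"
    by (rule borel_M[OF borel_integral_space[OF um]])
  then show ?thesis using measurable_cong[of M "\<lambda>t. \<integral>x. W (x, t) \<bullet> u (x, t) \<partial>lebesgue"] eq by (simp add: space_M)
qed

definition wn :: "real \<Rightarrow> real" where "wn t = (\<integral>x. (norm (W (x, t)))\<^sup>2 \<partial>lebesgue)"
definition gw :: "real \<Rightarrow> real" where "gw t = wgrad_sqnorm (slice W t)"

lemma wn_bounds: "0 \<le> wn t" "t \<in> T0 \<Longrightarrow> wn t \<le> CW"
  using W_good(5) by (simp_all add: wn_def)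

lemma gw_nonneg: "0 \<le> gw t"
  by (simp add: gw_def wgrad_sqnorm_def sum_nonneg)

lemma wn_integrable: "integrable M wn"
proof -
  have "W \<in> bochner \<infinity> S L2_sigma (Lp_norm lebesgue 2)" using LH by (simp add: leray_hopf_def)
  then have "(\<lambda>t. Lp_norm lebesgue 2 (slice W t)) \<in> borel_measurable (lebesgue_on {0<..<S})"
    by (simp add: bochner_def Lp_def)
  then have "(\<lambda>t. Lp_norm lebesgue 2 (slice W t)) \<in> borel_measurable M"
    by (rule measurable_restrict_mono[OF _ T0(2)])
  then have "(\<lambda>t. (Lp_norm lebesgue 2 (slice W t))\<^sup>2) \<in> borel_measurable M" by simp
  then have m: "wn \<in> borel_measurable M" by (simp add: Lp_norm_2_square wn_def[abs_def])
  show ?thesis by (rule bounded_integrable_M[OF m, of CW]) (use wn_bounds in auto)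
qed

lemma gw_integrable: "integrable M gw"
proof -
  have "W \<in> bochner 2 S H1 H1_norm" using LH by (simp add: leray_hopf_def)
  then have "integrable (lebesgue_on {0<..<S}) (\<lambda>t. (norm (H1_norm (slice W t)))\<^sup>2)"
    by (simp add: bochner_def Lp_2_iff)
  then have "set_integrable lebesgue {0<..<S} (\<lambda>t. (H1_norm (slice W t))\<^sup>2)"
    by (simp add: set_integrable_def integrable_restrict_space)
  then have "integrable M (\<lambda>t. (H1_norm (slice W t))\<^sup>2)"
    using full_measure_integral(1)[OF T0] by blast
  from Bochner_Integration.integrable_diff[OF this wn_integrable]
  have "integrable M (\<lambda>t. (H1_norm (slice W t))\<^sup>2 - wn t)" .
  moreover have "(H1_norm (slice W t))\<^sup>2 - wn t = gw t" for t
  proof -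
    have "0 \<le> (Lp_norm lebesgue 2 (slice W t))\<^sup>2 + wgrad_sqnorm (slice W t)"
      using gw_nonneg[of t] by (simp add: gw_def)
    then show ?thesis by (simp add: H1_norm_def gw_def Lp_norm_2_square wn_def)
  qed
  ultimately show ?thesis by simp
qed

text \<open>The majorant b does not depend on m and n, so that dominated convergence along the
  partial sums becomes possible.\<close>

lemma pairings:
  fixes U :: "nat \<Rightarrow> space \<times> real \<Rightarrow> space"
  assumes U: "localized U" "dominated d U" "d < 7/2" "\<And>k. U k \<in> borel_measurable borel"
  obtains b where "integrable M b" 
    "\<And>t n. t \<in> T0 \<Longrightarrow> \<bar>\<integral>x. W (x, t) \<bullet> part n U (x, t) \<partial>lebesgue\<bar> \<le> b t" "\<And>t. t \<in> T0 \<Longrightarrow> \<bar>\<integral>x. W (x, t) \<bullet> glue U (x, t) \<partial>lebesgue\<bar> \<le> b t"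
    "\<And>t n m. t \<in> T0 \<Longrightarrow> \<bar>\<integral>x. part m B (x, t) \<bullet> part n U (x, t) \<partial>lebesgue\<bar> \<le> b t"
    "\<And>t n m. t \<in> T0 \<Longrightarrow> \<bar>\<integral>x. part m B (x, t) \<bullet> glue U (x, t) \<partial>lebesgue\<bar> \<le> b t"
    "\<And>n. integrable M (\<lambda>t. \<integral>x. W (x, t) \<bullet> part n U (x, t) \<partial>lebesgue)" "integrable M (\<lambda>t. \<integral>x. W (x, t) \<bullet> glue U (x, t) \<partial>lebesgue)"
    "\<And>m n. integrable M (\<lambda>t. \<integral>x. part m B (x, t) \<bullet> part n U (x, t) \<partial>lebesgue)" "\<And>m. integrable M (\<lambda>t. \<integral>x. part m B (x, t) \<bullet> glue U (x, t) \<partial>lebesgue)"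
    "\<And>t n. t \<in> T0 \<Longrightarrow> integrable lebesgue (\<lambda>x. W (x, t) \<bullet> part n U (x, t))" "\<And>t. t \<in> T0 \<Longrightarrow> integrable lebesgue (\<lambda>x. W (x, t) \<bullet> glue U (x, t))"
proof -
  obtain \<alpha> :: "space \<Rightarrow> real" and \<beta> :: "real \<Rightarrow> real" where ab:
    "\<alpha> \<in> borel_measurable borel" "integrable lborel (\<lambda>x. (\<alpha> x)\<^sup>2)" "\<And>t. 0 \<le> \<beta> t" "integrable lborel \<beta>"
    "\<And>x t. good t \<Longrightarrow> norm (glue U (x, t)) \<le> \<alpha> x * \<beta> t"
    "\<And>x t n. good t \<Longrightarrow> norm (part n U (x, t)) \<le> \<alpha> x * \<beta> t"
    by (rule energy_product_bound[OF U(1-3)], rule that)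
  obtain C where C: "0 \<le> C" "\<And>x t. norm (V (x, t)) \<le> C * alpha \<delta> x" "\<And>n x t. norm (part n B (x, t)) \<le> C * alpha \<delta> x"
    by (rule V_bound, rule that)
  define cv where "cv = (\<integral>x. (C * alpha \<delta> x)\<^sup>2 \<partial>lborel)"
  define ca where "ca = (\<integral>x. (\<alpha> x)\<^sup>2 \<partial>lborel)"
  define b where "b t = \<beta> t * (max CW cv + ca)" for t
  have bi: "integrable M b" unfolding b_def[abs_def] using lborel_integrable_M[OF ab(4)] by simp
  have um: "part n U \<in> borel_measurable borel" "glue U \<in> borel_measurable borel" for n
    by (rule part_borel[OF U(4)], rule glue_borel[OF U(1,4)])
  have us: "(\<lambda>x. part n U (x, t)) \<in> borel_measurable borel" "(\<lambda>x. glue U (x, t)) \<in> borel_measurable borel" for n t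
    by (rule borel_slice_space[OF um(1)], rule borel_slice_space[OF um(2)])
  note d = inner_dominated[OF _ _ _ ab(3) ab(1,2)]
  have vb: "(\<integral>x. (norm (part m B (x, t)))\<^sup>2 \<partial>lebesgue) \<le> cv" for m t
  proof -
    have m: "(\<lambda>x. (norm (part m B (x, t)))\<^sup>2) \<in> borel_measurable borel" using borel_slice_space[OF glue_B_borel(5), of m t] by simp
    show ?thesis unfolding integral_lebesgue_eq[OF m] cv_def
      by (rule bounded_L2(2)[OF borel_slice_space[OF glue_B_borel(5)] C(3)])
  qed
  have up: "\<beta> t * (y + (\<integral>x. (\<alpha> x)\<^sup>2 \<partial>lborel)) \<le> b t" if "y \<le> CW \<or> y \<le> cv" for y t
    unfolding b_def ca_def[symmetric] using that ab(3)[of t] by (intro mult_left_mono) auto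
  have b1: "\<bar>\<integral>x. W (x, t) \<bullet> part n U (x, t) \<partial>lebesgue\<bar> \<le> b t" "integrable lebesgue (\<lambda>x. W (x, t) \<bullet> part n U (x, t))"
    "\<bar>\<integral>x. W (x, t) \<bullet> glue U (x, t) \<partial>lebesgue\<bar> \<le> b t" "integrable lebesgue (\<lambda>x. W (x, t) \<bullet> glue U (x, t))" if t: "t \<in> T0" for t n
    using d[OF W_L2[OF t] us(1) ab(6)[OF W_good(1)[OF t]], of n] d[OF W_L2[OF t] us(2) ab(5)[OF W_good(1)[OF t]]]
      up[OF disjI1[OF W_good(5)[OF t]], of t] by linarith+
  have b2: "\<bar>\<integral>x. part m B (x, t) \<bullet> part n U (x, t) \<partial>lebesgue\<bar> \<le> b t" "\<bar>\<integral>x. part m B (x, t) \<bullet> glue U (x, t) \<partial>lebesgue\<bar> \<le> b t"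
    if t: "t \<in> T0" for t n m
    using d(2)[OF V_L2(2)[where n=m and t=t] us(1) ab(6)[OF W_good(1)[OF t]], of n]
      d(2)[OF V_L2(2)[where n=m and t=t] us(2) ab(5)[OF W_good(1)[OF t]]]
      up[OF disjI2[OF vb[of m t]], of t] by linarith+
  have vm: "(\<lambda>t. \<integral>x. part m B (x, t) \<bullet> u (x, t) \<partial>lebesgue) \<in> borel_measurable M" if u: "u \<in> borel_measurable borel" for m u
  proof -
    have um: "(\<lambda>z. part m B z \<bullet> u z) \<in> borel_measurable borel" using u glue_B_borel(5)[of m] by simp
    have "(\<integral>x. part m B (x, t) \<bullet> u (x, t) \<partial>lebesgue) = (\<integral>x. part m B (x, t) \<bullet> u (x, t) \<partial>lborel)" for t
      by (rule integral_lebesgue_eq[OF borel_slice_space[OF um]])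
    then show ?thesis using borel_M[OF borel_integral_space[OF um]] by simp
  qed
  have ib: "integrable M h" if "h \<in> borel_measurable M" "\<And>t. t \<in> T0 \<Longrightarrow> \<bar>h t\<bar> \<le> b t" for h :: "real \<Rightarrow> real"
    by (rule Bochner_Integration.integrable_bound[OF bi that(1)]) (use that(2) in \<open>auto intro!: AE_I2 order_trans[OF _ abs_ge_self]\<close>)
  show thesis
    by (rule that[OF bi b1(1) b1(3) b2(1) b2(2) ib[OF W_pairing_measurable[OF um(1)] b1(1)] ib[OF W_pairing_measurable[OF um(2)] b1(3)]
      ib[OF vm[OF um(1)] b2(1)] ib[OF vm[OF um(2)] b2(2)] b1(2) b1(4)])
qed

text \<open>\<open>wpartial\<close> is chosen separately at each time.
  \<open>weak_integral_class\<close> reduces the claim to pairings with test functions; there the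
  derivative moves to the test function, and \<open>W_pairing_measurable\<close> applies.\<close>

lemma weak_deriv_pairing_measurable:
  assumes G: "G \<in> borel_measurable borel"
    "\<And>t. t \<in> T0 \<Longrightarrow> integrable lebesgue (\<lambda>x. G (x, t) * (wpartial i (slice W t) x \<bullet> axis j 1))"
  shows "(\<lambda>t. \<integral>x. G (x, t) * (wpartial i (slice W t) x \<bullet> axis j 1) \<partial>lebesgue) \<in> borel_measurable M"
proof (rule weak_integral_class[where T=T0 and D="\<lambda>t x. wpartial i (slice W t) x \<bullet> axis j 1" and C="borel_measurable M", OF _ _ _ _ _ _ G])
  show "loc_integrable UNIV (\<lambda>x. wpartial i (slice W t) x \<bullet> axis j 1)" if "t \<in> T0" for t
    by (rule loc_integrable_inner[OF loc_integrable_L2[OF wpartial_H1(2)[OF W_good(3)[OF that]]]])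
next
  fix \<phi> :: "space \<Rightarrow> real" assume \<phi>: "\<phi> \<in> test_fun UNIV"
  obtain K where K: "smooth \<phi>" "compact K" "\<And>x. x \<notin> K \<Longrightarrow> \<phi> x = 0" using \<phi> by (rule test_funD) (rule that)
  define v where "v x = \<phi> x *\<^sub>R axis j (1::real)" for x
  have v: "smooth v" "\<And>x. x \<notin> K \<Longrightarrow> v x = 0"
    unfolding v_def[abs_def] using K by (auto intro: smooth_scaleR smooth_const)
  have vm: "(\<lambda>z. partial i v (fst z)) \<in> borel_measurable (borel :: (space \<times> real) measure)"
    by (rule measurable_compose[OF _ continuous_borel[OF smooth_imp_continuous[OF smooth_partial[OF v(1)]]]])
      (auto intro!: continuous_borel continuous_intros)
  have m: "(\<lambda>t. - (\<integral>x. W (x, t) \<bullet> partial i v x \<partial>lebesgue)) \<in> borel_measurable M"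
    using W_pairing_measurable[OF vm] by simp
  have eq: "- (\<integral>x. W (x, t) \<bullet> partial i v x \<partial>lebesgue) = (\<integral>x. \<phi> x * (wpartial i (slice W t) x \<bullet> axis j 1) \<partial>lebesgue)" if t: "t \<in> T0" for t
  proof -
    have "v x \<bullet> y = \<phi> x * (y \<bullet> axis j 1)" for x y by (simp add: v_def inner_commute)
    then show ?thesis
      using weak_deriv_inner(1)[OF wpartial_H1(1)[OF W_good(3)[OF t]] v(1) K(2) v(2), of i]
      by (simp add: inner_commute[of "W _"])
  qed
  show "(\<lambda>t. \<integral>x. \<phi> x * (wpartial i (slice W t) x \<bullet> axis j 1) \<partial>lebesgue) \<in> borel_measurable M"
    by (rule measurable_cong[THEN iffD1, OF _ m]) (rule eq, simp add: space_M)
next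
  fix u :: "nat \<Rightarrow> real \<Rightarrow> real" and h assume u: "\<And>n. u n \<in> borel_measurable M" "\<And>t. t \<in> T0 \<Longrightarrow> (\<lambda>n. u n t) \<longlonglongrightarrow> h t"
  show "h \<in> borel_measurable M" by (rule borel_measurable_LIMSEQ_metric[OF u(1)]) (use u(2) space_M in auto)
next
  fix a b :: real and u :: "real \<Rightarrow> real" assume "u \<in> borel_measurable M"
  moreover have "(\<lambda>t. indicator (box a b) t :: real) \<in> borel_measurable M" by (rule borel_M) simp
  ultimately show "(\<lambda>t. indicator (box a b) t * u t) \<in> borel_measurable M" by simp
qed auto

lemma integrable_M_cont_mult:
  fixes h :: "real \<Rightarrow> real"
  assumes h: "integrable M h" and \<theta>: "continuous_on UNIV \<theta>" shows "integrable M (\<lambda>t. \<theta> t * h t)"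
proof -
  have "bounded (\<theta> ` {0..S})"
    by (intro compact_imp_bounded compact_continuous_image continuous_on_subset[OF \<theta>]) auto
  then obtain c where c: "\<forall>y\<in>\<theta> ` {0..S}. norm y \<le> c" using bounded_iff by blast
  show ?thesis
    by (rule integrable_M_bounded_mult[OF h continuous_borel[OF \<theta>], of c]) (use c T0(2) in force)
qed

definition Y :: "nat \<Rightarrow> real \<Rightarrow> real" where "Y n t = (\<integral>x. (norm (W (x, t) - part n B (x, t)))\<^sup>2 \<partial>lebesgue)"

text \<open>The pairing of W - v with f - f_n, for the n-th partial sum v and its force f_n, written
  out so that each of the four terms is integrable by itself.\<close>

definition R :: "nat \<Rightarrow> real \<Rightarrow> real" where
  "R n t = (\<integral>x. W (x, t) \<bullet> f (x, t) \<partial>lebesgue) + (\<integral>x. part n B (x, t) \<bullet> part n fB (x, t) \<partial>lebesgue)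
    - (\<integral>x. W (x, t) \<bullet> part n fB (x, t) \<partial>lebesgue) - (\<integral>x. part n B (x, t) \<bullet> f (x, t) \<partial>lebesgue)"

lemma part_B_bounded: obtains c where "0 \<le> c" "\<And>z. norm (part n B z) \<le> c"
proof -
  obtain C where C: "C \<ge> 0" "\<And>k z. norm (B k z) \<le> C * \<epsilon> k powr (- \<delta>)" using dominated_B(1) by (auto simp: dominated_def)
  show thesis
  proof (rule that[of "\<Sum>k<n. C * \<epsilon> k powr (- \<delta>)"])
    show "0 \<le> (\<Sum>k<n. C * \<epsilon> k powr (- \<delta>))" using C(1) by (intro sum_nonneg) auto
    show "norm (part n B z) \<le> (\<Sum>k<n. C * \<epsilon> k powr (- \<delta>))" for z
      unfolding part_def by (rule order_trans[OF norm_sum sum_mono]) (rule C(2))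
  qed
qed

text \<open>Measurability comes from splitting into the nine scalar pairings of a component of W
  with a component of a weak derivative. In the majorant the factor 3 counts the three directions of
  differentiation.\<close>

lemma convection_pairing_integrable:
  "integrable M (\<lambda>t. \<integral>x. convection (slice W t) x \<bullet> part n B (x, t) \<partial>lebesgue)"
proof -
  obtain c where c: "0 \<le> c" "\<And>z. norm (part n B z) \<le> c" by (rule part_B_bounded[of n], rule that)
  let ?v = "\<lambda>t x. part n B (x, t)"
  have vm: "?v t \<in> borel_measurable lebesgue" for t
    using borel_slice_space[OF glue_B_borel(5), of n t] by (simp add: measurable_completion)
  have vjm: "(\<lambda>x. (part n B (x, t) \<bullet> axis j 1) *\<^sub>R axis j (1::real)) \<in> borel_measurable lebesgue" for t j
    using vm[of t] by (intro borel_measurable_scaleR borel_measurable_inner) auto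
  have vjb: "norm ((part n B z \<bullet> axis j 1) *\<^sub>R axis j (1::real)) \<le> c" for z j
    using c(2)[of z] component_le_norm_cart[of "part n B z" j] by (simp add: vec_nth_inner)
  define G where "G i j z = (W' z $ i) * (part n B z \<bullet> axis j 1)" for i j z
  have Gm: "G i j \<in> borel_measurable borel" for i j
    unfolding G_def[abs_def] vec_nth_inner using W' glue_B_borel(5)[of n] by simp
  have I: "integrable lebesgue (\<lambda>x. (W (x, t) $ i) * (wpartial i (slice W t) x \<bullet> ((part n B (x, t) \<bullet> axis j 1) *\<^sub>R axis j 1)))"
    if t: "t \<in> T0" for t i j
    by (rule integrable_mult_bounded[OF W_L2[OF t] wpartial_H1(2)[OF W_good(3)[OF t]] vjm vjb])
  have ae: "AE x in lebesgue. G i j (x, t) * (wpartial i (slice W t) x \<bullet> axis j 1)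
     = (W (x, t) $ i) * (wpartial i (slice W t) x \<bullet> ((part n B (x, t) \<bullet> axis j 1) *\<^sub>R axis j 1))" if t: "t \<in> T0" for t i j
    using W_good(4)[OF t] by eventually_elim (simp add: G_def)
  note GI = integral_cong_AE_lebesgue[OF ae I]
  have "(\<lambda>t. \<Sum>i\<in>UNIV. \<Sum>j\<in>UNIV. \<integral>x. G i j (x, t) * (wpartial i (slice W t) x \<bullet> axis j 1) \<partial>lebesgue) \<in> borel_measurable M"
    by (intro borel_measurable_sum weak_deriv_pairing_measurable[OF Gm] GI(2))
  moreover have "(\<Sum>i\<in>UNIV. \<Sum>j\<in>UNIV. \<integral>x. G i j (x, t) * (wpartial i (slice W t) x \<bullet> axis j 1) \<partial>lebesgue)
     = (\<integral>x. convection (slice W t) x \<bullet> part n B (x, t) \<partial>lebesgue)" if t: "t \<in> T0" for t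
  proof -
    have e: "convection (slice W t) x \<bullet> part n B (x, t) = (\<Sum>i\<in>UNIV. \<Sum>j\<in>UNIV.
       (W (x, t) $ i) * (wpartial i (slice W t) x \<bullet> ((part n B (x, t) \<bullet> axis j 1) *\<^sub>R axis j 1)))" for x
      by (simp add: convection_def inner_sum_left inner_vec_def[of "wpartial _ _ _" "part n B _"] sum_distrib_left inner_axis mult_ac)
    show ?thesis
      unfolding e GI(1)[OF t t]
      by (subst Bochner_Integration.integral_sum, rule Bochner_Integration.integrable_sum, rule I[OF t])
        (subst Bochner_Integration.integral_sum, rule I[OF t], rule refl)
  qed
  ultimately have m: "(\<lambda>t. \<integral>x. convection (slice W t) x \<bullet> part n B (x, t) \<partial>lebesgue) \<in> borel_measurable M"
    by (rule measurable_cong[THEN iffD1, rotated]) (simp add: space_M)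
  have ji: "integrable M (\<lambda>t. c * (3 * wn t + gw t))"
    by (intro integrable_mult_right Bochner_Integration.integrable_add wn_integrable gw_integrable)
  show ?thesis
  proof (rule Bochner_Integration.integrable_bound[OF ji m])
    show "AE t in M. norm (\<integral>x. convection (slice W t) x \<bullet> part n B (x, t) \<partial>lebesgue) \<le> norm (c * (3 * wn t + gw t))"
    proof (rule AE_I2)
      fix t assume "t \<in> space M"
      then have t: "t \<in> T0" by simp
      let ?D = "\<lambda>i. wpartial i (slice W t)"
      have DL: "?D i \<in> Lp lebesgue 2" for i by (rule wpartial_H1(2)[OF W_good(3)[OF t]])
      have b: "\<bar>convection (slice W t) x \<bullet> part n B (x, t)\<bar> \<le> (\<Sum>i\<in>UNIV. c * ((norm (W (x, t)))\<^sup>2 + (norm (?D i x))\<^sup>2))" for x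
      proof -
        have "\<bar>(W (x, t) $ i) * (?D i x \<bullet> part n B (x, t))\<bar> \<le> c * ((norm (W (x, t)))\<^sup>2 + (norm (?D i x))\<^sup>2)" for i
        proof -
          have "\<bar>?D i x \<bullet> part n B (x, t)\<bar> \<le> norm (?D i x) * c"
            using Cauchy_Schwarz_ineq2[of "?D i x" "part n B (x, t)"] mult_left_mono[OF c(2) norm_ge_zero[of "?D i x"], of "(x, t)"] by linarith
          then have "\<bar>W (x, t) $ i\<bar> * \<bar>?D i x \<bullet> part n B (x, t)\<bar> \<le> norm (W (x, t)) * (norm (?D i x) * c)"
            by (intro mult_mono component_le_norm_cart) auto
          also have "\<dots> = c * (norm (W (x, t)) * norm (?D i x))" by simp
          also have "\<dots> \<le> c * ((norm (W (x, t)))\<^sup>2 + (norm (?D i x))\<^sup>2)"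
          proof (rule mult_left_mono[OF _ c(1)])
            have "2 * (norm (W (x, t)) * norm (?D i x)) \<le> (norm (W (x, t)))\<^sup>2 + (norm (?D i x))\<^sup>2"
              using zero_le_power2[of "norm (W (x, t)) - norm (?D i x)"] by (simp add: power2_diff)
            moreover have "0 \<le> norm (W (x, t)) * norm (?D i x)" by simp
            ultimately show "norm (W (x, t)) * norm (?D i x) \<le> (norm (W (x, t)))\<^sup>2 + (norm (?D i x))\<^sup>2" by linarith
          qed
          finally show ?thesis by (simp add: abs_mult)
        qed
        then have "(\<Sum>i\<in>UNIV. \<bar>(W (x, t) $ i) * (?D i x \<bullet> part n B (x, t))\<bar>) \<le> (\<Sum>i\<in>UNIV. c * ((norm (W (x, t)))\<^sup>2 + (norm (?D i x))\<^sup>2))"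
          by (rule sum_mono)
        moreover have "\<bar>convection (slice W t) x \<bullet> part n B (x, t)\<bar> \<le> (\<Sum>i\<in>UNIV. \<bar>(W (x, t) $ i) * (?D i x \<bullet> part n B (x, t))\<bar>)"
          by (simp add: convection_def inner_sum_left)
        ultimately show ?thesis by linarith
      qed
      have bi: "integrable lebesgue (\<lambda>x. c * ((norm (W (x, t)))\<^sup>2 + (norm (?D i x))\<^sup>2))" for i
        using W_L2[OF t] DL[of i] by (simp add: Lp_2_iff)
      have ci: "integrable lebesgue (\<lambda>x. convection (slice W t) x \<bullet> part n B (x, t))"
        by (rule integrable_convection[OF W_good(3,2)[OF t] smooth_slice_part(1) compact_support_part[OF localized_B(1)] divergence_part(1) c(2)])
      have "\<bar>\<integral>x. convection (slice W t) x \<bullet> part n B (x, t) \<partial>lebesgue\<bar> \<le> (\<integral>x. \<bar>convection (slice W t) x \<bullet> part n B (x, t)\<bar> \<partial>lebesgue)"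
        by (rule integral_abs_bound)
      also have "\<dots> \<le> (\<integral>x. (\<Sum>i\<in>UNIV. c * ((norm (W (x, t)))\<^sup>2 + (norm (?D i x))\<^sup>2)) \<partial>lebesgue)"
        by (rule integral_mono[OF integrable_abs[OF ci] Bochner_Integration.integrable_sum[OF bi] b])
      also have "\<dots> = (\<Sum>i\<in>(UNIV :: 3 set). c * (wn t + (\<integral>x. (norm (?D i x))\<^sup>2 \<partial>lebesgue)))"
        using W_L2[OF t] DL by (simp add: Bochner_Integration.integral_sum[OF bi] wn_def Lp_2_iff)
      also have "\<dots> = c * (3 * wn t + gw t)"
        by (simp add: sum_distrib_left[symmetric] sum.distrib gw_def wgrad_sqnorm_eq)
      finally show "norm (\<integral>x. convection (slice W t) x \<bullet> part n B (x, t) \<partial>lebesgue) \<le> norm (c * (3 * wn t + gw t))" by simp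
    qed
  qed
qed

text \<open>The energy inequality at time t is multiplied by -\<theta>' \<ge> 0 and integrated;
  \<open>integral_time_triangle\<close> replaces the integrals up to t by weights \<theta>.\<close>

lemma weighted_energy_W:
  assumes \<theta>: "\<And>t. (\<theta> has_real_derivative \<theta>' t) (at t)" "continuous_on UNIV \<theta>'" "\<theta> S = 0" "\<And>t. t \<in> {0<..<S} \<Longrightarrow> \<theta>' t \<le> 0"
    and ei: "integrable M (\<lambda>t. \<integral>x. W (x, t) \<bullet> f (x, t) \<partial>lebesgue)"
  shows "- (\<integral>t. \<theta>' t * wn t \<partial>M) + 2 * (\<integral>t. \<theta> t * gw t \<partial>M) \<le> 2 * (\<integral>t. \<theta> t * (\<integral>x. W (x, t) \<bullet> f (x, t) \<partial>lebesgue) \<partial>M)"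
proof -
  let ?e = "\<lambda>t. \<integral>x. W (x, t) \<bullet> f (x, t) \<partial>lebesgue"
  have \<theta>c: "continuous_on UNIV \<theta>" using \<theta>(1) by (auto intro!: continuous_at_imp_continuous_on DERIV_isCont)
  have en: "wn t + 2 * (LINT s:{0<..<t}|lebesgue. gw s) \<le> 2 * (LINT s:{0<..<t}|lebesgue. ?e s)" if t: "t \<in> T0" for t
  proof -
    have "t \<in> {0<..S}" using t T0(2) by auto
    then have "energy_lhs W t \<le> energy_rhs (\<lambda>x. 0) force W t" using LH by (simp add: leray_hopf_def)
    then show ?thesis
      by (simp add: energy_lhs_def energy_rhs_def Lp_norm_2_square force_slice wn_def gw_def inner_commute)
  qed
  have sg: "set_integrable lebesgue {0<..<S} gw" "set_integrable lebesgue {0<..<S} ?e"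
    using full_measure_integral(1)[OF T0] gw_integrable ei by blast+
  note tg = integral_time_triangle[OF S sg(1) \<theta>(1,2,3)]
  note te = integral_time_triangle[OF S sg(2) \<theta>(1,2,3)]
  have i1: "integrable M (\<lambda>t. - \<theta>' t * (LINT s:{0<..<t}|lebesgue. gw s))" "integrable M (\<lambda>t. - \<theta>' t * (LINT s:{0<..<t}|lebesgue. ?e s))"
    using full_measure_integral(1)[OF T0] tg(1) te(1) by blast+
  have i2: "integrable M (\<lambda>t. \<theta> t * gw t)" "integrable M (\<lambda>t. \<theta> t * ?e t)"
    by (rule integrable_M_cont_mult[OF gw_integrable \<theta>c] integrable_M_cont_mult[OF ei \<theta>c])+
  have i3: "integrable M (\<lambda>t. \<theta>' t * wn t)" by (rule integrable_M_cont_mult[OF wn_integrable \<theta>(2)])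
  have eg: "(\<integral>t. - \<theta>' t * (LINT s:{0<..<t}|lebesgue. gw s) \<partial>M) = (\<integral>t. \<theta> t * gw t \<partial>M)"
    using tg(2) full_measure_integral(2)[OF T0 i1(1)] full_measure_integral(2)[OF T0 i2(1)] by linarith
  have ee: "(\<integral>t. - \<theta>' t * (LINT s:{0<..<t}|lebesgue. ?e s) \<partial>M) = (\<integral>t. \<theta> t * ?e t \<partial>M)"
    using te(2) full_measure_integral(2)[OF T0 i1(2)] full_measure_integral(2)[OF T0 i2(2)] by linarith
  have "(\<integral>t. - (\<theta>' t * wn t) + 2 * (- \<theta>' t * (LINT s:{0<..<t}|lebesgue. gw s)) \<partial>M)
      \<le> (\<integral>t. 2 * (- \<theta>' t * (LINT s:{0<..<t}|lebesgue. ?e s)) \<partial>M)"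
  proof (rule integral_mono)
    fix t assume "t \<in> space M"
    then have t: "t \<in> T0" by simp
    then have "0 \<le> - \<theta>' t" using \<theta>(4)[of t] T0(2) by auto
    from mult_left_mono[OF en[OF t] this]
    show "- (\<theta>' t * wn t) + 2 * (- \<theta>' t * (LINT s:{0<..<t}|lebesgue. gw s)) \<le> 2 * (- \<theta>' t * (LINT s:{0<..<t}|lebesgue. ?e s))"
      by (simp add: algebra_simps)
  qed (intro Bochner_Integration.integrable_add integrable_minus integrable_mult_right i1 i3)+
  moreover have "(\<integral>t. - (\<theta>' t * wn t) + 2 * (- \<theta>' t * (LINT s:{0<..<t}|lebesgue. gw s)) \<partial>M)
     = - (\<integral>t. \<theta>' t * wn t \<partial>M) + 2 * (\<integral>t. - \<theta>' t * (LINT s:{0<..<t}|lebesgue. gw s) \<partial>M)"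
    by (subst Bochner_Integration.integral_add[OF integrable_minus[OF i3] integrable_mult_right[OF i1(1)]]) simp
  moreover have "(\<integral>t. 2 * (- \<theta>' t * (LINT s:{0<..<t}|lebesgue. ?e s)) \<partial>M) = 2 * (\<integral>t. - \<theta>' t * (LINT s:{0<..<t}|lebesgue. ?e s) \<partial>M)"
    by (rule integral_mult_right_zero)
  ultimately show ?thesis unfolding eg ee by linarith
qed

lemma part_pairings_integrable:
  fixes U :: "nat \<Rightarrow> space \<times> real \<Rightarrow> space"
  assumes U: "localized U" "dominated d U" "d < 7/2" "\<And>k. U k \<in> borel_measurable borel"
  shows "integrable M (\<lambda>t. \<integral>x. W (x, t) \<bullet> part n U (x, t) \<partial>lebesgue)" "integrable M (\<lambda>t. \<integral>x. W (x, t) \<bullet> glue U (x, t) \<partial>lebesgue)"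
    "integrable M (\<lambda>t. \<integral>x. part m B (x, t) \<bullet> part n U (x, t) \<partial>lebesgue)" "integrable M (\<lambda>t. \<integral>x. part m B (x, t) \<bullet> glue U (x, t) \<partial>lebesgue)"
    "t \<in> T0 \<Longrightarrow> integrable lebesgue (\<lambda>x. W (x, t) \<bullet> part n U (x, t))"
proof -
  \<comment> \<open>Only the integrability claims are kept; b is a dummy for which 0 is
    supplied.\<close>
  obtain b where "\<And>n. integrable M (\<lambda>t. \<integral>x. W (x, t) \<bullet> part n U (x, t) \<partial>lebesgue)" "integrable M (\<lambda>t. \<integral>x. W (x, t) \<bullet> glue U (x, t) \<partial>lebesgue)"
    "\<And>m n. integrable M (\<lambda>t. \<integral>x. part m B (x, t) \<bullet> part n U (x, t) \<partial>lebesgue)" "\<And>m. integrable M (\<lambda>t. \<integral>x. part m B (x, t) \<bullet> glue U (x, t) \<partial>lebesgue)"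
    "\<And>t n. t \<in> T0 \<Longrightarrow> integrable lebesgue (\<lambda>x. W (x, t) \<bullet> part n U (x, t))" "b = (0::real)"
    by (rule pairings[OF U], rule that) (assumption | rule refl)+
  then show "integrable M (\<lambda>t. \<integral>x. W (x, t) \<bullet> part n U (x, t) \<partial>lebesgue)" "integrable M (\<lambda>t. \<integral>x. W (x, t) \<bullet> glue U (x, t) \<partial>lebesgue)"
    "integrable M (\<lambda>t. \<integral>x. part m B (x, t) \<bullet> part n U (x, t) \<partial>lebesgue)" "integrable M (\<lambda>t. \<integral>x. part m B (x, t) \<bullet> glue U (x, t) \<partial>lebesgue)"
    "t \<in> T0 \<Longrightarrow> integrable lebesgue (\<lambda>x. W (x, t) \<bullet> part n U (x, t))" by simp_all
qed

lemma exponents: "\<delta> < 7/2" "2 + \<delta> < 7/2" "1 + 2 * \<delta> < 7/2"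
  using delta by simp_all

lemmas B_pairings = part_pairings_integrable[OF localized_B(1) dominated_B(1) exponents(1) B_borel(1)]
lemmas TB_pairings = part_pairings_integrable[OF localized_B(2) dominated_B(2) exponents(2) B_borel(2)]
lemmas LB_pairings = part_pairings_integrable[OF localized_B(3) dominated_B(3) exponents(2) B_borel(3)]
lemmas AB_pairings = part_pairings_integrable[OF localized_B(5) dominated_B(5) exponents(3) B_borel(5)]
lemmas fB_pairings = part_pairings_integrable[OF localized_fB dominated_fB exponents(2) B_borel(6)]

lemma Y_eq: assumes t: "t \<in> T0"
  shows "Y n t = wn t - 2 * (\<integral>x. W (x, t) \<bullet> part n B (x, t) \<partial>lebesgue) + (\<integral>x. part n B (x, t) \<bullet> part n B (x, t) \<partial>lebesgue)"
proof -
  have e: "(norm (W (x, t) - part n B (x, t)))\<^sup>2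
      = (norm (W (x, t)))\<^sup>2 - 2 * (W (x, t) \<bullet> part n B (x, t)) + part n B (x, t) \<bullet> part n B (x, t)" for x
    by (simp add: power2_norm_eq_inner inner_diff inner_commute)
  have i: "integrable lebesgue (\<lambda>x. (norm (W (x, t)))\<^sup>2)" "integrable lebesgue (\<lambda>x. part n B (x, t) \<bullet> part n B (x, t))"
    using W_L2[OF t] V_L2(2)[of n t] by (simp_all add: Lp_2_iff power2_norm_eq_inner)
  show ?thesis unfolding Y_def e wn_def using i B_pairings(5)[OF t, of n] by simp
qed

lemma Y_nonneg: "0 \<le> Y n t"
  by (simp add: Y_def)

lemma Y_integrable: "integrable M (Y n)"
proof -
  have i: "integrable M (\<lambda>t. wn t - 2 * (\<integral>x. W (x, t) \<bullet> part n B (x, t) \<partial>lebesgue) + (\<integral>x. part n B (x, t) \<bullet> part n B (x, t) \<partial>lebesgue))"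
    by (intro Bochner_Integration.integrable_add Bochner_Integration.integrable_diff integrable_mult_right wn_integrable B_pairings)
  show ?thesis
    by (rule iffD1[OF Bochner_Integration.integrable_cong[OF refl] i]) (simp add: Y_eq)
qed

lemma R_integrable: "integrable M (R n)"
  unfolding R_def[abs_def]
  by (intro Bochner_Integration.integrable_add Bochner_Integration.integrable_diff fB_pairings)

text \<open>The weak formulation tested with \<open>\<theta> v\<close>, \<open>v\<close> a partial sum of the cascade, whose time derivative is
  eliminated by the equation that \<open>v\<close> satisfies.\<close>

definition tested :: "nat \<Rightarrow> real \<Rightarrow> real" where
  "tested n t = - 2 * (\<integral>x. W (x, t) \<bullet> part n LB (x, t) \<partial>lebesgue) + (\<integral>x. convection (slice W t) x \<bullet> part n B (x, t) \<partial>lebesgue)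
    + (\<integral>x. W (x, t) \<bullet> part n AB (x, t) \<partial>lebesgue) - (\<integral>x. W (x, t) \<bullet> part n fB (x, t) \<partial>lebesgue)"

lemma tested_integrable: "integrable M (tested n)"
  unfolding tested_def[abs_def]
  by (intro Bochner_Integration.integrable_add Bochner_Integration.integrable_diff integrable_mult_right
      LB_pairings AB_pairings fB_pairings convection_pairing_integrable)

text \<open>\<open>convection_ineq\<close> with the sup bound sqrt m. The two terms with
  \<open>LB\<close> cancel, and the energy identity of the partial sum replaces its Dirichlet
  integral by pairings with its force and its time derivative.\<close>

lemma tested_le:
  assumes t: "t \<in> T0" and m: "0 \<le> m" "\<And>x. (norm (part n B (x, t)))\<^sup>2 \<le> m"
  shows "tested n t \<le> gw t + ((\<integral>x. part n B (x, t) \<bullet> part n fB (x, t) \<partial>lebesgue) - (\<integral>x. part n B (x, t) \<bullet> part n TB (x, t) \<partial>lebesgue))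
    + m / 4 * Y n t - (\<integral>x. W (x, t) \<bullet> part n fB (x, t) \<partial>lebesgue)"
proof -
  have n: "norm (part n B (x, t)) \<le> sqrt m" for x by (rule real_le_rsqrt[OF m(2)])
  note v = smooth_slice_part(1)[of n t] compact_support_part[OF localized_B(1)]
  have g: "(\<integral>x. (\<Sum>i\<in>UNIV. wpartial i (slice W t) x \<bullet> partial i (slice (part n B) t) x) \<partial>lebesgue) = - (\<integral>x. W (x, t) \<bullet> part n LB (x, t) \<partial>lebesgue)"
    using integral_wgrad[OF W_good(3)[OF t] v] by (simp add: laplacian_part)
  have di: "integrable lebesgue (\<lambda>x. (norm (part n (DB i) (x, t)))\<^sup>2)" for i
    using C1c_L2(2)[OF C1c_part(1)[of n t], of i] by (simp add: Lp_2_iff partial_part)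
  have d: "(\<integral>x. (\<Sum>i\<in>UNIV. (norm (partial i (slice (part n B) t) x))\<^sup>2) \<partial>lebesgue)
      = (\<Sum>i\<in>UNIV. \<integral>x. (norm (part n (DB i) (x, t)))\<^sup>2 \<partial>lebesgue)"
    by (simp add: partial_part Bochner_Integration.integral_sum[OF di])
  have "(\<integral>x. convection (slice W t) x \<bullet> part n B (x, t) \<partial>lebesgue) + (\<integral>x. W (x, t) \<bullet> part n AB (x, t) \<partial>lebesgue)
      \<le> gw t + 2 * (\<integral>x. W (x, t) \<bullet> part n LB (x, t) \<partial>lebesgue) + (\<Sum>i\<in>UNIV. \<integral>x. (norm (part n (DB i) (x, t)))\<^sup>2 \<partial>lebesgue) + m / 4 * Y n t"
    using convection_ineq[OF W_good(3)[OF t] W_good(2)[OF t] v divergence_part(1) n] m(1)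
    unfolding g d by (simp add: self_adv_part gw_def Y_def)
  then show ?thesis
    using energy_identity_part[of n t] by (simp add: tested_def inner_commute[of "part n B _"])
qed

text \<open>The first identity is the weak formulation of W, tested with \<theta> v. The second is
  the integral of the time derivative of \<theta> |v|^2, which vanishes because v is 0 early and
  \<theta> is 0 late.\<close>

lemma tested_weak_form:
  assumes S': "0 < S'" "S' < S" and \<theta>: "smooth \<theta>" "\<And>t. S' \<le> t \<Longrightarrow> \<theta> t = 0"
    and d: "\<And>t. (\<theta> has_real_derivative \<theta>' t) (at t)" "continuous_on UNIV \<theta>'"
  shows "(\<integral>t. \<theta> t * tested n t - \<theta>' t * (\<integral>x. W (x, t) \<bullet> part n B (x, t) \<partial>lebesgue) \<partial>M)
      = (\<integral>t. \<theta> t * (\<integral>x. part n B (x, t) \<bullet> f (x, t) \<partial>lebesgue) \<partial>M)"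
    "(\<integral>t. 2 * (\<theta> t * (\<integral>x. part n B (x, t) \<bullet> part n TB (x, t) \<partial>lebesgue)) + \<theta>' t * (\<integral>x. part n B (x, t) \<bullet> part n B (x, t) \<partial>lebesgue) \<partial>M) = 0"
proof -
  define \<phi> where "\<phi> z = \<theta> (snd z) *\<^sub>R part n B z" for z
  have \<phi>: "\<phi> \<in> sol_test_fun S" unfolding \<phi>_def[abs_def] by (rule weighted_test_fun[OF S' \<theta>])
  obtain K where sl: "slab_test \<phi> S K" by (rule sol_test_fun_slab[OF \<phi> S])
  interpret sl: slab_test \<phi> S K by (rule sl)
  have \<theta>c: "continuous_on UNIV \<theta>" by (rule smooth_imp_continuous[OF \<theta>(1)])
  have td: "time_deriv \<phi> (x, t) = \<theta>' t *\<^sub>R part n B (x, t) + \<theta> t *\<^sub>R part n TB (x, t)" if t: "t \<in> T0" for x t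
  proof -
    have "((\<lambda>s. \<phi> (x, s)) has_vector_derivative \<theta> t *\<^sub>R part n TB (x, t) + \<theta>' t *\<^sub>R part n B (x, t)) (at t)"
      unfolding \<phi>_def snd_conv by (rule has_vector_derivative_scaleR[OF d(1) part_time_deriv])
    moreover have "((\<lambda>s. \<phi> (x, s)) has_vector_derivative time_deriv \<phi> (x, t)) (at t)"
      by (rule sl.slice_deriv(3)) (use t T0(2) in auto)
    ultimately show ?thesis using vector_derivative_unique_at by fastforce
  qed
  have pd: "partial i (slice \<phi> t) x = \<theta> t *\<^sub>R partial i (slice (part n B) t) x" for i t x
    unfolding \<phi>_def snd_conv
    by (rule partial_const_scaleR[OF smooth_imp_differentiable[OF smooth_slice_part(1)]])
  have inner: "(\<integral>x. (\<Sum>i\<in>UNIV. wpartial i (slice W t) x \<bullet> partial i (slice \<phi> t) x) + convection (slice W t) x \<bullet> \<phi> (x, t)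
      - W (x, t) \<bullet> time_deriv \<phi> (x, t) \<partial>lebesgue) = \<theta> t * tested n t - \<theta>' t * (\<integral>x. W (x, t) \<bullet> part n B (x, t) \<partial>lebesgue)"
    if t: "t \<in> T0" for t
  proof -
    obtain c where c: "0 \<le> c" "\<And>z. norm (part n B z) \<le> c" by (rule part_B_bounded[of n], rule that)
    note v = smooth_slice_part(1)[of n t] compact_support_part[OF localized_B(1)]
    define g where "g x = (\<Sum>i\<in>UNIV. wpartial i (slice W t) x \<bullet> partial i (slice (part n B) t) x)" for x
    define k where "k x = convection (slice W t) x \<bullet> part n B (x, t)" for x
    define a where "a x = W (x, t) \<bullet> part n B (x, t)" for x
    define u where "u x = W (x, t) \<bullet> part n TB (x, t)" for x
    have i: "integrable lebesgue g" "integrable lebesgue k" "integrable lebesgue a" "integrable lebesgue u"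
      unfolding g_def[abs_def] k_def[abs_def] a_def[abs_def] u_def[abs_def]
      by (rule Bochner_Integration.integrable_sum, rule integrable_wgrad[OF W_good(3)[OF t] v], assumption)
        (rule integrable_convection[OF W_good(3,2)[OF t] v divergence_part(1) c(2)], assumption, rule B_pairings(5)[OF t], rule TB_pairings(5)[OF t])
    have gi: "(\<integral>x. g x \<partial>lebesgue) = - (\<integral>x. W (x, t) \<bullet> part n LB (x, t) \<partial>lebesgue)"
      unfolding g_def[abs_def] using integral_wgrad[OF W_good(3)[OF t] v] by (simp add: laplacian_part)
    have "part n fB (x, t) = part n TB (x, t) - part n LB (x, t) + part n AB (x, t)" for x by (rule part_fB)
    then have ui: "(\<integral>x. W (x, t) \<bullet> part n fB (x, t) \<partial>lebesgue) = (\<integral>x. u x \<partial>lebesgue) - (\<integral>x. W (x, t) \<bullet> part n LB (x, t) \<partial>lebesgue)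
       + (\<integral>x. W (x, t) \<bullet> part n AB (x, t) \<partial>lebesgue)"
      using TB_pairings(5)[OF t, of n] LB_pairings(5)[OF t, of n] AB_pairings(5)[OF t, of n] by (simp add: u_def inner_add_right inner_diff_right)
    have "(\<integral>x. (\<Sum>i\<in>UNIV. wpartial i (slice W t) x \<bullet> partial i (slice \<phi> t) x) + convection (slice W t) x \<bullet> \<phi> (x, t)
      - W (x, t) \<bullet> time_deriv \<phi> (x, t) \<partial>lebesgue) = (\<integral>x. \<theta> t * g x + \<theta> t * k x - (\<theta>' t * a x + \<theta> t * u x) \<partial>lebesgue)"
      unfolding pd td[OF t] g_def k_def a_def u_def
      by (simp add: \<phi>_def inner_add_right sum_distrib_left)
    also have "\<dots> = \<theta> t * (\<integral>x. g x \<partial>lebesgue) + \<theta> t * (\<integral>x. k x \<partial>lebesgue) - (\<theta>' t * (\<integral>x. a x \<partial>lebesgue) + \<theta> t * (\<integral>x. u x \<partial>lebesgue))"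
      using i by simp
    also have "\<dots> = \<theta> t * tested n t - \<theta>' t * (\<integral>x. W (x, t) \<bullet> part n B (x, t) \<partial>lebesgue)"
      unfolding tested_def ui gi a_def k_def by (simp add: algebra_simps)
    finally show ?thesis .
  qed
  have il: "integrable M (\<lambda>t. \<theta> t * tested n t - \<theta>' t * (\<integral>x. W (x, t) \<bullet> part n B (x, t) \<partial>lebesgue))"
    by (intro Bochner_Integration.integrable_diff integrable_M_cont_mult tested_integrable B_pairings \<theta>c d(2))
  have ir: "integrable M (\<lambda>t. \<theta> t * (\<integral>x. part n B (x, t) \<bullet> f (x, t) \<partial>lebesgue))"
    by (intro integrable_M_cont_mult fB_pairings \<theta>c)
  have "(LINT t:{0<..<S}|lebesgue. (\<integral>x. (\<Sum>i\<in>UNIV. wpartial i (slice W t) x \<bullet> partial i (slice \<phi> t) x) + convection (slice W t) x \<bullet> \<phi> (x, t)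
      - W (x, t) \<bullet> time_deriv \<phi> (x, t) \<partial>lebesgue)) = (LINT t:{0<..<S}|lebesgue. force t (slice \<phi> t)) + L2_inner (\<lambda>x. 0) (slice \<phi> 0)"
    using LH \<phi> by (simp add: leray_hopf_def)
  moreover have "L2_inner (\<lambda>x. 0) (slice \<phi> 0) = 0" by (simp add: L2_inner_def)
  moreover have "force t (slice \<phi> t) = \<theta> t * (\<integral>x. part n B (x, t) \<bullet> f (x, t) \<partial>lebesgue)" for t
    unfolding force_slice by (simp add: \<phi>_def inner_commute)
  moreover have "(LINT t:{0<..<S}|lebesgue. (\<integral>x. (\<Sum>i\<in>UNIV. wpartial i (slice W t) x \<bullet> partial i (slice \<phi> t) x) + convection (slice W t) x \<bullet> \<phi> (x, t)
      - W (x, t) \<bullet> time_deriv \<phi> (x, t) \<partial>lebesgue))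
     = (LINT t:{0<..<S}|lebesgue. \<theta> t * tested n t - \<theta>' t * (\<integral>x. W (x, t) \<bullet> part n B (x, t) \<partial>lebesgue))"
  proof (rule set_integral_cong_AE_lebesgue(1))
    show "set_integrable lebesgue {0<..<S} (\<lambda>t. \<theta> t * tested n t - \<theta>' t * (\<integral>x. W (x, t) \<bullet> part n B (x, t) \<partial>lebesgue))"
      using il full_measure_integral(1)[OF T0] by blast
    show "AE t in lebesgue. t \<in> {0<..<S} \<longrightarrow> (\<integral>x. (\<Sum>i\<in>UNIV. wpartial i (slice W t) x \<bullet> partial i (slice \<phi> t) x) + convection (slice W t) x \<bullet> \<phi> (x, t)
      - W (x, t) \<bullet> time_deriv \<phi> (x, t) \<partial>lebesgue) = \<theta> t * tested n t - \<theta>' t * (\<integral>x. W (x, t) \<bullet> part n B (x, t) \<partial>lebesgue)"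
      using T0(3) by eventually_elim (rule impI, drule mp, assumption, rule inner)
  qed
  ultimately have "(LINT t:{0<..<S}|lebesgue. \<theta> t * tested n t - \<theta>' t * (\<integral>x. W (x, t) \<bullet> part n B (x, t) \<partial>lebesgue))
     = (LINT t:{0<..<S}|lebesgue. \<theta> t * (\<integral>x. part n B (x, t) \<bullet> f (x, t) \<partial>lebesgue))" by (simp only: add_0_right)
  then show "(\<integral>t. \<theta> t * tested n t - \<theta>' t * (\<integral>x. W (x, t) \<bullet> part n B (x, t) \<partial>lebesgue) \<partial>M)
      = (\<integral>t. \<theta> t * (\<integral>x. part n B (x, t) \<bullet> f (x, t) \<partial>lebesgue) \<partial>M)"
    using full_measure_integral(2)[OF T0 il] full_measure_integral(2)[OF T0 ir] by linarith

  let ?q = "\<lambda>t. \<integral>x. part n B (x, t) \<bullet> part n TB (x, t) \<partial>lebesgue"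
  let ?b = "\<lambda>t. \<integral>x. part n B (x, t) \<bullet> part n B (x, t) \<partial>lebesgue"
  have i1: "integrable M (\<lambda>t. \<theta> t * ?q t)" "integrable M (\<lambda>t. \<theta>' t * ?b t + \<theta> t * ?q t)"
    by (intro Bochner_Integration.integrable_add integrable_M_cont_mult B_pairings TB_pairings \<theta>c d(2))+
  have "(LINT t:{0<..<S}|lebesgue. \<integral>x. part n TB (x, t) \<bullet> \<phi> (x, t) \<partial>lebesgue)
    + (LINT t:{0<..<S}|lebesgue. \<integral>x. part n B (x, t) \<bullet> time_deriv \<phi> (x, t) \<partial>lebesgue) = 0"
    by (rule sl.time_parts[OF glue_B_integrable(4,5) half_t0 early_0(2)[OF localized_B(1)] early_0(2)[OF localized_B(2)] part_time_deriv])
  moreover have "(\<integral>x. part n TB (x, t) \<bullet> \<phi> (x, t) \<partial>lebesgue) = \<theta> t * ?q t" for t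
    by (simp add: \<phi>_def inner_commute)
  moreover have "(LINT t:{0<..<S}|lebesgue. \<integral>x. part n B (x, t) \<bullet> time_deriv \<phi> (x, t) \<partial>lebesgue)
     = (LINT t:{0<..<S}|lebesgue. \<theta>' t * ?b t + \<theta> t * ?q t)"
  proof (rule set_integral_cong_AE_lebesgue(1))
    show "set_integrable lebesgue {0<..<S} (\<lambda>t. \<theta>' t * ?b t + \<theta> t * ?q t)"
      using i1(2) full_measure_integral(1)[OF T0] by blast
    have e: "(\<integral>x. part n B (x, t) \<bullet> time_deriv \<phi> (x, t) \<partial>lebesgue) = \<theta>' t * ?b t + \<theta> t * ?q t" if t: "t \<in> T0" for t
    proof -
      have "integrable lebesgue (\<lambda>x. part n B (x, t) \<bullet> part n B (x, t))" "integrable lebesgue (\<lambda>x. part n B (x, t) \<bullet> part n TB (x, t))"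
        by (rule part_integrable[OF smooth_B(1) localized_B(1) smooth_imp_continuous[OF smooth_slice_part(1)]]
            part_integrable[OF smooth_B(1) localized_B(1) smooth_imp_continuous[OF smooth_slice_part(2)]])+
      then show ?thesis unfolding td[OF t] by (simp add: inner_add_right)
    qed
    show "AE t in lebesgue. t \<in> {0<..<S} \<longrightarrow> (\<integral>x. part n B (x, t) \<bullet> time_deriv \<phi> (x, t) \<partial>lebesgue) = \<theta>' t * ?b t + \<theta> t * ?q t"
      using T0(3) by eventually_elim (rule impI, drule mp, assumption, rule e)
  qed
  ultimately have "(\<integral>t. \<theta> t * ?q t \<partial>M) + (\<integral>t. \<theta>' t * ?b t + \<theta> t * ?q t \<partial>M) = 0"
    using full_measure_integral(2)[OF T0 i1(1)] full_measure_integral(2)[OF T0 i1(2)] by simp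
  moreover have "(\<integral>t. \<theta> t * ?q t \<partial>M) + (\<integral>t. \<theta>' t * ?b t + \<theta> t * ?q t \<partial>M) = (\<integral>t. \<theta> t * ?q t + (\<theta>' t * ?b t + \<theta> t * ?q t) \<partial>M)"
    by (rule Bochner_Integration.integral_add[OF i1, symmetric])
  moreover have "\<theta> t * ?q t + (\<theta>' t * ?b t + \<theta> t * ?q t) = 2 * (\<theta> t * ?q t) + \<theta>' t * ?b t" for t by simp
  ultimately show "(\<integral>t. 2 * (\<theta> t * ?q t) + \<theta>' t * ?b t \<partial>M) = 0" by (simp only:)
qed

text \<open>The squared distance is expanded: |W|^2 is controlled by the weighted energy inequality,
  the mixed term by the weak formulation tested with \<theta> v, and |v|^2 by the product rule. The
  gradient terms cancel through \<open>tested_le\<close>; what is left is a Gronwall term and the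
  error \<open>R n\<close>.\<close>

lemma stability:
  assumes S': "0 < S'" "S' < S" and \<theta>: "smooth \<theta>" "\<And>t. S' \<le> t \<Longrightarrow> \<theta> t = 0" "\<And>t. 0 \<le> \<theta> t"
    and d: "\<And>t. (\<theta> has_real_derivative \<theta>' t) (at t)" "continuous_on UNIV \<theta>'" "\<And>t. t \<in> {0<..<S} \<Longrightarrow> \<theta>' t \<le> 0"
    and m: "continuous_on UNIV m" "\<And>t. 0 \<le> m t" "\<And>x t. (norm (part n B (x, t)))\<^sup>2 \<le> m t"
  shows "(\<integral>t. (- \<theta>' t - m t / 2 * \<theta> t) * Y n t \<partial>M) \<le> 2 * (\<integral>t. \<theta> t * R n t \<partial>M)"
proof -
  have \<theta>c: "continuous_on UNIV \<theta>" by (rule smooth_imp_continuous[OF \<theta>(1)])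
  define e1 where "e1 t = (\<integral>x. part n B (x, t) \<bullet> f (x, t) \<partial>lebesgue)" for t
  define e where "e t = (\<integral>x. W (x, t) \<bullet> f (x, t) \<partial>lebesgue)" for t
  define c where "c t = (\<integral>x. W (x, t) \<bullet> part n B (x, t) \<partial>lebesgue)" for t
  define b where "b t = (\<integral>x. part n B (x, t) \<bullet> part n B (x, t) \<partial>lebesgue)" for t
  define q where "q t = (\<integral>x. part n B (x, t) \<bullet> part n TB (x, t) \<partial>lebesgue)" for t
  have ei: "integrable M e" unfolding e_def[abs_def] by (rule fB_pairings)
  define I where "I t = \<theta> t * tested n t - \<theta>' t * c t" for t
  define J where "J t = 2 * (\<theta> t * q t) + \<theta>' t * b t" for t
  define X1 where "X1 t = \<theta> t * e1 t" for t
  define X2 where "X2 t = \<theta> t * gw t" for t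
  define X3 where "X3 t = \<theta>' t * wn t" for t
  define X4 where "X4 t = \<theta> t * e t" for t
  define X5 where "X5 t = \<theta> t * R n t" for t
  define X6 where "X6 t = (- \<theta>' t - m t / 2 * \<theta> t) * Y n t" for t
  have i: "integrable M I" "integrable M J" "integrable M X1" "integrable M X2" "integrable M X3" "integrable M X4" "integrable M X5"
    unfolding I_def[abs_def] J_def[abs_def] X1_def[abs_def] X2_def[abs_def] X3_def[abs_def] X4_def[abs_def] X5_def[abs_def]
      c_def q_def b_def e1_def
    by (intro Bochner_Integration.integrable_diff Bochner_Integration.integrable_add integrable_mult_right integrable_M_cont_mult
        tested_integrable B_pairings TB_pairings fB_pairings gw_integrable wn_integrable R_integrable ei \<theta>c d(2))+
  have i6: "integrable M X6" unfolding X6_def[abs_def]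
    by (intro integrable_M_cont_mult Y_integrable continuous_intros d(2) m(1) \<theta>c) auto
  note w = tested_weak_form[OF S' \<theta>(1,2) d(1,2), of n, folded c_def q_def b_def e1_def, folded I_def J_def X1_def]
  have en: "- (\<integral>t. X3 t \<partial>M) + 2 * (\<integral>t. X2 t \<partial>M) \<le> 2 * (\<integral>t. X4 t \<partial>M)"
    unfolding X2_def X3_def X4_def e_def
    by (rule weighted_energy_W[OF d(1,2) _ d(3) ei[unfolded e_def[abs_def]]]) (use \<theta>(2)[of S] S'(2) in auto)
  \<comment> \<open>Pointwise this is 2\<theta> times \<open>tested_le\<close>. The coefficients are
    such that X2, X3 and X4 form the energy inequality, while J and I - X1 have integral 0.\<close>
  have "(\<integral>t. X6 t \<partial>M) \<le> (\<integral>t. 2 * X5 t - X3 t + 2 * X2 t - 2 * X4 t - J t - 2 * I t + 2 * X1 t \<partial>M)"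
  proof (rule integral_mono[OF i6])
    show "integrable M (\<lambda>t. 2 * X5 t - X3 t + 2 * X2 t - 2 * X4 t - J t - 2 * I t + 2 * X1 t)"
      by (intro Bochner_Integration.integrable_diff Bochner_Integration.integrable_add integrable_mult_right i)
    fix t assume "t \<in> space M"
    then have t: "t \<in> T0" by simp
    from mult_left_mono[OF tested_le[OF t m(2) m(3)] \<theta>(3)[of t]]
    show "X6 t \<le> 2 * X5 t - X3 t + 2 * X2 t - 2 * X4 t - J t - 2 * I t + 2 * X1 t"
      unfolding X1_def X2_def X3_def X4_def X5_def X6_def I_def J_def R_def Y_eq[OF t] c_def q_def b_def e_def e1_def
      by (simp add: algebra_simps)
  qed
  also have "\<dots> = 2 * (\<integral>t. X5 t \<partial>M) - (\<integral>t. X3 t \<partial>M) + 2 * (\<integral>t. X2 t \<partial>M) - 2 * (\<integral>t. X4 t \<partial>M) - (\<integral>t. J t \<partial>M)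
      - 2 * (\<integral>t. I t \<partial>M) + 2 * (\<integral>t. X1 t \<partial>M)"
    using i by simp
  also have "\<dots> \<le> 2 * (\<integral>t. X5 t \<partial>M)" using en w by linarith
  finally show ?thesis unfolding X5_def X6_def .
qed

end

section \<open>The Gronwall argument and the limit of the partial sums\<close>

lemma cutoff'_nonpos: "cutoff' s \<le> 0"
  using cutoff_bounds(4)[of s] cutoff_eq_0(2)[of s] by (cases "s < 1") auto

context competitor
begin

definition Y_lim :: "real \<Rightarrow> real" where "Y_lim t = (\<integral>x. (norm (W (x, t) - V (x, t)))\<^sup>2 \<partial>lebesgue)"

text \<open>At a fixed good time V and f coincide with their partial sums from some n on, so the
  error is eventually 0 and not merely small.\<close>

lemma eventually_glued: assumes t: "t \<in> T0" shows "\<forall>\<^sub>F n in sequentially. Y n t = Y_lim t \<and> R n t = 0"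
proof -
  obtain N where N: "\<And>m. N \<le> m \<Longrightarrow> slice V t = slice (part m B) t" "\<And>m. N \<le> m \<Longrightarrow> slice f t = slice (part m fB) t"
    by (rule goodE[OF W_good(1)[OF t]], rule that)
  have "Y n t = Y_lim t \<and> R n t = 0" if n: "N \<le> n" for n
    using fun_cong[OF N(1)[OF n]] fun_cong[OF N(2)[OF n]] by (simp add: Y_def Y_lim_def R_def)
  then show ?thesis using eventually_sequentially by blast
qed

lemma Y_lim_measurable: "Y_lim \<in> borel_measurable M"
proof (rule borel_measurable_LIMSEQ_real)
  show "Y n \<in> borel_measurable M" for n using Y_integrable by blast
  fix t assume "t \<in> space M"
  then have "t \<in> T0" by simp
  then have "\<forall>\<^sub>F n in sequentially. Y n t = Y_lim t" using eventually_glued[of t] by (simp add: eventually_conj_iff)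
  then show "(\<lambda>n. Y n t) \<longlonglongrightarrow> Y_lim t" by (rule tendsto_eventually)
qed

lemma Y_dominated: obtains b where "integrable M b" "\<And>t n. t \<in> T0 \<Longrightarrow> \<bar>Y n t\<bar> \<le> b t"
proof -
  obtain b where b: "integrable M b" "\<And>t n. t \<in> T0 \<Longrightarrow> \<bar>\<integral>x. W (x, t) \<bullet> part n B (x, t) \<partial>lebesgue\<bar> \<le> b t"
    "\<And>t n m. t \<in> T0 \<Longrightarrow> \<bar>\<integral>x. part m B (x, t) \<bullet> part n B (x, t) \<partial>lebesgue\<bar> \<le> b t"
    by (rule pairings[OF localized_B(1) dominated_B(1) exponents(1) B_borel(1)], rule that)
  show thesis
  proof (rule that[of "\<lambda>t. wn t + 3 * b t"])
    show "integrable M (\<lambda>t. wn t + 3 * b t)" using b(1) wn_integrable by simp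
    fix t n assume t: "t \<in> T0"
    show "\<bar>Y n t\<bar> \<le> wn t + 3 * b t"
      using b(2)[OF t, of n] b(3)[OF t, of n n] Y_nonneg[of n t] Y_eq[OF t, of n] by linarith
  qed
qed

lemma R_dominated: obtains b where "integrable M b" "\<And>t n. t \<in> T0 \<Longrightarrow> \<bar>R n t\<bar> \<le> b t"
proof -
  obtain b where b: "integrable M b" "\<And>t n. t \<in> T0 \<Longrightarrow> \<bar>\<integral>x. W (x, t) \<bullet> part n fB (x, t) \<partial>lebesgue\<bar> \<le> b t"
    "\<And>t. t \<in> T0 \<Longrightarrow> \<bar>\<integral>x. W (x, t) \<bullet> f (x, t) \<partial>lebesgue\<bar> \<le> b t"
    "\<And>t n m. t \<in> T0 \<Longrightarrow> \<bar>\<integral>x. part m B (x, t) \<bullet> part n fB (x, t) \<partial>lebesgue\<bar> \<le> b t"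
    "\<And>t n m. t \<in> T0 \<Longrightarrow> \<bar>\<integral>x. part m B (x, t) \<bullet> f (x, t) \<partial>lebesgue\<bar> \<le> b t"
    by (rule pairings[OF localized_fB dominated_fB exponents(2) B_borel(6)], rule that)
  show thesis
  proof (rule that[of "\<lambda>t. 4 * b t"])
    show "integrable M (\<lambda>t. 4 * b t)" using b(1) by simp
    fix t n assume t: "t \<in> T0"
    show "\<bar>R n t\<bar> \<le> 4 * b t"
      using b(2)[OF t, of n] b(3)[OF t] b(4)[OF t, of n n] b(5)[OF t, of n] unfolding R_def by linarith
  qed
qed

text \<open>The weight \<theta> contains the integrating factor exp(-A), where A' = m/2; it cancels
  the Gronwall term exactly and leaves the derivative of the cutoff, which has one sign. As |A|
  \<le> A0 for every n, the constant is independent of n.\<close>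

lemma stability_uniform:
  assumes S': "0 < S'" "S' < S"
  obtains A0 where "\<And>n. (\<integral>t. - (cutoff' (t / S') / S') * Y n t \<partial>M) \<le> A0 * (\<integral>t. \<bar>R n t\<bar> \<partial>M)"
proof -
  obtain A0 where A0: "A0 \<ge> 0" "\<forall>n. \<exists>A m. smooth A \<and> (\<forall>t. (A has_real_derivative m t / 2) (at t)) \<and> continuous_on UNIV m \<and>
     (\<forall>t. 0 \<le> m t \<and> \<bar>A t\<bar> \<le> A0) \<and> (\<forall>x t. (norm (part n B (x, t)))\<^sup>2 \<le> m t)" using Gronwall_weights by auto
  \<comment> \<open>One factor exp A0 bounds \<theta> from above, the other undoes the lower bound
    exp(-A0) of the integrating factor; 2 is the factor in \<open>stability\<close>.\<close>
  have *: "(\<integral>t. - (cutoff' (t / S') / S') * Y n t \<partial>M) \<le> (2 * exp A0 * exp A0) * (\<integral>t. \<bar>R n t\<bar> \<partial>M)" for n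
  proof -
    from A0(2) obtain A m where A: "smooth A" "\<And>t. (A has_real_derivative m t / 2) (at t)" "continuous_on UNIV m"
      "\<And>t. 0 \<le> m t" "\<And>t. \<bar>A t\<bar> \<le> A0" "\<And>x t. (norm (part n B (x, t)))\<^sup>2 \<le> m t" by meson
    have Ac: "continuous_on UNIV A" by (rule smooth_imp_continuous[OF A(1)])
    define \<theta> where "\<theta> t = cutoff ((1 / S') * t) * exp (- 1 * A t)" for t
    define \<theta>' where "\<theta>' t = cutoff' ((1 / S') * t) * (1 / S') * exp (- 1 * A t) - m t / 2 * \<theta> t" for t
    have cc: "continuous_on UNIV (\<lambda>t. cutoff' ((1 / S') * t))" "continuous_on UNIV (\<lambda>t. cutoff ((1 / S') * t))"
      by (rule continuous_on_compose2[OF smooth_imp_continuous[OF smooth_cutoff'] continuous_on_mult_left[OF continuous_on_id] subset_UNIV]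
          continuous_on_compose2[OF smooth_imp_continuous[OF smooth_cutoff] continuous_on_mult_left[OF continuous_on_id] subset_UNIV])+
    have s: "smooth \<theta>" unfolding \<theta>_def[abs_def]
      by (intro smooth_mult smooth_compose_real[OF smooth_cutoff] smooth_compose_real[OF smooth_exp] smooth_const smooth_ident A(1))
    have \<theta>c: "continuous_on UNIV \<theta>" by (rule smooth_imp_continuous[OF s])
    have d: "(\<theta> has_real_derivative \<theta>' t) (at t)" for t
      unfolding \<theta>_def[abs_def] \<theta>'_def
      by (rule DERIV_cong[OF DERIV_mult[OF DERIV_chain2[OF cutoff_deriv DERIV_cmult_Id] DERIV_chain2[OF DERIV_exp DERIV_cmult[OF A(2)]]]])
        (simp add: algebra_simps)
    have \<theta>0: "0 \<le> \<theta> t" for t by (simp add: \<theta>_def cutoff_bounds)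
    have st: "(\<integral>t. (- \<theta>' t - m t / 2 * \<theta> t) * Y n t \<partial>M) \<le> 2 * (\<integral>t. \<theta> t * R n t \<partial>M)"
    proof (rule stability[OF S' s _ \<theta>0 d _ _ A(3,4,6)])
      show "\<theta> t = 0" if "S' \<le> t" for t using that S' by (simp add: \<theta>_def cutoff_eq_0)
      show "continuous_on UNIV \<theta>'" unfolding \<theta>'_def[abs_def]
        by (intro continuous_intros cc Ac A(3) \<theta>c) simp
      show "\<theta>' t \<le> 0" for t
      proof -
        have "cutoff' ((1 / S') * t) * (1 / S') * exp (- 1 * A t) \<le> 0"
          using S' by (intro mult_nonpos_nonneg cutoff'_nonpos) auto
        moreover have "0 \<le> m t / 2 * \<theta> t" using A(4) \<theta>0 by (intro mult_nonneg_nonneg) auto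
        ultimately show ?thesis unfolding \<theta>'_def by linarith
      qed
    qed
    define h where "h t = - (cutoff' (t / S') / S')" for t
    have h0: "0 \<le> h t" for t using S' cutoff'_nonpos[of "t / S'"] by (simp add: h_def divide_nonpos_pos)
    have hc: "continuous_on UNIV h"
      unfolding h_def[abs_def] using continuous_on_mult_right[OF cc(1), of "- (1 / S')"] by simp
    have ex: "exp (- A0) \<le> exp (- 1 * A t)" "exp (- 1 * A t) \<le> exp A0" for t using A(5)[of t] by auto
    have hY: "integrable M (\<lambda>t. h t * Y n t)" by (rule integrable_M_cont_mult[OF Y_integrable hc])
    have "exp (- A0) * (\<integral>t. h t * Y n t \<partial>M) = (\<integral>t. exp (- A0) * (h t * Y n t) \<partial>M)" by simp
    also have "\<dots> \<le> (\<integral>t. exp (- 1 * A t) * (h t * Y n t) \<partial>M)"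
      by (rule integral_mono[OF integrable_mult_right[OF hY] integrable_M_cont_mult[OF hY]])
        (auto intro!: continuous_intros Ac mult_right_mono ex(1)[simplified] mult_nonneg_nonneg h0 Y_nonneg)
    also have "\<dots> = (\<integral>t. (- \<theta>' t - m t / 2 * \<theta> t) * Y n t \<partial>M)"
      by (rule Bochner_Integration.integral_cong) (simp_all add: \<theta>'_def h_def)
    also note st
    also have "(\<integral>t. \<theta> t * R n t \<partial>M) \<le> (\<integral>t. exp A0 * \<bar>R n t\<bar> \<partial>M)"
    proof (rule integral_mono[OF integrable_M_cont_mult[OF R_integrable \<theta>c] integrable_mult_right[OF integrable_abs[OF R_integrable]]])
      fix t
      have "\<theta> t \<le> exp A0" unfolding \<theta>_def
        using mult_mono[OF cutoff_bounds(2) ex(2) _ exp_ge_zero, of "(1 / S') * t" t] by simp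
      then have "\<theta> t * \<bar>R n t\<bar> \<le> exp A0 * \<bar>R n t\<bar>" by (rule mult_right_mono) simp
      moreover have "\<theta> t * R n t \<le> \<theta> t * \<bar>R n t\<bar>" by (rule mult_left_mono[OF abs_ge_self \<theta>0])
      ultimately show "\<theta> t * R n t \<le> exp A0 * \<bar>R n t\<bar>" by linarith
    qed
    finally have "exp (- A0) * (\<integral>t. h t * Y n t \<partial>M) \<le> 2 * (exp A0 * (\<integral>t. \<bar>R n t\<bar> \<partial>M))" by simp
    from mult_left_mono[OF this exp_ge_zero[of A0]]
    have "exp A0 * (exp (- A0) * (\<integral>t. h t * Y n t \<partial>M)) \<le> exp A0 * (2 * (exp A0 * (\<integral>t. \<bar>R n t\<bar> \<partial>M)))" .
    moreover have "exp A0 * (exp (- A0) * y) = y" for y by (simp add: exp_minus)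
    moreover have "exp A0 * (2 * (exp A0 * y)) = (2 * exp A0 * exp A0) * y" for y by simp
    ultimately have "(\<integral>t. h t * Y n t \<partial>M) \<le> (2 * exp A0 * exp A0) * (\<integral>t. \<bar>R n t\<bar> \<partial>M)" by (simp only:)
    then show ?thesis unfolding h_def .
  qed
  show thesis by (rule that[OF *])
qed

text \<open>The right-hand side of \<open>stability_uniform\<close> tends to 0. The weight h is
  strictly positive before S', so the limiting squared distance vanishes at almost every such
  time.\<close>

lemma coincide_before:
  assumes S': "0 < S'" "S' < S"
  shows "AE t in lebesgue. t \<in> {0<..<S'} \<longrightarrow> (AE x in lebesgue. W (x, t) = V (x, t))"
proof -
  define h where "h t = - (cutoff' (t / S') / S')" for t
  have h0: "0 \<le> h t" for t using S' cutoff'_nonpos[of "t / S'"] by (simp add: h_def divide_nonpos_pos)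
  have hp: "0 < h t" if "t < S'" for t
    using cutoff_bounds(4)[of "t / S'"] that S' by (simp add: h_def divide_less_0_iff)
  have hc: "continuous_on UNIV h"
    unfolding h_def[abs_def] using S'
    by (intro continuous_intros continuous_on_compose2[OF smooth_imp_continuous[OF smooth_cutoff']]) auto
  have hm: "h \<in> borel_measurable M" by (rule borel_M[OF continuous_borel[OF hc]])
  obtain A0 where "\<And>n. (\<integral>t. - (cutoff' (t / S') / S') * Y n t \<partial>M) \<le> A0 * (\<integral>t. \<bar>R n t\<bar> \<partial>M)"
    by (rule stability_uniform[OF S'], rule that)
  note A0 = this[folded h_def]
  obtain bY where bY: "integrable M bY" "\<And>t n. t \<in> T0 \<Longrightarrow> \<bar>Y n t\<bar> \<le> bY t" by (rule Y_dominated, rule that)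
  obtain bR where bR: "integrable M bR" "\<And>t n. t \<in> T0 \<Longrightarrow> \<bar>R n t\<bar> \<le> bR t" by (rule R_dominated, rule that)
  have hYm: "(\<lambda>t. h t * Y n t) \<in> borel_measurable M" for n using hm Y_integrable[of n] by simp
  have hLm: "(\<lambda>t. h t * Y_lim t) \<in> borel_measurable M" using hm Y_lim_measurable by simp
  have hb: "integrable M (\<lambda>t. h t * bY t)" by (rule integrable_M_cont_mult[OF bY(1) hc])
  have l1: "AE t in M. (\<lambda>n. h t * Y n t) \<longlonglongrightarrow> h t * Y_lim t"
  proof (rule AE_I2)
    fix t assume "t \<in> space M"
    then have "\<forall>\<^sub>F n in sequentially. Y n t = Y_lim t \<and> R n t = 0" by (intro eventually_glued) simp
    then show "(\<lambda>n. h t * Y n t) \<longlonglongrightarrow> h t * Y_lim t" by (intro tendsto_eventually) (auto simp: eventually_conj_iff)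
  qed
  have b1: "AE t in M. norm (h t * Y n t) \<le> h t * bY t" for n
    by (rule AE_I2) (use bY(2) h0 in \<open>auto simp: abs_mult intro!: mult_left_mono\<close>)
  note c1 = integral_dominated_convergence[OF hLm hYm hb l1 b1] integrable_dominated_convergence[OF hLm hYm hb l1 b1]
  have c2: "(\<lambda>n. \<integral>t. \<bar>R n t\<bar> \<partial>M) \<longlonglongrightarrow> (\<integral>t. 0 \<partial>M)"
  proof (rule integral_dominated_convergence[OF _ _ bR(1)])
    show "(\<lambda>t. \<bar>R n t\<bar>) \<in> borel_measurable M" for n using R_integrable[of n] by (intro borel_measurable_abs) blast
    show "AE t in M. (\<lambda>n. \<bar>R n t\<bar>) \<longlonglongrightarrow> 0"
    proof (rule AE_I2)
      fix t assume "t \<in> space M"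
      then have "\<forall>\<^sub>F n in sequentially. Y n t = Y_lim t \<and> R n t = 0" by (intro eventually_glued) simp
      then show "(\<lambda>n. \<bar>R n t\<bar>) \<longlonglongrightarrow> 0" by (intro tendsto_eventually) (auto simp: eventually_conj_iff)
    qed
    show "AE t in M. norm \<bar>R n t\<bar> \<le> bR t" for n by (rule AE_I2) (use bR(2) in auto)
  qed simp
  have "(\<integral>t. h t * Y_lim t \<partial>M) \<le> A0 * (\<integral>t. 0 \<partial>M)"
    by (rule LIMSEQ_le[OF c1(1) tendsto_mult_left[OF c2]]) (use A0 in blast)
  moreover have L0: "0 \<le> h t * Y_lim t" for t by (intro mult_nonneg_nonneg h0) (simp add: Y_lim_def)
  moreover have "0 \<le> (\<integral>t. h t * Y_lim t \<partial>M)" by (rule Bochner_Integration.integral_nonneg[OF L0])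
  ultimately have "(\<integral>t. h t * Y_lim t \<partial>M) = 0" by simp
  then have "AE t in M. h t * Y_lim t = 0"
    using integral_nonneg_eq_0_iff_AE[OF c1(2)] L0 by simp
  then have "AE t in lebesgue. t \<in> T0 \<longrightarrow> h t * Y_lim t = 0"
    using T0(1) by (simp add: AE_restrict_space_iff)
  with T0(3) show ?thesis
  proof eventually_elim
    case (elim t)
    show ?case
    proof
      assume tS: "t \<in> {0<..<S'}"
      with elim S' have t: "t \<in> T0" and "h t * Y_lim t = 0" by auto
      with hp[of t] tS have 0: "Y_lim t = 0" by simp
      have "(\<lambda>x. W (x, t) - V (x, t)) \<in> Lp lebesgue 2" by (rule Lp_2_diff[OF W_L2[OF t] V_L2(1)])
      then have "integrable lebesgue (\<lambda>x. (norm (W (x, t) - V (x, t)))\<^sup>2)" by (simp add: Lp_2_iff)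
      from integral_nonneg_eq_0_iff_AE[OF this] 0
      have "AE x in lebesgue. (norm (W (x, t) - V (x, t)))\<^sup>2 = 0" by (simp add: Y_lim_def)
      then show "AE x in lebesgue. W (x, t) = V (x, t)" by eventually_elim simp
    qed
  qed
qed

lemma coincide: "AE t in lebesgue. t \<in> {0<..<S} \<longrightarrow> (AE x in lebesgue. W (x, t) = V (x, t))"
proof -
  \<comment> \<open>Countably many intervals exhaust (0, S); the offset 2 makes already the first
    one nonempty.\<close>
  have "AE t in lebesgue. \<forall>j::nat. t \<in> {0<..<S - S / (j + 2)} \<longrightarrow> (AE x in lebesgue. W (x, t) = V (x, t))"
    unfolding AE_all_countable by (intro allI coincide_before) (use S in \<open>auto simp: field_simps intro!: add_pos_nonneg\<close>)
  then show ?thesis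
  proof eventually_elim
    case (elim t)
    show ?case
    proof
      assume t: "t \<in> {0<..<S}"
      then have "0 < (S - t) / S" by simp
      then obtain j where j: "inverse (real (Suc j)) < (S - t) / S" using reals_Archimedean by blast
      have "1 / (j + 2) \<le> inverse (real (Suc j))" by (simp add: field_simps)
      with j have "1 / (j + 2) < (S - t) / S" by linarith
      then have "1 / (real j + 2) * S < S - t" using S by (simp add: less_divide_eq add.commute)
      with t have "t \<in> {0<..<S - S / (real j + 2)}" by simp
      with elim show "AE x in lebesgue. W (x, t) = V (x, t)" by blast
    qed
  qed
qed

end

text \<open>The properties of W that hold at almost every time are gathered in one set T0, which
  opens the locale \<open>competitor\<close>.\<close>

lemma (in cascade) uniqueness:
  assumes S: "0 < S" and LH: "leray_hopf S (\<lambda>x. 0) force W"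
  shows "AE t in lebesgue_on {0<..<S}. AE x in lebesgue. W (x, t) = V (x, t)"
proof -
  have bi: "W \<in> bochner \<infinity> S L2_sigma (Lp_norm lebesgue 2)" and b2: "W \<in> bochner 2 S H1 H1_norm"
    using LH by (simp_all add: leray_hopf_def)
  have Wm: "W \<in> borel_measurable (lebesgue_on (UNIV \<times> {0<..<S}))" using bi by (simp add: bochner_def)
  have A: "UNIV \<times> {0<..<S} \<in> sets (borel :: (space \<times> real) measure)"
    by (intro borel_open open_Times) auto
  obtain W' where W': "W' \<in> borel_measurable borel" "AE z in lborel. z \<in> UNIV \<times> {0<..<S} \<longrightarrow> W z = W' z"
    by (rule borel_representative[OF Wm A], rule that)
  have "AE t in lborel. AE x in lborel. t \<in> {0<..<S} \<longrightarrow> W (x, t) = W' (x, t)"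
    using AE_slices[OF W'(2)] by simp
  then have "AE t in lborel. t \<in> {0<..<S} \<longrightarrow> (AE x in lebesgue. W (x, t) = W' (x, t))"
    by eventually_elim (auto intro: AE_completion)
  then have "AE t in lebesgue. t \<in> {0<..<S} \<longrightarrow> (AE x in lebesgue. W (x, t) = W' (x, t))" by (rule AE_completion)
  then have a1: "AE t in lebesgue_on {0<..<S}. AE x in lebesgue. W (x, t) = W' (x, t)" by (simp add: AE_restrict_space_iff)
  have a2: "AE t in lebesgue_on {0<..<S}. slice W t \<in> L2_sigma" using bi by (simp add: bochner_def)
  have a3: "AE t in lebesgue_on {0<..<S}. slice W t \<in> H1" using b2 by (simp add: bochner_def)
  have a4: "AE t in lebesgue_on {0<..<S}. good t" by (subst AE_restrict_space_iff) (use AE_good_lebesgue in \<open>auto elim: eventually_mono\<close>)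
  obtain C where "AE t in lebesgue_on {0<..<S}. norm (Lp_norm lebesgue 2 (slice W t)) \<le> C"
    using bi by (auto simp: bochner_def Lp_def)
  then have a5: "AE t in lebesgue_on {0<..<S}. (\<integral>x. (norm (W (x, t)))\<^sup>2 \<partial>lebesgue) \<le> C\<^sup>2"
  proof eventually_elim
    case (elim t)
    then have "(norm (Lp_norm lebesgue 2 (slice W t)))\<^sup>2 \<le> C\<^sup>2" by (rule power_mono) simp
    then show ?case by (simp add: Lp_norm_2_square)
  qed
  have ae: "AE t in lebesgue_on {0<..<S}. good t \<and> slice W t \<in> L2_sigma \<and> slice W t \<in> H1 \<and>
      (AE x in lebesgue. W (x, t) = W' (x, t)) \<and> (\<integral>x. (norm (W (x, t)))\<^sup>2 \<partial>lebesgue) \<le> C\<^sup>2"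
    using a1 a2 a3 a4 a5 by eventually_elim blast
  obtain T0 where T0: "T0 \<in> sets lebesgue" "T0 \<subseteq> {0<..<S}"
    "\<And>t. t \<in> T0 \<Longrightarrow> good t \<and> slice W t \<in> L2_sigma \<and> slice W t \<in> H1 \<and>
      (AE x in lebesgue. W (x, t) = W' (x, t)) \<and> (\<integral>x. (norm (W (x, t)))\<^sup>2 \<partial>lebesgue) \<le> C\<^sup>2"
    "AE t in lebesgue. t \<in> {0<..<S} \<longrightarrow> t \<in> T0" by (rule full_measure_set[OF ae], rule that)
  interpret competitor p \<tau> \<epsilon> \<delta> t0 S W W' T0 "C\<^sup>2"
    by unfold_locales (use S LH W'(1) T0 in simp_all)
  show ?thesis using coincide by (simp add: AE_restrict_space_iff)
qed

section \<open>Clusters of swirls\<close>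

text \<open>Nonempty open sets are not null, so every essential bound is at least Z. Membership of u
  ensures that the set of bounds is nonempty, as its infimum requires.\<close>

lemma Lp_norm_infinity_ge:
  fixes u :: "'a::euclidean_space \<Rightarrow> 'b::real_normed_vector"
  assumes u: "u \<in> Lp lebesgue \<infinity>" and A: "open A" "A \<noteq> {}" "\<And>x. x \<in> A \<Longrightarrow> Z \<le> norm (u x)"
  shows "Z \<le> Lp_norm lebesgue \<infinity> u"
proof -
  let ?S = "{C. 0 \<le> C \<and> (AE x in lebesgue. norm (u x) \<le> C)}"
  obtain C where C: "AE x in lebesgue. norm (u x) \<le> C" using u by (auto simp: Lp_def)
  have "AE x in lebesgue. norm (u x) \<le> max 0 C" using C by eventually_elim simp
  then have "max 0 C \<in> ?S" by simp
  moreover have "Z \<le> C" if "C \<in> ?S" for C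
  proof (rule ccontr)
    assume "\<not> Z \<le> C"
    moreover have "AE x in lebesgue. norm (u x) \<le> C" using that by simp
    ultimately have "AE x in lebesgue. x \<notin> A"
    proof -
      assume Z: "\<not> Z \<le> C"
      assume "AE x in lebesgue. norm (u x) \<le> C"
      then show ?thesis by eventually_elim (use A(3) Z in force)
    qed
    then have "negligible A" using A(1) by (subst negligible_iff_null_sets, subst AE_iff_null_sets) auto
    then show False using open_not_negligible A(1,2) by blast
  qed
  ultimately have "Z \<le> Inf ?S" by (intro cInf_greatest) blast+
  then show ?thesis by (simp add: Lp_norm_def)
qed

lemma zero_Lp: "(\<lambda>x. 0) \<in> Lp M p"
  by (auto simp: Lp_def)

lemma zero_LrLq_loc: "(\<lambda>z. 0) \<in> LrLq_loc (ennreal r) (ennreal q)"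
proof -
  have "Lp_norm lebesgue (ennreal q) (\<lambda>x::space. 0::'a) = 0" by (simp add: Lp_norm_def)
  then show ?thesis by (simp add: LrLq_loc_def LrLq_def bochner_def zero_Lp)
qed

text \<open>A cluster reaches less than 2 from its centre, so the spacing 4 keeps clusters apart;
  and the centres leave every bounded set.\<close>

definition center :: "nat \<Rightarrow> space" where "center m = (4 * real m) *\<^sub>R axis 1 1"
text \<open>The offset 2 starts the sequence at T/2, away from time 0.\<close>

definition blowup_time :: "real \<Rightarrow> nat \<Rightarrow> real" where "blowup_time T m = T - T / (real m + 2)"

text \<open>The swirl number \<open>prod_encode (m, j)\<close> is the \<open>j\<close>-th member of the cluster that shrinks to \<open>center m\<close>.\<close>

definition cluster :: "nat \<Rightarrow> nat" where "cluster k = fst (prod_decode k)"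
definition depth :: "nat \<Rightarrow> nat" where "depth k = snd (prod_decode k)"
definition place :: "nat \<Rightarrow> space" where "place k = center (cluster k) + (1/2) ^ depth k *\<^sub>R axis 1 1"
text \<open>The radius decays with the overall index k, which makes sums over all swirls geometric.
  As the depth is at most k, the balls also fit into the dyadic gaps of their cluster.\<close>

definition radius :: "real \<Rightarrow> nat \<Rightarrow> real" where "radius \<kappa> k = \<kappa> * (1/2) ^ k"

lemma cluster_encode [simp]: "cluster (prod_encode (m, j)) = m" "depth (prod_encode (m, j)) = j"
  by (simp_all add: cluster_def depth_def)

lemma encode_cluster: "prod_encode (cluster k, depth k) = k"
  by (simp add: cluster_def depth_def)

lemma depth_le: "depth k \<le> k"
  using le_prod_encode_2[of "depth k" "cluster k"] by (simp add: encode_cluster)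

lemma blowup_time_mono: "0 < T \<Longrightarrow> strict_mono (blowup_time T)"
  by (auto simp: strict_mono_def blowup_time_def intro!: divide_strict_left_mono mult_pos_pos add_nonneg_pos)

lemma blowup_time_bounds: assumes "0 < T" shows "T / 2 \<le> blowup_time T m" "blowup_time T m < T"
proof -
  have "T / (real m + 2) \<le> T / 2" using assms by (intro divide_left_mono) auto
  then show "T / 2 \<le> blowup_time T m" by (simp add: blowup_time_def)
  show "blowup_time T m < T" using assms by (simp add: blowup_time_def add_nonneg_pos)
qed

lemma blowup_time_limit: "blowup_time T \<longlonglongrightarrow> T"
proof -
  have "(\<lambda>m. T / (real m + 2)) \<longlonglongrightarrow> 0"
    using LIMSEQ_ignore_initial_segment[OF lim_const_over_n[of T], of 2] by (simp add: add.commute)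
  from tendsto_diff[OF tendsto_const[of T] this] show ?thesis by (simp add: blowup_time_def[abs_def])
qed

lemma closed_blowup_times: "closed (insert T (range (blowup_time T)))"
  by (intro compact_imp_closed compact_sequence_with_limit blowup_time_limit)

text \<open>\<kappa> \<le> 1/8 makes the balls disjoint. \<kappa> \<le> T/4 bounds the half-length
  of each window by T/4, so that no window begins before T/2 - T/4 = T/4.\<close>

locale clusters =
  fixes T \<kappa> \<delta> :: real
  assumes T: "0 < T" and \<kappa>: "0 < \<kappa>" "\<kappa> \<le> 1/8" "\<kappa> \<le> T/4" and \<delta>: "0 < \<delta>" "\<delta> \<le> 1/4"
begin

lemma radius_pos: "0 < radius \<kappa> k"
  using \<kappa> by (simp add: radius_def)

lemma radius_le: "radius \<kappa> k \<le> (1/2) ^ depth k / 8" "radius \<kappa> k \<le> 1" "radius \<kappa> k \<le> (1/2) ^ k" "(radius \<kappa> k)\<^sup>2 \<le> radius \<kappa> k"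
  "(radius \<kappa> k)\<^sup>2 \<le> T/4"
proof -
  have k1: "(1/2::real) ^ k \<le> 1" by (rule power_le_one) auto
  have "radius \<kappa> k \<le> 1/8 * (1/2) ^ depth k" unfolding radius_def
    by (rule mult_mono[OF \<kappa>(2) power_decreasing[OF depth_le]]) auto
  then show "radius \<kappa> k \<le> (1/2) ^ depth k / 8" by simp
  show "radius \<kappa> k \<le> (1/2) ^ k" unfolding radius_def using \<kappa> by (intro mult_left_le_one_le) auto
  with k1 show 1: "radius \<kappa> k \<le> 1" by linarith
  show 2: "(radius \<kappa> k)\<^sup>2 \<le> radius \<kappa> k" unfolding power2_eq_square using radius_pos[of k] 1 by (intro mult_left_le) auto
  have "radius \<kappa> k \<le> \<kappa>" unfolding radius_def using \<kappa> k1 by (intro mult_left_le) auto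
  with 2 \<kappa>(3) show "(radius \<kappa> k)\<^sup>2 \<le> T/4" by linarith
qed

lemma place_dist: "dist (place k) (place l) = \<bar>(4 * real (cluster k) + (1/2) ^ depth k) - (4 * real (cluster l) + (1/2) ^ depth l)\<bar>"
proof -
  have "place k - place l = ((4 * real (cluster k) + (1/2) ^ depth k) - (4 * real (cluster l) + (1/2) ^ depth l)) *\<^sub>R axis 1 1"
    by (simp add: place_def center_def algebra_simps)
  then show ?thesis by (simp add: dist_norm)
qed

lemma half_power: "0 < (1/2::real) ^ j" "(1/2::real) ^ j \<le> 1"
  by (auto intro: power_le_one)

text \<open>In one cluster the deeper swirl is at most half as far from the centre, so the gap is at
  least half the larger offset, while each radius is at most an eighth of its own offset. Different
  clusters are at least 3 apart.\<close>

lemma places_apart: assumes "k \<noteq> l" shows "radius \<kappa> k + radius \<kappa> l < dist (place k) (place l)"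
proof -
  have *: "radius \<kappa> k + radius \<kappa> l < dist (place k) (place l)" if kl: "k \<noteq> l" "depth k \<le> depth l" for k l
  proof (cases "cluster k = cluster l")
    case True
    then have "depth k \<noteq> depth l" using kl encode_cluster[of k] encode_cluster[of l] by auto
    then have "Suc (depth k) \<le> depth l" using kl by simp
    then have "(1/2::real) ^ depth l \<le> (1/2) ^ Suc (depth k)" by (rule power_decreasing) auto
    then have "2 * (1/2::real) ^ depth l \<le> (1/2) ^ depth k" by simp
    then show ?thesis unfolding place_dist True using radius_le(1)[of k] radius_le(1)[of l] half_power(1)[of "depth k"] by linarith
  next
    case False
    then have "1 \<le> \<bar>real (cluster k) - real (cluster l)\<bar>" by linarith
    then show ?thesis unfolding place_dist using radius_le(1)[of k] radius_le(1)[of l] half_power[of "depth k"] half_power[of "depth l"] by linarith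
  qed
  show ?thesis using *[of k l] *[of l k] assms by (cases "depth k \<le> depth l") (auto simp: dist_commute)
qed

lemma radius_summable: assumes "0 < e" shows "summable (\<lambda>k. radius \<kappa> k powr e)"
proof -
  have "radius \<kappa> k powr e = \<kappa> powr e * ((1/2) powr e) ^ k" for k
    using \<kappa> by (simp add: radius_def powr_mult powr_realpow[symmetric] powr_powr mult.commute)
  moreover have "(1/2::real) powr e < 1" using assms by (simp add: powr01_less_one)
  ultimately show ?thesis by (simp add: summable_geometric)
qed

text \<open>The blow-up times together with their limit T form a closed set, so t has positive
  distance from it, while the windows shrink to length 0.\<close>

lemma finitely_many_windows:
  assumes "t \<notin> insert T (range (blowup_time T))"
  shows "\<exists>n. \<forall>k\<ge>n. t \<notin> cball (blowup_time T (cluster k)) ((radius \<kappa> k)\<^sup>2)"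
proof -
  have "open (- insert T (range (blowup_time T)))" using closed_blowup_times by (rule open_Compl)
  then obtain d where d: "0 < d" "ball t d \<subseteq> - insert T (range (blowup_time T))" using assms open_contains_ball by blast
  obtain n where n: "(1/2::real) ^ n < d" using real_arch_pow_inv[OF d(1), of "1/2"] by auto
  have "t \<notin> cball (blowup_time T (cluster k)) ((radius \<kappa> k)\<^sup>2)" if "n \<le> k" for k
  proof
    assume "t \<in> cball (blowup_time T (cluster k)) ((radius \<kappa> k)\<^sup>2)"
    moreover have "(1/2::real) ^ k \<le> (1/2) ^ n" using that by (rule power_decreasing) auto
    ultimately have "dist t (blowup_time T (cluster k)) < d"
      using radius_le(3,4)[of k] n unfolding mem_cball dist_commute[of "blowup_time T _"] by linarith
    then show False using d(2) by (auto simp: subset_iff)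
  qed
  then show ?thesis by blast
qed

sublocale cascade place "\<lambda>k. blowup_time T (cluster k)" "radius \<kappa>" \<delta> "T/4"
proof
  show "cball (place k) (radius \<kappa> k) \<inter> cball (place l) (radius \<kappa> l) = {}" if "k \<noteq> l" for k l
  proof -
    have "dist (place k) (place l) \<le> radius \<kappa> k + radius \<kappa> l" if "x \<in> cball (place k) (radius \<kappa> k) \<inter> cball (place l) (radius \<kappa> l)" for x
      using that dist_triangle2[of "place k" "place l" x] by simp
    then show ?thesis using places_apart[OF that] by fastforce
  qed
  show "T / 4 \<le> blowup_time T (cluster k) - (radius \<kappa> k)\<^sup>2" for k
    using radius_le(5)[of k] blowup_time_bounds(1)[OF T, of "cluster k"] T by linarith
  have "insert T (range (blowup_time T)) \<in> null_sets lborel" by (intro countable_imp_null_set_lborel) auto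
  then have "AE t in lborel. t \<notin> insert T (range (blowup_time T))" by (rule AE_not_in)
  then show "AE t in lborel. \<exists>n. \<forall>k\<ge>n. t \<notin> cball (blowup_time T (cluster k)) ((radius \<kappa> k)\<^sup>2)"
    by eventually_elim (rule finitely_many_windows)
qed (use radius_pos radius_le radius_summable T \<delta> in simp_all)

lemma good_time: "t \<notin> insert T (range (blowup_time T)) \<Longrightarrow> good t"
  using finitely_many_windows by (simp add: good_def win_def)

text \<open>A blow-up time is isolated among the bad times, whose only limit point is T.\<close>

lemma eventually_good: "\<forall>\<^sub>F t in at (blowup_time T m). good t"
proof -
  \<comment> \<open>All bad times except the m-th. The later ones with T form a compact set, and the
    earlier ones are finitely many.\<close>
  let ?A = "insert T (range (\<lambda>k. blowup_time T (k + Suc m))) \<union> blowup_time T ` {..<m}"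
  have "closed ?A"
    by (intro closed_Un compact_imp_closed compact_sequence_with_limit LIMSEQ_ignore_initial_segment blowup_time_limit finite_imp_compact) auto
  moreover have "blowup_time T m \<notin> ?A"
    using strict_mono_eq[OF blowup_time_mono[OF T]] blowup_time_bounds(2)[OF T, of m] by auto
  ultimately have "\<forall>\<^sub>F t in nhds (blowup_time T m). t \<in> - ?A" by (intro eventually_nhds_in_open) auto
  then have "\<forall>\<^sub>F t in at (blowup_time T m). t \<in> - ?A \<and> t \<noteq> blowup_time T m"
    by (auto simp: eventually_at_filter elim: eventually_mono)
  then show ?thesis
  proof eventually_elim
    case (elim t)
    have "t \<noteq> blowup_time T k" for k
    proof -
      consider "k < m" | "k = m" | i where "k = i + Suc m" by (metis less_iff_Suc_add add.commute add_Suc_right linorder_neqE_nat)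
      then show ?thesis using elim by cases auto
    qed
    then show ?case using elim by (intro good_time) auto
  qed
qed

text \<open>A swirl of depth j in cluster m lies within 3/2^j of the singular point of that cluster,
  so only small depths reach a neighbourhood that avoids the singular points. Only finitely many
  clusters meet a bounded set; this also covers points at time T.\<close>

lemma locally_finite:
  assumes z: "z \<notin> range (\<lambda>m. (center m, blowup_time T m))"
  obtains N n where "open N" "z \<in> N" "\<And>k w. w \<in> N \<Longrightarrow> fst w \<in> blob k \<Longrightarrow> snd w \<in> win k \<Longrightarrow> k < n"
proof -
  let ?X = "\<lambda>m. (center m, blowup_time T m)"
  have "closed (range ?X)"
  proof (rule discrete_imp_closed[of 1])
    show "\<forall>x\<in>range ?X. \<forall>y\<in>range ?X. dist y x < 1 \<longrightarrow> y = x"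
    proof (intro ballI impI, clarify)
      fix m l assume d: "dist (?X l) (?X m) < 1"
      have "center l - center m = (4 * real l - 4 * real m) *\<^sub>R axis 1 1" by (simp add: center_def algebra_simps)
      then have "dist (center l) (center m) = \<bar>4 * real l - 4 * real m\<bar>" by (simp add: dist_norm)
      with d dist_fst_le[of "?X l" "?X m"] have "l = m" by simp
      then show "center l = center m \<and> blowup_time T l = blowup_time T m" by simp
    qed
  qed simp
  then obtain d where d: "0 < d" "ball z d \<subseteq> - range ?X" using z open_contains_ball open_Compl by blast
  have dX: "d \<le> dist z (?X m)" for m using d(2) by (force simp: subset_iff not_less[symmetric])
  \<comment> \<open>A swirl that meets the ball of radius d/2 satisfies d/2 < 3/2^j for its depth j,
    so 1/2^j exceeds d/6 and all the more d/8.\<close>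
  obtain J where J: "(1/2::real) ^ J < d / 8" using real_arch_pow_inv[of "d/8" "1/2"] d(1) by auto
  obtain L :: nat where L: "norm (fst z) + d + 4 < L" using reals_Archimedean2 by blast
  show thesis
  proof (rule that[of "ball z (d/2)" "Suc (Max (prod_encode ` ({..L} \<times> {..J})))"])
    fix k w assume w: "w \<in> ball z (d/2)" "fst w \<in> blob k" "snd w \<in> win k"
    let ?m = "cluster k" and ?e = "(1/2::real) ^ depth k"
    have "dist (place k) (center ?m) = ?e" by (simp add: place_def dist_norm)
    moreover have "dist (place k) (fst w) \<le> ?e / 8" using w(2) radius_le(1)[of k] by (simp add: blob_def)
    ultimately have 1: "dist (fst w) (center ?m) \<le> 2 * ?e"
      using dist_triangle3[of "fst w" "center ?m" "place k"] half_power(1)[of "depth k"] by linarith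
    have 2: "dist (snd w) (blowup_time T ?m) \<le> ?e"
      using w(3) radius_le(1,4)[of k] half_power(1)[of "depth k"]
      unfolding win_def mem_cball dist_commute[of "blowup_time T _"] by linarith
    have 3: "dist w (?X ?m) \<le> 3 * ?e"
      using 1 2 sqrt_sum_squares_le_sum[of "dist (fst w) (center ?m)" "dist (snd w) (blowup_time T ?m)"]
      by (simp add: dist_prod_def)
    have zw: "dist z w < d / 2" using w(1) by simp
    have "d < d / 2 + 3 * ?e" using dX[of ?m] dist_triangle[of z "?X ?m" w] 3 zw by linarith
    then have "(1/2) ^ J < ?e" using J half_power(1)[of "depth k"] by linarith
    then have j: "depth k \<le> J" using power_decreasing[of J "depth k" "1/2::real"] by (cases "depth k \<le> J") auto
    have "dist (fst z) (fst w) \<le> d / 2" using dist_fst_le[of z w] zw by linarith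
    then have "norm (center ?m) \<le> norm (fst z) + d / 2 + 2"
      using 1 half_power(2)[of "depth k"] norm_triangle_ineq2[of "center ?m" "fst z"] dist_triangle[of "center ?m" "fst z" "fst w"]
      by (simp add: dist_norm norm_minus_commute)
    then have "?m \<le> L" using L d(1) by (simp add: center_def)
    with j have "prod_encode (?m, depth k) \<in> prod_encode ` ({..L} \<times> {..J})" by auto
    then have "k \<le> Max (prod_encode ` ({..L} \<times> {..J}))" unfolding encode_cluster by (intro Max_ge) auto
    then show "k < Suc (Max (prod_encode ` ({..L} \<times> {..J})))" by simp
  qed (use d(1) in auto)
qed

lemma smooth_V: "smooth_on (UNIV \<times> {0..} - (\<Union>m. {(center m, blowup_time T m)})) V"
  unfolding smooth_on_def
proof
  fix z assume "z \<in> UNIV \<times> {0..} - (\<Union>m. {(center m, blowup_time T m)})"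
  then have z: "z \<notin> range (\<lambda>m. (center m, blowup_time T m))" by auto
  obtain N n where N: "open N" "z \<in> N" "\<And>k w. w \<in> N \<Longrightarrow> fst w \<in> blob k \<Longrightarrow> snd w \<in> win k \<Longrightarrow> k < n"
    by (rule locally_finite[OF z], rule that)
  have "part n B w = V w" if w: "w \<in> N" for w
  proof (cases "\<exists>k. fst w \<in> blob k")
    case True
    then obtain k where k: "fst w \<in> blob k" by blast
    have "B k (fst w, snd w) = 0" if "\<not> k < n"
      using N(3)[OF w k] localized_B(1) that by (cases w) (auto simp: localized_def)
    then show ?thesis using glue_in[OF localized_B(1) k, of "snd w"] part_in[OF localized_B(1) k, of n "snd w"] by auto
  next
    case False
    then show ?thesis using glue_out[OF localized_B(1), of "fst w" "snd w"] part_out[OF localized_B(1), of "fst w" n "snd w"] by auto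
  qed
  moreover have "smooth_open N (part n B)"
    using smooth_part_B[of n] N(1) Ck_open_subset[of _ UNIV "part n B" N] by (simp add: smooth_open_def)
  ultimately show "\<exists>N v. z \<in> N \<and> smooth_open N v \<and> (\<forall>y\<in>(UNIV \<times> {0..} - (\<Union>m. {(center m, blowup_time T m)})) \<inter> N. v y = V y)"
    using N(2) by blast
qed

lemma good_Lp_infinity: "good t \<Longrightarrow> slice V t \<in> Lp lebesgue \<infinity>"
  using good_C1c(4) borel_slice_space[OF glue_B_borel(1)] by (force simp: Lp_def measurable_completion)

lemma amp_unbounded: "\<exists>j. Z < amp (prod_encode (m, j))"
proof -
  define Z' where "Z' = max Z 1"
  \<comment> \<open>The radius at which the amplitude y^(-\<delta>) equals Z'.\<close>
  define y where "y = Z' powr (- (1 / \<delta>))"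
  have "0 < y" by (simp add: y_def Z'_def)
  then obtain j where j: "(1/2::real) ^ j < y" using real_arch_pow_inv[of y "1/2"] by auto
  let ?k = "prod_encode (m, j)"
  have "radius \<kappa> ?k < y" using radius_le(1)[of ?k] half_power(1)[of j] j unfolding cluster_encode by linarith
  then have "y powr (- \<delta>) < amp ?k" unfolding amp_def
    using \<delta> radius_pos by (intro powr_less_mono2_neg) auto
  moreover have "y powr (- \<delta>) = Z'" using \<delta> by (simp add: y_def powr_powr Z'_def)
  ultimately show ?thesis by (auto simp: Z'_def)
qed

text \<open>For each bound one sufficiently deep swirl of cluster m suffices: it peaks at the m-th
  blow-up time, and by continuity it exceeds the bound on a fixed open set of space for all nearby
  times.\<close>

lemma blowup: "filterlim (\<lambda>t. Lp_norm lebesgue \<infinity> (slice V t)) at_top (at (blowup_time T m))"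
  unfolding filterlim_at_top
proof
  fix Z0 :: real
  \<comment> \<open>Z is nonnegative, so a value above it is nonzero and its point lies in the ball
    of the swirl.\<close>
  define Z where "Z = max 0 Z0"
  define c where "c = cutoff 0 * (cutoff (1/4) / 2)"
  have c: "0 < c" by (simp add: c_def cutoff_bounds)
  obtain j where j: "Z / c < amp (prod_encode (m, j))" using amp_unbounded by blast
  define k where "k = prod_encode (m, j)"
  \<comment> \<open>A swirl vanishes on its axis, so it is evaluated half a radius off the centre,
    where |y|^2 = 1/4; c is the resulting size at unit amplitude.\<close>
  define x0 where "x0 = place k + (radius \<kappa> k / 2) *\<^sub>R axis 1 1"
  have "yy k x0 = (1/2) *\<^sub>R axis 1 1" using radius_pos[of k] by (simp add: yy_def x0_def)
  moreover have "rot ((1/2) *\<^sub>R axis 1 1) = (1/2) *\<^sub>R axis 2 (1::real)" by (simp add: rot_def vec_eq_iff axis_def forall_3)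
  ultimately have "norm (scaled_swirl cutoff (place k) (radius \<kappa> k) x0) = cutoff (1/4) / 2"
    by (simp add: swirl_yy swirl_def inner_axis_axis cutoff_bounds abs_of_nonneg)
  moreover have "tp k (blowup_time T m) = cutoff 0" by (simp add: tp_def sc_def k_def)
  ultimately have "norm (B k (x0, blowup_time T m)) = amp k * c"
    using amp_powr(4)[of k] by (simp add: B_def c_def abs_mult cutoff_bounds)
  then have big: "Z < norm (B k (x0, blowup_time T m))" using j c by (simp add: k_def divide_less_eq)
  have "open {z. Z < norm (B k z)}"
    by (intro open_Collect_less continuous_intros smooth_imp_continuous smooth_B)
  moreover have "(x0, blowup_time T m) \<in> {z. Z < norm (B k z)}" using big by simp
  ultimately obtain A I where AI: "open A" "open I" "x0 \<in> A" "blowup_time T m \<in> I" "A \<times> I \<subseteq> {z. Z < norm (B k z)}"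
    by (rule open_prod_elim) auto
  have "\<forall>\<^sub>F t in at (blowup_time T m). t \<in> I"
    using AI(2,4) by (intro eventually_at_in_open') auto
  with eventually_good[of m] show "\<forall>\<^sub>F t in at (blowup_time T m). Z0 \<le> Lp_norm lebesgue \<infinity> (slice V t)"
  proof eventually_elim
    case (elim t)
    have "Z \<le> Lp_norm lebesgue \<infinity> (slice V t)"
    proof (rule Lp_norm_infinity_ge[OF good_Lp_infinity[OF elim(1)] AI(1)])
      fix x assume "x \<in> A"
      then have b: "Z < norm (B k (x, t))" using AI(5) elim(2) by auto
      then have "x \<in> blob k" using localized_B(1) by (force simp: localized_def Z_def)
      then show "Z \<le> norm (V (x, t))" using b glue_in[OF localized_B(1)] by simp
    qed (use AI(3) in auto)
    then show ?case by (simp add: Z_def)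
  qed
qed

lemma theorem_data:
  assumes r: "1 \<le> r" and q: "1 < q" and d: "2 + \<delta> < 2 / r + 3 / q"
  shows "f \<in> LrLq_loc (ennreal r) (ennreal q)" "same_force f force" "global_leray_hopf (\<lambda>x. 0) force V" "V \<in> C0L2"
    "\<forall>t>0. energy_lhs V t = energy_rhs (\<lambda>x. 0) force V t"
    "\<exists>qbar>3. \<forall>s>qbar. V \<in> LrLq_loc (ennreal (2 * s / (s - 3))) (ennreal s)"
    "\<forall>S>0. \<forall>W. leray_hopf S (\<lambda>x. 0) force W \<longrightarrow> (AE t in lebesgue_on {0<..<S}. AE \<xi> in lebesgue. W (\<xi>, t) = V (\<xi>, t))"
proof -
  show "f \<in> LrLq_loc (ennreal r) (ennreal q)" using f_LrLq[OF _ _ d] r q by (simp add: LrLq_loc_def)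
  show "same_force f force" by (rule same_force)
  show "global_leray_hopf (\<lambda>x. 0) force V" by (simp add: global_leray_hopf_def leray_hopf_V)
  show "V \<in> C0L2" by (rule V_C0L2)
  show "\<forall>t>0. energy_lhs V t = energy_rhs (\<lambda>x. 0) force V t" using energy_equality by blast
  show "\<forall>S>0. \<forall>W. leray_hopf S (\<lambda>x. 0) force W \<longrightarrow> (AE t in lebesgue_on {0<..<S}. AE \<xi> in lebesgue. W (\<xi>, t) = V (\<xi>, t))"
    using uniqueness by blast
  have "V \<in> LrLq (ennreal (2 * s / (s - 3))) (ennreal s) S" if "4 < s" for s S
  proof (rule V_LrLq)
    \<comment> \<open>The exponents lie on the Serrin line, while V has order \<delta> < 1; the
      bound 4 for s is one choice above 3.\<close>
    have "2 / (2 * s / (s - 3)) + 3 / s = 1" using that by (simp add: field_simps)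
    then show "\<delta> < 2 / (2 * s / (s - 3)) + 3 / s" using \<delta> by simp
  qed (use that in auto)
  then show "\<exists>qbar>3. \<forall>s>qbar. V \<in> LrLq_loc (ennreal (2 * s / (s - 3))) (ennreal s)"
    by (intro exI[of _ 4]) (simp add: LrLq_loc_def)
qed

lemma blowup_times: "\<exists>Tm \<xi>m. strict_mono (Tm :: nat \<Rightarrow> real) \<and> (\<forall>m. 0 < Tm m \<and> Tm m < T) \<and>
       smooth_on (UNIV \<times> {0..} - (\<Union>m. {(\<xi>m m, Tm m)})) V \<and>
       smooth_on (UNIV \<times> {0..} - (\<Union>m. {(\<xi>m m, Tm m)})) (\<lambda>z. 0 :: real) \<and>
       (\<forall>m. (\<forall>\<^sub>F t in at (Tm m). slice V t \<in> Lp lebesgue \<infinity>) \<and>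
            filterlim (\<lambda>t. Lp_norm lebesgue \<infinity> (slice V t)) at_top (at (Tm m)))"
proof (intro exI[of _ "blowup_time T"] exI[of _ center] conjI allI)
  show "strict_mono (blowup_time T)" by (rule blowup_time_mono[OF T])
  show "0 < blowup_time T m" "blowup_time T m < T" for m using blowup_time_bounds[OF T, of m] T by auto
  show "smooth_on (UNIV \<times> {0..} - (\<Union>m. {(center m, blowup_time T m)})) V" by (rule smooth_V)
  show "smooth_on (UNIV \<times> {0..} - (\<Union>m. {(center m, blowup_time T m)})) (\<lambda>z. 0 :: real)"
    unfolding smooth_on_def by (intro ballI exI[of _ UNIV] exI[of _ "\<lambda>z. 0"]) (simp add: smooth_const)
  show "\<forall>\<^sub>F t in at (blowup_time T m). slice V t \<in> Lp lebesgue \<infinity>" for m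
    using eventually_good by (rule eventually_mono) (rule good_Lp_infinity)
  show "filterlim (\<lambda>t. Lp_norm lebesgue \<infinity> (slice V t)) at_top (at (blowup_time T m))" for m by (rule blowup)
qed

end

section \<open>Assembly: zero initial value, zero pressure and the choice of parameters\<close>

lemma zero_weak_deriv: "weak_deriv bs (\<lambda>x. 0) (\<lambda>x. 0)"
  by (simp add: weak_deriv_def loc_integrable_def set_integrable_def)

lemma zero_G_sigma: "(\<lambda>x. 0) \<in> G_sigma"
proof -
  have "partial i (\<lambda>x. 0 :: space) \<xi> = 0" for i \<xi>
    unfolding partial_def by (rule dir_derivI[where u'="\<lambda>v. 0"]) simp
  moreover have "(\<lambda>x::space. 0::space) \<in> sobolev k p" for k p
    unfolding sobolev_def by (auto intro!: zero_Lp bexI[of _ "\<lambda>x. 0"] zero_weak_deriv)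
  ultimately show ?thesis by (simp add: G_sigma_def G_space_def divergence_def smooth_const)
qed

theorem theorem2p5:
  fixes T r q :: real
  assumes "T > 0"
    and "1 \<le> r" and "1 < q"
    and "(r \<ge> 1 \<and> q > 3/2 \<and> 2 < 2/r + 3/q \<and> 2/r + 3/q < 5) \<or>
         (r \<ge> 1 \<and> (2/r + 3/q \<ge> 5 \<or> (1 < q \<and> q \<le> 3/2)))"
  shows "\<exists>V0 \<in> G_sigma. \<exists>f \<in> LrLq_loc (ennreal r) (ennreal q). \<exists>F V P.
    same_force f F \<and>
    \<comment> \<open>(a)\<close>
    global_leray_hopf V0 F V \<and> V \<in> C0L2 \<and>
    (\<forall>t>0. energy_lhs V t = energy_rhs V0 F V t) \<and>
    \<comment> \<open>(b)\<close>
    (\<exists>qbar>3. \<forall>s>qbar. V \<in> LrLq_loc (ennreal (2 * s / (s - 3))) (ennreal s)) \<and>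
    (\<forall>S>0. \<forall>W. leray_hopf S V0 F W \<longrightarrow>
       (AE t in lebesgue_on {0<..<S}. AE \<xi> in lebesgue. W (\<xi>, t) = V (\<xi>, t))) \<and>
    \<comment> \<open>(c), (d)\<close>
    associated_pressure F V P \<and>
    (\<exists>Tm \<xi>m. strict_mono (Tm :: nat \<Rightarrow> real) \<and> (\<forall>m. 0 < Tm m \<and> Tm m < T) \<and>
       smooth_on (UNIV \<times> {0..} - (\<Union>m. {(\<xi>m m, Tm m)})) V \<and>
       smooth_on (UNIV \<times> {0..} - (\<Union>m. {(\<xi>m m, Tm m)})) P \<and>
       (\<forall>m. (\<forall>\<^sub>F t in at (Tm m). slice V t \<in> Lp lebesgue \<infinity>) \<and>
            filterlim (\<lambda>t. Lp_norm lebesgue \<infinity> (slice V t)) at_top (at (Tm m)))) \<and>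
    (\<forall>p\<ge>1. P \<in> LrLq_loc 2 (ennreal p)) \<and>
    (\<exists>Q. is_space_gradient P Q \<and> Q \<in> LrLq_loc (ennreal r) (ennreal q))"
proof -
  \<comment> \<open>Both alternatives of the hypothesis give this: for q \<le> 3/2 the space term
    alone reaches 2, and otherwise it is assumed or follows from the bound 5.\<close>
  have two: "2 < 2 / r + 3 / q"
  proof (cases "q \<le> 3/2")
    case True
    then have "2 \<le> 3 / q" using assms(3) by (simp add: field_simps)
    moreover have "0 < 2 / r" using assms(2) by simp
    ultimately show ?thesis by linarith
  next
    case False then show ?thesis using assms(4) by auto
  qed
  \<comment> \<open>Half of the available gap keeps 2 + \<delta> strictly below 2/r + 3/q; 1/4 is
    the bound of the cascade.\<close>
  define \<delta> where "\<delta> = min (1/4) ((2 / r + 3 / q - 2) / 2)"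
  define \<kappa> where "\<kappa> = min (1/8) (T/4)"
  interpret clusters T \<kappa> \<delta>
    by unfold_locales (use assms(1) two in \<open>auto simp: \<delta>_def \<kappa>_def\<close>)
  have d: "2 + \<delta> < 2 / r + 3 / q" using two by (auto simp: \<delta>_def min_def field_simps)
  note data = theorem_data[OF assms(2,3) d]
  \<comment> \<open>With the pressure 0, the claims on its regularity, integrability and gradient
    become facts about the zero function.\<close>
  have g: "is_space_gradient (\<lambda>z. 0) (\<lambda>z. 0)" by (simp add: is_space_gradient_def zero_weak_deriv)
  have P: "\<forall>p\<ge>1. (\<lambda>z. 0 :: real) \<in> LrLq_loc 2 (ennreal p)" by (intro allI impI) (rule zero_LrLq_loc[of 2, simplified])
  show ?thesis
    by (intro bexI[OF _ zero_G_sigma] bexI[OF _ data(1)] exI[of _ force] exI[of _ V] exI[of _ "\<lambda>z. 0"] conjI data(2-7)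
        pressure_V blowup_times P exI[of _ "\<lambda>z. 0"] g zero_LrLq_loc)
qed

end
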